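(* Let $\alpha_n,\alpha\in L^3(\Lambda^1\mathbb{S}^3)$ with $d^*(|\alpha_n|\alpha_n)=d^*(|\alpha|\alpha)=0$ and $d\alpha_n\rightharpoonup d\alpha$ weakly in $L^{3/2}(\Lambda^2\mathbb{S}^3)$. Then $\alpha_n\to\alpha$ in $L^q(\Lambda^1\mathbb{S}^3)$ for any $q<3$.
   Context: $\mathbb{S}^3$ carries its standard round metric and surface measure; $L^p(\Lambda^k\mathbb{S}^3)$ denotes the space of $p$-integrable $k$-forms on $\mathbb{S}^3$, with pointwise norms $|\cdot|$ induced by the metric. $d$ is the exterior derivative and $d^*$ its formal adjoint (codifferential), both understood in the weak/distributional sense; in particular $d\alpha_n\in L^{3/2}(\Lambda^2\mathbb{S}^3)$ is part of the hypothesis, and $d^*(|\alpha|\alpha)=0$ means $\int_{\mathbb{S}^3}\langle|\alpha|\alpha,df\rangle\,d\omega=0$ for all smooth functions $f$. *)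

theory Defs
  imports "HOL-Analysis.Analysis"
begin

type_synonym R4 = "real ^ 4"
type_synonym M4 = "real ^ 4 ^ 4"

text \<open>Standard surface measure on S^3 = sphere 0 1 in R^4, via the cone construction:
  sigma(A) = 4 * Lebesgue measure of {r x | 0 < r <= 1, x in A}.
  (Pushforward of Lebesgue measure on the punctured closed unit ball under x / |x|, times n = 4.)\<close>
definition S3 :: "R4 measure" where
  "S3 = density
          (distr (restrict_space lborel {x::R4. 0 < norm x \<and> norm x \<le> 1})
                 (restrict_space borel (sphere 0 1))
                 (\<lambda>x. x /\<^sub>R norm x))
          (\<lambda>_. 4)"

definition tproj :: "R4 \<Rightarrow> R4 \<Rightarrow> R4" where
  "tproj x v = v - (v \<bullet> x) *\<^sub>R x"

definition tprojM :: "R4 \<Rightarrow> M4" where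
  "tprojM x = mat 1 - (\<chi> i j. x $ i * x $ j)"

text \<open>1-forms on S^3 are identified (via the metric) with tangent vector fields
  a : R4 \<Rightarrow> R4, a x \<bullet> x = 0 for x on the sphere; pointwise norm = euclidean norm.
  2-forms on S^3 are represented by tangential skew matrices M (M x = 0),
  with w(u,v) = u \<bullet> (M *v v); pointwise inner product <w,w'> = 1/2 sum_ij M_ij M'_ij.\<close>

definition is_1form :: "(R4 \<Rightarrow> R4) \<Rightarrow> bool" where
  "is_1form a \<longleftrightarrow> a \<in> borel_measurable S3 \<and> (\<forall>x\<in>sphere 0 1. a x \<bullet> x = 0)"

definition is_2form :: "(R4 \<Rightarrow> M4) \<Rightarrow> bool" where
  "is_2form b \<longleftrightarrow> b \<in> borel_measurable S3 \<and>
     (\<forall>x\<in>sphere 0 1. transpose (b x) = - b x \<and> b x *v x = 0)"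

definition inner2 :: "M4 \<Rightarrow> M4 \<Rightarrow> real" where
  "inner2 M N = (1/2) * (\<Sum>i\<in>UNIV. \<Sum>j\<in>UNIV. M $ i $ j * N $ i $ j)"

definition norm2 :: "M4 \<Rightarrow> real" where
  "norm2 M = sqrt (inner2 M M)"

definition L_1form :: "real \<Rightarrow> (R4 \<Rightarrow> R4) \<Rightarrow> bool" where
  "L_1form p a \<longleftrightarrow> is_1form a \<and> integrable S3 (\<lambda>x. norm (a x) powr p)"

definition L_2form :: "real \<Rightarrow> (R4 \<Rightarrow> M4) \<Rightarrow> bool" where
  "L_2form p b \<longleftrightarrow> is_2form b \<and> integrable S3 (\<lambda>x. norm2 (b x) powr p)"

definition smooth_fun :: "(R4 \<Rightarrow> real) \<Rightarrow> bool" where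
  "smooth_fun f \<longleftrightarrow> (\<exists>D :: 4 list \<Rightarrow> R4 \<Rightarrow> real. D [] = f \<and>
      (\<forall>l x. (D l has_derivative (\<lambda>h. \<Sum>i\<in>UNIV. h $ i * D (i # l) x)) (at x)))"

definition smooth_field :: "(R4 \<Rightarrow> R4) \<Rightarrow> bool" where
  "smooth_field F \<longleftrightarrow> (\<forall>k. smooth_fun (\<lambda>x. F x $ k))"

text \<open>Smooth functions / 1-forms on S^3 are restrictions of smooth ambient ones.
  The differential of f on S^3 is the tangential gradient; the 1-form induced by an
  ambient field F is its tangential part, and its exterior derivative is the pullback
  of d(F-flat), i.e. the tangential part of the skew matrix J^T - J (J the Jacobian).\<close>
definition grad :: "(R4 \<Rightarrow> real) \<Rightarrow> R4 \<Rightarrow> R4" where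
  "grad f x = (\<chi> i. frechet_derivative f (at x) (axis i 1))"

definition d0 :: "(R4 \<Rightarrow> real) \<Rightarrow> R4 \<Rightarrow> R4" where
  "d0 f x = tproj x (grad f x)"

definition form1_of :: "(R4 \<Rightarrow> R4) \<Rightarrow> R4 \<Rightarrow> R4" where
  "form1_of F x = tproj x (F x)"

definition d1 :: "(R4 \<Rightarrow> R4) \<Rightarrow> R4 \<Rightarrow> M4" where
  "d1 F x = tprojM x ** (transpose (jacobian F (at x)) - jacobian F (at x)) ** tprojM x"

text \<open>Volume form of S^3 at x (orientation by the outer normal) and the function
  (beta \<and> psi) / vol for a 2-form beta and a 1-form psi.\<close>
definition vol3 :: "R4 \<Rightarrow> R4 \<Rightarrow> R4 \<Rightarrow> R4 \<Rightarrow> real" where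
  "vol3 x u v w = det (\<chi> r. if r = 1 then x else if r = 2 then u else if r = 3 then v else w)"

definition wedge21 :: "M4 \<Rightarrow> R4 \<Rightarrow> R4 \<Rightarrow> real" where
  "wedge21 M v x = (1/2) * (\<Sum>i\<in>UNIV. \<Sum>j\<in>UNIV. \<Sum>k\<in>UNIV. M $ i $ j * v $ k * vol3 x (axis i 1) (axis j 1) (axis k 1))"

text \<open>Weak exterior derivative: d a = b in the distributional sense, i.e. for every smooth
  1-form psi: integral of b \<and> psi = integral of a \<and> d psi  (= d psi \<and> a),
  which is the Stokes identity for d(a \<and> psi) = da \<and> psi - a \<and> d psi.\<close>
definition weak_d :: "(R4 \<Rightarrow> R4) \<Rightarrow> (R4 \<Rightarrow> M4) \<Rightarrow> bool" where
  "weak_d a b \<longleftrightarrow> (\<forall>F. smooth_field F \<longrightarrow>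
      (\<integral>x. wedge21 (b x) (form1_of F x) x \<partial>S3) = (\<integral>x. wedge21 (d1 F x) (a x) x \<partial>S3))"

definition codiff_free :: "(R4 \<Rightarrow> R4) \<Rightarrow> bool" where
  "codiff_free a \<longleftrightarrow> (\<forall>f. smooth_fun f \<longrightarrow> (\<integral>x. norm (a x) * (a x \<bullet> d0 f x) \<partial>S3) = 0)"

definition weak_conv_2form :: "real \<Rightarrow> (nat \<Rightarrow> R4 \<Rightarrow> M4) \<Rightarrow> (R4 \<Rightarrow> M4) \<Rightarrow> bool" where
  "weak_conv_2form p bn b \<longleftrightarrow> (\<forall>g. L_2form (p / (p - 1)) g \<longrightarrow>
     (\<lambda>n. \<integral>x. inner2 (bn n x) (g x) \<partial>S3) \<longlonglongrightarrow> (\<integral>x. inner2 (b x) (g x) \<partial>S3))"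

definition conv_1form :: "real \<Rightarrow> (nat \<Rightarrow> R4 \<Rightarrow> R4) \<Rightarrow> (R4 \<Rightarrow> R4) \<Rightarrow> bool" where
  "conv_1form q an a \<longleftrightarrow> (\<lambda>n. \<integral>x. norm (an n x - a x) powr q \<partial>S3) \<longlonglongrightarrow> 0"

end

theory Submission
  imports Defs "HOL-Library.Diagonal_Subsequence"
begin

text \<open>Write \<open>X\<close> for the difference of the fields \<open>|a|a\<close> of two members of the sequence and \<open>D\<close> for
  the difference of the members themselves. Then \<open>X\<close> is divergence free and \<open>X \<bullet> D \<ge> |D|\<^sup>3 / 2\<close>.
  Expanding \<open>D\<close> in the left-invariant frame of the three-sphere and solving the Laplace equation with
  an explicit zonal kernel expresses \<open>\<integral> z (X \<bullet> D)\<close>, for a polynomial \<open>z\<close>, through \<open>d D\<close> and a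
  potential of \<open>D\<close> paired with \<open>dz(X)\<close>. With the kernel truncated to a polynomial, both terms tend
  to zero by weak convergence. The tail of the kernel is of Riesz type at the critical exponent and is
  small except near the finitely many points where \<open>d D\<close> concentrates, which the cut-off \<open>z\<close>
  removes. Hence a subsequence is Cauchy in \<open>L\<^sup>1\<close>. Its limit satisfies the same equations as the given
  limit, so both agree by the same monotonicity (with \<open>z = 1\<close> and \<open>d D = 0\<close>), and the uniform
  bound in \<open>L\<^sup>3\<close>, obtained from the identity with \<open>z = 1\<close>, upgrades the convergence to all
  exponents below 3.\<close>

text \<open>The exponents are critical: in dimension three a kernel of size |x - y|^(-2) pairs two
  functions of class L^(3/2) with no power to spare, so weak convergence of \<open>d a_n\<close>
  does not by itself control the product of \<open>X\<close> and \<open>D\<close>, and mass may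
  escape into points. This is also where the restriction to exponents below 3 comes from. What
  remains is that only boundedly many grid cells can carry a fixed share of the mass of
  \<open>d D\<close>, however fine the grid. Their position changes with the pair of indices, but
  their number does not. Hence the degree and the gradient of the cut-off, and then the truncation
  order of the kernel, can be fixed before the pair is. A potential appears because
  \<open>d D\<close> determines \<open>D\<close> only up to a gradient. The field \<open>X\<close>
  annihilates gradients, except for the part in which the derivative falls on the cut-off. The
  potentials of the \<open>a_n\<close> are not assumed to converge, so they are made to converge
  along a subsequence. The global frame turns an equation for one-forms into scalar ones, and all
  kernels are polynomials in the inner product of \<open>x\<close> and \<open>y\<close>. Potentials
  and cut-offs are then polynomials, hence legitimate smooth test functions.\<close>

section \<open>Coordinates and the quaternionic frame\<close>

definition vec4 :: "real \<Rightarrow> real \<Rightarrow> real \<Rightarrow> real \<Rightarrow> R4" where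
  "vec4 p q r s = (\<chi> i. if i = 1 then p else if i = 2 then q else if i = 3 then r else s)"

lemma vec4_nth [simp]:
  "vec4 p q r s $ 1 = p" "vec4 p q r s $ 2 = q" "vec4 p q r s $ 3 = r" "vec4 p q r s $ 4 = s"
  by (simp_all add: vec4_def)

lemma inner_R4: "(x::R4) \<bullet> y = x$1 * y$1 + x$2 * y$2 + x$3 * y$3 + x$4 * y$4"
  by (simp add: inner_vec_def sum_4)

lemma vec_eq_R4: "(x::R4) = y \<longleftrightarrow> x$1 = y$1 \<and> x$2 = y$2 \<and> x$3 = y$3 \<and> x$4 = y$4"
  by (simp add: vec_eq_iff forall_4)

text \<open>Right multiplication by the quaternion units i, j, k: a left-invariant orthonormal frame
  of the unit quaternions.\<close>
definition fr :: "3 \<Rightarrow> R4 \<Rightarrow> R4" where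
  "fr k y = (if k = 1 then vec4 (- y$2) (y$1) (y$4) (- y$3)
    else if k = 2 then vec4 (- y$3) (- y$4) (y$1) (y$2)
    else vec4 (- y$4) (y$3) (- y$2) (y$1))"

lemma fr_simps:
  "fr 1 y = vec4 (- y$2) (y$1) (y$4) (- y$3)"
  "fr 2 y = vec4 (- y$3) (- y$4) (y$1) (y$2)"
  "fr 3 y = vec4 (- y$4) (y$3) (- y$2) (y$1)"
  by (simp_all add: fr_def)

lemma linear_fr: "linear (fr k)"
  by (rule linearI) (auto simp: fr_def vec_eq_R4)

lemma bounded_linear_fr: "bounded_linear (fr k)"
  using linear_fr linear_conv_bounded_linear by blast

lemma inner_fr_fr_same: "fr k x \<bullet> fr k y = x \<bullet> y"
  using exhaust_3[of k] by (auto simp: fr_simps inner_R4)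

lemma norm_fr [simp]: "norm (fr k y) = norm y"
  by (simp add: norm_eq_sqrt_inner inner_fr_fr_same)

lemma inner_fr_skew: "x \<bullet> fr k y = - (fr k x \<bullet> y)"
  using exhaust_3[of k] by (auto simp: fr_simps inner_R4)

lemma inner_fr_self [simp]: "y \<bullet> fr k y = 0" "fr k y \<bullet> y = 0"
  using exhaust_3[of k] by (auto simp: fr_simps inner_R4)

lemma fr_fr [simp]: "fr k (fr k y) = - y"
  using exhaust_3[of k] by (auto simp: fr_simps vec_eq_R4)

text \<open>The vectors \<open>y\<close>, \<open>fr 1 y\<close>, \<open>fr 2 y\<close>,
  \<open>fr 3 y\<close> are pairwise orthogonal of equal length. Keeping the factor
  \<open>y \<bullet> y\<close> instead of normalizing makes this a polynomial identity in the
  coordinates.\<close>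

lemma fr_expansion: "(x \<bullet> y) *\<^sub>R y + (\<Sum>k\<in>UNIV. (x \<bullet> fr k y) *\<^sub>R fr k y) = (y \<bullet> y) *\<^sub>R x"
  by (simp add: sum_3 fr_simps inner_R4 vec_eq_R4) algebra

lemma fr_parseval: "(u \<bullet> y) * (v \<bullet> y) + (\<Sum>k\<in>UNIV. (u \<bullet> fr k y) * (v \<bullet> fr k y)) = (y \<bullet> y) * (u \<bullet> v)"
proof -
  have "((u \<bullet> y) *\<^sub>R y + (\<Sum>k\<in>UNIV. (u \<bullet> fr k y) *\<^sub>R fr k y)) \<bullet> v = (y \<bullet> y) * (u \<bullet> v)"
    by (subst fr_expansion) simp
  then show ?thesis
    unfolding inner_add_left inner_sum_left inner_scaleR_left by (simp only: inner_commute)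
qed

section \<open>The surface measure\<close>

lemma space_S3 [simp]: "space S3 = sphere 0 1"
  by (simp add: S3_def space_restrict_space)

lemma sets_S3: "sets S3 = sets (restrict_space borel (sphere 0 1))"
  by (simp add: S3_def)

lemma measurable_S3_borel: "(\<lambda>x. x) \<in> measurable S3 borel"
proof -
  have "measurable S3 (borel::R4 measure) = measurable (restrict_space borel (sphere 0 1)) borel"
    by (rule measurable_cong_sets) (simp_all add: sets_S3)
  then show ?thesis by (simp add: measurable_restrict_space1)
qed

lemma borel_measurable_S3I: "f \<in> borel_measurable borel \<Longrightarrow> f \<in> borel_measurable S3"
  using measurable_compose[OF measurable_S3_borel] by blast

text \<open>Cones carry questions about the surface measure over to Lebesgue measure in the unit
  ball, from which rotation invariance and the size of caps are inherited.\<close>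

definition cone4 :: "R4 set \<Rightarrow> R4 set" where
  "cone4 A = {x. 0 < norm x \<and> norm x \<le> 1 \<and> x /\<^sub>R norm x \<in> A}"

lemma measurable_radial:
  "(\<lambda>x. x /\<^sub>R norm x) \<in> measurable (restrict_space lborel {x::R4. 0 < norm x \<and> norm x \<le> 1}) (restrict_space borel (sphere 0 1))"
proof (rule measurable_restrict_space2)
  show "(\<lambda>x. x /\<^sub>R norm x) \<in> space (restrict_space lborel {x::R4. 0 < norm x \<and> norm x \<le> 1}) \<rightarrow> sphere 0 1"
    by (auto simp: space_restrict_space)
  have "(\<lambda>x::R4. inverse (norm x) *\<^sub>R x) \<in> borel_measurable lborel"
    by (intro borel_measurable_scaleR borel_measurable_inverse borel_measurable_norm) simp_all
  then show "(\<lambda>x. x /\<^sub>R norm x) \<in> borel_measurable (restrict_space lborel {x::R4. 0 < norm x \<and> norm x \<le> 1})"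
    by (rule measurable_restrict_space1)
qed

lemma sets_punctured: "{x::R4. 0 < norm x \<and> norm x \<le> 1} \<in> sets borel"
  by measurable

lemma cone4_sets:
  assumes "A \<in> sets S3"
  shows "cone4 A \<in> sets borel"
proof -
  have "(\<lambda>x. x /\<^sub>R norm x) -` A \<inter> space (restrict_space lborel {x::R4. 0 < norm x \<and> norm x \<le> 1})
     \<in> sets (restrict_space lborel {x::R4. 0 < norm x \<and> norm x \<le> 1})"
    using measurable_sets[OF measurable_radial] assms by (simp add: sets_S3)
  moreover have "(\<lambda>x. x /\<^sub>R norm x) -` A \<inter> space (restrict_space lborel {x::R4. 0 < norm x \<and> norm x \<le> 1}) = cone4 A"
    by (auto simp: cone4_def space_restrict_space)
  ultimately show ?thesis
    using sets_punctured by (simp add: sets_restrict_space_iff)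
qed

lemma emeasure_S3:
  assumes "A \<in> sets S3"
  shows "emeasure S3 A = 4 * emeasure lborel (cone4 A)"
proof -
  let ?B = "restrict_space lborel {x::R4. 0 < norm x \<and> norm x \<le> 1}"
  let ?D = "distr ?B (restrict_space borel (sphere 0 1)) (\<lambda>x. x /\<^sub>R norm x)"
  have eq: "(\<lambda>x. x /\<^sub>R norm x) -` A \<inter> space ?B = cone4 A"
    by (auto simp: cone4_def space_restrict_space)
  have "emeasure S3 A = 4 * emeasure ?D A"
    using assms by (simp add: S3_def emeasure_density nn_integral_cmult_indicator)
  also have "emeasure ?D A = emeasure ?B (cone4 A)"
    using assms by (subst emeasure_distr[OF measurable_radial]) (simp_all only: sets_S3 eq)
  also have "\<dots> = emeasure lborel (cone4 A)"
    using sets_punctured by (intro emeasure_restrict_space) (auto simp: cone4_def)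
  finally show ?thesis .
qed

lemma cone4_subset: "cone4 A \<subseteq> cball 0 1"
  by (auto simp: cone4_def)

lemma cone4_lmeasurable:
  assumes "A \<in> sets S3"
  shows "cone4 A \<in> lmeasurable"
proof (rule fmeasurableI2[of "cball 0 1"])
  show "cone4 A \<in> sets lebesgue"
    using cone4_sets[OF assms] by (simp add: sets_completionI_sets)
qed (use cone4_subset in auto)

lemma emeasure_cone4:
  assumes "A \<in> sets S3"
  shows "emeasure lborel (cone4 A) = measure lebesgue (cone4 A)"
proof -
  have "emeasure lborel (cone4 A) = emeasure lebesgue (cone4 A)"
    using cone4_sets[OF assms] by (simp add: emeasure_completion)
  also have "\<dots> = measure lebesgue (cone4 A)"
    using cone4_lmeasurable[OF assms] by (simp add: emeasure_eq_measure2 fmeasurableD2)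
  finally show ?thesis .
qed

lemma emeasure_S3':
  assumes "A \<in> sets S3"
  shows "emeasure S3 A = ennreal (4 * measure lebesgue (cone4 A))"
  using emeasure_S3[OF assms] emeasure_cone4[OF assms] by (simp add: ennreal_mult)

lemma measure_S3:
  assumes "A \<in> sets S3"
  shows "measure S3 A = 4 * measure lebesgue (cone4 A)"
  using emeasure_S3'[OF assms] by (simp add: measure_def)

interpretation S3: finite_measure S3
  by standard (simp add: emeasure_S3'[of "sphere 0 1"] del: sphere_eq_empty, simp add: emeasure_S3'[OF sets.top, simplified])

definition area3 :: real where "area3 = measure S3 (sphere 0 1)"

lemma area3_pos: "area3 > 0"
proof -
  have s: "sphere 0 1 \<in> sets S3" using sets.top[of S3] by simp
  \<comment> \<open>An open ball with the origin on its boundary avoids the origin, and this one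
    stays inside the unit ball.\<close>
  have "ball (axis 1 (1/2)) (1/2) \<subseteq> cone4 (sphere 0 1)"
  proof
    fix x :: R4 assume x: "x \<in> ball (axis 1 (1/2)) (1/2)"
    have n: "norm (axis 1 (1/2) :: R4) = 1/2"
      by (simp add: norm_eq_sqrt_inner inner_axis_axis real_sqrt_divide)
    have "norm x \<le> 1"
      using x n norm_triangle_ineq2[of x "axis 1 (1/2)"] by (simp add: dist_norm norm_minus_commute)
    moreover have "x \<noteq> 0" using x n by auto
    ultimately show "x \<in> cone4 (sphere 0 1)" by (auto simp: cone4_def)
  qed
  then have "measure lebesgue (ball (axis 1 (1/2) :: R4) (1/2)) \<le> measure lebesgue (cone4 (sphere 0 1))"
    by (intro measure_mono_fmeasurable cone4_lmeasurable s) auto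
  moreover have "measure lebesgue (ball (axis 1 (1/2) :: R4) (1/2)) > 0"
    by (simp add: measure_completion)
  ultimately show ?thesis
    unfolding area3_def measure_S3[OF s] by linarith
qed

text \<open>Orthogonal maps preserve lengths and commute with radial projection, so they map cones
  to cones; Lebesgue measure is invariant under them.\<close>

lemma S3_rotation_invariant:
  assumes R: "orthogonal_transformation R"
  shows "R \<in> measurable S3 S3" "distr S3 S3 R = S3"
proof -
  have lin: "linear R" using R orthogonal_transformation_linear by blast
  have nR: "norm (R x) = norm x" for x using R by (simp add: orthogonal_transformation)
  have "R \<in> borel_measurable borel"
    using lin by (intro borel_measurable_continuous_onI linear_continuous_on) (simp add: linear_conv_bounded_linear)
  then have mb: "R \<in> measurable S3 borel" by (rule borel_measurable_S3I)
  have "R \<in> measurable S3 (restrict_space borel (sphere 0 1))"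
    by (rule measurable_restrict_space2[OF _ mb]) (auto simp: nR)
  then show m: "R \<in> measurable S3 S3"
    using measurable_cong_sets[OF refl sets_S3] by blast
  show "distr S3 S3 R = S3"
  proof (rule measure_eqI)
    fix A assume "A \<in> sets (distr S3 S3 R)"
    then have A: "A \<in> sets S3" by simp
    have A': "R -` A \<inter> space S3 \<in> sets S3" using m A by (rule measurable_sets)
    have "A \<subseteq> sphere 0 1" using sets.sets_into_space[OF A] by simp
    have R0: "R x = 0 \<longleftrightarrow> x = 0" for x using nR[of x] by (metis norm_eq_zero)
    have surj: "surj R" using R orthogonal_transformation_surj by blast
    have "R ` cone4 (R -` A \<inter> space S3) = cone4 A"
    proof safe
      fix x assume "x \<in> cone4 (R -` A \<inter> space S3)"
      then show "R x \<in> cone4 A" by (simp add: cone4_def nR R0 linear_scale[OF lin])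
    next
      fix z assume z: "z \<in> cone4 A"
      obtain x where x: "z = R x" using surj by (metis surjD)
      have "x \<in> cone4 (R -` A \<inter> space S3)" using z by (simp add: cone4_def x nR R0 linear_scale[OF lin])
      then show "z \<in> R ` cone4 (R -` A \<inter> space S3)" using x by blast
    qed
    then have "measure lebesgue (cone4 A) = measure lebesgue (cone4 (R -` A \<inter> space S3))"
      using measure_orthogonal_image[OF R cone4_lmeasurable[OF A']] by simp
    then show "emeasure (distr S3 S3 R) A = emeasure S3 A"
      using A A' by (simp add: emeasure_distr[OF m A] emeasure_S3')
  qed simp
qed

lemma integral_S3_rotation:
  assumes "orthogonal_transformation R" "f \<in> borel_measurable S3"
  shows "(\<integral>x. f (R x) \<partial>S3) = (\<integral>x. f x \<partial>S3 :: real)"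
  using integral_distr[OF S3_rotation_invariant(1)[OF assms(1)] assms(2)]
  by (simp add: S3_rotation_invariant(2)[OF assms(1)])

text \<open>The cone over a cap of radius \<open>r\<close> lies in a tube of width comparable to
  \<open>r\<close> around the segment from 0 to \<open>y\<close>. About \<open>1/r\<close> balls of
  volume comparable to \<open>r^4\<close> cover the tube, which leaves the third power. The constant
  128 is four, from the definition of the measure, times 32 from the covering.\<close>

lemma measure_S3_ball:
  obtains C where "C > 0" "\<And>y r. y \<in> sphere 0 1 \<Longrightarrow> r > 0 \<Longrightarrow> measure S3 (sphere 0 1 \<inter> ball y r) \<le> C * r^3"
proof -
  define v where "v = measure lebesgue (ball (0::R4) 1)"
  have vpos: "v > 0" unfolding v_def by (simp add: measure_completion)
  have vb: "measure lebesgue (ball (c::R4) r) = r^4 * v" if "r > 0" for c r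
    using content_ball_conv_unit_ball[of r c] that unfolding v_def by (simp add: measure_completion)
  have sb: "sphere 0 1 \<inter> ball y r \<in> sets S3" for y :: R4 and r
    by (simp add: sets_S3 sets_restrict_space)
  have main: "measure S3 (sphere 0 1 \<inter> ball y r) \<le> 128 * v * r^3" if y: "y \<in> sphere 0 1" and r: "r > 0" for y :: R4 and r
  proof (cases "r \<le> 1")
    case True
    define n where "n = nat \<lfloor>1/r\<rfloor>"
    have n: "real n \<le> 1/r" using r by (simp add: n_def)
    \<comment> \<open>The centres lie on the segment at spacing \<open>r\<close>. Rounding
      \<open>norm x\<close> down to a multiple of \<open>r\<close> costs at most \<open>r\<close>,
      and replacing the direction of \<open>x\<close> by \<open>y\<close> costs less than
      \<open>r\<close>.\<close>
    let ?U = "\<Union>k\<in>{0..n}. ball (real k *\<^sub>R r *\<^sub>R y) (2*r)"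
    have "cone4 (sphere 0 1 \<inter> ball y r) \<subseteq> ?U"
    proof
      fix x assume x: "x \<in> cone4 (sphere 0 1 \<inter> ball y r)"
      define k where "k = nat \<lfloor>norm x / r\<rfloor>"
      have x0: "0 < norm x" "norm x \<le> 1" and d: "norm (y - x /\<^sub>R norm x) < r"
        using x by (auto simp: cone4_def dist_norm)
      have "norm x / r \<le> 1 / r" using x0 r by (simp add: divide_right_mono)
      then have "k \<le> n" unfolding k_def n_def by (intro nat_mono floor_mono)
      have k: "real k = of_int \<lfloor>norm x / r\<rfloor>" using r by (simp add: k_def)
      have k1: "real k \<le> norm x / r" "norm x / r < real k + 1" unfolding k by linarith+
      have k2: "\<bar>real k * r - norm x\<bar> \<le> r" using k1 r by (simp add: field_simps abs_le_iff)
      have "real k *\<^sub>R r *\<^sub>R y - x = (real k * r - norm x) *\<^sub>R y + norm x *\<^sub>R (y - x /\<^sub>R norm x)"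
        using x0 by (simp add: algebra_simps)
      then have "norm (real k *\<^sub>R r *\<^sub>R y - x) \<le> \<bar>real k * r - norm x\<bar> + norm x * norm (y - x /\<^sub>R norm x)"
        using norm_triangle_ineq[of "(real k * r - norm x) *\<^sub>R y" "norm x *\<^sub>R (y - x /\<^sub>R norm x)"] y
        by simp
      also have "\<dots> < r + r"
      proof -
        have "norm x * norm (y - x /\<^sub>R norm x) \<le> norm (y - x /\<^sub>R norm x)"
          using x0 by (simp add: mult_left_le_one_le)
        then show ?thesis using k2 d by linarith
      qed
      finally have "x \<in> ball (real k *\<^sub>R r *\<^sub>R y) (2*r)" by (simp add: dist_norm)
      then show "x \<in> ?U" using \<open>k \<le> n\<close> by auto
    qed
    then have "measure lebesgue (cone4 (sphere 0 1 \<inter> ball y r)) \<le> measure lebesgue ?U"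
      by (intro measure_mono_fmeasurable fmeasurable.finite_UN fmeasurableD[OF cone4_lmeasurable] sb) auto
    also have "\<dots> \<le> (\<Sum>k\<in>{0..n}. measure lebesgue (ball (real k *\<^sub>R r *\<^sub>R y) (2*r)))"
      by (intro measure_UNION_le) auto
    also have "\<dots> = (real n + 1) * ((2*r)^4 * v)"
      using r by (simp add: vb del: measure_completion)
    also have "\<dots> \<le> (2/r) * ((2*r)^4 * v)"
    proof (rule mult_right_mono)
      have "1 \<le> 1/r" using r True by simp
      then show "real n + 1 \<le> 2/r" using n by (simp add: field_simps)
    qed (use vpos r in auto)
    also have "\<dots> = 32 * v * r^3" using r by (simp add: power_numeral_reduce field_simps)
    finally show ?thesis unfolding measure_S3[OF sb] by simp
  next
    case False
    have "measure lebesgue (cone4 (sphere 0 1 \<inter> ball y r)) \<le> measure lebesgue (ball (0::R4) 2)"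
      by (intro measure_mono_fmeasurable fmeasurableD[OF cone4_lmeasurable] sb) (use cone4_subset in \<open>fastforce+\<close>)
    also have "\<dots> = 16 * v" by (simp add: vb del: measure_completion)
    also have "\<dots> \<le> 16 * v * r^3" using vpos False by simp
    finally have "4 * measure lebesgue (cone4 (sphere 0 1 \<inter> ball y r)) \<le> 64 * (v * r^3)" by linarith
    also have "\<dots> \<le> 128 * v * r^3" using vpos r by simp
    finally show ?thesis unfolding measure_S3[OF sb] .
  qed
  show thesis by (rule that[of "128 * v"]) (use vpos main in auto)
qed

section \<open>The zonal kernels\<close>

text \<open>\<open>mom n\<close> is the mean of \<open>sK x y ^ n\<close> over the sphere, \<open>pk N\<close> a polynomial approximate identity
  in \<open>s = sK x y\<close>, \<open>gamN N\<close> the partial sum of the Green kernel of \<open>pk N - 1\<close> differentiated once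
  in \<open>t = 2 s - 1\<close>, and \<open>dgamN N\<close> its derivative in \<open>t\<close>.\<close>
fun mom :: "nat \<Rightarrow> real" where
  "mom 0 = 1"
| "mom (Suc n) = mom n * (real n + 3/2) / (real n + 3)"

text \<open>Chosen so that \<open>ck N * (real N + 3) = 1 / mom (Suc N)\<close> and
  \<open>ck N * (real N + 3/2) = 1 / mom N\<close>. With these two values the Laplacian of one more
  power of \<open>s\<close> is exactly the increment from \<open>pk N\<close> to
  \<open>pk (Suc N)\<close>.\<close>

definition ck :: "nat \<Rightarrow> real" where "ck j = 1 / ((real j + 3) * mom (Suc j))"

definition gamN :: "nat \<Rightarrow> real \<Rightarrow> real" where
  "gamN N s = 1/2 * (\<Sum>j<N. ck j * s^j)"

definition dgamN :: "nat \<Rightarrow> real \<Rightarrow> real" where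
  "dgamN N s = 1/4 * (\<Sum>j<N. ck j * real j * s^(j-1))"

text \<open>The full series is of order (1 - s)^(-3/2) at worst. The default 0 at
  \<open>s = 1\<close> makes the bound \<open>6 / norm (x - y)^3\<close> valid on the diagonal too,
  where division by zero yields 0.\<close>

definition gam :: "real \<Rightarrow> real" where
  "gam s = (if s < 1 then 1/2 * (\<Sum>j. ck j * s^j) else 0)"

definition pk :: "nat \<Rightarrow> real \<Rightarrow> real" where "pk N s = s^N / mom N"

lemma mom_pos [simp]: "mom n > 0"
  by (induction n) auto

lemma ck_pos: "ck j > 0"
  by (simp add: ck_def del: mom.simps)

text \<open>On the three-sphere, \<open>(1 - t\<^sup>2) u'' - 3 t u'\<close> is the Laplacian of a zonal function \<open>u\<close> of
  \<open>t = 2 s - 1\<close>: the left-hand side is the approximate identity minus its mean.\<close>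
lemma pk_eq_laplacian:
  "pk N s - 1 = - ((1 - (2 * s - 1)^2) * dgamN N s - 3 * (2 * s - 1) * gamN N s)"
proof (induction N)
  case 0
  then show ?case by (simp add: pk_def dgamN_def gamN_def)
next
  case (Suc N)
  have m: "mom N > 0" by simp
  have c: "ck N * (real N + 3/2) = 1 / mom N" "ck N * (real N + 3) = 1 / mom (Suc N)"
  proof -
    have "ck N = 1 / (mom N * (real N + 3/2))" using m by (simp add: ck_def)
    then show "ck N * (real N + 3/2) = 1 / mom N" using m by simp
    show "ck N * (real N + 3) = 1 / mom (Suc N)" by (simp add: ck_def del: mom.simps)
  qed
  have p: "real N * s^(N-1) * s = real N * s^N" by (cases N) auto
  have "pk (Suc N) s - pk N s = s^Suc N * (1 / mom (Suc N)) - s^N * (1 / mom N)"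
    by (simp add: pk_def del: mom.simps)
  also have "\<dots> = ck N * ((real N + 3) * s^Suc N - (real N + 3/2) * s^N)"
    unfolding c[symmetric] by (simp add: algebra_simps del: mom.simps)
  finally have "pk (Suc N) s - pk N s = ck N * ((real N + 3) * s^Suc N - (real N + 3/2) * s^N)" .
  also have "\<dots> = - ((1 - (2 * s - 1)^2) * (ck N * real N * s^(N-1) / 4) - 3 * (2 * s - 1) * (ck N * s^N / 2))"
  proof -
    \<comment> \<open>The quadratic equals \<open>4 * s * (1 - s)\<close>; its factor
      \<open>s\<close> restores the exponent lowered by differentiation.\<close>
    have "(1 - (2 * s - 1)^2) * (ck N * real N * s^(N-1) / 4) = ck N * (1 - s) * (real N * s^(N-1) * s)"
      by (simp add: power2_eq_square field_simps)
    then show ?thesis unfolding p by (simp add: field_simps)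
  qed
  finally have step: "pk (Suc N) s - pk N s = \<dots>" .
  have dist: "- (X * (d + d') - T * (g + g')) = - (X * d - T * g) + - (X * d' - T * g')" for X T d d' g g' :: real
    by (simp add: algebra_simps)
  have "dgamN (Suc N) s = dgamN N s + ck N * real N * s^(N-1) / 4" "gamN (Suc N) s = gamN N s + ck N * s^N / 2"
    by (simp_all add: dgamN_def gamN_def)
  then show ?case
    using Suc.IH step by (simp only: dist)
qed

text \<open>The moments decay like n^(-3/2). The square is bounded because the induction step is
  then a polynomial inequality with nonnegative coefficients.\<close>

lemma mom_lower: "mom n ^ 2 \<ge> 1 / (real n + 1)^3"
proof (induction n)
  case (Suc n)
  have "(real n + 1)^3 * (real n + 3)^2 \<le> (real n + 3/2)^2 * (real n + 2)^3"
  proof -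
    have "(r + 1)^3 * (r + 3)^2 \<le> (r + 3/2)^2 * (r + 2)^3" if "r \<ge> 0" for r :: real
    proof -
      have "(r + 3/2)^2 * (r + 2)^3 - (r + 1)^3 * (r + 3)^2 = 9/4 * r^3 + 23/2 * r^2 + 18 * r + 9"
        by (simp add: power2_eq_square power3_eq_cube field_simps)
      also have "\<dots> \<ge> 0" using that by simp
      finally show ?thesis by simp
    qed
    then show ?thesis by simp
  qed
  then have "1 / (real (Suc n) + 1)^3 \<le> 1 / (real n + 1)^3 * (real n + 3/2)^2 / (real n + 3)^2"
    by (simp add: field_simps)
  also have "\<dots> \<le> mom n ^ 2 * (real n + 3/2)^2 / (real n + 3)^2"
    by (intro divide_right_mono mult_right_mono Suc) auto
  finally show ?case by (simp add: power_mult_distrib power_divide)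
qed simp

lemma ck_le: "ck j \<le> sqrt (real j + 2)"
proof (rule real_le_rsqrt)
  have "1 / (real j + 2)^3 \<le> mom (Suc j) ^ 2"
    using mom_lower[of "Suc j"] by (simp add: add.commute del: mom.simps)
  then have "1 / mom (Suc j) ^ 2 \<le> (real j + 2)^3"
    using mom_pos[of "Suc j"] by (simp add: field_simps del: mom.simps mom_pos)
  then have "1 / mom (Suc j) ^ 2 * (1 / (real j + 3)^2) \<le> (real j + 2)^3 * (1 / (real j + 3)^2)"
    by (rule mult_right_mono) simp
  then have "(ck j)\<^sup>2 \<le> (real j + 2)^3 / (real j + 3)^2"
    unfolding ck_def by (simp only: power_divide power_mult_distrib) (simp add: mult.commute del: mom.simps)
  also have "\<dots> \<le> real j + 2"
  proof -
    have "(real j + 2)^3 \<le> (real j + 2) * (real j + 3)^2"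
      unfolding power3_eq_cube power2_eq_square by (simp add: mult.assoc mult_mono)
    then show ?thesis by (simp add: divide_le_eq)
  qed
  finally show "(ck j)\<^sup>2 \<le> real j + 2" .
qed

text \<open>The coefficients grow at most like a square root. The arithmetic-geometric mean
  inequality with weight \<open>u\<close> replaces this root by a linear function of the index, so
  only the geometric series and its derivative are needed, and with this weight both contribute at
  the order u^(-3). The variable \<open>u\<close> will be half the chord length.\<close>

lemma sum_ck_le:
  assumes s: "0 \<le> s" and u: "u > 0" "u^2 = 1 - s"
  shows "(\<Sum>j<N. ck j * s^j) \<le> 3 / (2 * u^3)"
proof -
  have s1: "norm s < 1" using s u zero_less_power[OF u(1), of 2] by simp
  have amgm: "sqrt (real j + 2) \<le> ((real j + 2) * u + 1/u) / 2" for j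
  proof -
    have "0 \<le> (sqrt (real j + 2) * sqrt u - 1 / sqrt u)^2" by simp
    also have "\<dots> = (real j + 2) * u + 1/u - 2 * sqrt (real j + 2)"
      using u by (simp add: power2_diff power_mult_distrib power_divide)
    finally show ?thesis by simp
  qed
  have g1: "(\<Sum>j<N. s^j) \<le> 1 / u^2"
    using sum_le_suminf[OF summable_geometric[OF s1], of "{..<N}"] s
    by (simp add: suminf_geometric[OF s1] u)
  have "(\<lambda>n. of_nat (Suc n) * s ^ n) sums (1 / (1 - s)^2)"
    by (rule geometric_deriv_sums[OF s1])
  then have g2: "(\<Sum>j<N. (real j + 1) * s^j) \<le> 1 / (u^2)^2"
    using sum_le_suminf[of "\<lambda>n. of_nat (Suc n) * s ^ n" "{..<N}"] s
    by (simp add: sums_iff u add.commute)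
  have "(\<Sum>j<N. ck j * s^j) \<le> (\<Sum>j<N. ((real j + 2) * u + 1/u) / 2 * s^j)"
    using s by (intro sum_mono mult_right_mono order_trans[OF ck_le amgm]) auto
  also have "\<dots> = (\<Sum>j<N. (real j + 1) * s^j) * (u/2) + (\<Sum>j<N. s^j) * (u/2 + 1/(2*u))"
    unfolding sum_distrib_right sum.distrib[symmetric] by (intro sum.cong refl) (simp add: field_simps)
  also have "\<dots> \<le> 1 / (u^2)^2 * (u/2) + 1/u^2 * (u/2 + 1/(2*u))"
    using u by (intro add_mono mult_right_mono g1 g2) auto
  also have "\<dots> \<le> 3 / (2 * u^3)"
  proof -
    have "u^2 \<le> 1" using u s by simp
    then have "u^3 \<le> u" using u by (simp add: power3_eq_cube power2_eq_square mult_left_le_one_le)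
    have "1 / (u^2)^2 * (u/2) + 1/u^2 * (u/2 + 1/(2*u)) = (2 + u^2) / (2 * u^3)"
      using u by (simp add: field_simps power2_eq_square power3_eq_cube)
    also have "\<dots> \<le> 3 / (2*u^3)" using u \<open>u^2 \<le> 1\<close> by (intro divide_right_mono) auto
    finally show ?thesis .
  qed
  finally show ?thesis .
qed

lemma summable_ck:
  assumes "0 \<le> s" "s < 1"
  shows "summable (\<lambda>j. ck j * s^j)"
proof (rule bounded_imp_summable)
  show "(\<Sum>k\<le>n. ck k * s^k) \<le> 3 / (2 * sqrt (1-s)^3)" for n
    using sum_ck_le[of s "sqrt (1-s)" "Suc n"] assms by (simp add: lessThan_Suc_atMost)
qed (use assms less_imp_le[OF ck_pos] in auto)

lemma gamN_nonneg: "0 \<le> s \<Longrightarrow> 0 \<le> gamN N s"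
  using less_imp_le[OF ck_pos] by (auto simp: gamN_def intro!: sum_nonneg)

lemma gamN_le_gam:
  assumes "0 \<le> s" "s < 1"
  shows "gamN N s \<le> gam s"
  using sum_le_suminf[OF summable_ck[OF assms], of "{..<N}"] assms less_imp_le[OF ck_pos]
  by (simp add: gam_def gamN_def)

lemma gamN_tendsto:
  assumes "0 \<le> s" "s < 1"
  shows "(\<lambda>N. gamN N s) \<longlonglongrightarrow> gam s"
  using summable_LIMSEQ[OF summable_ck[OF assms]] assms
  by (auto simp: gam_def gamN_def intro!: tendsto_intros)

lemma gam_le:
  assumes "0 \<le> s" "u > 0" "u^2 = 1 - s"
  shows "gam s \<le> 3 / (4 * u^3)"
proof -
  have s1: "s < 1" using assms zero_less_power[of u 2] by simp
  have "gamN N s \<le> 3 / (4 * u^3)" for N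
    using sum_ck_le[OF assms, of N] by (simp add: gamN_def)
  then show ?thesis
    using LIMSEQ_le_const2[OF gamN_tendsto[OF assms(1) s1]] by blast
qed

text \<open>A tail of a power series with nonnegative coefficients is increasing. One number
  \<open>s0\<close> therefore controls the tails at all pairs of points that are separated by a
  fixed distance.\<close>

lemma gam_tail_mono:
  assumes "0 \<le> s" "s \<le> s0" "s0 < 1"
  shows "gam s - gamN N s \<le> gam s0 - gamN N s0"
proof -
  have "(\<lambda>M. gamN M s - gamN N s) \<longlonglongrightarrow> gam s - gamN N s"
    "(\<lambda>M. gamN M s0 - gamN N s0) \<longlonglongrightarrow> gam s0 - gamN N s0"
    using assms by (auto intro!: tendsto_intros gamN_tendsto)
  then show ?thesis
  proof (rule LIMSEQ_le, intro exI allI impI)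
    fix M assume "N \<le> M"
    have split: "gamN M r - gamN N r = 1/2 * (\<Sum>j\<in>{N..<M}. ck j * r^j)" for r
      using sum_diff_nat_ivl[of 0 N M "\<lambda>j. ck j * r^j"] \<open>N \<le> M\<close>
      by (simp add: gamN_def lessThan_atLeast0 algebra_simps)
    show "gamN M s - gamN N s \<le> gamN M s0 - gamN N s0"
      unfolding split using assms less_imp_le[OF ck_pos] by (auto intro!: sum_mono mult_left_mono power_mono)
  qed
qed

section \<open>The kernel variable and the chordal distance\<close>

text \<open>Rescaling the inner product to the unit interval makes all powers nonnegative on the
  sphere, and \<open>1 - sK x y\<close> becomes the square of half the chord.\<close>

definition sK :: "R4 \<Rightarrow> R4 \<Rightarrow> real" where "sK x y = (1 + x \<bullet> y) / 2"

lemma sK_dist: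
  assumes "norm x = 1" "norm y = 1"
  shows "1 - sK x y = (norm (x - y) / 2)^2"
  using assms by (simp add: sK_def power_divide power2_norm_eq_inner inner_diff norm_eq_1 inner_commute field_simps)

lemma sK_bounds:
  assumes "norm x = 1" "norm y = 1"
  shows "0 \<le> sK x y" "sK x y \<le> 1"
  using Cauchy_Schwarz_ineq2[of x y] assms by (auto simp: sK_def)

lemma sK_eq_1_iff:
  assumes "norm x = 1" "norm y = 1"
  shows "sK x y < 1 \<longleftrightarrow> x \<noteq> y"
  using sK_dist[OF assms] zero_less_power2[of "norm (x-y)/2"] by (smt (verit) divide_eq_0_iff right_minus_eq norm_eq_zero)

lemma sK_commute: "sK x y = sK y x"
  by (simp add: sK_def inner_commute)

lemma gam_sK_le:
  assumes "norm x = 1" "norm y = 1"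
  shows "gam (sK x y) \<le> 6 / norm (x - y)^3"
proof (cases "x = y")
  case True
  then show ?thesis using sK_eq_1_iff[OF assms] by (simp add: gam_def)
next
  case False
  then have "gam (sK x y) \<le> 3 / (4 * (norm (x-y)/2)^3)"
    using sK_bounds[OF assms] sK_dist[OF assms] by (intro gam_le) auto
  then show ?thesis by (simp add: power_divide)
qed

section \<open>Moments of the zonal functions\<close>

text \<open>Since \<open>fr k\<close> is skew with square minus the identity, this is its
  exponential, that is, right multiplication by a unit quaternion.\<close>

lemma rotation_flow:
  "orthogonal_transformation (\<lambda>y. cos t *\<^sub>R y + sin t *\<^sub>R fr k y)"
proof -
  have "linear (\<lambda>y. cos t *\<^sub>R y + sin t *\<^sub>R fr k y)"
    by (intro linear_compose_add linear_compose_scale_right linear_ident linear_fr)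
  moreover have "(cos t *\<^sub>R x + sin t *\<^sub>R fr k x) \<bullet> (cos t *\<^sub>R y + sin t *\<^sub>R fr k y) = x \<bullet> y" for x y
  proof -
    have "(cos t *\<^sub>R x + sin t *\<^sub>R fr k x) \<bullet> (cos t *\<^sub>R y + sin t *\<^sub>R fr k y)
       = cos t * cos t * (x \<bullet> y) + sin t * sin t * (x \<bullet> y)"
      using inner_fr_skew[of x k y] by (simp add: inner_add_left inner_add_right inner_fr_fr_same algebra_simps)
    also have "\<dots> = ((cos t)^2 + (sin t)^2) * (x \<bullet> y)"
      by (simp only: power2_eq_square distrib_right)
    finally show ?thesis by simp
  qed
  ultimately show ?thesis by (auto simp: orthogonal_transformation_def)
qed

text \<open>This is integration by parts along a frame field. The field generates a flow of
  rotations, so every difference quotient along the flow has integral zero, and the Lipschitz bound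
  allows the passage to the limit under the integral.\<close>

lemma integral_fr_derivative:
  fixes q :: "R4 \<Rightarrow> real"
  assumes q: "\<And>y. (q has_derivative q' y) (at y)"
    and lip: "\<And>x y. norm x = 1 \<Longrightarrow> norm y = 1 \<Longrightarrow> \<bar>q x - q y\<bar> \<le> B * norm (x - y)"
  shows "(\<integral>y. q' y (fr k y) \<partial>S3) = 0"
proof -
  define R where "R t y = cos t *\<^sub>R y + sin t *\<^sub>R fr k y" for t :: real and y :: R4
  define h where "h n = 1 / real (Suc n)" for n
  have hpos: "h n > 0" for n by (simp add: h_def)
  have hlim: "filterlim h (at 0) sequentially"
    unfolding h_def using LIMSEQ_inverse_real_of_nat
    by (auto simp: filterlim_at inverse_eq_divide)
  have qc: "continuous_on UNIV q"
    using q has_derivative_continuous_on[of UNIV q q'] by (auto intro: has_derivative_at_withinI)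
  have qm: "q \<in> borel_measurable S3"
    by (intro borel_measurable_S3I borel_measurable_continuous_onI qc)
  have B: "B \<ge> 0"
  proof -
    have "0 \<le> B * norm (axis 1 1 - (- axis 1 1) :: R4)"
      by (rule order_trans[OF abs_ge_zero lip]) simp_all
    moreover have "norm (axis 1 1 - (- axis 1 1) :: R4) = 2"
      using norm_scaleR[of 2 "axis 1 1 :: R4"] by (simp add: scaleR_2)
    ultimately show ?thesis by simp
  qed
  have Rn: "norm (R t y) = norm y" for t y
    using rotation_flow[of t k] unfolding R_def by (simp add: orthogonal_transformation)
  have Rm: "R t \<in> measurable S3 S3" for t
    using S3_rotation_invariant(1)[OF rotation_flow[of t k]] unfolding R_def .
  have qRm: "(\<lambda>y. q (R t y)) \<in> borel_measurable S3" for t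
    using measurable_compose[OF Rm qm] .
  have qI: "integrable S3 q" and qRI: "integrable S3 (\<lambda>y. q (R t y))" for t
  proof -
    have bd: "\<bar>q y\<bar> \<le> \<bar>q (axis 1 1)\<bar> + 2 * B" if "norm y = 1" for y
    proof -
      have "\<bar>q y - q (axis 1 1)\<bar> \<le> B * norm (y - axis 1 1)" using lip that by simp
      also have "\<dots> \<le> B * 2" using B norm_triangle_ineq4[of y "axis 1 1"] that by (intro mult_left_mono) auto
      finally show ?thesis by linarith
    qed
    show "integrable S3 q"
      by (rule S3.integrable_const_bound[OF _ qm]) (auto intro!: AE_I2 bd)
    show "integrable S3 (\<lambda>y. q (R t y))"
      by (rule S3.integrable_const_bound[OF _ qRm]) (auto intro!: AE_I2 bd simp: Rn)
  qed
  have z: "(\<integral>y. (q (R (h n) y) - q y) / h n \<partial>S3) = 0" for n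
    using integral_S3_rotation[OF rotation_flow[of "h n" k] qm] qI qRI by (simp add: R_def)
  have dR: "((\<lambda>t. R t y) has_vector_derivative fr k y) (at 0)" for y
    unfolding R_def by (auto intro!: derivative_eq_intros)
  have lim: "(\<lambda>n. (q (R (h n) y) - q y) / h n) \<longlonglongrightarrow> q' y (fr k y)" for y
  proof -
    have "((\<lambda>t. q (R t y)) has_derivative (\<lambda>t. q' y (t *\<^sub>R fr k y))) (at 0)"
      using has_derivative_compose[OF dR[of y, unfolded has_vector_derivative_def], of q "q' y"] q[of y]
      by (simp add: R_def)
    moreover have "(\<lambda>t. t * q' y (fr k y)) = (*) (q' y (fr k y))" by (auto simp: fun_eq_iff)
    ultimately have "((\<lambda>t. q (R t y)) has_real_derivative q' y (fr k y)) (at 0)"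
      using linear_scale[OF has_derivative_linear[OF q[of y]]]
      by (simp add: has_field_derivative_def)
    then have "((\<lambda>t. (q (R t y) - q y) / t) \<longlongrightarrow> q' y (fr k y)) (at 0)"
      by (simp add: has_field_derivative_iff R_def)
    then show ?thesis by (rule filterlim_compose[OF _ hlim])
  qed
  have "(\<lambda>n. \<integral>y. (q (R (h n) y) - q y) / h n \<partial>S3) \<longlonglongrightarrow> (\<integral>y. q' y (fr k y) \<partial>S3)"
  proof (rule integral_dominated_convergence[where w = "\<lambda>_. 2 * B"])
    show "(\<lambda>y. q' y (fr k y)) \<in> borel_measurable S3"
      by (rule borel_measurable_LIMSEQ_real[OF lim]) (use qRm qm in measurable)
    show "AE y in S3. (\<lambda>n. (q (R (h n) y) - q y) / h n) \<longlonglongrightarrow> q' y (fr k y)"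
      using lim by auto
    show "AE y in S3. norm ((q (R (h n) y) - q y) / h n) \<le> 2 * B" for n
    proof (rule AE_I2)
      fix y assume "y \<in> space S3"
      then have y: "norm y = 1" by simp
      have "R (h n) y - y = (cos (h n) - 1) *\<^sub>R y + sin (h n) *\<^sub>R fr k y" by (simp add: R_def algebra_simps)
      then have "norm (R (h n) y - y) \<le> \<bar>cos (h n) - 1\<bar> + \<bar>sin (h n)\<bar>"
        using norm_triangle_ineq[of "(cos (h n) - 1) *\<^sub>R y" "sin (h n) *\<^sub>R fr k y"] y by simp
      also have "\<dots> \<le> h n + h n"
      proof (rule add_mono)
        show "\<bar>sin (h n)\<bar> \<le> h n" using abs_sin_x_le_abs_x[of "h n"] hpos[of n] by simp
        have "1 - cos (h n) = 2 * (sin (h n / 2))^2" using cos_double_sin[of "h n / 2"] by simp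
        also have "\<dots> = 2 * (\<bar>sin (h n / 2)\<bar> * \<bar>sin (h n / 2)\<bar>)" by (simp add: power2_eq_square)
        also have "\<dots> \<le> 2 * (\<bar>h n / 2\<bar> * 1)"
          by (intro mult_left_mono mult_mono abs_sin_x_le_abs_x) auto
        finally show "\<bar>cos (h n) - 1\<bar> \<le> h n" using hpos[of n] cos_le_one[of "h n"] by linarith
      qed
      finally have "\<bar>q (R (h n) y) - q y\<bar> \<le> B * (2 * h n)"
        using lip[of "R (h n) y" y] B y Rn by (smt (verit) mult_left_mono)
      then show "norm ((q (R (h n) y) - q y) / h n) \<le> 2 * B"
        using hpos[of n] by (simp add: divide_le_eq mult.commute mult.left_commute)
    qed
  qed (use qRm qm in measurable)
  then show ?thesis by (simp only: z LIMSEQ_const_iff)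
qed

lemma integrable_S3_bounded:
  fixes f :: "R4 \<Rightarrow> real"
  assumes "continuous_on UNIV f"
  shows "integrable S3 f"
proof -
  have "compact (f ` sphere 0 1)"
    using assms by (intro compact_continuous_image) (auto intro: continuous_on_subset)
  then obtain B where "\<And>y. y \<in> sphere 0 1 \<Longrightarrow> norm (f y) \<le> B"
    by (meson bounded_iff compact_imp_bounded image_eqI)
  then show ?thesis
    by (intro S3.integrable_const_bound[of _ B] borel_measurable_S3I borel_measurable_continuous_onI assms AE_I2) auto
qed

lemma continuous_sK [continuous_intros]:
  "continuous_on A f \<Longrightarrow> continuous_on A g \<Longrightarrow> continuous_on A (\<lambda>z. sK (f z) (g z))"
  unfolding sK_def by (intro continuous_intros) auto

lemma continuous_fr [continuous_intros]:
  "continuous_on A f \<Longrightarrow> continuous_on A (\<lambda>z. fr k (f z))"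
  by (rule bounded_linear.continuous_on[OF bounded_linear_fr])

text \<open>Integrating the divergence of \<open>sK x y ^ j\<close> times the gradient of
  \<open>y \<mapsto> x \<bullet> y\<close>, computed in the frame, gives a two-term recursion
  between consecutive moments. It is the recursion that defines \<open>mom\<close>.\<close>

lemma integral_sK_power:
  assumes x: "norm x = 1"
  shows "(\<integral>y. sK x y ^ n \<partial>S3) = area3 * mom n"
proof (induction n)
  case 0
  then show ?case by (simp add: area3_def)
next
  case (Suc j)
  have I: "integrable S3 (\<lambda>y. sK x y ^ m)" for m
    by (intro integrable_S3_bounded continuous_intros)
  have Jl: "bounded_linear (\<lambda>y. x \<bullet> fr k y)" for k
    using bounded_linear_compose[OF bounded_linear_inner_right bounded_linear_fr] .
  define q' where "q' k y h = real j * sK x y ^ (j-1) * (x \<bullet> h / 2) * (x \<bullet> fr k y) + sK x y ^ j * (x \<bullet> fr k h)" for k y h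
  have "(\<integral>y. q' k y (fr k y) \<partial>S3) = 0" for k
  proof (rule integral_fr_derivative)
    show d: "((\<lambda>y. sK x y ^ j * (x \<bullet> fr k y)) has_derivative q' k y) (at y)" for y
      unfolding sK_def q'_def
      by (rule derivative_eq_intros bounded_linear.has_derivative[OF Jl] refl | simp add: fun_eq_iff)+ 
    fix u v :: R4 assume uv: "norm u = 1" "norm v = 1"
    have "norm (sK x u ^ j * (x \<bullet> fr k u) - sK x v ^ j * (x \<bullet> fr k v)) \<le> (real j + 1) * norm (u - v)"
    proof (rule differentiable_bound[of "cball 0 1" _ "q' k"])
      show "((\<lambda>y. sK x y ^ j * (x \<bullet> fr k y)) has_derivative q' k y) (at y within cball 0 1)" for y
        using d by (rule has_derivative_at_withinI)
      fix y :: R4 assume y: "y \<in> cball 0 1"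
      show "onorm (q' k y) \<le> real j + 1"
      proof (rule onorm_le)
        fix h :: R4
        have xy: "\<bar>x \<bullet> y\<bar> \<le> 1" using Cauchy_Schwarz_ineq2[of x y] x y by (simp add: order_trans)
        then have s: "0 \<le> sK x y" "sK x y \<le> 1" by (auto simp: sK_def abs_le_iff)
        have f: "\<bar>x \<bullet> fr k z\<bar> \<le> norm z" "\<bar>x \<bullet> z\<bar> \<le> norm z" for z
          using Cauchy_Schwarz_ineq2[of x "fr k z"] Cauchy_Schwarz_ineq2[of x z] x by simp_all
        have p: "sK x y ^ m \<le> 1" "0 \<le> sK x y ^ m" for m using s by (auto simp: power_le_one)
        have "\<bar>real j * sK x y ^ (j-1) * (x \<bullet> h / 2) * (x \<bullet> fr k y)\<bar> \<le> (real j * 1 * (norm h) * 1)"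
          unfolding abs_mult using f[of h] f(1)[of y] y p
          by (intro mult_mono) auto
        moreover have "\<bar>sK x y ^ j * (x \<bullet> fr k h)\<bar> \<le> 1 * norm h"
          unfolding abs_mult using f[of h] p by (intro mult_mono) auto
        ultimately show "norm (q' k y h) \<le> (real j + 1) * norm h"
          unfolding q'_def real_norm_def by (simp add: algebra_simps)
      qed
    qed (use uv in auto)
    then show "\<bar>sK x u ^ j * (x \<bullet> fr k u) - sK x v ^ j * (x \<bullet> fr k v)\<bar> \<le> (real j + 1) * norm (u - v)"
      by simp
  qed
  then have "(\<Sum>k\<in>UNIV. \<integral>y. q' k y (fr k y) \<partial>S3) = 0" by simp
  moreover have "integrable S3 (\<lambda>y. q' k y (fr k y))" for k
    unfolding q'_def by (intro integrable_S3_bounded continuous_intros) auto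
  ultimately have "(\<integral>y. (\<Sum>k\<in>UNIV. q' k y (fr k y)) \<partial>S3) = 0"
    by (simp add: Bochner_Integration.integral_sum)
  moreover have "(\<integral>y. (\<Sum>k\<in>UNIV. q' k y (fr k y)) \<partial>S3) =
     (\<integral>y. (2 * real j + 3) * sK x y ^ j - (2 * real j + 6) * sK x y ^ Suc j \<partial>S3)"
  proof (rule Bochner_Integration.integral_cong[OF refl])
    fix y assume "y \<in> space S3"
    then have y: "y \<bullet> y = 1" by (simp add: norm_eq_1)
    have xx: "x \<bullet> x = 1" using x by (simp add: norm_eq_1)
    define t where "t = x \<bullet> y"
    have par: "(\<Sum>k\<in>UNIV. (x \<bullet> fr k y)^2) = 1 - t^2"
      using fr_parseval[of x y x] y xx by (simp add: power2_eq_square t_def)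
    have s: "sK x y = (1 + t)/2" by (simp add: sK_def t_def)
    have "q' k y (fr k y) = real j / 2 * sK x y ^ (j-1) * (x \<bullet> fr k y)^2 - sK x y ^ j * t" for k
      by (simp add: q'_def t_def power2_eq_square)
    then have "(\<Sum>k\<in>UNIV. q' k y (fr k y)) = real j / 2 * sK x y ^ (j-1) * (1 - t^2) - 3 * (sK x y ^ j * t)"
      by (simp only: sum_subtractf sum_distrib_left[symmetric] par) simp
    also have "1 - t^2 = 4 * sK x y * (1 - sK x y)" by (simp add: s power2_eq_square field_simps)
    also have "t = 2 * sK x y - 1" by (simp add: s field_simps)
    also have "real j / 2 * sK x y ^ (j-1) * (4 * sK x y * (1 - sK x y)) = 2 * real j * sK x y ^ j * (1 - sK x y)"
      by (cases j) (auto simp: field_simps)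
    finally show "(\<Sum>k\<in>UNIV. q' k y (fr k y)) = (2 * real j + 3) * sK x y ^ j - (2 * real j + 6) * sK x y ^ Suc j"
      by (simp add: algebra_simps)
  qed
  ultimately have "(2 * real j + 3) * (\<integral>y. sK x y ^ j \<partial>S3) - (2 * real j + 6) * (\<integral>y. sK x y ^ Suc j \<partial>S3) = 0"
    using I[of j] I[of "Suc j"] by simp
  then show ?case using Suc by (simp add: field_simps)
qed

section \<open>Riesz potentials on the sphere\<close>

interpretation S3xS3: pair_sigma_finite S3 S3 ..

lemma measurable_fst_S3: "(\<lambda>p. fst p) \<in> borel_measurable (S3 \<Otimes>\<^sub>M S3)"
  and measurable_snd_S3: "(\<lambda>p. snd p) \<in> borel_measurable (S3 \<Otimes>\<^sub>M S3)"
  using measurable_compose[OF measurable_fst measurable_S3_borel]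
    measurable_compose[OF measurable_snd measurable_S3_borel] by blast+

lemma measurable_fst_S3': "f \<in> borel_measurable S3 \<Longrightarrow> (\<lambda>p. f (fst p)) \<in> borel_measurable (S3 \<Otimes>\<^sub>M S3)"
  and measurable_snd_S3': "f \<in> borel_measurable S3 \<Longrightarrow> (\<lambda>p. f (snd p)) \<in> borel_measurable (S3 \<Otimes>\<^sub>M S3)"
  using measurable_compose[OF measurable_fst] measurable_compose[OF measurable_snd] by blast+

lemma measurable_S3_dist:
  "(\<lambda>p. norm (fst p - snd p)) \<in> borel_measurable (S3 \<Otimes>\<^sub>M S3)"
  by (rule measurable_compose[OF borel_measurable_diff[OF measurable_fst_S3 measurable_snd_S3] borel_measurable_norm])

lemma measurable_S3_dist1: "(\<lambda>x. norm (x - y)) \<in> borel_measurable S3"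
  by (rule measurable_compose[OF borel_measurable_diff[OF measurable_S3_borel borel_measurable_const] borel_measurable_norm])

lemma measurable_S3_ball: "(\<lambda>x. indicator {x. norm (x - y) < R} x :: real) \<in> borel_measurable S3"
  by (rule borel_measurable_S3I) (simp add: borel_measurable_indicator_iff)

lemma nn_integral_ball_le:
  assumes C: "\<And>y r. y \<in> sphere 0 1 \<Longrightarrow> r > 0 \<Longrightarrow> measure S3 (sphere 0 1 \<inter> ball y r) \<le> C * r^3"
    and "y \<in> sphere 0 1" "r > 0"
  shows "(\<integral>\<^sup>+x. ennreal (indicator {x. norm (x - y) < r} x) \<partial>S3) \<le> ennreal (C * r^3)"
proof -
  have s: "sphere 0 1 \<inter> ball y r \<in> sets S3" by (simp add: sets_S3 sets_restrict_space)
  have "(\<integral>\<^sup>+x. ennreal (indicator {x. norm (x - y) < r} x) \<partial>S3) = (\<integral>\<^sup>+x. indicator (sphere 0 1 \<inter> ball y r) x \<partial>S3)"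
    by (intro nn_integral_cong) (auto simp: indicator_def dist_norm norm_minus_commute)
  also have "\<dots> = ennreal (measure S3 (sphere 0 1 \<inter> ball y r))"
    using s by (simp add: S3.emeasure_eq_measure)
  finally show ?thesis using C assms by (simp add: ennreal_leI)
qed

text \<open>It suffices to find for each point one ball that contains it and bounds \<open>g\<close>
  there, since the sum over all balls dominates that single term.\<close>

lemma nn_integral_dyadic_le:
  fixes b :: "nat \<Rightarrow> real" and r :: "nat \<Rightarrow> real"
  assumes C: "\<And>y r. y \<in> sphere 0 1 \<Longrightarrow> r > 0 \<Longrightarrow> measure S3 (sphere 0 1 \<inter> ball y r) \<le> C * r^3"
    and y: "y \<in> sphere 0 1" and r: "\<And>k. r k > 0" and b: "\<And>k. b k \<ge> 0"
    and s: "(\<lambda>k. b k * (C * r k^3)) sums S"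
    and dom: "\<And>x. norm x = 1 \<Longrightarrow> g x \<noteq> 0 \<Longrightarrow> \<exists>k. norm (x - y) < r k \<and> g x \<le> b k"
    and C0: "C \<ge> 0"
  shows "(\<integral>\<^sup>+x. ennreal (g x) \<partial>S3) \<le> ennreal S"
proof -
  have "(\<integral>\<^sup>+x. ennreal (g x) \<partial>S3) \<le> (\<integral>\<^sup>+x. (\<Sum>k. ennreal (b k) * ennreal (indicator {x. norm (x - y) < r k} x)) \<partial>S3)"
  proof (rule nn_integral_mono)
    fix x assume "x \<in> space S3"
    then have x: "norm x = 1" by simp
    show "ennreal (g x) \<le> (\<Sum>k. ennreal (b k) * ennreal (indicator {x. norm (x - y) < r k} x))"
    proof (cases "g x = 0")
      case False
      then obtain k where k: "norm (x - y) < r k" "g x \<le> b k" using dom x by blast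
      then have "ennreal (g x) \<le> ennreal (b k) * ennreal (indicator {x. norm (x - y) < r k} x)"
        by (simp add: ennreal_leI)
      also have "\<dots> = (\<Sum>j\<in>{k}. ennreal (b j) * ennreal (indicator {x. norm (x - y) < r j} x))" by simp
      also have "\<dots> \<le> (\<Sum>j. ennreal (b j) * ennreal (indicator {x. norm (x - y) < r j} x))"
        by (rule sum_le_suminf) auto
      finally show ?thesis .
    qed simp
  qed
  also have "\<dots> = (\<Sum>k. ennreal (b k) * (\<integral>\<^sup>+x. ennreal (indicator {x. norm (x - y) < r k} x) \<partial>S3))"
    using measurable_S3_ball by (simp add: nn_integral_suminf nn_integral_cmult)
  also have "\<dots> \<le> (\<Sum>k. ennreal (b k * (C * r k^3)))"
  proof (intro suminf_le)
    fix k
    have "ennreal (b k) * (\<integral>\<^sup>+x. ennreal (indicator {x. norm (x - y) < r k} x) \<partial>S3) \<le> ennreal (b k) * ennreal (C * r k^3)"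
      by (intro mult_left_mono nn_integral_ball_le[OF C y r]) auto
    also have "\<dots> = ennreal (b k * (C * r k^3))"
      using b C0 less_imp_le[OF r] by (simp add: ennreal_mult)
    finally show "ennreal (b k) * (\<integral>\<^sup>+x. ennreal (indicator {x. norm (x - y) < r k} x) \<partial>S3) \<le> ennreal (b k * (C * r k^3))" .
  qed auto
  also have "\<dots> = ennreal S"
    using s b C0 r less_imp_le[OF r] by (subst suminf_ennreal2) (auto simp: sums_iff)
  finally show ?thesis .
qed

text \<open>On dyadic shells the volume scales with the cube of the radius, so exponent 2 gives a
  convergent geometric series inwards and exponent 6 one outwards. The exponent 6 is what the dual
  exponent 3 makes of the kernel |x - y|^(-2).\<close>

lemma riesz_near_far:
  obtains C where "C > 0"
    "\<And>y R. norm y = 1 \<Longrightarrow> R > 0 \<Longrightarrow>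
      (\<integral>\<^sup>+x. ennreal (if norm (x - y) < R then 1 / norm (x - y)^2 else 0) \<partial>S3) \<le> ennreal (C * R)"
    "\<And>y R. norm y = 1 \<Longrightarrow> R > 0 \<Longrightarrow>
      (\<integral>\<^sup>+x. ennreal (if norm (x - y) < R then 0 else 1 / norm (x - y)^6) \<partial>S3) \<le> ennreal (C / R^3)"
proof -
  obtain C where C: "C > 0" "\<And>y r. y \<in> sphere 0 1 \<Longrightarrow> r > 0 \<Longrightarrow> measure S3 (sphere 0 1 \<inter> ball y r) \<le> C * r^3"
    using measure_S3_ball by blast
  have near: "(\<integral>\<^sup>+x. ennreal (if norm (x - y) < R then 1 / norm (x - y)^2 else 0) \<partial>S3) \<le> ennreal (16 * C * R)"
    if y: "norm y = 1" and R: "R > 0" for y R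
  proof (rule order_trans[OF nn_integral_dyadic_le[where C = C and y = y and r = "\<lambda>k. R / 2^k" and b = "\<lambda>k. (2^Suc k / R)^2" and S = "8 * C * R"]])
    have "(\<lambda>k. 4 * C * R * (1/2)^k) sums (4 * C * R * (1 / (1 - 1/2)))"
      by (intro sums_mult geometric_sums) simp
    moreover have "(2^Suc k / R)^2 * (C * (R / 2^k)^3) = 4 * C * R * (1/2)^k" for k
      using R by (simp add: power_divide power2_eq_square power3_eq_cube field_simps)
    moreover have "4 * C * R * (1 / (1 - 1/2)) = 8 * C * R" by simp
    ultimately show "(\<lambda>k. (2^Suc k / R)^2 * (C * (R / 2^k)^3)) sums (8 * C * R)" by (simp only:)
    fix x :: R4 assume x: "norm x = 1" and nz: "(if norm (x - y) < R then 1 / norm (x - y)^2 else 0) \<noteq> 0"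
    define d where "d = norm (x - y)"
    have d: "0 < d" "d < R" using nz by (auto simp: d_def split: if_splits)
    obtain n where "R / d < 2^n" using real_arch_pow[of 2 "R/d"] by auto
    define k where "k = (LEAST n. R / d < 2^n)"
    have k: "R / d < 2^k" unfolding k_def using \<open>R / d < 2^n\<close> by (rule LeastI)
    have "k \<noteq> 0" using k d by (intro notI) (simp add: field_simps)
    then obtain m where m: "k = Suc m" using not0_implies_Suc by blast
    have "\<not> R / d < 2^m" using not_less_Least[of m "\<lambda>n. R / d < 2^n"] m unfolding k_def by simp
    then have a: "d * 2^m \<le> R" using d by (simp add: field_simps)
    have b: "R < d * 2^Suc m" using k d m by (simp add: field_simps)
    show "\<exists>k. norm (x - y) < R / 2^k \<and> (if norm (x - y) < R then 1 / norm (x - y)^2 else 0) \<le> (2^Suc k / R)^2"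
    \<comment> \<open>The balls are open. If \<open>d\<close> is exactly a dyadic radius, the next
      larger ball is used, and the bound on \<open>1/d\<close> is then an equality.\<close>
    proof (cases "d * 2^m < R")
      case True
      have "1/d \<le> 2^Suc m / R" using b d R by (simp add: field_simps)
      then have "(1/d)^2 \<le> (2^Suc m / R)^2" using d by (intro power_mono) auto
      then show ?thesis using True d R unfolding d_def[symmetric]
        by (intro exI[of _ m]) (simp add: field_simps power_divide)
    next
      case False
      then have eq: "d * 2^m = R" using a by simp
      then have "m \<noteq> 0" using d by (intro notI) simp
      then obtain l where l: "m = Suc l" using not0_implies_Suc by blast
      have "1/d \<le> 2^Suc l / R" using eq d R l by (simp add: field_simps)
      then have "(1/d)^2 \<le> (2^Suc l / R)^2" using d by (intro power_mono) auto
      moreover have "d < R / 2^l" using eq d l by (simp add: field_simps)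
      ultimately show ?thesis using d R unfolding d_def[symmetric]
        by (intro exI[of _ l]) (simp add: field_simps power_divide)
    qed
  qed (use C y R in \<open>auto intro!: ennreal_leI\<close>)
  have far: "(\<integral>\<^sup>+x. ennreal (if norm (x - y) < R then 0 else 1 / norm (x - y)^6) \<partial>S3) \<le> ennreal (16 * C / R^3)"
    if y: "norm y = 1" and R: "R > 0" for y R
  proof (rule order_trans[OF nn_integral_dyadic_le[where C = C and y = y and r = "\<lambda>k. R * 2^Suc k" and b = "\<lambda>k. (1 / (R * 2^k))^6" and S = "8 * C / R^3 * (1 / (1 - 1/8))"]])
    have "(\<lambda>k. 8 * C / R^3 * (1/8)^k) sums (8 * C / R^3 * (1 / (1 - 1/8)))"
      by (intro sums_mult geometric_sums) simp
    moreover have "(1 / (R * 2^k))^6 * (C * (R * 2^Suc k)^3) = 8 * C / R^3 * (1/8)^k" for k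
    proof -
      have "(8::real)^k = (2^k)^3" by (simp add: power_mult[symmetric] mult.commute[of k]) (simp add: power_mult)
      then show ?thesis
        using R by (simp add: power_divide power_mult_distrib power_numeral_reduce field_simps)
    qed
    ultimately show "(\<lambda>k. (1 / (R * 2^k))^6 * (C * (R * 2^Suc k)^3)) sums (8 * C / R^3 * (1 / (1 - 1/8)))" by simp
    fix x :: R4 assume x: "norm x = 1" and nz: "(if norm (x - y) < R then 0 else 1 / norm (x - y)^6) \<noteq> 0"
    define d where "d = norm (x - y)"
    have d: "R \<le> d" using nz by (auto simp: d_def split: if_splits)
    obtain n where "d / R < 2^n" using real_arch_pow[of 2 "d/R"] by auto
    define k where "k = (LEAST n. d / R < 2^n)"
    have k: "d / R < 2^k" unfolding k_def using \<open>d / R < 2^n\<close> by (rule LeastI)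
    have "k \<noteq> 0" using k d R by (intro notI) (simp add: field_simps)
    then obtain m where m: "k = Suc m" using not0_implies_Suc by blast
    have "\<not> d / R < 2^m" using not_less_Least[of m "\<lambda>n. d / R < 2^n"] m unfolding k_def by simp
    then have a: "R * 2^m \<le> d" using R by (simp add: field_simps)
    have b: "d < R * 2^Suc m" using k R m by (simp add: field_simps)
    have "1/d \<le> 1 / (R * 2^m)" using a R by (intro frac_le) auto
    then have "(1/d)^6 \<le> (1 / (R * 2^m))^6" using d R by (intro power_mono) (auto intro: order_trans)
    then show "\<exists>k. norm (x - y) < R * 2^Suc k \<and> (if norm (x - y) < R then 0 else 1 / norm (x - y)^6) \<le> (1 / (R * 2^k))^6"
      using b d unfolding d_def[symmetric] by (intro exI[of _ m]) (simp add: power_divide)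
  qed (use C y R in \<open>auto intro!: ennreal_leI simp: field_simps\<close>)
  show thesis by (rule that[of "16 * C"]) (use C near far in auto)
qed

text \<open>Young's inequality for the dual exponents 3/2 and 3. Comparing \<open>a\<close> with
  \<open>b^2\<close> shows that one of the two terms already dominates the product.\<close>

lemma young_3_2:
  fixes a b :: real
  assumes "0 \<le> a" "0 \<le> b"
  shows "a * b \<le> a powr (3/2) + b^3"
proof (cases "a \<le> b^2")
  case True
  then have "a * b \<le> b^2 * b" using assms by (intro mult_right_mono)
  also have "\<dots> = b^3" by (simp add: power2_eq_square power3_eq_cube)
  finally show ?thesis using powr_ge_zero[of a "3/2"] by linarith
next
  case False
  then have "b \<le> sqrt a" by (intro real_le_rsqrt) simp
  then have "a * b \<le> a * sqrt a" using assms by (intro mult_left_mono)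
  also have "\<dots> = a powr (3/2)"
    using powr_add[of a 1 "1/2"] assms by (simp add: powr_half_sqrt)
  finally show ?thesis using assms zero_le_power[of b 3] by linarith
qed

lemma ennreal_combination:
  "0 \<le> a \<Longrightarrow> 0 \<le> b \<Longrightarrow> 0 \<le> c \<Longrightarrow> 0 \<le> d \<Longrightarrow> 0 \<le> e \<Longrightarrow> 0 \<le> f \<Longrightarrow>
    ennreal a * ennreal b + ennreal c * (ennreal d + ennreal e * ennreal f) = ennreal (a * b + c * (d + e * f))"
  by (simp add: ennreal_mult[symmetric] ennreal_plus[symmetric] del: ennreal_plus)

text \<open>Inside a ball of radius \<open>R\<close> the bound \<open>s\<close> on the truncated
  function is integrated against the kernel. Outside, Young's inequality uses the normalization of
  \<open>f\<close>. The result is a pointwise bound on the potential of the part of \<open>f\<close>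
  below the level \<open>s\<close>.\<close>

lemma riesz_level:
  obtains C where "C > 0"
    "\<And>f y s. f \<in> borel_measurable S3 \<Longrightarrow> (\<And>x. 0 \<le> f x) \<Longrightarrow> (\<integral>\<^sup>+x. ennreal (f x powr (3/2)) \<partial>S3) \<le> 1 \<Longrightarrow>
      norm y = 1 \<Longrightarrow> 0 < s \<Longrightarrow>
      (\<integral>\<^sup>+x. ennreal ((if f x \<le> s then f x else 0) / norm (x - y)^2) \<partial>S3) \<le> ennreal (C * sqrt s)"
proof -
  obtain C where C: "C > 0" and
    near: "\<And>y R. norm y = 1 \<Longrightarrow> R > 0 \<Longrightarrow>
      (\<integral>\<^sup>+x. ennreal (if norm (x - y) < R then 1 / norm (x - y)^2 else 0) \<partial>S3) \<le> ennreal (C * R)" and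
    far: "\<And>y R. norm y = 1 \<Longrightarrow> R > 0 \<Longrightarrow>
      (\<integral>\<^sup>+x. ennreal (if norm (x - y) < R then 0 else 1 / norm (x - y)^6) \<partial>S3) \<le> ennreal (C / R^3)"
    using riesz_near_far by blast
  show thesis
  proof (rule that[of "2 * C + 1"])
    show "2 * C + 1 > 0" using C by simp
    fix f y and s :: real
    assume f: "f \<in> borel_measurable S3" "\<And>x. 0 \<le> f x" "(\<integral>\<^sup>+x. ennreal (f x powr (3/2)) \<partial>S3) \<le> 1"
      and y: "norm (y::R4) = 1" and s: "0 < s"
    \<comment> \<open>The near part is of order \<open>s * R\<close> and the far part of order
      \<open>1 / R\<close>; this radius balances them.\<close>
    define R where "R = 1 / sqrt s"
    have R: "R > 0" using s by (simp add: R_def)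
    note [measurable] = f(1) measurable_S3_dist1
    let ?n = "\<lambda>x. if norm (x - y) < R then 1 / norm (x - y)^2 else 0"
    let ?f = "\<lambda>x. if norm (x - y) < R then 0 else 1 / norm (x - y)^6"
    have pt: "(if f x \<le> s then f x else 0) / norm (x - y)^2 \<le> s * ?n x + (1/R) * (f x powr (3/2) + R^3 * ?f x)" for x
    proof (cases "norm (x - y) < R")
      case True
      have "(if f x \<le> s then f x else 0) / norm (x - y)^2 \<le> s / norm (x - y)^2"
        using s by (intro divide_right_mono) auto
      moreover have "0 \<le> (1/R) * (f x powr (3/2) + R^3 * ?f x)" using R by (intro mult_nonneg_nonneg add_nonneg_nonneg) auto
      ultimately show ?thesis using True by simp
    next
      case False
      define d where "d = norm (x - y)"
      have "(if f x \<le> s then f x else 0) / d^2 \<le> f x / d^2"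
        using f(2) by (intro divide_right_mono) auto
      also have "\<dots> = (1/R) * (f x * (R / d^2))" using R by simp
      also have "\<dots> \<le> (1/R) * (f x powr (3/2) + (R / d^2)^3)"
        using R f(2) by (intro mult_left_mono young_3_2) auto
      also have "(R / d^2)^3 = R^3 * (1 / d^6)" by (simp add: power_divide flip: power_mult)
      finally show ?thesis using False by (simp add: d_def)
    qed
    have "(\<integral>\<^sup>+x. ennreal ((if f x \<le> s then f x else 0) / norm (x - y)^2) \<partial>S3)
      \<le> (\<integral>\<^sup>+x. ennreal s * ennreal (?n x) + ennreal (1/R) * (ennreal (f x powr (3/2)) + ennreal (R^3) * ennreal (?f x)) \<partial>S3)"
    proof (rule nn_integral_mono)
      fix x
      have "ennreal s * ennreal (?n x) + ennreal (1/R) * (ennreal (f x powr (3/2)) + ennreal (R^3) * ennreal (?f x))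
        = ennreal (s * ?n x + (1/R) * (f x powr (3/2) + R^3 * ?f x))"
        using s R by (intro ennreal_combination) auto
      then show "ennreal ((if f x \<le> s then f x else 0) / norm (x - y)^2) \<le> ennreal s * ennreal (?n x) + ennreal (1/R) * (ennreal (f x powr (3/2)) + ennreal (R^3) * ennreal (?f x))"
        using pt[of x] by (simp only: ennreal_leI)
    qed
    also have "\<dots> = ennreal s * (\<integral>\<^sup>+x. ennreal (?n x) \<partial>S3) + ennreal (1/R) * ((\<integral>\<^sup>+x. ennreal (f x powr (3/2)) \<partial>S3) + ennreal (R^3) * (\<integral>\<^sup>+x. ennreal (?f x) \<partial>S3))"
      by (simp add: nn_integral_add nn_integral_cmult)
    also have "\<dots> \<le> ennreal s * ennreal (C * R) + ennreal (1/R) * (1 + ennreal (R^3) * ennreal (C / R^3))"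
      by (intro add_mono mult_left_mono near far f(3) y R) auto
    also have "\<dots> = ennreal (s * (C * R) + (1/R) * (1 + R^3 * (C / R^3)))"
      unfolding ennreal_1[symmetric] using s R C by (intro ennreal_combination) auto
    also have "s * (C * R) + (1/R) * (1 + R^3 * (C / R^3)) = (2 * C + 1) * sqrt s"
    proof -
      have "s = sqrt s * sqrt s" using s by simp
      then have "s * R = sqrt s" using s by (simp add: R_def field_simps)
      moreover have "1 / R = sqrt s" by (simp add: R_def)
      ultimately show ?thesis using R by (simp add: algebra_simps)
    qed
    finally show "(\<integral>\<^sup>+x. ennreal ((if f x \<le> s then f x else 0) / norm (x - y)^2) \<partial>S3) \<le> ennreal ((2 * C + 1) * sqrt s)" .
  qed
qed

text \<open>In the diagonal case no interpolation is necessary. For each pair of points either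
  \<open>f x \<le> g y\<close> or \<open>g y \<le> f x\<close>, and the kernel is symmetric. In the
  first case \<open>riesz_level\<close> at the level \<open>g y\<close> gains the root of
  \<open>g y\<close>, and \<open>g y\<close> times its root is the integrable power 3/2. General
  norms follow by scaling.\<close>

lemma hardy_littlewood_sobolev:
  obtains C where "C > 0"
    "\<And>f g A B. f \<in> borel_measurable S3 \<Longrightarrow> g \<in> borel_measurable S3 \<Longrightarrow> (\<And>x. 0 \<le> f x) \<Longrightarrow> (\<And>x. 0 \<le> g x) \<Longrightarrow>
      0 < A \<Longrightarrow> 0 < B \<Longrightarrow>
      (\<integral>\<^sup>+x. ennreal (f x powr (3/2)) \<partial>S3) \<le> ennreal (A powr (3/2)) \<Longrightarrow>
      (\<integral>\<^sup>+x. ennreal (g x powr (3/2)) \<partial>S3) \<le> ennreal (B powr (3/2)) \<Longrightarrow>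
      (\<integral>\<^sup>+x. (\<integral>\<^sup>+y. ennreal (f x * g y / norm (x - y)^2) \<partial>S3) \<partial>S3) \<le> ennreal (C * A * B)"
proof -
  obtain C where C: "C > 0" and lev: 
    "\<And>f y s. f \<in> borel_measurable S3 \<Longrightarrow> (\<And>x. 0 \<le> f x) \<Longrightarrow> (\<integral>\<^sup>+x. ennreal (f x powr (3/2)) \<partial>S3) \<le> 1 \<Longrightarrow>
      norm y = 1 \<Longrightarrow> 0 < s \<Longrightarrow>
      (\<integral>\<^sup>+x. ennreal ((if f x \<le> s then f x else 0) / norm (x - y)^2) \<partial>S3) \<le> ennreal (C * sqrt s)"
    using riesz_level by blast
  have half: "(\<integral>\<^sup>+y. (\<integral>\<^sup>+x. ennreal ((if f x \<le> g y then f x else 0) * g y / norm (x - y)^2) \<partial>S3) \<partial>S3) \<le> ennreal C"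
    if f: "f \<in> borel_measurable S3" "\<And>x. 0 \<le> f x" "(\<integral>\<^sup>+x. ennreal (f x powr (3/2)) \<partial>S3) \<le> 1"
      and g: "g \<in> borel_measurable S3" "\<And>x. 0 \<le> g x" "(\<integral>\<^sup>+x. ennreal (g x powr (3/2)) \<partial>S3) \<le> 1" for f g
  proof -
    note [measurable] = f(1) g(1) measurable_S3_dist1
    have "(\<integral>\<^sup>+y. (\<integral>\<^sup>+x. ennreal ((if f x \<le> g y then f x else 0) * g y / norm (x - y)^2) \<partial>S3) \<partial>S3)
      \<le> (\<integral>\<^sup>+y. ennreal C * ennreal (g y powr (3/2)) \<partial>S3)"
    proof (rule nn_integral_mono)
      fix y assume "y \<in> space S3"
      then have y: "norm y = 1" by simp
      show "(\<integral>\<^sup>+x. ennreal ((if f x \<le> g y then f x else 0) * g y / norm (x - y)^2) \<partial>S3) \<le> ennreal C * ennreal (g y powr (3/2))"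
      proof (cases "g y = 0")
        case False
        then have s: "0 < g y" using g(2)[of y] by simp
        have "(\<integral>\<^sup>+x. ennreal ((if f x \<le> g y then f x else 0) * g y / norm (x - y)^2) \<partial>S3)
          = (\<integral>\<^sup>+x. ennreal (g y) * ennreal ((if f x \<le> g y then f x else 0) / norm (x - y)^2) \<partial>S3)"
          using s f(2) by (intro nn_integral_cong) (simp add: ennreal_mult[symmetric] mult.commute)
        also have "\<dots> = ennreal (g y) * (\<integral>\<^sup>+x. ennreal ((if f x \<le> g y then f x else 0) / norm (x - y)^2) \<partial>S3)"
          by (rule nn_integral_cmult) measurable
        also have "\<dots> \<le> ennreal (g y) * ennreal (C * sqrt (g y))"
          by (intro mult_left_mono lev f y s) auto
        also have "\<dots> = ennreal C * ennreal (g y powr (3/2))"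
          using s C powr_add[of "g y" 1 "1/2"] by (simp add: ennreal_mult[symmetric] powr_half_sqrt mult_ac)
        finally show ?thesis .
      qed simp
    qed
    also have "\<dots> = ennreal C * (\<integral>\<^sup>+y. ennreal (g y powr (3/2)) \<partial>S3)"
      by (rule nn_integral_cmult) measurable
    also have "\<dots> \<le> ennreal C * 1" by (intro mult_left_mono g(3)) auto
    finally show ?thesis by simp
  qed
  have unit: "(\<integral>\<^sup>+x. (\<integral>\<^sup>+y. ennreal (f x * g y / norm (x - y)^2) \<partial>S3) \<partial>S3) \<le> ennreal (2 * C)"
    if f: "f \<in> borel_measurable S3" "\<And>x. 0 \<le> f x" "(\<integral>\<^sup>+x. ennreal (f x powr (3/2)) \<partial>S3) \<le> 1"
      and g: "g \<in> borel_measurable S3" "\<And>x. 0 \<le> g x" "(\<integral>\<^sup>+x. ennreal (g x powr (3/2)) \<partial>S3) \<le> 1" for f g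
  proof -
    note [measurable] = measurable_fst_S3'[OF f(1)] measurable_snd_S3'[OF f(1)] measurable_fst_S3'[OF g(1)] measurable_snd_S3'[OF g(1)] measurable_S3_dist
    let ?P = "\<lambda>p. ennreal ((if f (fst p) \<le> g (snd p) then f (fst p) else 0) * g (snd p) / norm (fst p - snd p)^2)"
    let ?Q = "\<lambda>p. ennreal (f (fst p) * (if g (snd p) \<le> f (fst p) then g (snd p) else 0) / norm (fst p - snd p)^2)"
    have PQ [measurable]: "?P \<in> borel_measurable (S3 \<Otimes>\<^sub>M S3)" "?Q \<in> borel_measurable (S3 \<Otimes>\<^sub>M S3)"
      by measurable
    have inner: "(\<lambda>y. ?P (x, y)) \<in> borel_measurable S3" "(\<lambda>y. ?Q (x, y)) \<in> borel_measurable S3" if "x \<in> space S3" for x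
      using measurable_compose[OF measurable_Pair1'[OF that] PQ(1)] measurable_compose[OF measurable_Pair1'[OF that] PQ(2)] by simp_all
    have "(\<integral>\<^sup>+x. (\<integral>\<^sup>+y. ennreal (f x * g y / norm (x - y)^2) \<partial>S3) \<partial>S3)
      \<le> (\<integral>\<^sup>+x. (\<integral>\<^sup>+y. ?P (x, y) + ?Q (x, y) \<partial>S3) \<partial>S3)"
    proof (intro nn_integral_mono)
      fix x y
      have "f x * g y / norm (x - y)^2 \<le> (if f x \<le> g y then f x else 0) * g y / norm (x - y)^2 + f x * (if g y \<le> f x then g y else 0) / norm (x - y)^2"
        using f(2)[of x] g(2)[of y] by auto
      then show "ennreal (f x * g y / norm (x - y)^2) \<le> ?P (x, y) + ?Q (x, y)"
        using f(2)[of x] g(2)[of y] by (simp add: ennreal_plus[symmetric] ennreal_leI del: ennreal_plus)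
    qed
    also have "\<dots> = (\<integral>\<^sup>+x. (\<integral>\<^sup>+y. ?P (x, y) \<partial>S3) + (\<integral>\<^sup>+y. ?Q (x, y) \<partial>S3) \<partial>S3)"
      using inner by (intro nn_integral_cong nn_integral_add) auto
    also have "\<dots> = (\<integral>\<^sup>+x. (\<integral>\<^sup>+y. ?P (x, y) \<partial>S3) \<partial>S3) + (\<integral>\<^sup>+x. (\<integral>\<^sup>+y. ?Q (x, y) \<partial>S3) \<partial>S3)"
      by (rule nn_integral_add) (use PQ S3.borel_measurable_nn_integral_fst in auto)
    also have "(\<integral>\<^sup>+x. (\<integral>\<^sup>+y. ?P (x, y) \<partial>S3) \<partial>S3) = (\<integral>\<^sup>+y. (\<integral>\<^sup>+x. ?P (x, y) \<partial>S3) \<partial>S3)"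
      using S3xS3.Fubini[OF PQ(1)] by simp
    also have "\<dots> \<le> ennreal C" using half[OF f g] unfolding fst_conv snd_conv .
    also have "(\<integral>\<^sup>+x. (\<integral>\<^sup>+y. ?Q (x, y) \<partial>S3) \<partial>S3) \<le> ennreal C"
      using half[OF g f] unfolding fst_conv snd_conv by (simp only: norm_minus_commute mult.commute)
    finally show ?thesis using C by (simp add: ennreal_plus[symmetric] del: ennreal_plus)
  qed
  show thesis
  proof (rule that[of "2 * C"])
    fix f g :: "R4 \<Rightarrow> real" and A B :: real
    assume f: "f \<in> borel_measurable S3" and g: "g \<in> borel_measurable S3" and f0: "\<And>x. 0 \<le> f x" and g0: "\<And>x. 0 \<le> g x"
      and A: "0 < A" and B: "0 < B"
      and fA: "(\<integral>\<^sup>+x. ennreal (f x powr (3/2)) \<partial>S3) \<le> ennreal (A powr (3/2))"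
      and gB: "(\<integral>\<^sup>+x. ennreal (g x powr (3/2)) \<partial>S3) \<le> ennreal (B powr (3/2))"
    have norm: "(\<integral>\<^sup>+x. ennreal ((h x / D) powr (3/2)) \<partial>S3) \<le> 1"
      if [measurable]: "h \<in> borel_measurable S3" and h: "\<And>x. 0 \<le> h x" and D: "0 < D"
        and hD: "(\<integral>\<^sup>+x. ennreal (h x powr (3/2)) \<partial>S3) \<le> ennreal (D powr (3/2))" for h :: "R4 \<Rightarrow> real" and D
    proof -
      have "(\<integral>\<^sup>+x. ennreal ((h x / D) powr (3/2)) \<partial>S3) = (\<integral>\<^sup>+x. ennreal (1 / D powr (3/2)) * ennreal (h x powr (3/2)) \<partial>S3)"
        using h D by (intro nn_integral_cong) (simp add: powr_divide ennreal_mult[symmetric])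
      also have "\<dots> = ennreal (1 / D powr (3/2)) * (\<integral>\<^sup>+x. ennreal (h x powr (3/2)) \<partial>S3)"
        by (rule nn_integral_cmult) measurable
      also have "\<dots> \<le> ennreal (1 / D powr (3/2)) * ennreal (D powr (3/2))"
        by (intro mult_left_mono hD) auto
      also have "\<dots> = 1" using D by (simp add: ennreal_mult[symmetric])
      finally show ?thesis .
    qed
    note [measurable] = f g measurable_fst_S3'[OF f] measurable_snd_S3'[OF g] measurable_S3_dist
    let ?F = "\<lambda>p. ennreal (f (fst p) / A * (g (snd p) / B) / norm (fst p - snd p)^2)"
    have F [measurable]: "?F \<in> borel_measurable (S3 \<Otimes>\<^sub>M S3)" by measurable
    have inner: "(\<lambda>y. ?F (x, y)) \<in> borel_measurable S3" if "x \<in> space S3" for x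
      using measurable_compose[OF measurable_Pair1'[OF that] F] by simp
    have "(\<integral>\<^sup>+x. (\<integral>\<^sup>+y. ennreal (f x * g y / norm (x - y)^2) \<partial>S3) \<partial>S3)
      = (\<integral>\<^sup>+x. (\<integral>\<^sup>+y. ennreal (A * B) * ?F (x, y) \<partial>S3) \<partial>S3)"
      using A B f0 g0 by (intro nn_integral_cong) (simp add: ennreal_mult[symmetric])
    also have "\<dots> = (\<integral>\<^sup>+x. ennreal (A * B) * (\<integral>\<^sup>+y. ?F (x, y) \<partial>S3) \<partial>S3)"
      using inner by (intro nn_integral_cong nn_integral_cmult) auto
    also have "\<dots> = ennreal (A * B) * (\<integral>\<^sup>+x. (\<integral>\<^sup>+y. ?F (x, y) \<partial>S3) \<partial>S3)"
      by (rule nn_integral_cmult) (use F S3.borel_measurable_nn_integral_fst in auto)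
    also have "\<dots> \<le> ennreal (A * B) * ennreal (2 * C)"
      using unit[of "\<lambda>x. f x / A" "\<lambda>x. g x / B"] norm[OF f f0 A fA] norm[OF g g0 B gB] A B f0 g0
      by (intro mult_left_mono) simp_all
    also have "\<dots> = ennreal (2 * C * A * B)" using A B C by (simp add: ennreal_mult[symmetric] mult_ac)
    finally show "(\<integral>\<^sup>+x. (\<integral>\<^sup>+y. ennreal (f x * g y / norm (x - y)^2) \<partial>S3) \<partial>S3) \<le> ennreal (2 * C * A * B)" .
  qed (use C in simp)
qed

section \<open>The approximate identity\<close>

lemma pk_nonneg: "norm x = 1 \<Longrightarrow> norm y = 1 \<Longrightarrow> 0 \<le> pk N (sK x y)"
  using sK_bounds(1)[of x y] less_imp_le[OF mom_pos[of N]] by (simp add: pk_def)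

lemma continuous_pk: "continuous_on UNIV (\<lambda>y. pk N (sK x y))"
  unfolding pk_def by (intro continuous_intros) (simp add: less_imp_neq[OF mom_pos, symmetric])

lemma measurable_sK: "(\<lambda>p. sK (fst p) (snd p)) \<in> borel_measurable (S3 \<Otimes>\<^sub>M S3)"
  unfolding sK_def using measurable_fst_S3 measurable_snd_S3 by simp

lemma measurable_pk: "(\<lambda>p. pk N (sK (fst p) (snd p))) \<in> borel_measurable (S3 \<Otimes>\<^sub>M S3)"
  unfolding pk_def using measurable_sK by simp

lemma measurable_pk1: "(\<lambda>y. pk N (sK x y)) \<in> borel_measurable S3"
  by (intro borel_measurable_S3I borel_measurable_continuous_onI continuous_pk)

lemma integral_pk:
  assumes "norm x = 1"
  shows "(\<integral>y. pk N (sK x y) \<partial>S3) = area3"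
  using integral_sK_power[OF assms, of N] less_imp_neq[OF mom_pos[of N]] by (simp add: pk_def)

lemma nn_integral_pk:
  assumes "norm x = 1"
  shows "(\<integral>\<^sup>+y. ennreal (pk N (sK x y)) \<partial>S3) = ennreal area3"
    "(\<integral>\<^sup>+y. ennreal (pk N (sK y x)) \<partial>S3) = ennreal area3"
proof -
  have "AE y in S3. 0 \<le> pk N (sK x y)"
    by (rule AE_I2) (use assms pk_nonneg in simp)
  then show "(\<integral>\<^sup>+y. ennreal (pk N (sK x y)) \<partial>S3) = ennreal area3"
    using nn_integral_eq_integral[OF integrable_S3_bounded[OF continuous_pk[of N x]]] assms
    by (simp add: integral_pk)
  then show "(\<integral>\<^sup>+y. ennreal (pk N (sK y x)) \<partial>S3) = ennreal area3"
    by (simp add: sK_commute[of _ x])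
qed

text \<open>The squared chord is \<open>4 * (1 - sK x y)\<close>, so the integral is a difference of
  consecutive moments. Its decay in \<open>N\<close> expresses that \<open>pk N\<close> concentrates
  on the diagonal.\<close>

lemma nn_integral_pk_dist2:
  assumes x: "norm x = 1"
  shows "(\<integral>\<^sup>+y. ennreal (pk N (sK x y) * norm (x - y)^2) \<partial>S3) = ennreal (6 * area3 / (real N + 3))"
proof -
  have c: "continuous_on UNIV (\<lambda>y. pk N (sK x y) * norm (x - y)^2)"
    by (intro continuous_intros continuous_pk)
  have I: "integrable S3 (\<lambda>y. sK x y ^ n)" for n by (intro integrable_S3_bounded continuous_intros)
  have "(\<integral>y. pk N (sK x y) * norm (x - y)^2 \<partial>S3) = (\<integral>y. 4 / mom N * sK x y ^ N - 4 / mom N * sK x y ^ Suc N \<partial>S3)"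
  proof (rule Bochner_Integration.integral_cong[OF refl])
    fix y assume "y \<in> space S3"
    then have eq: "norm (x - y)^2 = 4 * (1 - sK x y)"
      using sK_dist[OF x, of y] by (simp add: power_divide)
    show "pk N (sK x y) * norm (x - y)^2 = 4 / mom N * sK x y ^ N - 4 / mom N * sK x y ^ Suc N"
      unfolding eq by (simp add: pk_def diff_divide_distrib algebra_simps)
  qed
  also have "\<dots> = 4 / mom N * (area3 * mom N) - 4 / mom N * (area3 * mom (Suc N))"
    using I[of N] I[of "Suc N"] integral_sK_power[OF x] by (simp del: mom.simps power_Suc)
  also have "\<dots> = 6 * area3 / (real N + 3)"
  proof -
    have "4 / m * (a * m) - 4 / m * (a * (m * (q - 3/2) / q)) = 6 * a / q" if "m \<noteq> 0" "q \<noteq> 0" for m a q :: real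
      using that by (simp add: field_simps)
    from this[of "mom N" "real N + 3" area3] show ?thesis
      using less_imp_neq[OF mom_pos[of N]] by (simp add: add.commute)
  qed
  finally have "(\<integral>y. pk N (sK x y) * norm (x - y)^2 \<partial>S3) = 6 * area3 / (real N + 3)" .
  moreover have "AE y in S3. 0 \<le> pk N (sK x y) * norm (x - y)^2"
    by (rule AE_I2) (use pk_nonneg[OF x] in simp)
  ultimately show ?thesis
    using nn_integral_eq_integral[OF integrable_S3_bounded[OF c]] by simp
qed

lemma nn_integral_pk_cmult_left:
  assumes [measurable]: "h \<in> borel_measurable S3" and h: "\<And>x. 0 \<le> h x"
  shows "(\<integral>\<^sup>+x. (\<integral>\<^sup>+y. ennreal (pk N (sK x y) * h x) \<partial>S3) \<partial>S3) = ennreal area3 * (\<integral>\<^sup>+x. ennreal (h x) \<partial>S3)"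
proof -
  note [measurable] = measurable_pk1
  have "(\<integral>\<^sup>+x. (\<integral>\<^sup>+y. ennreal (pk N (sK x y) * h x) \<partial>S3) \<partial>S3) = (\<integral>\<^sup>+x. ennreal area3 * ennreal (h x) \<partial>S3)"
  proof (rule nn_integral_cong)
    fix x assume "x \<in> space S3"
    then have x: "norm x = 1" by simp
    have "(\<integral>\<^sup>+y. ennreal (pk N (sK x y) * h x) \<partial>S3) = (\<integral>\<^sup>+y. ennreal (pk N (sK x y)) * ennreal (h x) \<partial>S3)"
      using pk_nonneg[OF x] h by (intro nn_integral_cong ennreal_mult) auto
    also have "\<dots> = ennreal area3 * ennreal (h x)"
      by (simp add: nn_integral_multc nn_integral_pk[OF x])
    finally show "(\<integral>\<^sup>+y. ennreal (pk N (sK x y) * h x) \<partial>S3) = ennreal area3 * ennreal (h x)" .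
  qed
  then show ?thesis by (simp add: nn_integral_cmult)
qed

lemma nn_integral_pk_cmult_right:
  assumes h: "h \<in> borel_measurable S3" "\<And>x. 0 \<le> h x"
  shows "(\<integral>\<^sup>+x. (\<integral>\<^sup>+y. ennreal (pk N (sK x y) * h y) \<partial>S3) \<partial>S3) = ennreal area3 * (\<integral>\<^sup>+x. ennreal (h x) \<partial>S3)"
proof -
  have m: "(\<lambda>p. ennreal (pk N (sK (fst p) (snd p)) * h (snd p))) \<in> borel_measurable (S3 \<Otimes>\<^sub>M S3)"
    using measurable_pk measurable_snd_S3'[OF h(1)] by simp
  show ?thesis
    using S3xS3.Fubini[OF m] nn_integral_pk_cmult_left[OF h, of N] by (simp add: sK_commute)
qed

section \<open>Continuity in the mean\<close>

text \<open>A modulus of continuity in L^1, averaged against the approximate identity; it plays the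
  part that continuity of translations in L^1 plays on a vector space.\<close>

definition osc :: "nat \<Rightarrow> (R4 \<Rightarrow> real) \<Rightarrow> ennreal" where
  "osc N f = (\<integral>\<^sup>+x. (\<integral>\<^sup>+y. ennreal (pk N (sK x y) * \<bar>f x - f y\<bar>) \<partial>S3) \<partial>S3)"

lemma measurable_osc:
  assumes "f \<in> borel_measurable S3"
  shows "(\<lambda>p. ennreal (pk N (sK (fst p) (snd p)) * \<bar>f (fst p) - f (snd p)\<bar>)) \<in> borel_measurable (S3 \<Otimes>\<^sub>M S3)"
  using measurable_pk measurable_fst_S3'[OF assms] measurable_snd_S3'[OF assms] by simp

lemma nn_integral_S3_add:
  assumes "F \<in> borel_measurable (S3 \<Otimes>\<^sub>M S3)" "G \<in> borel_measurable (S3 \<Otimes>\<^sub>M S3)"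
  shows "(\<integral>\<^sup>+x. (\<integral>\<^sup>+y. F (x, y) + G (x, y) \<partial>S3) \<partial>S3)
    = (\<integral>\<^sup>+x. (\<integral>\<^sup>+y. F (x, y) \<partial>S3) \<partial>S3) + (\<integral>\<^sup>+x. (\<integral>\<^sup>+y. G (x, y) \<partial>S3) \<partial>S3)"
proof -
  have "(\<integral>\<^sup>+x. (\<integral>\<^sup>+y. F (x, y) + G (x, y) \<partial>S3) \<partial>S3) = integral\<^sup>N (S3 \<Otimes>\<^sub>M S3) (\<lambda>p. F p + G p)"
    using assms by (subst S3.nn_integral_fst[of "\<lambda>p. F p + G p", symmetric]) auto
  also have "\<dots> = integral\<^sup>N (S3 \<Otimes>\<^sub>M S3) F + integral\<^sup>N (S3 \<Otimes>\<^sub>M S3) G"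
    using assms by (rule nn_integral_add)
  finally show ?thesis using assms by (simp add: S3.nn_integral_fst)
qed

lemma osc_triangle:
  assumes f: "f \<in> borel_measurable S3" and g: "g \<in> borel_measurable S3"
  shows "osc N f \<le> osc N g + osc N (\<lambda>x. f x - g x)"
proof -
  have d: "(\<lambda>x. f x - g x) \<in> borel_measurable S3" using f g by simp
  have "osc N f \<le> (\<integral>\<^sup>+x. (\<integral>\<^sup>+y. ennreal (pk N (sK x y) * \<bar>g x - g y\<bar>) +
     ennreal (pk N (sK x y) * \<bar>(f x - g x) - (f y - g y)\<bar>) \<partial>S3) \<partial>S3)"
    unfolding osc_def
  proof (intro nn_integral_mono)
    fix x y assume "x \<in> space S3" "y \<in> space S3"
    then have p: "0 \<le> pk N (sK x y)" using pk_nonneg by simp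
    have "pk N (sK x y) * \<bar>f x - f y\<bar> \<le> pk N (sK x y) * (\<bar>g x - g y\<bar> + \<bar>(f x - g x) - (f y - g y)\<bar>)"
      using p by (intro mult_left_mono) auto
    then show "ennreal (pk N (sK x y) * \<bar>f x - f y\<bar>) \<le> ennreal (pk N (sK x y) * \<bar>g x - g y\<bar>) +
     ennreal (pk N (sK x y) * \<bar>(f x - g x) - (f y - g y)\<bar>)"
      using p by (simp add: ennreal_plus[symmetric] ennreal_leI distrib_left del: ennreal_plus)
  qed
  also have "\<dots> = osc N g + osc N (\<lambda>x. f x - g x)"
    unfolding osc_def using nn_integral_S3_add[OF measurable_osc[OF g] measurable_osc[OF d]] by simp
  finally show ?thesis .
qed

lemma osc_le_L1:
  assumes f: "f \<in> borel_measurable S3"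
  shows "osc N f \<le> ennreal (2 * area3) * (\<integral>\<^sup>+x. ennreal \<bar>f x\<bar> \<partial>S3)"
proof -
  have a: "(\<lambda>x. \<bar>f x\<bar>) \<in> borel_measurable S3" using f by simp
  have m: "(\<lambda>p. ennreal (pk N (sK (fst p) (snd p)) * \<bar>f (fst p)\<bar>)) \<in> borel_measurable (S3 \<Otimes>\<^sub>M S3)"
     "(\<lambda>p. ennreal (pk N (sK (fst p) (snd p)) * \<bar>f (snd p)\<bar>)) \<in> borel_measurable (S3 \<Otimes>\<^sub>M S3)"
    using measurable_pk measurable_fst_S3'[OF f] measurable_snd_S3'[OF f] by simp_all
  have "osc N f \<le> (\<integral>\<^sup>+x. (\<integral>\<^sup>+y. ennreal (pk N (sK x y) * \<bar>f x\<bar>) + ennreal (pk N (sK x y) * \<bar>f y\<bar>) \<partial>S3) \<partial>S3)"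
    unfolding osc_def
  proof (intro nn_integral_mono)
    fix x y assume "x \<in> space S3" "y \<in> space S3"
    then have p: "0 \<le> pk N (sK x y)" using pk_nonneg by simp
    have "pk N (sK x y) * \<bar>f x - f y\<bar> \<le> pk N (sK x y) * (\<bar>f x\<bar> + \<bar>f y\<bar>)"
      using p by (intro mult_left_mono) auto
    then show "ennreal (pk N (sK x y) * \<bar>f x - f y\<bar>) \<le> ennreal (pk N (sK x y) * \<bar>f x\<bar>) + ennreal (pk N (sK x y) * \<bar>f y\<bar>)"
      using p by (simp add: ennreal_plus[symmetric] ennreal_leI distrib_left del: ennreal_plus)
  qed
  also have "\<dots> = ennreal area3 * (\<integral>\<^sup>+x. ennreal \<bar>f x\<bar> \<partial>S3) + ennreal area3 * (\<integral>\<^sup>+x. ennreal \<bar>f x\<bar> \<partial>S3)"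
    using nn_integral_S3_add[OF m] nn_integral_pk_cmult_left[OF a, of N] nn_integral_pk_cmult_right[OF a, of N] by simp
  also have "\<dots> = ennreal (2 * area3) * (\<integral>\<^sup>+x. ennreal \<bar>f x\<bar> \<partial>S3)"
    using area3_pos by (simp add: distrib_right[symmetric] ennreal_plus[symmetric] del: ennreal_plus)
  finally show ?thesis .
qed

text \<open>The class is closed in L^1. It is enlarged from Lipschitz functions to indicators of
  compact sets, then of measurable sets, and finally to all integrable functions.\<close>

definition osc_small :: "(R4 \<Rightarrow> real) \<Rightarrow> bool" where
  "osc_small f \<longleftrightarrow> f \<in> borel_measurable S3 \<and> (\<forall>e>0. \<exists>N0. \<forall>N\<ge>N0. osc N f \<le> ennreal e)"

lemma osc_small_L1_closed:
  assumes f: "f \<in> borel_measurable S3"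
    and ap: "\<And>e. e > 0 \<Longrightarrow> \<exists>g. osc_small g \<and> (\<integral>\<^sup>+x. ennreal \<bar>f x - g x\<bar> \<partial>S3) \<le> ennreal e"
  shows "osc_small f"
  unfolding osc_small_def
proof (intro conjI allI impI f)
  fix e :: real assume e: "e > 0"
  then have e': "e / (4 * area3) > 0" using area3_pos by simp
  then obtain g where g: "osc_small g" "(\<integral>\<^sup>+x. ennreal \<bar>f x - g x\<bar> \<partial>S3) \<le> ennreal (e / (4 * area3))"
    using ap by blast
  have gm: "g \<in> borel_measurable S3" using g by (simp add: osc_small_def)
  have "e/2 > 0" using e by simp
  then obtain N0 where N0: "\<forall>N\<ge>N0. osc N g \<le> ennreal (e/2)" using g(1) unfolding osc_small_def by blast
  show "\<exists>N0. \<forall>N\<ge>N0. osc N f \<le> ennreal e"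
  proof (intro exI[of _ N0] allI impI)
    fix N assume N: "N0 \<le> N"
    have "osc N (\<lambda>x. f x - g x) \<le> ennreal (2 * area3) * ennreal (e / (4 * area3))"
      using f gm g(2) by (intro order_trans[OF osc_le_L1] mult_left_mono) auto
    also have "\<dots> = ennreal (e/2)" using area3_pos e by (simp add: ennreal_mult[symmetric])
    finally have "osc N f \<le> ennreal (e/2) + ennreal (e/2)"
      using N0 N by (intro order_trans[OF osc_triangle[OF f gm]] add_mono) auto
    then show "osc N f \<le> ennreal e" using e by (simp add: ennreal_plus[symmetric] del: ennreal_plus)
  qed
qed

lemma ennreal_combination2:
  "0 \<le> a \<Longrightarrow> 0 \<le> b \<Longrightarrow> 0 \<le> c \<Longrightarrow> 0 \<le> d \<Longrightarrow>
    ennreal a * ennreal b + ennreal c * ennreal d = ennreal (a * b + c * d)"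
  by (simp add: ennreal_mult[symmetric] ennreal_plus[symmetric] del: ennreal_plus)

text \<open>A distance \<open>d\<close> is at most \<open>\<delta> + d^2 / \<delta>\<close>. The
  first term meets the mass of the kernel, the second its second moment, which tends to
  zero.\<close>

lemma osc_small_lipschitz:
  assumes f: "f \<in> borel_measurable S3" and L: "L \<ge> 0"
    and lip: "\<And>x y. norm x = 1 \<Longrightarrow> norm y = 1 \<Longrightarrow> \<bar>f x - f y\<bar> \<le> L * norm (x - y)"
  shows "osc_small f"
  unfolding osc_small_def
proof (intro conjI allI impI f)
  fix e :: real assume e: "e > 0"
  \<comment> \<open>One factor \<open>area3\<close> is the mass of the kernel, the other that of the
    outer integral. Using \<open>L + 1\<close> keeps the quotient meaningful for
    \<open>L = 0\<close>.\<close>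
  define \<delta> where "\<delta> = e / (2 * (L + 1) * area3 * area3)"
  have \<delta>: "\<delta> > 0" using e L area3_pos by (simp add: \<delta>_def)
  obtain N0 :: nat where N0: "real N0 \<ge> 12 * (L + 1) * area3 * area3 / (\<delta> * e)" using real_arch_simple by blast
  show "\<exists>N0. \<forall>N\<ge>N0. osc N f \<le> ennreal e"
  proof (intro exI[of _ N0] allI impI)
    fix N assume N: "N0 \<le> N"
    have "osc N f \<le> (\<integral>\<^sup>+x. ennreal e / ennreal area3 \<partial>S3)"
      unfolding osc_def
    proof (rule nn_integral_mono)
      fix x assume "x \<in> space S3"
      then have x: "norm x = 1" by simp
      note [measurable] = measurable_pk1 measurable_S3_dist1
      have [measurable]: "(\<lambda>y. norm (x - y)) \<in> borel_measurable S3"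
        using measurable_S3_dist1[of x] by (simp add: norm_minus_commute)
      have "(\<integral>\<^sup>+y. ennreal (pk N (sK x y) * \<bar>f x - f y\<bar>) \<partial>S3)
        \<le> (\<integral>\<^sup>+y. ennreal ((L + 1) * \<delta>) * ennreal (pk N (sK x y)) + ennreal ((L + 1) / \<delta>) * ennreal (pk N (sK x y) * norm (x - y)^2) \<partial>S3)"
      proof (rule nn_integral_mono)
        fix y assume "y \<in> space S3"
        then have y: "norm y = 1" by simp
        have p: "0 \<le> pk N (sK x y)" using pk_nonneg x y by simp
        define d where "d = norm (x - y)"
        have "d \<le> \<delta> + d^2 / \<delta>"
        proof (cases "d \<le> \<delta>")
          case False
          then have "d * 1 \<le> d * (d / \<delta>)" using \<delta> by (intro mult_left_mono) auto
          then show ?thesis using \<delta> by (simp add: power2_eq_square)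
        qed (use \<delta> in \<open>simp add: add_increasing2\<close>)
        then have "L * d \<le> (L + 1) * (\<delta> + d^2 / \<delta>)" using L by (intro mult_mono) (auto simp: d_def)
        then have "\<bar>f x - f y\<bar> \<le> (L + 1) * \<delta> + (L + 1) / \<delta> * d^2"
          using lip[OF x y] by (simp add: d_def distrib_left)
        then have "pk N (sK x y) * \<bar>f x - f y\<bar> \<le> pk N (sK x y) * ((L + 1) * \<delta> + (L + 1) / \<delta> * d^2)"
          using p by (rule mult_left_mono)
        also have "\<dots> = (L + 1) * \<delta> * pk N (sK x y) + (L + 1) / \<delta> * (pk N (sK x y) * d^2)"
          by (simp only: distrib_left mult_ac)
        finally have "ennreal (pk N (sK x y) * \<bar>f x - f y\<bar>) \<le> ennreal ((L + 1) * \<delta> * pk N (sK x y) + (L + 1) / \<delta> * (pk N (sK x y) * d^2))"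
          by (rule ennreal_leI)
        also have "\<dots> = ennreal ((L + 1) * \<delta>) * ennreal (pk N (sK x y)) + ennreal ((L + 1) / \<delta>) * ennreal (pk N (sK x y) * d^2)"
          using L \<delta> p by (intro ennreal_combination2[symmetric]) auto
        finally show "ennreal (pk N (sK x y) * \<bar>f x - f y\<bar>) \<le> ennreal ((L + 1) * \<delta>) * ennreal (pk N (sK x y)) + ennreal ((L + 1) / \<delta>) * ennreal (pk N (sK x y) * norm (x - y)^2)"
          by (simp add: d_def)
      qed
      also have "\<dots> = ennreal ((L + 1) * \<delta>) * ennreal area3 + ennreal ((L + 1) / \<delta>) * ennreal (6 * area3 / (real N + 3))"
        by (simp add: nn_integral_add nn_integral_cmult nn_integral_pk[OF x] nn_integral_pk_dist2[OF x])
      also have "\<dots> = ennreal ((L + 1) * \<delta> * area3 + (L + 1) / \<delta> * (6 * area3 / (real N + 3)))"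
        using L \<delta> area3_pos by (intro ennreal_combination2) auto
      also have "\<dots> \<le> ennreal (e / area3)"
      proof (rule ennreal_leI)
        have half: "e / area3 = e / (2 * area3) + e / (2 * area3)" by simp
        have a: "(L + 1) * \<delta> * area3 = e / (2 * area3)"
        proof -
          have "M * (e / (2 * M * A * A)) * A = e / (2 * A)" if "M \<noteq> 0" "A \<noteq> 0" for M A :: real
            using that by (simp add: field_simps)
          from this[of "L + 1" area3] show ?thesis
            unfolding \<delta>_def using L area3_pos by simp
        qed
        have "12 * (L + 1) * area3 * area3 / (\<delta> * e) \<le> real N + 3" using N0 N by linarith
        then have "12 * (L + 1) * area3 * area3 \<le> (real N + 3) * (\<delta> * e)" using \<delta> e by (simp add: pos_divide_le_eq)
        then have "(L + 1) / \<delta> * (6 * area3 / (real N + 3)) \<le> e / (2 * area3)"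
        proof -
          assume le: "12 * (L + 1) * area3 * area3 \<le> (real N + 3) * (\<delta> * e)"
          have "(L + 1) / \<delta> * (6 * area3 / (real N + 3)) = 12 * (L + 1) * area3 * area3 / ((real N + 3) * (\<delta> * e)) * (e / (2 * area3))"
            using \<delta> e area3_pos by (simp add: divide_simps)
          also have "\<dots> \<le> 1 * (e / (2 * area3))"
            using le \<delta> e area3_pos by (intro mult_right_mono) (auto simp: pos_divide_le_eq)
          finally show ?thesis by simp
        qed
        then show "(L + 1) * \<delta> * area3 + (L + 1) / \<delta> * (6 * area3 / (real N + 3)) \<le> e / area3"
          unfolding a using half by linarith
      qed
      also have "ennreal (e / area3) = ennreal e / ennreal area3"
        using area3_pos e by (simp add: divide_ennreal)
      finally show "(\<integral>\<^sup>+y. ennreal (pk N (sK x y) * \<bar>f x - f y\<bar>) \<partial>S3) \<le> ennreal e / ennreal area3" .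
    qed
    also have "\<dots> = ennreal e / ennreal area3 * ennreal area3"
      by (simp add: S3.emeasure_eq_measure area3_def)
    also have "\<dots> = ennreal e" using area3_pos e by (simp add: divide_ennreal ennreal_mult[symmetric])
    finally show "osc N f \<le> ennreal e" .
  qed
qed

text \<open>The indicator is the pointwise limit of Lipschitz functions of the distance to
  \<open>K\<close>, and dominated convergence makes this a limit in L^1.\<close>

lemma osc_small_compact:
  assumes K: "compact K" "K \<subseteq> sphere 0 1"
  shows "osc_small (indicator K)"
\<comment> \<open>The distance to the empty set is 0 by convention, so the approximating functions
  would not tend to its indicator.\<close>
proof (cases "K = {}")
  case True
  then show ?thesis by (intro osc_small_lipschitz[of _ 0]) auto
next
  case False
  define h where "h j x = max 0 (1 - real j * infdist x K)" for j x
  have hm: "h j \<in> borel_measurable S3" for j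
    unfolding h_def by (intro borel_measurable_S3I borel_measurable_continuous_onI continuous_intros)
  have im: "(indicator K :: R4 \<Rightarrow> real) \<in> borel_measurable S3"
    using K by (intro borel_measurable_S3I) (simp add: compact_imp_closed borel_closed)
  have hs: "osc_small (h j)" for j
  proof (rule osc_small_lipschitz[OF hm, of "real j"])
    fix x y :: R4
    have "\<bar>h j x - h j y\<bar> \<le> \<bar>real j * infdist x K - real j * infdist y K\<bar>" unfolding h_def by linarith
    also have "\<dots> = real j * \<bar>infdist x K - infdist y K\<bar>" by (simp add: abs_mult flip: right_diff_distrib)
    also have "\<dots> \<le> real j * norm (x - y)"
      using infdist_triangle_abs[of x K y] by (intro mult_left_mono) (auto simp: dist_norm)
    finally show "\<bar>h j x - h j y\<bar> \<le> real j * norm (x - y)" .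
  qed simp
  have lim: "(\<lambda>j. h j x) \<longlonglongrightarrow> indicator K x" for x
  proof (cases "x \<in> K")
    case True
    then show ?thesis by (simp add: h_def)
  next
    case False
    then have pos: "infdist x K > 0"
      using \<open>K \<noteq> {}\<close> K in_closed_iff_infdist_zero[of K x] infdist_nonneg[of x K] by (auto simp: compact_imp_closed order.strict_iff_order)
    obtain n :: nat where n: "real n * infdist x K > 1" using ex_less_of_nat_mult[OF pos] by blast
    have "\<forall>\<^sub>F j in sequentially. h j x = 0"
      using eventually_ge_at_top[of n]
    proof eventually_elim
      case (elim j)
      then have "real n * infdist x K \<le> real j * infdist x K" by (intro mult_right_mono infdist_nonneg) auto
      then show ?case using n by (simp add: h_def)
    qed
    then show ?thesis using False by (simp add: tendsto_eventually)
  qed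
  have hb: "0 \<le> h j x" "h j x \<le> 1" for j x using infdist_nonneg[of x K] by (auto simp: h_def)
  have "(\<lambda>j. \<integral>x. \<bar>indicator K x - h j x\<bar> \<partial>S3) \<longlonglongrightarrow> (\<integral>x. 0 \<partial>S3)"
  proof (rule integral_dominated_convergence[where w = "\<lambda>_. 1"])
    show "AE x in S3. (\<lambda>j. \<bar>indicator K x - h j x\<bar>) \<longlonglongrightarrow> 0"
    proof (rule AE_I2)
      fix x
      have "(\<lambda>j. \<bar>indicator K x - h j x\<bar>) \<longlonglongrightarrow> \<bar>indicator K x - indicator K x\<bar>"
        by (intro tendsto_intros lim)
      then show "(\<lambda>j. \<bar>indicator K x - h j x\<bar>) \<longlonglongrightarrow> 0" by simp
    qed
    show "AE x in S3. norm \<bar>indicator K x - h j x\<bar> \<le> 1" for j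
      using hb by (intro AE_I2) (auto simp: indicator_def)
  qed (use hm im in auto)
  then have lim0: "(\<lambda>j. \<integral>x. \<bar>indicator K x - h j x\<bar> \<partial>S3) \<longlonglongrightarrow> 0" by simp
  show ?thesis
  proof (rule osc_small_L1_closed[OF im])
    fix e :: real assume "e > 0"
    then have "\<forall>\<^sub>F j in sequentially. (\<integral>x. \<bar>indicator K x - h j x\<bar> \<partial>S3) < e"
      using lim0 by (auto dest: order_tendstoD(2))
    then obtain j where j: "(\<integral>x. \<bar>indicator K x - h j x\<bar> \<partial>S3) < e" by (auto simp: eventually_sequentially)
    have "integrable S3 (\<lambda>x. \<bar>indicator K x - h j x\<bar>)"
    proof (rule S3.integrable_const_bound[of _ 1])
      show "AE x in S3. norm \<bar>indicator K x - h j x\<bar> \<le> 1"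
        using hb by (intro AE_I2) (auto simp: indicator_def)
    qed (use hm im in simp)
    then have "(\<integral>\<^sup>+x. ennreal \<bar>indicator K x - h j x\<bar> \<partial>S3) \<le> ennreal e"
      using j by (subst nn_integral_eq_integral) (auto intro: ennreal_leI)
    then show "\<exists>g. osc_small g \<and> (\<integral>\<^sup>+x. ennreal \<bar>indicator K x - g x\<bar> \<partial>S3) \<le> ennreal e"
      using hs by blast
  qed
qed

text \<open>Inner regularity of a finite Borel measure approximates the set from inside by a compact
  set, with small error in L^1.\<close>

lemma osc_small_indicator:
  assumes A: "A \<in> sets S3"
  shows "osc_small (indicator A)"
proof (rule osc_small_L1_closed)
  show im: "(indicator A :: R4 \<Rightarrow> real) \<in> borel_measurable S3" using A by simp
  fix e :: real assume e: "e > 0"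
  \<comment> \<open>Regularity concerns Borel measures on the whole space, so the surface measure is
    pushed forward along the inclusion.\<close>
  let ?M = "distr S3 borel (\<lambda>x. x)"
  have As: "A \<subseteq> sphere 0 1" using sets.sets_into_space[OF A] by simp
  have Ab: "A \<in> sets borel" using A by (simp add: sets_S3 sets_restrict_space_iff)
  have em: "emeasure ?M B = emeasure S3 B" if "B \<in> sets borel" "B \<subseteq> sphere 0 1" for B
    using that by (subst emeasure_distr[OF measurable_S3_borel]) (auto simp: Int_absorb2)
  have fin: "emeasure ?M (space ?M) \<noteq> \<infinity>"
    by (subst emeasure_distr[OF measurable_S3_borel]) (auto simp: S3.emeasure_eq_measure)
  have reg: "emeasure ?M A = (SUP K \<in> {K. K \<subseteq> A \<and> compact K}. emeasure ?M K)"
    by (rule inner_regular) (use fin Ab in auto)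
  have "\<exists>K\<in>{K. K \<subseteq> A \<and> compact K}. emeasure S3 A < emeasure S3 K + ennreal e"
  proof (rule ccontr)
    assume "\<not> ?thesis"
    then have le: "emeasure S3 K + ennreal e \<le> emeasure S3 A" if "K \<subseteq> A" "compact K" for K using that by (auto simp: not_less)
    have "(SUP K \<in> {K. K \<subseteq> A \<and> compact K}. emeasure ?M K) + ennreal e \<le> emeasure S3 A"
    proof (subst ennreal_SUP_add_left[symmetric])
      show "(SUP K\<in>{K. K \<subseteq> A \<and> compact K}. emeasure ?M K + ennreal e) \<le> emeasure S3 A"
        using le As em by (intro SUP_least) (auto simp: compact_imp_closed borel_closed)
    qed auto
    then have "emeasure S3 A + ennreal e \<le> emeasure S3 A" using reg em[OF Ab As] by simp
    then show False using e by (simp add: S3.emeasure_eq_measure ennreal_plus[symmetric] del: ennreal_plus)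
  qed
  then obtain K where K: "K \<subseteq> A" "compact K" "emeasure S3 A < emeasure S3 K + ennreal e" by auto
  have Ks: "K \<in> sets S3"
    using K As by (auto simp: sets_S3 sets_restrict_space_iff compact_imp_closed borel_closed)
  have "(\<integral>\<^sup>+x. ennreal \<bar>indicator A x - indicator K x\<bar> \<partial>S3) = (\<integral>\<^sup>+x. indicator (A - K) x \<partial>S3)"
    using K(1) by (intro nn_integral_cong) (auto simp: indicator_def)
  also have "\<dots> = emeasure S3 (A - K)" using A Ks by simp
  also have "\<dots> = emeasure S3 A - emeasure S3 K" using A Ks K(1) by (intro emeasure_Diff) auto
  also have "\<dots> \<le> ennreal e" using K(3) by (simp add: ennreal_minus_le_iff add.commute less_imp_le)
  finally show "\<exists>g. osc_small g \<and> (\<integral>\<^sup>+x. ennreal \<bar>indicator A x - g x\<bar> \<partial>S3) \<le> ennreal e"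
    using osc_small_compact[of K] K As by blast
qed

lemma osc_small_add:
  assumes f: "osc_small f" and g: "osc_small g"
  shows "osc_small (\<lambda>x. f x + g x)"
  unfolding osc_small_def
proof (intro conjI allI impI)
  have fm: "f \<in> borel_measurable S3" "g \<in> borel_measurable S3" using f g by (auto simp: osc_small_def)
  then show m: "(\<lambda>x. f x + g x) \<in> borel_measurable S3" by simp
  fix e :: real assume "e > 0"
  then have "e/2 > 0" by simp
  then obtain N1 N2 where "\<forall>N\<ge>N1. osc N f \<le> ennreal (e/2)" "\<forall>N\<ge>N2. osc N g \<le> ennreal (e/2)"
    using f g unfolding osc_small_def by meson
  then have "osc N (\<lambda>x. f x + g x) \<le> ennreal (e/2) + ennreal (e/2)" if "N \<ge> max N1 N2" for N
    using that osc_triangle[OF m fm(1), of N] by (auto intro!: order_trans[OF osc_triangle[OF m fm(1), of N]] add_mono)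
  then have "\<forall>N\<ge>max N1 N2. osc N (\<lambda>x. f x + g x) \<le> ennreal e"
    using \<open>e > 0\<close> by (simp add: ennreal_plus[symmetric] del: ennreal_plus)
  then show "\<exists>N0. \<forall>N\<ge>N0. osc N (\<lambda>x. f x + g x) \<le> ennreal e" by blast
qed

lemma osc_small_integrable:
  fixes f :: "R4 \<Rightarrow> real"
  assumes "integrable S3 f"
  shows "osc_small f"
  using assms
proof (induction f rule: integrable_induct)
  case (base A c)
  have "osc N (\<lambda>x. indicator A x *\<^sub>R c) = ennreal \<bar>c\<bar> * osc N (indicator A)" for N
  proof -
    have m: "(indicator A :: R4 \<Rightarrow> real) \<in> borel_measurable S3" using base by simp
    note M = measurable_osc[OF m, of N]
    have "osc N (\<lambda>x. indicator A x *\<^sub>R c) = (\<integral>\<^sup>+x. (\<integral>\<^sup>+y. ennreal \<bar>c\<bar> * ennreal (pk N (sK x y) * \<bar>indicator A x - indicator A y\<bar>) \<partial>S3) \<partial>S3)"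
      unfolding osc_def
    proof (intro nn_integral_cong)
      fix x y assume "x \<in> space S3" "y \<in> space S3"
      then have p: "0 \<le> pk N (sK x y)" using pk_nonneg by simp
      have "pk N (sK x y) * \<bar>indicator A x *\<^sub>R c - indicator A y *\<^sub>R c\<bar> = \<bar>c\<bar> * (pk N (sK x y) * \<bar>indicator A x - indicator A y\<bar>)"
        by (simp add: abs_mult flip: left_diff_distrib)
      then show "ennreal (pk N (sK x y) * \<bar>indicator A x *\<^sub>R c - indicator A y *\<^sub>R c\<bar>) = ennreal \<bar>c\<bar> * ennreal (pk N (sK x y) * \<bar>indicator A x - indicator A y\<bar>)"
        using p by (simp only: ennreal_mult[symmetric] abs_ge_zero mult_nonneg_nonneg)
    qed
    also have "\<dots> = (\<integral>\<^sup>+x. ennreal \<bar>c\<bar> * (\<integral>\<^sup>+y. ennreal (pk N (sK x y) * \<bar>indicator A x - indicator A y\<bar>) \<partial>S3) \<partial>S3)"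
      using measurable_compose[OF measurable_Pair1' M] by (intro nn_integral_cong nn_integral_cmult) simp
    also have "\<dots> = ennreal \<bar>c\<bar> * osc N (indicator A)"
      unfolding osc_def using S3.borel_measurable_nn_integral_fst[OF M] by (intro nn_integral_cmult) simp
    finally show ?thesis .
  qed
  note eq = this
  show ?case unfolding osc_small_def
  proof (intro conjI allI impI)
    fix e :: real assume "e > 0"
    then have "e / (\<bar>c\<bar> + 1) > 0" by simp
    then obtain N0 where N0: "\<forall>N\<ge>N0. osc N (indicator A) \<le> ennreal (e / (\<bar>c\<bar> + 1))"
      using osc_small_indicator[OF base(1)] unfolding osc_small_def by blast
    have "osc N (\<lambda>x. indicator A x *\<^sub>R c) \<le> ennreal e" if "N \<ge> N0" for N
    proof -
      have "ennreal \<bar>c\<bar> * osc N (indicator A) \<le> ennreal \<bar>c\<bar> * ennreal (e / (\<bar>c\<bar> + 1))"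
        using N0 that by (intro mult_left_mono) auto
      also have "\<dots> = ennreal (\<bar>c\<bar> * (e / (\<bar>c\<bar> + 1)))" using \<open>e > 0\<close> by (intro ennreal_mult[symmetric]) auto
      also have "\<dots> \<le> ennreal e" using \<open>e > 0\<close> by (intro ennreal_leI) (simp add: field_simps)
      finally show ?thesis unfolding eq .
    qed
    then show "\<exists>N0. \<forall>N\<ge>N0. osc N (\<lambda>x. indicator A x *\<^sub>R c) \<le> ennreal e" by blast
  qed (use base in simp)
next
  case (add f g)
  then show ?case by (intro osc_small_add)
next
  case (lim f s)
  have sm: "\<And>i. s i \<in> borel_measurable S3" and fm: "f \<in> borel_measurable S3" using lim.hyps by auto
  have "(\<lambda>i. \<integral>x. \<bar>f x - s i x\<bar> \<partial>S3) \<longlonglongrightarrow> (\<integral>x. 0 \<partial>S3)"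
  proof (rule integral_dominated_convergence[where w = "\<lambda>x. 3 * \<bar>f x\<bar>"])
    show "AE x in S3. (\<lambda>i. \<bar>f x - s i x\<bar>) \<longlonglongrightarrow> 0"
    proof (rule AE_I2)
      fix x assume "x \<in> space S3"
      then have "(\<lambda>i. \<bar>f x - s i x\<bar>) \<longlonglongrightarrow> \<bar>f x - f x\<bar>"
        by (intro tendsto_intros lim.hyps)
      then show "(\<lambda>i. \<bar>f x - s i x\<bar>) \<longlonglongrightarrow> 0" by simp
    qed
    show "AE x in S3. norm \<bar>f x - s i x\<bar> \<le> 3 * \<bar>f x\<bar>" for i
    proof (rule AE_I2)
      fix x assume "x \<in> space S3"
      then have "norm (s i x) \<le> 2 * norm (f x)" by (rule lim.hyps)
      then show "norm \<bar>f x - s i x\<bar> \<le> 3 * \<bar>f x\<bar>" by simp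
    qed
  qed (use sm fm lim.hyps in auto)
  then have lim0: "(\<lambda>i. \<integral>x. \<bar>f x - s i x\<bar> \<partial>S3) \<longlonglongrightarrow> 0" by simp
  show ?case
  proof (rule osc_small_L1_closed[OF fm])
    fix e :: real assume "e > 0"
    then have "\<forall>\<^sub>F i in sequentially. (\<integral>x. \<bar>f x - s i x\<bar> \<partial>S3) < e"
      using lim0 by (auto dest: order_tendstoD(2))
    then obtain i where i: "(\<integral>x. \<bar>f x - s i x\<bar> \<partial>S3) < e" by (auto simp: eventually_sequentially)
    have "integrable S3 (\<lambda>x. \<bar>f x - s i x\<bar>)" using lim.hyps by auto
    then have "(\<integral>\<^sup>+x. ennreal \<bar>f x - s i x\<bar> \<partial>S3) \<le> ennreal e"
      using i by (subst nn_integral_eq_integral) (auto intro: ennreal_leI)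
    then show "\<exists>g. osc_small g \<and> (\<integral>\<^sup>+x. ennreal \<bar>f x - g x\<bar> \<partial>S3) \<le> ennreal e"
      using lim.IH by blast
  qed
qed

section \<open>Two-forms as tangent vector fields\<close>

text \<open>With the determinant written out as 24 monomials, the vector identities below become
  polynomial identities in coordinates.\<close>

lemma vol3_eq: "vol3 x u v w = x$1 * u$2 * v$3 * w$4 - x$1 * u$2 * v$4 * w$3 - x$1 * u$3 * v$2 * w$4 + x$1 * u$3 * v$4 * w$2 + x$1 * u$4 * v$2 * w$3 - x$1 * u$4 * v$3 * w$2 - x$2 * u$1 * v$3 * w$4 + x$2 * u$1 * v$4 * w$3 + x$2 * u$3 * v$1 * w$4 - x$2 * u$3 * v$4 * w$1 - x$2 * u$4 * v$1 * w$3 + x$2 * u$4 * v$3 * w$1 + x$3 * u$1 * v$2 * w$4 - x$3 * u$1 * v$4 * w$2 - x$3 * u$2 * v$1 * w$4 + x$3 * u$2 * v$4 * w$1 + x$3 * u$4 * v$1 * w$2 - x$3 * u$4 * v$2 * w$1 - x$4 * u$1 * v$2 * w$3 + x$4 * u$1 * v$3 * w$2 + x$4 * u$2 * v$1 * w$3 - x$4 * u$2 * v$3 * w$1 - x$4 * u$3 * v$1 * w$2 + x$4 * u$3 * v$2 * w$1"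
proof -
  have f: "finite {2::4, 3, 4}" "1 \<notin> {2::4, 3, 4}" "finite {3::4, 4}" "2 \<notin> {3::4, 4}" "finite {4::4}" "3 \<notin> {4::4}"
    by auto
  show ?thesis
    unfolding vol3_def det_def UNIV_4
    unfolding sum_over_permutations_insert[OF f(1,2)]
    unfolding sum_over_permutations_insert[OF f(3,4)]
    unfolding sum_over_permutations_insert[OF f(5,6)]
    unfolding permutes_sing
    by (simp add: sign_swap_id permutation_swap_id permutation_compose sign_compose sign_id swap_id_eq)
qed

lemma linear_vol3:
  "linear (\<lambda>z. vol3 z u v w)" "linear (\<lambda>z. vol3 x z v w)" "linear (\<lambda>z. vol3 x u z w)" "linear (\<lambda>z. vol3 x u v z)"
  by (rule linearI; simp add: vol3_eq algebra_simps)+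

lemma vol3_same [simp]: "vol3 x x v w = 0" "vol3 x u x w = 0" "vol3 x u v x = 0"
  "vol3 x u u w = 0" "vol3 x u v u = 0" "vol3 x u v v = 0"
  by (simp_all add: vol3_eq algebra_simps)

lemma vol3_swap: "vol3 x v u w = - vol3 x u v w"
  by (simp add: vol3_eq algebra_simps)

text \<open>The factor 24 counts the monomials. It is far from sharp, but only the finiteness of
  such constants enters later.\<close>

lemma abs_vol3_le: "\<bar>vol3 x u v w\<bar> \<le> 24 * (norm x * norm u * norm v * norm w)"
proof -
  define B where "B = norm x * norm u * norm v * norm w"
  have "\<bar>x$i * u$j * v$k * w$l\<bar> \<le> B" for i j k l
    unfolding abs_mult B_def by (intro mult_mono component_le_norm_cart mult_nonneg_nonneg) auto
  then have T: "x$i * u$j * v$k * w$l \<le> B" "- (x$i * u$j * v$k * w$l) \<le> B" for i j k l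
    by (simp_all add: abs_le_iff)
  show ?thesis
    unfolding vol3_eq B_def[symmetric]
  proof (rule abs_leI)
    show "x$1 * u$2 * v$3 * w$4 - x$1 * u$2 * v$4 * w$3 - x$1 * u$3 * v$2 * w$4 + x$1 * u$3 * v$4 * w$2 + x$1 * u$4 * v$2 * w$3 - x$1 * u$4 * v$3 * w$2 - x$2 * u$1 * v$3 * w$4 + x$2 * u$1 * v$4 * w$3 + x$2 * u$3 * v$1 * w$4 - x$2 * u$3 * v$4 * w$1 - x$2 * u$4 * v$1 * w$3 + x$2 * u$4 * v$3 * w$1 + x$3 * u$1 * v$2 * w$4 - x$3 * u$1 * v$4 * w$2 - x$3 * u$2 * v$1 * w$4 + x$3 * u$2 * v$4 * w$1 + x$3 * u$4 * v$1 * w$2 - x$3 * u$4 * v$2 * w$1 - x$4 * u$1 * v$2 * w$3 + x$4 * u$1 * v$3 * w$2 + x$4 * u$2 * v$1 * w$3 - x$4 * u$2 * v$3 * w$1 - x$4 * u$3 * v$1 * w$2 + x$4 * u$3 * v$2 * w$1 \<le> 24 * B"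
      using T(1)[of 1 2 3 4] T(2)[of 1 2 4 3] T(2)[of 1 3 2 4] T(1)[of 1 3 4 2] T(1)[of 1 4 2 3] T(2)[of 1 4 3 2] T(2)[of 2 1 3 4] T(1)[of 2 1 4 3] T(1)[of 2 3 1 4] T(2)[of 2 3 4 1] T(2)[of 2 4 1 3] T(1)[of 2 4 3 1] T(1)[of 3 1 2 4] T(2)[of 3 1 4 2] T(2)[of 3 2 1 4] T(1)[of 3 2 4 1] T(1)[of 3 4 1 2] T(2)[of 3 4 2 1] T(2)[of 4 1 2 3] T(1)[of 4 1 3 2] T(1)[of 4 2 1 3] T(2)[of 4 2 3 1] T(2)[of 4 3 1 2] T(1)[of 4 3 2 1] by linarith
    show "- (x$1 * u$2 * v$3 * w$4 - x$1 * u$2 * v$4 * w$3 - x$1 * u$3 * v$2 * w$4 + x$1 * u$3 * v$4 * w$2 + x$1 * u$4 * v$2 * w$3 - x$1 * u$4 * v$3 * w$2 - x$2 * u$1 * v$3 * w$4 + x$2 * u$1 * v$4 * w$3 + x$2 * u$3 * v$1 * w$4 - x$2 * u$3 * v$4 * w$1 - x$2 * u$4 * v$1 * w$3 + x$2 * u$4 * v$3 * w$1 + x$3 * u$1 * v$2 * w$4 - x$3 * u$1 * v$4 * w$2 - x$3 * u$2 * v$1 * w$4 + x$3 * u$2 * v$4 * w$1 + x$3 * u$4 * v$1 * w$2 - x$3 * u$4 * v$2 * w$1 - x$4 * u$1 * v$2 * w$3 + x$4 * u$1 * v$3 * w$2 + x$4 * u$2 * v$1 * w$3 - x$4 * u$2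 * v$3 * w$1 - x$4 * u$3 * v$1 * w$2 + x$4 * u$3 * v$2 * w$1) \<le> 24 * B"
      using T(2)[of 1 2 3 4] T(1)[of 1 2 4 3] T(1)[of 1 3 2 4] T(2)[of 1 3 4 2] T(2)[of 1 4 2 3] T(1)[of 1 4 3 2] T(1)[of 2 1 3 4] T(2)[of 2 1 4 3] T(2)[of 2 3 1 4] T(1)[of 2 3 4 1] T(1)[of 2 4 1 3] T(2)[of 2 4 3 1] T(2)[of 3 1 2 4] T(1)[of 3 1 4 2] T(1)[of 3 2 1 4] T(2)[of 3 2 4 1] T(2)[of 3 4 1 2] T(1)[of 3 4 2 1] T(1)[of 4 1 2 3] T(2)[of 4 1 3 2] T(2)[of 4 2 1 3] T(1)[of 4 2 3 1] T(1)[of 4 3 1 2] T(2)[of 4 3 2 1] by linarith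
  qed
qed

text \<open>For a unit vector \<open>y\<close> and tangent vectors \<open>u\<close>,
  \<open>v\<close> this is their cross product in the oriented three-dimensional tangent space at
  \<open>y\<close>.\<close>

definition crs :: "R4 \<Rightarrow> R4 \<Rightarrow> R4 \<Rightarrow> R4" where
  "crs y u v = (\<chi> k. vol3 y u v (axis k 1))"

lemma sum_axis_R4: "(\<Sum>k\<in>UNIV. w $ k *\<^sub>R axis k 1) = (w :: R4)"
  using basis_expansion[of w] by (simp add: scalar_mult_eq_scaleR)

lemma vol3_expand: "vol3 x u v w = (\<Sum>k\<in>UNIV. w $ k * vol3 x u v (axis k 1))"
proof -
  have "vol3 x u v w = vol3 x u v (\<Sum>k\<in>UNIV. w $ k *\<^sub>R axis k 1)" by (simp only: sum_axis_R4)
  also have "\<dots> = (\<Sum>k\<in>UNIV. vol3 x u v (w $ k *\<^sub>R axis k 1))" by (rule linear_sum[OF linear_vol3(4)])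
  also have "\<dots> = (\<Sum>k\<in>UNIV. w $ k * vol3 x u v (axis k 1))" by (simp add: linear_scale[OF linear_vol3(4)])
  finally show ?thesis .
qed

lemma inner_crs: "crs y u v \<bullet> w = vol3 y u v w"
  by (subst vol3_expand) (simp add: crs_def inner_vec_def mult.commute)

lemma norm_crs_le: "norm (crs y u v) \<le> 24 * (norm y * norm u * norm v)"
proof (cases "norm (crs y u v) = 0")
  case False
  have "norm (crs y u v) * norm (crs y u v) = vol3 y u v (crs y u v)"
    by (simp add: inner_crs[symmetric] norm_eq_square dot_square_norm power2_eq_square)
  also have "\<dots> \<le> 24 * (norm y * norm u * norm v) * norm (crs y u v)"
    using abs_vol3_le[of y u v "crs y u v"] by (simp add: mult_ac)
  finally show ?thesis using False by simp
qed simp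

lemma bilinear_crs: "bounded_bilinear (\<lambda>y v. crs y x v)"
proof -
  have "bilinear (\<lambda>y v. crs y x v)"
    unfolding bilinear_def
    by (auto intro!: linearI simp: crs_def vec_eq_iff linear_add[OF linear_vol3(1)] linear_add[OF linear_vol3(3)]
        linear_scale[OF linear_vol3(1)] linear_scale[OF linear_vol3(3)])
  then show ?thesis by (simp add: bilinear_conv_bounded_bilinear)
qed

text \<open>The vector \<open>starv M y\<close> represents the linear form \<open>v \<mapsto> (M \<and> v) / vol\<close> on the tangent space at \<open>y\<close>.\<close>
definition starv :: "M4 \<Rightarrow> R4 \<Rightarrow> R4" where
  "starv M y = (\<chi> k. 1/2 * (\<Sum>i\<in>UNIV. \<Sum>j\<in>UNIV. M $ i $ j * vol3 y (axis i 1) (axis j 1) (axis k 1)))"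

lemma wedge21_vol3: "wedge21 M v y = 1/2 * (\<Sum>i\<in>UNIV. \<Sum>j\<in>UNIV. M $ i $ j * vol3 y (axis i 1) (axis j 1) v)"
  unfolding wedge21_def
  by (subst vol3_expand[of y _ _ v]) (simp add: sum_distrib_left mult.assoc)

lemma inner_starv: "starv M y \<bullet> v = wedge21 M v y"
proof -
  have "starv M y \<bullet> v = 1/2 * (\<Sum>k\<in>UNIV. \<Sum>i\<in>UNIV. \<Sum>j\<in>UNIV. M $ i $ j * v $ k * vol3 y (axis i 1) (axis j 1) (axis k 1))"
    by (simp add: starv_def inner_vec_def sum_distrib_left sum_distrib_right mult_ac)
  also have "(\<Sum>k\<in>UNIV. \<Sum>i\<in>UNIV. \<Sum>j\<in>UNIV. M $ i $ j * v $ k * vol3 y (axis i 1) (axis j 1) (axis k 1))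
    = (\<Sum>i\<in>UNIV. \<Sum>k\<in>UNIV. \<Sum>j\<in>UNIV. M $ i $ j * v $ k * vol3 y (axis i 1) (axis j 1) (axis k 1))"
    by (rule sum.swap)
  also have "\<dots> = (\<Sum>i\<in>UNIV. \<Sum>j\<in>UNIV. \<Sum>k\<in>UNIV. M $ i $ j * v $ k * vol3 y (axis i 1) (axis j 1) (axis k 1))"
    by (intro sum.cong refl sum.swap)
  finally show ?thesis by (simp add: wedge21_def)
qed

lemma starv_tangent [simp]: "starv M y \<bullet> y = 0"
  by (simp add: inner_starv wedge21_vol3)

lemma starv_form1_of: "wedge21 M (form1_of F y) y = starv M y \<bullet> F y"
  by (simp add: inner_starv[symmetric] form1_of_def tproj_def inner_diff_right)

lemma abs_le_norm2: "\<bar>M $ i $ j\<bar> \<le> 2 * norm2 M"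
proof -
  have "(M $ i $ j)^2 \<le> (\<Sum>j\<in>UNIV. (M $ i $ j)^2)"
    by (rule member_le_sum) auto
  also have "\<dots> \<le> (\<Sum>i\<in>UNIV. \<Sum>j\<in>UNIV. (M $ i $ j)^2)"
    by (rule member_le_sum[of i UNIV "\<lambda>i. \<Sum>j\<in>UNIV. (M $ i $ j)^2"]) (auto intro: sum_nonneg)
  also have "\<dots> = 2 * inner2 M M" by (simp add: inner2_def power2_eq_square)
  finally have a: "(M $ i $ j)^2 \<le> 2 * inner2 M M" .
  then have "0 \<le> inner2 M M" using zero_le_power2[of "M $ i $ j"] by linarith
  then have "sqrt ((M $ i $ j)^2) \<le> sqrt (2^2 * inner2 M M)" using a by (intro real_sqrt_le_mono) simp
  then show ?thesis by (simp add: norm2_def real_sqrt_mult)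
qed

text \<open>Each component is half a sum of 16 products, with entries at most
  \<open>2 * norm2 M\<close> and volumes at most 24; four components give 1536.\<close>

lemma norm_starv_le:
  assumes "norm y = 1"
  shows "norm (starv M y) \<le> 1536 * norm2 M"
proof -
  have c: "\<bar>starv M y $ k\<bar> \<le> 384 * norm2 M" for k
  proof -
    have "\<bar>\<Sum>i\<in>UNIV. \<Sum>j\<in>UNIV. M $ i $ j * vol3 y (axis i 1) (axis j 1) (axis k 1)\<bar>
      \<le> (\<Sum>i\<in>UNIV. \<Sum>j\<in>UNIV. \<bar>M $ i $ j * vol3 y (axis i 1) (axis j 1) (axis k 1)\<bar>)"
      by (rule order_trans[OF sum_abs sum_mono[OF sum_abs]])
    then have "\<bar>starv M y $ k\<bar> \<le> 1/2 * (\<Sum>i\<in>UNIV. \<Sum>j\<in>UNIV. \<bar>M $ i $ j * vol3 y (axis i 1) (axis j 1) (axis k 1)\<bar>)"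
      unfolding starv_def by simp
    also have "\<dots> \<le> 1/2 * (\<Sum>i\<in>(UNIV::4 set). \<Sum>j\<in>(UNIV::4 set). 2 * norm2 M * 24)"
    proof -
      have "\<bar>vol3 y (axis i 1) (axis j 1) (axis k 1)\<bar> \<le> 24" for i j
        using abs_vol3_le[of y "axis i 1" "axis j 1" "axis k 1"] assms by simp
      moreover have "0 \<le> norm2 M" using abs_le_norm2[of M 1 1] by simp
      ultimately show ?thesis
        unfolding abs_mult by (intro mult_left_mono sum_mono mult_mono abs_le_norm2) auto
    qed
    finally show ?thesis by simp
  qed
  have "norm (starv M y) \<le> (\<Sum>k\<in>UNIV. \<bar>starv M y $ k\<bar>)" by (rule norm_le_l1_cart)
  also have "\<dots> \<le> (\<Sum>k\<in>(UNIV::4 set). 384 * norm2 M)" by (intro sum_mono c)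
  finally show ?thesis by simp
qed

text \<open>The two-form dual to the vector \<open>w\<close>, adjoint to \<open>starv\<close>. With
  it a scalar test function for one component of \<open>starv\<close> becomes a test
  two-form.\<close>

definition dual2 :: "R4 \<Rightarrow> R4 \<Rightarrow> M4" where
  "dual2 y w = (\<chi> i j. vol3 y (axis i 1) (axis j 1) w)"

lemma inner2_dual2: "inner2 M (dual2 y w) = starv M y \<bullet> w"
  by (simp add: inner2_def dual2_def inner_starv wedge21_vol3)

lemma dual2_skew: "transpose (dual2 y w) = - dual2 y w"
proof -
  have "transpose (dual2 y w) $ i $ j = (- dual2 y w) $ i $ j" for i j
    by (simp add: transpose_def dual2_def) (rule vol3_swap)
  then show ?thesis by (simp add: vec_eq_iff)
qed

lemma dual2_tangent: "dual2 y w *v y = 0"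
proof -
  have "(\<Sum>j\<in>UNIV. vol3 y (axis i 1) (axis j 1) w * y $ j) = 0" for i
  proof -
    have "(\<Sum>j\<in>UNIV. vol3 y (axis i 1) (axis j 1) w * y $ j) = (\<Sum>j\<in>UNIV. vol3 y (axis i 1) (y $ j *\<^sub>R axis j 1) w)"
      by (simp add: linear_scale[OF linear_vol3(3)] mult.commute)
    also have "\<dots> = vol3 y (axis i 1) y w" by (simp only: linear_sum[OF linear_vol3(3), symmetric] sum_axis_R4)
    finally show ?thesis by simp
  qed
  then show ?thesis by (simp add: dual2_def matrix_vector_mult_def vec_eq_iff)
qed

lemma norm2_dual2_le:
  assumes "norm y = 1"
  shows "norm2 (dual2 y w) \<le> 96 * norm w"
proof -
  have "inner2 (dual2 y w) (dual2 y w) \<le> 1/2 * (\<Sum>i\<in>(UNIV::4 set). \<Sum>j\<in>(UNIV::4 set). (24 * norm w) * (24 * norm w))"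
    unfolding inner2_def
  proof (intro mult_left_mono sum_mono)
    fix i j :: 4
    have "\<bar>dual2 y w $ i $ j\<bar> \<le> 24 * norm w"
      using abs_vol3_le[of y "axis i 1" "axis j 1" w] assms by (simp add: dual2_def)
    then have "\<bar>dual2 y w $ i $ j\<bar> * \<bar>dual2 y w $ i $ j\<bar> \<le> (24 * norm w) * (24 * norm w)" by (intro mult_mono) auto
    then show "dual2 y w $ i $ j * dual2 y w $ i $ j \<le> (24 * norm w) * (24 * norm w)" by simp
  qed simp
  also have "\<dots> \<le> (96 * norm w)^2" by (simp add: power2_eq_square)
  finally show ?thesis unfolding norm2_def by (simp add: real_le_lsqrt)
qed

lemma wedge21_matrix_transpose:
  "wedge21 (transpose A - A) a y = (\<Sum>j\<in>UNIV. vol3 y (axis j 1) (A *v axis j 1) a)"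
proof -
  let ?B = "\<lambda>u v. vol3 y u v a"
  have 1: "(\<Sum>j\<in>UNIV. ?B (axis j 1) (A *v axis j 1)) = (\<Sum>j\<in>UNIV. \<Sum>i\<in>UNIV. A $ i $ j * ?B (axis j 1) (axis i 1))"
  proof (intro sum.cong refl)
    fix j
    have "?B (axis j 1) (A *v axis j 1) = (\<Sum>i\<in>UNIV. ?B (axis j 1) ((A *v axis j 1) $ i *\<^sub>R axis i 1))"
      by (simp only: linear_sum[OF linear_vol3(3), symmetric] sum_axis_R4)
    also have "\<dots> = (\<Sum>i\<in>UNIV. A $ i $ j * ?B (axis j 1) (axis i 1))"
      by (simp add: linear_scale[OF linear_vol3(3)] matrix_vector_mul_component inner_axis)
    finally show "?B (axis j 1) (A *v axis j 1) = (\<Sum>i\<in>UNIV. A $ i $ j * ?B (axis j 1) (axis i 1))" .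
  qed
  have 2: "(\<Sum>i\<in>UNIV. \<Sum>j\<in>UNIV. A $ i $ j * ?B (axis i 1) (axis j 1)) = - (\<Sum>j\<in>UNIV. \<Sum>i\<in>UNIV. A $ i $ j * ?B (axis j 1) (axis i 1))"
  proof -
    have "(\<Sum>i\<in>UNIV. \<Sum>j\<in>UNIV. A $ i $ j * ?B (axis i 1) (axis j 1)) = (\<Sum>j\<in>UNIV. \<Sum>i\<in>UNIV. A $ i $ j * ?B (axis i 1) (axis j 1))"
      by (rule sum.swap)
    also have "\<dots> = (\<Sum>j\<in>UNIV. \<Sum>i\<in>UNIV. - (A $ i $ j * ?B (axis j 1) (axis i 1)))"
    proof (intro sum.cong refl)
      fix i j
      show "A $ i $ j * ?B (axis i 1) (axis j 1) = - (A $ i $ j * ?B (axis j 1) (axis i 1))"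
        using vol3_swap[of y "axis i 1" "axis j 1" a] by simp
    qed
    finally show ?thesis by (simp add: sum_negf)
  qed
  show ?thesis
    unfolding wedge21_vol3 1
    using 2 by (simp add: transpose_def left_diff_distrib sum_subtractf)
qed

text \<open>The projections change the arguments of \<open>vol3 y\<close> only by multiples of
  \<open>y\<close>, and these contribute nothing because \<open>y\<close> already occupies the first
  slot.\<close>

lemma wedge21_tprojM: "wedge21 (tprojM y ** M ** tprojM y) a y = wedge21 M a y"
proof -
  let ?P = "tprojM y" and ?B = "\<lambda>u v. vol3 y u v a"
  have P: "?P $ i $ k = (if i = k then 1 else 0) - y $ i * y $ k" for i k
    by (simp add: tprojM_def mat_def)
  have Pe: "(\<Sum>i\<in>UNIV. ?P $ i $ k *\<^sub>R axis i 1) = axis k 1 - y $ k *\<^sub>R y" for k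
    using sum_axis_R4[of "axis k 1 - y $ k *\<^sub>R y"] by (simp add: P axis_def mult.commute eq_commute[of k])
  have sym: "?P $ l $ j = ?P $ j $ l" for l j by (simp add: P mult.commute)
  have "(\<Sum>i\<in>UNIV. \<Sum>j\<in>UNIV. (?P ** M ** ?P) $ i $ j * ?B (axis i 1) (axis j 1))
     = (\<Sum>i\<in>UNIV. \<Sum>j\<in>UNIV. \<Sum>l\<in>UNIV. \<Sum>k\<in>UNIV. ?P $ i $ k * M $ k $ l * ?P $ l $ j * ?B (axis i 1) (axis j 1))"
    by (simp add: matrix_matrix_mult_def sum_distrib_right)
  also have "\<dots> = (\<Sum>k\<in>UNIV. \<Sum>l\<in>UNIV. \<Sum>i\<in>UNIV. \<Sum>j\<in>UNIV. ?P $ i $ k * M $ k $ l * ?P $ l $ j * ?B (axis i 1) (axis j 1))"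
    by (simp add: sum_4 algebra_simps)
  also have "\<dots> = (\<Sum>k\<in>UNIV. \<Sum>l\<in>UNIV. M $ k $ l * ?B (axis k 1 - y $ k *\<^sub>R y) (axis l 1 - y $ l *\<^sub>R y))"
  proof (intro sum.cong refl)
    fix k l
    have "?B (axis k 1 - y $ k *\<^sub>R y) (axis l 1 - y $ l *\<^sub>R y)
      = ?B (\<Sum>i\<in>UNIV. ?P $ i $ k *\<^sub>R axis i 1) (\<Sum>j\<in>UNIV. ?P $ j $ l *\<^sub>R axis j 1)"
      by (simp only: Pe)
    also have "\<dots> = (\<Sum>i\<in>UNIV. \<Sum>j\<in>UNIV. ?P $ i $ k * (?P $ j $ l * ?B (axis i 1) (axis j 1)))"
      by (simp add: linear_sum[OF linear_vol3(2)] linear_sum[OF linear_vol3(3)] linear_scale[OF linear_vol3(2)] linear_scale[OF linear_vol3(3)] sum_distrib_left)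
        (subst sum.swap, simp add: mult_ac)
    finally show "(\<Sum>i\<in>UNIV. \<Sum>j\<in>UNIV. ?P $ i $ k * M $ k $ l * ?P $ l $ j * ?B (axis i 1) (axis j 1))
      = M $ k $ l * ?B (axis k 1 - y $ k *\<^sub>R y) (axis l 1 - y $ l *\<^sub>R y)"
      by (simp add: sum_distrib_left sym[of l] mult_ac)
  qed
  also have "\<dots> = (\<Sum>k\<in>UNIV. \<Sum>l\<in>UNIV. M $ k $ l * ?B (axis k 1) (axis l 1))"
    by (simp add: linear_diff[OF linear_vol3(2)] linear_diff[OF linear_vol3(3)] linear_scale[OF linear_vol3(2)] linear_scale[OF linear_vol3(3)])
  finally show ?thesis by (simp add: wedge21_vol3)
qed

text \<open>Skew symmetry merges the two halves of the skew Jacobian, so curls of test fields can be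
  read off from any expression for their derivative.\<close>

lemma wedge21_d1:
  assumes "(F has_derivative F') (at y)"
  shows "wedge21 (d1 F y) a y = (\<Sum>j\<in>UNIV. vol3 y (axis j 1) (F' (axis j 1)) a)"
proof -
  have "F differentiable (at y)" using assms by (rule differentiableI)
  then have "(F has_derivative (\<lambda>h. jacobian F (at y) *v h)) (at y)" by (simp add: jacobian_works)
  then have "jacobian F (at y) *v v = F' v" for v
    using has_derivative_unique[OF assms] by metis
  then show ?thesis
    unfolding d1_def wedge21_tprojM by (simp add: wedge21_matrix_transpose)
qed

section \<open>The test fields\<close>

text \<open>The bracket is the Gram determinant of \<open>y\<close>, \<open>x\<close>,
  \<open>v\<close> against \<open>y\<close>, \<open>x\<close>, \<open>a\<close>: up to sign, the
  left-hand side is the inner product of two cross products.\<close>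

lemma vol3_crs_gram:
  "vol3 y x (crs y x v) a = - (
     (y \<bullet> y) * ((x \<bullet> x) * (v \<bullet> a) - (x \<bullet> a) * (v \<bullet> x))
   - (y \<bullet> x) * ((x \<bullet> y) * (v \<bullet> a) - (x \<bullet> a) * (v \<bullet> y))
   + (y \<bullet> a) * ((x \<bullet> y) * (v \<bullet> x) - (x \<bullet> x) * (v \<bullet> y)))"
  by (simp add: vol3_eq crs_def inner_R4 axis_def) algebra

lemma sum_vol3_crs:
  "(\<Sum>j\<in>UNIV. vol3 y (axis j 1) (crs (axis j 1) x (fr k y)) a) = 2 * (x \<bullet> y) * (a \<bullet> fr k y)"
  using exhaust_3[of k] by (auto simp: sum_4 vol3_eq crs_def inner_R4 axis_def fr_simps algebra_simps)

lemma sum_vol3_crs_fr: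
  "(\<Sum>j\<in>UNIV. vol3 y (axis j 1) (crs y x (fr k (axis j 1))) a) =
    (y \<bullet> y) * (x \<bullet> fr k a) + (x \<bullet> y) * (a \<bullet> fr k y) - (a \<bullet> y) * (x \<bullet> fr k y)"
  using exhaust_3[of k] by (auto simp: sum_4 vol3_eq crs_def inner_R4 axis_def fr_simps algebra_simps)

lemma sum_vol3_fr:
  "(\<Sum>j\<in>UNIV. vol3 y (axis j 1) (fr k (axis j 1)) a) = - 2 * (a \<bullet> fr k y)"
  using exhaust_3[of k] by (auto simp: sum_4 vol3_eq inner_R4 axis_def fr_simps algebra_simps)

text \<open>Testing \<open>d a\<close> against \<open>Fk N k x\<close> produces the \<open>k\<close>-th frame coefficient of \<open>a\<close>, averaged by
  the approximate identity around \<open>x\<close>, up to a gradient.\<close>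
definition Fk :: "nat \<Rightarrow> 3 \<Rightarrow> R4 \<Rightarrow> R4 \<Rightarrow> R4" where
  "Fk N k x y = gamN N (sK x y) *\<^sub>R crs y x (fr k y)"

lemma gamN_has_derivative:
  "((\<lambda>y. gamN N (sK x y)) has_derivative (\<lambda>h. dgamN N (sK x y) * (x \<bullet> h))) (at y)"
proof -
  have "((\<lambda>y. sK x y ^ j) has_derivative (\<lambda>h. real j * sK x y ^ (j-1) * (x \<bullet> h / 2))) (at y)" for j
    unfolding sK_def by (auto intro!: derivative_eq_intros simp: fun_eq_iff)
  then have "((\<lambda>y. gamN N (sK x y)) has_derivative (\<lambda>h. 1/2 * (\<Sum>j<N. ck j * (real j * sK x y ^ (j-1) * (x \<bullet> h / 2))))) (at y)"
    unfolding gamN_def by (intro has_derivative_mult_right has_derivative_sum)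
  moreover have "1/2 * (\<Sum>j<N. ck j * (real j * sK x y ^ (j-1) * (x \<bullet> h / 2))) = dgamN N (sK x y) * (x \<bullet> h)" for h
    unfolding dgamN_def sum_distrib_left sum_distrib_right by (intro sum.cong refl) simp
  ultimately show ?thesis by simp
qed

text \<open>\<open>Fk\<close> is the cross product of the gradient of a zonal function, whose
  derivative in \<open>x \<bullet> y\<close> is \<open>gamN\<close>, with a frame field. In its curl
  the coefficient of \<open>a \<bullet> fr k y\<close> is minus the Laplacian of that function,
  hence \<open>pk - 1\<close>. The other two terms are, up to sign, the integrand of
  \<open>dphi\<close> in the direction \<open>fr k x\<close>.\<close>

lemma wedge21_d1_Fk:
  assumes x: "norm x = 1" and y: "norm y = 1" and a: "a \<bullet> y = 0"
  shows "wedge21 (d1 (Fk N k x) y) a y = (pk N (sK x y) - 1) * (a \<bullet> fr k y)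
     + dgamN N (sK x y) * (x \<bullet> a) * (x \<bullet> fr k y) + gamN N (sK x y) * (x \<bullet> fr k a)"
proof -
  let ?F' = "\<lambda>h. gamN N (sK x y) *\<^sub>R (crs y x (fr k h) + crs h x (fr k y)) + (dgamN N (sK x y) * (x \<bullet> h)) *\<^sub>R crs y x (fr k y)"
  have "((\<lambda>y. crs y x (fr k y)) has_derivative (\<lambda>h. crs y x (fr k h) + crs h x (fr k y))) (at y)"
    by (rule bounded_bilinear.FDERIV[OF bilinear_crs has_derivative_ident bounded_linear.has_derivative[OF bounded_linear_fr has_derivative_ident]])
  then have D: "(Fk N k x has_derivative ?F') (at y)"
    unfolding Fk_def by (rule has_derivative_scaleR[OF gamN_has_derivative])
  have xx: "x \<bullet> x = 1" "y \<bullet> y = 1" using x y by (simp_all add: norm_eq_1)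
  define t where "t = x \<bullet> y"
  define g where "g = gamN N (sK x y)"
  define g' where "g' = dgamN N (sK x y)"
  have 1: "(\<Sum>j\<in>UNIV. vol3 y (axis j 1) ((g' * (x \<bullet> axis j 1)) *\<^sub>R crs y x (fr k y)) a)
     = g' * ((x \<bullet> a) * (x \<bullet> fr k y) - (1 - t^2) * (a \<bullet> fr k y))"
  proof -
    have "(\<Sum>j\<in>UNIV. vol3 y (axis j 1) ((g' * (x \<bullet> axis j 1)) *\<^sub>R crs y x (fr k y)) a)
      = g' * (\<Sum>j\<in>UNIV. vol3 y (x $ j *\<^sub>R axis j 1) (crs y x (fr k y)) a)"
      by (simp add: linear_scale[OF linear_vol3(2)] linear_scale[OF linear_vol3(3)] sum_distrib_left inner_axis mult.assoc)
    also have "(\<Sum>j\<in>UNIV. vol3 y (x $ j *\<^sub>R axis j 1) (crs y x (fr k y)) a) = vol3 y x (crs y x (fr k y)) a"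
      by (simp add: linear_sum[OF linear_vol3(2), symmetric] sum_axis_R4)
    also have "\<dots> = (x \<bullet> a) * (x \<bullet> fr k y) - (1 - t^2) * (a \<bullet> fr k y)"
    proof -
      have c: "y \<bullet> x = t" "x \<bullet> y = t" "y \<bullet> a = 0" "fr k y \<bullet> a = a \<bullet> fr k y" "fr k y \<bullet> x = x \<bullet> fr k y"
        using a by (simp_all add: t_def inner_commute)
      show ?thesis
        unfolding vol3_crs_gram c xx by (simp add: power2_eq_square algebra_simps)
    qed
    finally show ?thesis .
  qed
  have "wedge21 (d1 (Fk N k x) y) a y = g * ((x \<bullet> fr k a) + t * (a \<bullet> fr k y) + 2 * t * (a \<bullet> fr k y))
     + g' * ((x \<bullet> a) * (x \<bullet> fr k y) - (1 - t^2) * (a \<bullet> fr k y))"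
    unfolding wedge21_d1[OF D] g_def[symmetric] g'_def[symmetric] 1[symmetric]
    using sum_vol3_crs[of y x k a] sum_vol3_crs_fr[of y x k a] xx a
    by (simp add: linear_add[OF linear_vol3(3)] linear_scale[OF linear_vol3(3)] sum.distrib distrib_left t_def flip: sum_distrib_left)
  also have "\<dots> = (- ((1 - t^2) * g' - 3 * t * g)) * (a \<bullet> fr k y) + g' * (x \<bullet> a) * (x \<bullet> fr k y) + g * (x \<bullet> fr k a)"
    by (simp add: algebra_simps)
  also have "- ((1 - t^2) * g' - 3 * t * g) = pk N (sK x y) - 1"
  proof -
    have "2 * sK x y - 1 = t" by (simp add: sK_def t_def field_simps)
    then show ?thesis
      using pk_eq_laplacian[of N "sK x y"] by (simp add: g_def g'_def)
  qed
  finally show ?thesis by (simp add: g_def g'_def)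
qed

text \<open>The frame fields are eigenfields of the curl. Testing with them recovers the mean of a
  frame coefficient, which \<open>pk N - 1\<close> subtracts.\<close>

lemma wedge21_d1_fr:
  "wedge21 (d1 (fr k) y) a y = - 2 * (a \<bullet> fr k y)"
  by (subst wedge21_d1[OF bounded_linear.has_derivative[OF bounded_linear_fr has_derivative_ident]]) (rule sum_vol3_fr)

section \<open>Smoothness of polynomials\<close>

text \<open>Polynomials are closed under partial derivatives, so iterating this choice produces the
  whole family of derivatives demanded by \<open>smooth_fun\<close>. All test functions of the proof
  are of this kind.\<close>

lemma real_polynomial_partials:
  fixes f :: "R4 \<Rightarrow> real"
  assumes "real_polynomial_function f"
  shows "\<exists>g. (\<forall>i. real_polynomial_function (g i)) \<and> (\<forall>x. (f has_derivative (\<lambda>h. \<Sum>i\<in>UNIV. h $ i * g i x)) (at x))"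
  using assms
proof (induction f)
  case (linear f)
  have "f h = (\<Sum>i\<in>UNIV. h $ i * f (axis i 1))" for h
  proof -
    have "f h = f (\<Sum>i\<in>UNIV. h $ i *\<^sub>R axis i 1)" by (simp only: sum_axis_R4)
    also have "\<dots> = (\<Sum>i\<in>UNIV. f (h $ i *\<^sub>R axis i 1))" by (rule linear_sum[OF bounded_linear.linear[OF linear]])
    finally show ?thesis by (simp add: linear_scale[OF bounded_linear.linear[OF linear]])
  qed
  then have "(f has_derivative (\<lambda>h. \<Sum>i\<in>UNIV. h $ i * f (axis i 1))) (at x)" for x
    using bounded_linear_imp_has_derivative[OF linear, of "at x"] by (metis (no_types, lifting) ext)
  then show ?case by (intro exI[of _ "\<lambda>i _. f (axis i 1)"]) auto
next
  case (const c)
  then show ?case by (intro exI[of _ "\<lambda>_ _. 0"]) auto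
next
  case (add f1 f2)
  obtain g1 where g1: "\<forall>i. real_polynomial_function (g1 i)"
    "\<And>x. (f1 has_derivative (\<lambda>h. \<Sum>i\<in>UNIV. h $ i * g1 i x)) (at x)" using add.IH(1) by blast
  obtain g2 where g2: "\<forall>i. real_polynomial_function (g2 i)"
    "\<And>x. (f2 has_derivative (\<lambda>h. \<Sum>i\<in>UNIV. h $ i * g2 i x)) (at x)" using add.IH(2) by blast
  note g = g1(1) g2(1) g1(2) g2(2)
  have "((\<lambda>x. f1 x + f2 x) has_derivative (\<lambda>h. \<Sum>i\<in>UNIV. h $ i * (g1 i x + g2 i x))) (at x)" for x
    using has_derivative_add[OF g(3,4)] by (simp add: distrib_left sum.distrib)
  then show ?case using g by (intro exI[of _ "\<lambda>i x. g1 i x + g2 i x"]) auto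
next
  case (mult f1 f2)
  obtain g1 where g1: "\<forall>i. real_polynomial_function (g1 i)"
    "\<And>x. (f1 has_derivative (\<lambda>h. \<Sum>i\<in>UNIV. h $ i * g1 i x)) (at x)" using mult.IH(1) by blast
  obtain g2 where g2: "\<forall>i. real_polynomial_function (g2 i)"
    "\<And>x. (f2 has_derivative (\<lambda>h. \<Sum>i\<in>UNIV. h $ i * g2 i x)) (at x)" using mult.IH(2) by blast
  note g = g1(1) g2(1) g1(2) g2(2)
  have "((\<lambda>x. f1 x * f2 x) has_derivative (\<lambda>h. \<Sum>i\<in>UNIV. h $ i * (f1 x * g2 i x + g1 i x * f2 x))) (at x)" for x
    using has_derivative_mult[OF g(3)[of x] g(4)[of x]]
    by (simp add: distrib_left sum.distrib sum_distrib_left sum_distrib_right mult_ac)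
  moreover have "real_polynomial_function (\<lambda>x. f1 x * g2 i x + g1 i x * f2 x)" for i
    using g(1,2) mult.hyps by (intro real_polynomial_function.intros(3,4)) auto
  ultimately show ?case by (intro exI[of _ "\<lambda>i x. f1 x * g2 i x + g1 i x * f2 x"]) auto
qed

lemma smooth_fun_polynomial:
  assumes "real_polynomial_function f"
  shows "smooth_fun f"
proof -
  have "\<forall>f. \<exists>g. real_polynomial_function f \<longrightarrow> (\<forall>i. real_polynomial_function (g i)) \<and>
      (\<forall>x. (f has_derivative (\<lambda>h. \<Sum>i\<in>UNIV. h $ i * g i x)) (at (x::R4)))"
    using real_polynomial_partials by blast
  from choice[OF this] obtain P where
    "\<forall>f. real_polynomial_function f \<longrightarrow> (\<forall>i. real_polynomial_function (P f i)) \<and>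
      (\<forall>x. (f has_derivative (\<lambda>h. \<Sum>i\<in>UNIV. h $ i * P f i x)) (at (x::R4)))" ..
  then have P: "\<And>f i. real_polynomial_function f \<Longrightarrow> real_polynomial_function (P f i)"
    "\<And>f x. real_polynomial_function f \<Longrightarrow> (f has_derivative (\<lambda>h. \<Sum>i\<in>UNIV. h $ i * P f i x)) (at x)"
    by simp_all
  define D where "D l = foldr (\<lambda>i f. P f i) l f" for l :: "4 list"
  have D: "D [] = f" "D (i # l) = P (D l) i" for i l
    by (simp_all add: D_def)
  have p: "real_polynomial_function (D l)" for l
  proof (induction l)
    case Nil
    then show ?case using assms by (simp only: D)
  next
    case (Cons i l)
    then show ?case unfolding D by (rule P(1))
  qed
  show ?thesis
    unfolding smooth_fun_def
  proof (intro exI[of _ D] conjI allI)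
    fix l x
    show "(D l has_derivative (\<lambda>h. \<Sum>i\<in>UNIV. h $ i * D (i # l) x)) (at x)"
      unfolding D by (rule P(2)[OF p])
  qed (rule D)
qed

section \<open>Lebesgue classes of vector fields\<close>

definition L3v :: "(R4 \<Rightarrow> R4) \<Rightarrow> bool" where
  "L3v a \<longleftrightarrow> a \<in> borel_measurable S3 \<and> (\<forall>x\<in>sphere 0 1. a x \<bullet> x = 0) \<and> integrable S3 (\<lambda>x. norm (a x)^3)"

definition L32v :: "(R4 \<Rightarrow> R4) \<Rightarrow> bool" where
  "L32v X \<longleftrightarrow> X \<in> borel_measurable S3 \<and> (\<forall>x\<in>sphere 0 1. X x \<bullet> x = 0) \<and> integrable S3 (\<lambda>x. norm (X x) powr (3/2))"

lemma le_1_plus_cube: "0 \<le> t \<Longrightarrow> t \<le> 1 + t^3" for t :: real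
proof (cases "t \<le> 1")
  case False
  then show ?thesis using power_increasing[of 1 3 t] by simp
qed (simp add: add_increasing2)

lemma le_1_plus_powr: "0 \<le> t \<Longrightarrow> t \<le> 1 + t powr (3/2)" for t :: real
proof (cases "t \<le> 1")
  case False
  then show ?thesis using powr_mono[of 1 "3/2" t] by simp
qed (simp add: add_increasing2)

lemma cube_add_le: "0 \<le> s \<Longrightarrow> 0 \<le> t \<Longrightarrow> (s + t)^3 \<le> 4 * (s^3 + t^3)" for s t :: real
proof -
  assume "0 \<le> s" "0 \<le> t"
  then have "0 \<le> 3 * ((s + t) * (s - t)^2)" by simp
  also have "\<dots> = 4 * (s^3 + t^3) - (s + t)^3" by (simp add: power2_eq_square power3_eq_cube algebra_simps)
  finally show ?thesis by simp
qed

lemma powr_3_2_add_le: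
  fixes s t :: real
  assumes "0 \<le> s" "0 \<le> t"
  shows "(s + t) powr (3/2) \<le> 4 * (s powr (3/2) + t powr (3/2))"
proof -
  have 2: "(2::real) powr (3/2) \<le> 4" using powr_mono[of "3/2" 2 "2::real"] by simp
  have "(s + t) powr (3/2) \<le> (2 * max s t) powr (3/2)" using assms by (intro powr_mono2) auto
  also have "\<dots> = 2 powr (3/2) * max s t powr (3/2)" using assms by (simp add: powr_mult)
  also have "\<dots> \<le> 4 * max s t powr (3/2)" using 2 by (intro mult_right_mono) auto
  also have "\<dots> \<le> 4 * (s powr (3/2) + t powr (3/2))" by (simp add: max_def)
  finally show ?thesis .
qed

lemma L3v_integrable: "L3v a \<Longrightarrow> integrable S3 a"
  unfolding L3v_def
  by (intro Bochner_Integration.integrable_bound[of S3 "\<lambda>x. 1 + norm (a x)^3" a])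
    (auto intro!: AE_I2 simp: le_1_plus_cube abs_of_nonneg)

lemma L32v_integrable: "L32v X \<Longrightarrow> integrable S3 X"
  unfolding L32v_def
  by (intro Bochner_Integration.integrable_bound[of S3 "\<lambda>x. 1 + norm (X x) powr (3/2)" X])
    (auto intro!: AE_I2 simp: le_1_plus_powr abs_of_nonneg)

lemma L3v_diff: "L3v a \<Longrightarrow> L3v b \<Longrightarrow> L3v (\<lambda>x. a x - b x)"
  unfolding L3v_def
proof (safe, goal_cases)
  case 3
  have "norm (a x - b x)^3 \<le> 4 * (norm (a x)^3 + norm (b x)^3)" for x
    by (rule order_trans[OF power_mono[OF norm_triangle_ineq4] cube_add_le]) auto
  then have b: "norm (norm (a x - b x)^3) \<le> norm (4 * (norm (a x)^3 + norm (b x)^3))" for x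
    by (simp add: abs_of_nonneg)
  have i: "integrable S3 (\<lambda>x. 4 * (norm (a x)^3 + norm (b x)^3))"
    using 3 by simp
  have m: "(\<lambda>x. norm (a x - b x)^3) \<in> borel_measurable S3"
    using 3 by simp
  show ?case
    by (rule Bochner_Integration.integrable_bound[OF i m AE_I2[OF b]])
qed (auto simp: inner_diff_left)

lemma L32v_diff: "L32v a \<Longrightarrow> L32v b \<Longrightarrow> L32v (\<lambda>x. a x - b x)"
  unfolding L32v_def
proof (safe, goal_cases)
  case 3
  have "norm (a x - b x) powr (3/2) \<le> 4 * (norm (a x) powr (3/2) + norm (b x) powr (3/2))" for x
    by (rule order_trans[OF powr_mono2[OF _ _ norm_triangle_ineq4] powr_3_2_add_le]) auto
  then have b: "norm (norm (a x - b x) powr (3/2)) \<le> norm (4 * (norm (a x) powr (3/2) + norm (b x) powr (3/2)))" for x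
    by (simp add: abs_of_nonneg)
  have i: "integrable S3 (\<lambda>x. 4 * (norm (a x) powr (3/2) + norm (b x) powr (3/2)))"
    using 3 by simp
  have m: "(\<lambda>x. norm (a x - b x) powr (3/2)) \<in> borel_measurable S3"
    using 3 by simp
  show ?case
    by (rule Bochner_Integration.integrable_bound[OF i m AE_I2[OF b]])
qed (auto simp: inner_diff_left)

lemma square_powr_3_2: "0 \<le> t \<Longrightarrow> (t^2) powr (3/2) = t^3" for t :: real
  by (cases "t = 0") (simp_all add: powr_powr powr_numeral flip: powr_numeral)

lemma norm_scaleR_powr_3_2: "norm (norm v *\<^sub>R v) powr (3/2) = norm v ^ 3"
  by (simp add: square_powr_3_2 flip: power2_eq_square)

lemma norm_powr_3: "norm v powr 3 = norm v ^ 3"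
  by (cases "v = 0") (simp_all flip: powr_numeral)

lemma integral_norm_diff_cube_le:
  assumes L: "L3v a" "L3v b" and A: "(\<integral>x. norm (a x)^3 \<partial>S3) \<le> A" "(\<integral>x. norm (b x)^3 \<partial>S3) \<le> A"
  shows "(\<integral>x. norm (a x - b x)^3 \<partial>S3) \<le> 8 * A"
proof -
  have i: "integrable S3 (\<lambda>x. norm (a x)^3)" "integrable S3 (\<lambda>x. norm (b x)^3)" using L by (simp_all add: L3v_def)
  have "(\<integral>x. norm (a x - b x)^3 \<partial>S3) \<le> (\<integral>x. 4 * (norm (a x)^3 + norm (b x)^3) \<partial>S3)"
  proof (rule integral_mono)
    show "integrable S3 (\<lambda>x. norm (a x - b x)^3)" using L3v_diff[OF L] by (simp add: L3v_def)
    show "norm (a x - b x)^3 \<le> 4 * (norm (a x)^3 + norm (b x)^3)" for x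
      by (rule order_trans[OF power_mono[OF norm_triangle_ineq4] cube_add_le]) auto
  qed (use i in simp)
  also have "\<dots> \<le> 8 * A" using A i by simp
  finally show ?thesis .
qed

lemma integral_norm_diff_powr_le:
  assumes L: "L32v X" "L32v Y" and A: "(\<integral>x. norm (X x) powr (3/2) \<partial>S3) \<le> A" "(\<integral>x. norm (Y x) powr (3/2) \<partial>S3) \<le> A"
  shows "(\<integral>x. norm (X x - Y x) powr (3/2) \<partial>S3) \<le> 8 * A"
proof -
  have i: "integrable S3 (\<lambda>x. norm (X x) powr (3/2))" "integrable S3 (\<lambda>x. norm (Y x) powr (3/2))" using L by (simp_all add: L32v_def)
  have "(\<integral>x. norm (X x - Y x) powr (3/2) \<partial>S3) \<le> (\<integral>x. 4 * (norm (X x) powr (3/2) + norm (Y x) powr (3/2)) \<partial>S3)"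
  proof (rule integral_mono)
    show "integrable S3 (\<lambda>x. norm (X x - Y x) powr (3/2))" using L32v_diff[OF L] by (simp add: L32v_def)
    show "norm (X x - Y x) powr (3/2) \<le> 4 * (norm (X x) powr (3/2) + norm (Y x) powr (3/2))" for x
      by (rule order_trans[OF powr_mono2[OF _ _ norm_triangle_ineq4] powr_3_2_add_le]) auto
  qed (use i in simp)
  also have "\<dots> \<le> 8 * A" using A i by simp
  finally show ?thesis .
qed

lemma integral_norm_le_cube:
  assumes "L3v a" and "(\<integral>x. norm (a x)^3 \<partial>S3) \<le> A"
  shows "(\<integral>x. norm (a x) \<partial>S3) \<le> A + area3"
proof -
  have "(\<integral>x. norm (a x) \<partial>S3) \<le> (\<integral>x. norm (a x)^3 + 1 \<partial>S3)"
    using assms L3v_integrable[OF assms(1)] le_1_plus_cube by (intro integral_mono) (auto simp: L3v_def add.commute)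
  also have "\<dots> \<le> A + area3" using assms by (simp add: L3v_def area3_def)
  finally show ?thesis .
qed

lemma L32v_of_L3v: "L3v a \<Longrightarrow> L32v (\<lambda>x. norm (a x) *\<^sub>R a x)"
  unfolding L3v_def L32v_def by (auto simp: square_powr_3_2 simp flip: power2_eq_square)

lemma integrable_continuous_mult:
  fixes f u :: "R4 \<Rightarrow> real"
  assumes f: "continuous_on UNIV f" and u: "integrable S3 u"
  shows "integrable S3 (\<lambda>y. f y * u y)"
proof -
  have "compact (f ` sphere 0 1)"
    using f by (intro compact_continuous_image) (auto intro: continuous_on_subset)
  then obtain B where B: "\<And>y. y \<in> sphere 0 1 \<Longrightarrow> norm (f y) \<le> B"
    by (meson bounded_iff compact_imp_bounded image_eqI)
  have fm: "f \<in> borel_measurable S3" by (intro borel_measurable_S3I borel_measurable_continuous_onI f)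
  show ?thesis
  proof (rule Bochner_Integration.integrable_bound[of S3 "\<lambda>y. B * \<bar>u y\<bar>"])
    show "integrable S3 (\<lambda>y. B * \<bar>u y\<bar>)" using u by simp
    show "(\<lambda>y. f y * u y) \<in> borel_measurable S3" using fm u by simp
    show "AE y in S3. norm (f y * u y) \<le> norm (B * \<bar>u y\<bar>)"
    proof (rule AE_I2)
      fix y assume "y \<in> space S3"
      then have fy: "\<bar>f y\<bar> \<le> B" using B by simp
      have "\<bar>f y\<bar> * \<bar>u y\<bar> \<le> B * \<bar>u y\<bar>" using fy by (rule mult_right_mono) simp
      also have "\<dots> \<le> \<bar>B * \<bar>u y\<bar>\<bar>" by (rule abs_ge_self)
      finally show "norm (f y * u y) \<le> norm (B * \<bar>u y\<bar>)" by (simp add: abs_mult)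
    qed
  qed
qed

lemma integrable_vec_component: "integrable S3 (a :: R4 \<Rightarrow> R4) \<Longrightarrow> integrable S3 (\<lambda>y. a y $ i)"
  using integrable_bounded_linear[OF bounded_linear_vec_nth] .

lemma integrable_inner_continuous:
  assumes g: "continuous_on UNIV g" and a: "integrable S3 (a :: R4 \<Rightarrow> R4)"
  shows "integrable S3 (\<lambda>y. a y \<bullet> g y)" "integrable S3 (\<lambda>y. g y \<bullet> a y)"
proof -
  have "integrable S3 (\<lambda>y. \<Sum>i\<in>UNIV. g y $ i * a y $ i)"
    using g a by (intro Bochner_Integration.integrable_sum integrable_continuous_mult integrable_vec_component continuous_on_component) auto
  then show "integrable S3 (\<lambda>y. a y \<bullet> g y)" "integrable S3 (\<lambda>y. g y \<bullet> a y)"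
    by (simp_all add: inner_vec_def mult.commute)
qed

lemma continuous_real_polynomial: "real_polynomial_function f \<Longrightarrow> continuous_on A f"
  by (induction f rule: real_polynomial_function.induct) (auto intro: continuous_intros linear_continuous_on)

section \<open>Polynomial potentials\<close>

lemma integral_lincomb:
  fixes w :: "'a \<Rightarrow> real"
  assumes w: "integrable M w" and v: "\<And>i. integrable M (v i)" and u: "\<And>i. integrable M (u i)"
  shows "(\<integral>y. c * w y + (\<Sum>i\<in>I. d i * v i y + e i * u i y) \<partial>M)
    = c * (\<integral>y. w y \<partial>M) + (\<Sum>i\<in>I. d i * (\<integral>y. v i y \<partial>M) + e i * (\<integral>y. u i y \<partial>M))"
  using w v u by simp

lemma integral_lincomb2:
  fixes v u :: "nat \<Rightarrow> 'b \<Rightarrow> 'a \<Rightarrow> real"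
  assumes v: "\<And>j i. integrable M (v j i)" and u: "\<And>j i. integrable M (u j i)"
  shows "(\<integral>y. (\<Sum>j<N. \<Sum>i\<in>I. c j * (d i * v j i y + e i * u j i y)) \<partial>M)
    = (\<Sum>j<N. \<Sum>i\<in>I. c j * (d i * (\<integral>y. v j i y \<partial>M) + e i * (\<integral>y. u j i y \<partial>M)))"
  using v u by simp

text \<open>As \<open>sK x y\<close> is affine in \<open>x\<close>, one factor can be split off with
  its coefficients \<open>y $ i\<close> absorbed into the density; the induction therefore runs over
  all densities \<open>u\<close>. The same recursion gives the derivative without differentiating
  under the integral.\<close>

lemma sK_moment_polynomial:
  fixes u :: "R4 \<Rightarrow> real"
  assumes "integrable S3 u"
  shows "real_polynomial_function (\<lambda>x. \<integral>y. sK x y ^ j * u y \<partial>S3) \<and>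
    (\<forall>x. ((\<lambda>x. \<integral>y. sK x y ^ j * u y \<partial>S3) has_derivative
        (\<lambda>h. \<integral>y. real j * sK x y ^ (j-1) * (y \<bullet> h / 2) * u y \<partial>S3)) (at x))"
  using assms
proof (induction j arbitrary: u)
  case 0
  then show ?case by (auto simp: real_polynomial_function.intros(2))
next
  case (Suc j)
  let ?v = "\<lambda>i y. y $ i * u y / 2"
  have v: "integrable S3 (?v i)" for i
  proof -
    have "integrable S3 (\<lambda>y. y $ i * u y)"
      by (intro integrable_continuous_mult Suc.prems continuous_intros)
    then show ?thesis by simp
  qed
  have I: "integrable S3 (\<lambda>y. sK x y ^ j * w y)" "integrable S3 (\<lambda>y. real j * sK x y ^ (j-1) * (y \<bullet> h / 2) * w y)"
    if "integrable S3 w" for w x h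
    using that by (auto intro!: integrable_continuous_mult continuous_intros)
  have spl: "sK x y ^ Suc j * u y = 1/2 * (sK x y ^ j * u y) + (\<Sum>i\<in>UNIV. x $ i * (sK x y ^ j * ?v i y))" for x y
  proof -
    have "sK x y * Z = 1/2 * Z + (\<Sum>i\<in>UNIV. x $ i * y $ i) / 2 * Z" for Z
      by (simp add: sK_def inner_vec_def distrib_right add_divide_distrib)
    from this[of "sK x y ^ j * u y"] show ?thesis
      by (simp add: sum_distrib_left sum_distrib_right sum_divide_distrib mult_ac)
  qed
  have eq: "(\<integral>y. sK x y ^ Suc j * u y \<partial>S3) = 1/2 * (\<integral>y. sK x y ^ j * u y \<partial>S3) + (\<Sum>i\<in>UNIV. x $ i * (\<integral>y. sK x y ^ j * ?v i y \<partial>S3))" for x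
    unfolding spl using integral_lincomb[OF I(1)[OF Suc.prems] I(1)[OF v] I(1)[OF v], where c = "1/2" and d = "\<lambda>i. x $ i" and e = "\<lambda>_. 0" and I = UNIV]
    unfolding mult_zero_left add_0_right .
  have "real_polynomial_function (\<lambda>x::R4. x $ i)" for i
    by (intro real_polynomial_function.intros(1) bounded_linear_vec_nth)
  then have P: "real_polynomial_function (\<lambda>x. \<integral>y. sK x y ^ Suc j * u y \<partial>S3)"
    unfolding eq using Suc.IH[OF Suc.prems] Suc.IH[OF v]
    by (intro real_polynomial_function.intros(3,4) real_polynomial_function_sum real_polynomial_function.intros(2)) auto
  have D: "((\<lambda>x. \<integral>y. sK x y ^ Suc j * u y \<partial>S3) has_derivative
      (\<lambda>h. \<integral>y. real (Suc j) * sK x y ^ (Suc j - 1) * (y \<bullet> h / 2) * u y \<partial>S3)) (at x)" for x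
  proof -
    let ?T = "\<lambda>h w. \<integral>y. real j * sK x y ^ (j-1) * (y \<bullet> h / 2) * w y \<partial>S3"
    have "((\<lambda>x. 1/2 * (\<integral>y. sK x y ^ j * u y \<partial>S3) + (\<Sum>i\<in>UNIV. x $ i * (\<integral>y. sK x y ^ j * ?v i y \<partial>S3))) has_derivative
       (\<lambda>h. 1/2 * ?T h u + (\<Sum>i\<in>UNIV. x $ i * ?T h (?v i) + h $ i * (\<integral>y. sK x y ^ j * ?v i y \<partial>S3)))) (at x)"
      using Suc.IH[OF Suc.prems] Suc.IH[OF v]
      by (intro has_derivative_add has_derivative_mult_right has_derivative_sum has_derivative_mult
          bounded_linear_imp_has_derivative bounded_linear_vec_nth) auto
    moreover have "1/2 * ?T h u + (\<Sum>i\<in>UNIV. x $ i * ?T h (?v i) + h $ i * (\<integral>y. sK x y ^ j * ?v i y \<partial>S3))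
       = (\<integral>y. real (Suc j) * sK x y ^ (Suc j - 1) * (y \<bullet> h / 2) * u y \<partial>S3)" for h
    proof -
      have "1/2 * ?T h u + (\<Sum>i\<in>UNIV. x $ i * ?T h (?v i) + h $ i * (\<integral>y. sK x y ^ j * ?v i y \<partial>S3))
        = (\<integral>y. 1/2 * (real j * sK x y ^ (j-1) * (y \<bullet> h / 2) * u y) + (\<Sum>i\<in>UNIV. x $ i * (real j * sK x y ^ (j-1) * (y \<bullet> h / 2) * ?v i y) + h $ i * (sK x y ^ j * ?v i y)) \<partial>S3)"
        by (rule integral_lincomb[OF I(2)[OF Suc.prems] I(2)[OF v] I(1)[OF v], symmetric])
      also have "\<dots> = (\<integral>y. real (Suc j) * sK x y ^ (Suc j - 1) * (y \<bullet> h / 2) * u y \<partial>S3)"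
      proof (rule Bochner_Integration.integral_cong[OF refl])
        fix y
        define T where "T = real j * sK x y ^ (j-1) * (y \<bullet> h / 2)"
        have Ts: "T * sK x y = real j * sK x y ^ j * (y \<bullet> h / 2)" unfolding T_def by (cases j) auto
        have "1/2 * (T * u y) + (\<Sum>i\<in>UNIV. x $ i * (T * ?v i y) + h $ i * (sK x y ^ j * ?v i y))
          = T * u y * ((1 + (\<Sum>i\<in>UNIV. x $ i * y $ i)) / 2) + sK x y ^ j * u y * ((\<Sum>i\<in>UNIV. y $ i * h $ i) / 2)"
          by (simp add: sum.distrib sum_distrib_left sum_distrib_right sum_divide_distrib add_divide_distrib distrib_left mult_ac)
        also have "\<dots> = T * sK x y * u y + sK x y ^ j * (y \<bullet> h / 2) * u y"
          by (simp add: sK_def inner_vec_def mult_ac)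
        also have "\<dots> = real (Suc j) * sK x y ^ (Suc j - 1) * (y \<bullet> h / 2) * u y"
          unfolding Ts by (simp add: algebra_simps)
        finally show "1/2 * (real j * sK x y ^ (j-1) * (y \<bullet> h / 2) * u y) + (\<Sum>i\<in>UNIV. x $ i * (real j * sK x y ^ (j-1) * (y \<bullet> h / 2) * ?v i y) + h $ i * (sK x y ^ j * ?v i y))
           = real (Suc j) * sK x y ^ (Suc j - 1) * (y \<bullet> h / 2) * u y"
          unfolding T_def .
      qed
      finally show ?thesis .
    qed
    ultimately show ?thesis unfolding eq by (simp only:)
  qed
  show ?case using P D by blast
qed

text \<open>The pairing of \<open>a\<close> with the gradient in \<open>y\<close> of the zonal
  function whose derivative is \<open>gamN\<close>. Up to the factor \<open>area3\<close> and the
  truncation, it is the scalar potential of the exact part in the Hodge decomposition of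
  \<open>a\<close>.\<close>

definition phi :: "nat \<Rightarrow> (R4 \<Rightarrow> R4) \<Rightarrow> R4 \<Rightarrow> real" where
  "phi N a x = (\<integral>y. gamN N (sK x y) * (x \<bullet> a y) \<partial>S3)"

definition dphi :: "nat \<Rightarrow> (R4 \<Rightarrow> R4) \<Rightarrow> R4 \<Rightarrow> R4 \<Rightarrow> real" where
  "dphi N a x h = (\<integral>y. dgamN N (sK x y) * (y \<bullet> h) * (x \<bullet> a y) + gamN N (sK x y) * (h \<bullet> a y) \<partial>S3)"

lemma continuous_gamN [continuous_intros]: "continuous_on A f \<Longrightarrow> continuous_on A (\<lambda>z. gamN N (f z))"
  unfolding gamN_def by (intro continuous_intros)

lemma continuous_dgamN [continuous_intros]: "continuous_on A f \<Longrightarrow> continuous_on A (\<lambda>z. dgamN N (f z))"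
  unfolding dgamN_def by (intro continuous_intros)

lemma phi_eq:
  assumes a: "integrable S3 a"
  shows "phi N a x = (\<Sum>j<N. \<Sum>i\<in>UNIV. ck j / 2 * (x $ i * (\<integral>y. sK x y ^ j * a y $ i \<partial>S3)))"
proof -
  have I: "integrable S3 (\<lambda>y. sK x y ^ j * a y $ i)" for j i
    by (intro integrable_continuous_mult integrable_vec_component a continuous_intros)
  have "phi N a x = (\<integral>y. (\<Sum>j<N. \<Sum>i\<in>UNIV. ck j / 2 * (x $ i * (sK x y ^ j * a y $ i))) \<partial>S3)"
    unfolding phi_def
  proof (rule Bochner_Integration.integral_cong[OF refl])
    fix y
    have "(\<Sum>i\<in>UNIV. ck j / 2 * (x $ i * (sK x y ^ j * a y $ i))) = 1/2 * (ck j * sK x y ^ j) * (x \<bullet> a y)" for j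
      by (simp add: inner_vec_def sum_distrib_left mult_ac)
    then show "gamN N (sK x y) * (x \<bullet> a y) = (\<Sum>j<N. \<Sum>i\<in>UNIV. ck j / 2 * (x $ i * (sK x y ^ j * a y $ i)))"
      by (simp only: gamN_def sum_distrib_left sum_distrib_right)
  qed
  then show ?thesis using I by (simp add: Bochner_Integration.integral_sum)
qed

text \<open>Being a polynomial, the potential may be multiplied by a polynomial cut-off and then
  serve as a test function for \<open>divfree\<close>.\<close>

lemma phi_polynomial:
  assumes a: "integrable S3 a"
  shows "real_polynomial_function (phi N a)" "(phi N a has_derivative dphi N a x) (at x)"
proof -
  note M = sK_moment_polynomial[OF integrable_vec_component[OF a]]
  have eq: "phi N a = (\<lambda>x. \<Sum>j<N. \<Sum>i\<in>UNIV. ck j / 2 * (x $ i * (\<integral>y. sK x y ^ j * a y $ i \<partial>S3)))"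
    using phi_eq[OF a] by blast
  have c: "real_polynomial_function (\<lambda>x::R4. x $ i)" for i
    by (intro real_polynomial_function.intros(1) bounded_linear_vec_nth)
  show "real_polynomial_function (phi N a)"
    unfolding eq using M c
    by (intro real_polynomial_function_sum real_polynomial_function.intros(4) real_polynomial_function.intros(2)) auto
  let ?m = "\<lambda>j i. \<integral>y. sK x y ^ j * a y $ i \<partial>S3"
  let ?T = "\<lambda>h j i. \<integral>y. real j * sK x y ^ (j-1) * (y \<bullet> h / 2) * a y $ i \<partial>S3"
  have "(phi N a has_derivative (\<lambda>h. \<Sum>j<N. \<Sum>i\<in>UNIV. ck j / 2 * (x $ i * ?T h j i + h $ i * ?m j i))) (at x)"
    unfolding eq using M
    by (intro has_derivative_mult_right has_derivative_sum has_derivative_mult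
          bounded_linear_imp_has_derivative bounded_linear_vec_nth) auto
  moreover have "(\<Sum>j<N. \<Sum>i\<in>UNIV. ck j / 2 * (x $ i * ?T h j i + h $ i * ?m j i)) = dphi N a x h" for h
  proof -
    have I: "integrable S3 (\<lambda>y. sK x y ^ j * a y $ i)" "integrable S3 (\<lambda>y. real j * sK x y ^ (j-1) * (y \<bullet> h / 2) * a y $ i)" for j i
      by (intro integrable_continuous_mult integrable_vec_component a continuous_intros; simp)+
    have "(\<Sum>j<N. \<Sum>i\<in>UNIV. ck j / 2 * (x $ i * ?T h j i + h $ i * ?m j i))
      = (\<integral>y. (\<Sum>j<N. \<Sum>i\<in>UNIV. ck j / 2 * (x $ i * (real j * sK x y ^ (j-1) * (y \<bullet> h / 2) * a y $ i) + h $ i * (sK x y ^ j * a y $ i))) \<partial>S3)"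
      by (rule integral_lincomb2[OF I(2) I(1), symmetric])
    also have "\<dots> = dphi N a x h"
      unfolding dphi_def
    proof (rule Bochner_Integration.integral_cong[OF refl])
      fix y
      have "(\<Sum>i\<in>UNIV. ck j / 2 * (x $ i * (real j * sK x y ^ (j-1) * (y \<bullet> h / 2) * a y $ i) + h $ i * (sK x y ^ j * a y $ i)))
        = 1/4 * (ck j * real j * sK x y ^ (j-1)) * (y \<bullet> h) * (x \<bullet> a y) + 1/2 * (ck j * sK x y ^ j) * (h \<bullet> a y)" for j
        by (simp add: inner_vec_def[of x] inner_vec_def[of h "a y"] sum.distrib sum_distrib_left distrib_left mult_ac sum_divide_distrib)
      then show "(\<Sum>j<N. \<Sum>i\<in>UNIV. ck j / 2 * (x $ i * (real j * sK x y ^ (j-1) * (y \<bullet> h / 2) * a y $ i) + h $ i * (sK x y ^ j * a y $ i)))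
        = dgamN N (sK x y) * (y \<bullet> h) * (x \<bullet> a y) + gamN N (sK x y) * (h \<bullet> a y)"
        unfolding gamN_def dgamN_def by (simp add: sum.distrib sum_distrib_left sum_distrib_right)
    qed
    finally show ?thesis .
  qed
  ultimately show "(phi N a has_derivative dphi N a x) (at x)" by (simp only:)
qed

section \<open>The representation formula\<close>

text \<open>Only the instances of \<open>W = \<star> d a\<close> for the left-invariant frame and for the test fields
  \<open>Fk\<close> are needed.\<close>
definition curl_of :: "(R4 \<Rightarrow> R4) \<Rightarrow> (R4 \<Rightarrow> R4) \<Rightarrow> bool" where
  "curl_of a W \<longleftrightarrow> (\<forall>k. (\<integral>y. W y \<bullet> fr k y \<partial>S3) = - 2 * (\<integral>y. a y \<bullet> fr k y \<partial>S3)) \<and>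
    (\<forall>N k x. norm x = 1 \<longrightarrow> (\<integral>y. W y \<bullet> Fk N k x y \<partial>S3) =
      (\<integral>y. (pk N (sK x y) - 1) * (a y \<bullet> fr k y) + dgamN N (sK x y) * (x \<bullet> a y) * (x \<bullet> fr k y)
         + gamN N (sK x y) * (x \<bullet> fr k (a y)) \<partial>S3))"

lemma continuous_crs [continuous_intros]:
  "continuous_on A f \<Longrightarrow> continuous_on A g \<Longrightarrow> continuous_on A (\<lambda>z. crs (f z) x (g z))"
  by (rule bounded_bilinear.continuous_on[OF bilinear_crs])

lemma continuous_Fk: "continuous_on A (Fk N k x)"
  unfolding Fk_def by (intro continuous_intros)

lemma real_polynomial_component_linear: "bounded_linear f \<Longrightarrow> real_polynomial_function (\<lambda>y. (f y :: R4) $ i)"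
  by (intro real_polynomial_function.intros(1) bounded_linear_compose[OF bounded_linear_vec_nth])

lemma smooth_field_fr: "smooth_field (fr k)"
  unfolding smooth_field_def by (intro allI smooth_fun_polynomial real_polynomial_component_linear bounded_linear_fr)

lemma real_polynomial_sK: "real_polynomial_function (\<lambda>y. sK x y)"
proof -
  have "bounded_linear (\<lambda>y. x \<bullet> y / 2)"
    by (rule bounded_linear_compose[OF bounded_linear_divide bounded_linear_inner_right])
  then show ?thesis
    unfolding sK_def add_divide_distrib by (intro real_polynomial_function.intros(3)[OF real_polynomial_function.intros(2) real_polynomial_function.intros(1)])
qed

lemma real_polynomial_gamN: "real_polynomial_function (\<lambda>y. gamN N (sK x y))"
  unfolding gamN_def
  by (intro real_polynomial_function.intros(4) real_polynomial_function_sum real_polynomial_function_power real_polynomial_function.intros(2) real_polynomial_sK) auto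

lemma smooth_field_Fk: "smooth_field (Fk N k x)"
  unfolding smooth_field_def
proof (intro allI smooth_fun_polynomial)
  fix i
  have p: "real_polynomial_function (\<lambda>y::R4. y $ j)" "real_polynomial_function (\<lambda>y. fr k y $ j)" for j
    by (intro real_polynomial_component_linear bounded_linear_ident bounded_linear_fr)+
  have "real_polynomial_function (\<lambda>y. vol3 y x (fr k y) w)" for w
    unfolding vol3_eq diff_conv_add_uminus minus_mult_left
    by (intro real_polynomial_function.intros(3,4) real_polynomial_function_minus real_polynomial_function.intros(2) p)
  then have "real_polynomial_function (\<lambda>y. crs y x (fr k y) $ i)"
    by (simp add: crs_def)
  then show "real_polynomial_function (\<lambda>y. Fk N k x y $ i)"
    unfolding Fk_def vector_scaleR_component real_scaleR_def
    by (intro real_polynomial_function.intros(4) real_polynomial_gamN)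
qed

lemma curl_of_weak_d:
  assumes "weak_d a b" and a: "\<forall>x\<in>sphere 0 1. a x \<bullet> x = 0"
  shows "curl_of a (\<lambda>y. starv (b y) y)"
proof -
  have w: "(\<integral>y. starv (b y) y \<bullet> F y \<partial>S3) = (\<integral>y. wedge21 (d1 F y) (a y) y \<partial>S3)" if "smooth_field F" for F
    using assms(1) that unfolding weak_d_def starv_form1_of by blast
  show ?thesis
    unfolding curl_of_def
  proof (intro conjI allI impI)
    fix k
    show "(\<integral>y. starv (b y) y \<bullet> fr k y \<partial>S3) = - 2 * (\<integral>y. a y \<bullet> fr k y \<partial>S3)"
      unfolding w[OF smooth_field_fr] wedge21_d1_fr by simp
    fix N and x :: R4 assume x: "norm x = 1"
    show "(\<integral>y. starv (b y) y \<bullet> Fk N k x y \<partial>S3) = (\<integral>y. (pk N (sK x y) - 1) * (a y \<bullet> fr k y) + dgamN N (sK x y) * (x \<bullet> a y) * (x \<bullet> fr k y)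
         + gamN N (sK x y) * (x \<bullet> fr k (a y)) \<partial>S3)"
      unfolding w[OF smooth_field_Fk]
      using a by (intro Bochner_Integration.integral_cong refl wedge21_d1_Fk x) auto
  qed
qed

lemma integrable_curl_terms:
  assumes a: "integrable S3 a"
  shows "integrable S3 (\<lambda>y. pk N (sK x y) * (a y \<bullet> fr k y))" "integrable S3 (\<lambda>y. a y \<bullet> fr k y)"
    "integrable S3 (\<lambda>y. dgamN N (sK x y) * (x \<bullet> a y) * (x \<bullet> fr k y))"
    "integrable S3 (\<lambda>y. gamN N (sK x y) * (x \<bullet> fr k (a y)))"
proof -
  show 2: "integrable S3 (\<lambda>y. a y \<bullet> fr k y)"
    using a by (intro integrable_inner_continuous continuous_intros)
  show "integrable S3 (\<lambda>y. pk N (sK x y) * (a y \<bullet> fr k y))"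
    by (intro integrable_continuous_mult continuous_pk 2)
  have xa: "integrable S3 (\<lambda>y. x \<bullet> a y)" "integrable S3 (\<lambda>y. x \<bullet> fr k (a y))"
    using integrable_bounded_linear[OF bounded_linear_inner_right a]
      integrable_bounded_linear[OF bounded_linear_compose[OF bounded_linear_inner_right bounded_linear_fr] a] by auto
  have "integrable S3 (\<lambda>y. (dgamN N (sK x y) * (x \<bullet> fr k y)) * (x \<bullet> a y))"
    by (intro integrable_continuous_mult xa continuous_intros)
  then show "integrable S3 (\<lambda>y. dgamN N (sK x y) * (x \<bullet> a y) * (x \<bullet> fr k y))" by (simp add: mult_ac)
  show "integrable S3 (\<lambda>y. gamN N (sK x y) * (x \<bullet> fr k (a y)))"
    by (intro integrable_continuous_mult xa continuous_intros)
qed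

lemma curl_of_diff:
  assumes c: "curl_of a W" "curl_of a' W'" and I: "integrable S3 a" "integrable S3 a'" "integrable S3 W" "integrable S3 W'"
  shows "curl_of (\<lambda>y. a y - a' y) (\<lambda>y. W y - W' y)"
  unfolding curl_of_def
proof (intro conjI allI impI)
  fix k
  show "(\<integral>y. (W y - W' y) \<bullet> fr k y \<partial>S3) = - 2 * (\<integral>y. (a y - a' y) \<bullet> fr k y \<partial>S3)"
  proof -
    have i: "integrable S3 (\<lambda>y. u y \<bullet> fr k y)" if "integrable S3 u" for u
      using that by (intro integrable_inner_continuous continuous_intros)
    have "(\<integral>y. (W y - W' y) \<bullet> fr k y \<partial>S3) = (\<integral>y. W y \<bullet> fr k y \<partial>S3) - (\<integral>y. W' y \<bullet> fr k y \<partial>S3)"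
      unfolding inner_diff_left by (rule Bochner_Integration.integral_diff[OF i[OF I(3)] i[OF I(4)]])
    moreover have "(\<integral>y. (a y - a' y) \<bullet> fr k y \<partial>S3) = (\<integral>y. a y \<bullet> fr k y \<partial>S3) - (\<integral>y. a' y \<bullet> fr k y \<partial>S3)"
      unfolding inner_diff_left by (rule Bochner_Integration.integral_diff[OF i[OF I(1)] i[OF I(2)]])
    ultimately show ?thesis using c unfolding curl_of_def by simp
  qed
  fix N and x :: R4 assume x: "norm x = 1"
  let ?e = "\<lambda>a y. (pk N (sK x y) - 1) * (a y \<bullet> fr k y) + dgamN N (sK x y) * (x \<bullet> a y) * (x \<bullet> fr k y)
         + gamN N (sK x y) * (x \<bullet> fr k (a y))"
  have e: "integrable S3 (?e a)" if "integrable S3 a" for a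
    unfolding left_diff_distrib using integrable_curl_terms[OF that] by simp
  have i: "integrable S3 (\<lambda>y. u y \<bullet> Fk N k x y)" if "integrable S3 u" for u
    using that by (intro integrable_inner_continuous continuous_Fk)
  have "(\<integral>y. (W y - W' y) \<bullet> Fk N k x y \<partial>S3) = (\<integral>y. W y \<bullet> Fk N k x y \<partial>S3) - (\<integral>y. W' y \<bullet> Fk N k x y \<partial>S3)"
    unfolding inner_diff_left by (rule Bochner_Integration.integral_diff[OF i[OF I(3)] i[OF I(4)]])
  also have "\<dots> = (\<integral>y. ?e a y \<partial>S3) - (\<integral>y. ?e a' y \<partial>S3)"
  proof -
    have "(\<integral>y. W y \<bullet> Fk N k x y \<partial>S3) = (\<integral>y. ?e a y \<partial>S3)" using c(1) x unfolding curl_of_def by blast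
    moreover have "(\<integral>y. W' y \<bullet> Fk N k x y \<partial>S3) = (\<integral>y. ?e a' y \<partial>S3)" using c(2) x unfolding curl_of_def by blast
    ultimately show ?thesis by (simp only:)
  qed
  also have "\<dots> = (\<integral>y. ?e a y - ?e a' y \<partial>S3)" by (rule Bochner_Integration.integral_diff[OF e[OF I(1)] e[OF I(2)], symmetric])
  also have "\<dots> = (\<integral>y. ?e (\<lambda>y. a y - a' y) y \<partial>S3)"
    by (intro Bochner_Integration.integral_cong refl) (simp add: inner_diff_left inner_diff_right linear_diff[OF linear_fr] algebra_simps)
  finally show "(\<integral>y. (W y - W' y) \<bullet> Fk N k x y \<partial>S3) = (\<integral>y. ?e (\<lambda>y. a y - a' y) y \<partial>S3)" .
qed

text \<open>A Hodge decomposition of the averaged frame coefficient into a curl part and a gradient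
  part. The term with 1/2 restores the mean removed by \<open>pk N - 1\<close>; skewness of
  \<open>fr k\<close> moves the frame from \<open>y\<close> to \<open>x\<close>, where the remaining
  terms combine to a derivative of the potential.\<close>

lemma representation:
  assumes c: "curl_of a W" and a: "integrable S3 a" and W: "integrable S3 W" and x: "norm x = 1"
  shows "(\<integral>y. pk N (sK x y) * (a y \<bullet> fr k y) \<partial>S3) =
     (\<integral>y. W y \<bullet> (Fk N k x y - (1/2) *\<^sub>R fr k y) \<partial>S3) + dphi N a x (fr k x)"
proof -
  note I = integrable_curl_terms[OF a]
  let ?p = "\<lambda>y. pk N (sK x y) * (a y \<bullet> fr k y)" and ?m = "\<lambda>y. a y \<bullet> fr k y"
    and ?d = "\<lambda>y. dgamN N (sK x y) * (x \<bullet> a y) * (x \<bullet> fr k y)" and ?g = "\<lambda>y. gamN N (sK x y) * (x \<bullet> fr k (a y))"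
  have "(\<integral>y. W y \<bullet> Fk N k x y \<partial>S3) = (\<integral>y. ?p y - ?m y + ?d y + ?g y \<partial>S3)"
    using c x unfolding curl_of_def by (simp add: left_diff_distrib)
  also have "\<dots> = (\<integral>y. ?p y \<partial>S3) - (\<integral>y. ?m y \<partial>S3) + ((\<integral>y. ?d y \<partial>S3) + (\<integral>y. ?g y \<partial>S3))"
    using I by simp
  also have "(\<integral>y. ?d y \<partial>S3) + (\<integral>y. ?g y \<partial>S3) = (\<integral>y. ?d y + ?g y \<partial>S3)"
    using I by simp
  also have "\<dots> = - dphi N a x (fr k x)"
    unfolding dphi_def integral_minus[symmetric]
  proof (intro Bochner_Integration.integral_cong refl)
    fix y
    have "x \<bullet> fr k y = - (y \<bullet> fr k x)" "x \<bullet> fr k (a y) = - (fr k x \<bullet> a y)"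
      using inner_fr_skew[of x k y] inner_fr_skew[of x k "a y"] by (simp_all add: inner_commute)
    then show "?d y + ?g y = - (dgamN N (sK x y) * (y \<bullet> fr k x) * (x \<bullet> a y) + gamN N (sK x y) * (fr k x \<bullet> a y))"
      by simp
  qed
  finally have 1: "(\<integral>y. W y \<bullet> Fk N k x y \<partial>S3) = (\<integral>y. ?p y \<partial>S3) - (\<integral>y. ?m y \<partial>S3) - dphi N a x (fr k x)" by simp
  have 2: "(\<integral>y. W y \<bullet> fr k y \<partial>S3) = - 2 * (\<integral>y. ?m y \<partial>S3)" using c unfolding curl_of_def by blast
  have "(\<integral>y. W y \<bullet> (Fk N k x y - (1/2) *\<^sub>R fr k y) \<partial>S3) = (\<integral>y. W y \<bullet> Fk N k x y \<partial>S3) - 1/2 * (\<integral>y. W y \<bullet> fr k y \<partial>S3)"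
  proof -
    have i: "integrable S3 (\<lambda>y. W y \<bullet> Fk N k x y)" "integrable S3 (\<lambda>y. W y \<bullet> fr k y)"
      by (intro integrable_inner_continuous W continuous_Fk continuous_intros)+
    show ?thesis
      unfolding inner_diff_right inner_scaleR_right
      by (subst Bochner_Integration.integral_diff[OF i(1) integrable_mult_right[OF i(2)]]) simp
  qed
  then show ?thesis using 1 2 by simp
qed

section \<open>Tails of the kernel\<close>

text \<open>The part of the kernel lost by truncation, with the factor \<open>norm (x - y)\<close>
  that \<open>crs y x\<close> and \<open>x \<bullet> a y\<close> supply near the diagonal. That
  factor reduces the singularity from order 3 to the Riesz order 2.\<close>

definition tailk :: "nat \<Rightarrow> R4 \<Rightarrow> R4 \<Rightarrow> real" where
  "tailk N x y = (gam (sK x y) - gamN N (sK x y)) * norm (x - y)"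

lemma tailk_same [simp]: "tailk N x x = 0"
  by (simp add: tailk_def)

lemma tailk_commute: "tailk N x y = tailk N y x"
  by (simp add: tailk_def sK_commute norm_minus_commute)

lemma tailk_nonneg:
  assumes "norm x = 1" "norm y = 1"
  shows "0 \<le> tailk N x y"
proof (cases "x = y")
  case False
  then have "gamN N (sK x y) \<le> gam (sK x y)"
    using sK_bounds[OF assms] sK_eq_1_iff[OF assms] by (intro gamN_le_gam) auto
  then show ?thesis by (simp add: tailk_def)
qed simp

lemma tailk_le:
  assumes "norm x = 1" "norm y = 1"
  shows "tailk N x y \<le> 6 / norm (x - y)^2"
proof (cases "x = y")
  case False
  have "gam (sK x y) - gamN N (sK x y) \<le> 6 / norm (x - y)^3"
    using gam_sK_le[OF assms] gamN_nonneg[OF sK_bounds(1)[OF assms], of N] by linarith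
  then have "tailk N x y \<le> 6 / norm (x - y)^3 * norm (x - y)"
    unfolding tailk_def by (rule mult_right_mono) simp
  then show ?thesis using False by (simp add: power2_eq_square power3_eq_cube)
qed simp

text \<open>By monotonicity of the tails the worst value of \<open>sK x y\<close> is the one at
  distance \<open>r\<close>, so convergence of a single series suffices.\<close>

lemma tailk_uniform:
  assumes r: "r > 0" and e: "e > 0"
  shows "\<exists>N0. \<forall>N\<ge>N0. \<forall>x y. norm x = 1 \<longrightarrow> norm y = 1 \<longrightarrow> r \<le> norm (x - y) \<longrightarrow> tailk N x y \<le> e"
proof -
  \<comment> \<open>The maximum covers radii above the diameter 2 of the sphere.\<close>
  define s0 where "s0 = max 0 (1 - (r/2)^2)"
  have s0: "0 \<le> s0" "s0 < 1" using r by (auto simp: s0_def)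
  have "(\<lambda>N. 2 * (gam s0 - gamN N s0)) \<longlonglongrightarrow> 2 * (gam s0 - gam s0)"
    using s0 by (intro tendsto_intros gamN_tendsto)
  then have "\<forall>\<^sub>F N in sequentially. 2 * (gam s0 - gamN N s0) < e"
    using e by (intro order_tendstoD(2)) auto
  then obtain N0 where N0: "\<And>N. N \<ge> N0 \<Longrightarrow> 2 * (gam s0 - gamN N s0) < e"
    by (auto simp: eventually_sequentially)
  show ?thesis
  proof (intro exI[of _ N0] allI impI)
    fix N and x y :: R4 assume N: "N0 \<le> N" and xy: "norm x = 1" "norm y = 1" "r \<le> norm (x - y)"
    have "(r/2)^2 \<le> (norm (x - y) / 2)^2" using xy r by (intro power_mono) auto
    then have "sK x y \<le> s0" using sK_dist[OF xy(1,2)] by (simp add: s0_def)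
    then have le: "gam (sK x y) - gamN N (sK x y) \<le> gam s0 - gamN N s0"
      using sK_bounds[OF xy(1,2)] s0 by (intro gam_tail_mono) auto
    have "tailk N x y \<le> (gam s0 - gamN N s0) * norm (x - y)"
      unfolding tailk_def using le by (rule mult_right_mono) simp
    also have "\<dots> \<le> (gam s0 - gamN N s0) * 2"
      using gamN_le_gam[OF s0, of N] norm_triangle_ineq4[of x y] xy by (intro mult_left_mono) auto
    also have "\<dots> \<le> e" using N0[OF N] by simp
    finally show "tailk N x y \<le> e" .
  qed
qed

lemma measurable_gam: "gam \<in> borel_measurable borel"
  unfolding gam_def by measurable

lemma measurable_gamN: "gamN N \<in> borel_measurable borel"
  unfolding gamN_def by measurable

lemma measurable_tailk: "(\<lambda>p. tailk N (fst p) (snd p)) \<in> borel_measurable (S3 \<Otimes>\<^sub>M S3)"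
  unfolding tailk_def
  using measurable_compose[OF measurable_sK measurable_gam] measurable_compose[OF measurable_sK measurable_gamN] measurable_S3_dist
  by simp

lemma measurable_tailk1:
  assumes "norm x = 1"
  shows "(\<lambda>y. tailk N x y) \<in> borel_measurable S3"
proof -
  have "x \<in> space S3" using assms by simp
  from measurable_compose[OF measurable_Pair1'[OF this] measurable_tailk] show ?thesis by simp
qed

text \<open>Integrated in one variable, the Riesz bound of order 2 is subcritical: a small ball
  contributes little, and outside it the tail is uniformly small. No concentration can occur
  here.\<close>

lemma nn_integral_tailk_small:
  assumes e: "e > 0"
  shows "\<exists>N0. \<forall>N\<ge>N0. \<forall>x. norm x = 1 \<longrightarrow> (\<integral>\<^sup>+y. ennreal (tailk N x y) \<partial>S3) \<le> ennreal e"
proof -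
  obtain C where C: "C > 0" and near: "\<And>y R. norm y = 1 \<Longrightarrow> R > 0 \<Longrightarrow>
      (\<integral>\<^sup>+x. ennreal (if norm (x - y) < R then 1 / norm (x - y)^2 else 0) \<partial>S3) \<le> ennreal (C * R)"
    by (rule riesz_near_far) blast
  define r where "r = e / (12 * C)"
  have r: "r > 0" using e C by (simp add: r_def)
  define t where "t = e / (2 * area3)"
  have t: "t > 0" using e area3_pos by (simp add: t_def)
  obtain N0 where N0: "\<And>N x y. N \<ge> N0 \<Longrightarrow> norm x = 1 \<Longrightarrow> norm y = 1 \<Longrightarrow> r \<le> norm (x - y) \<Longrightarrow> tailk N x y \<le> t"
    using tailk_uniform[OF r t] by blast
  show ?thesis
  proof (intro exI[of _ N0] allI impI)
    fix N and x :: R4 assume N: "N0 \<le> N" and x: "norm x = 1"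
    note [measurable] = measurable_S3_dist1
    have "(\<integral>\<^sup>+y. ennreal (tailk N x y) \<partial>S3) \<le> (\<integral>\<^sup>+y. ennreal 6 * ennreal (if norm (y - x) < r then 1 / norm (y - x)^2 else 0) + ennreal t * ennreal 1 \<partial>S3)"
    proof (rule nn_integral_mono)
      fix y assume "y \<in> space S3"
      then have y: "norm y = 1" by simp
      have "tailk N x y \<le> 6 * (if norm (y - x) < r then 1 / norm (y - x)^2 else 0) + t * 1"
        using tailk_le[OF x y, of N] N0[OF N x y] t by (auto simp: norm_minus_commute)
      then have "ennreal (tailk N x y) \<le> ennreal (6 * (if norm (y - x) < r then 1 / norm (y - x)^2 else 0) + t * 1)"
        by (rule ennreal_leI)
      also have "\<dots> = ennreal 6 * ennreal (if norm (y - x) < r then 1 / norm (y - x)^2 else 0) + ennreal t * ennreal 1"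
        using t by (intro ennreal_combination2[symmetric]) auto
      finally show "ennreal (tailk N x y) \<le> ennreal 6 * ennreal (if norm (y - x) < r then 1 / norm (y - x)^2 else 0) + ennreal t * ennreal 1" .
    qed
    also have "\<dots> = ennreal 6 * (\<integral>\<^sup>+y. ennreal (if norm (y - x) < r then 1 / norm (y - x)^2 else 0) \<partial>S3) + ennreal t * ennreal area3"
      by (subst nn_integral_add) (auto simp: nn_integral_cmult S3.emeasure_eq_measure area3_def)
    also have "\<dots> \<le> ennreal 6 * ennreal (C * r) + ennreal t * ennreal area3"
      by (intro add_mono mult_left_mono near x r) auto
    also have "\<dots> = ennreal (6 * (C * r) + t * area3)"
      using C r t area3_pos by (intro ennreal_combination2) auto
    also have "6 * (C * r) + t * area3 = e" using C area3_pos by (simp add: r_def t_def)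
    finally show "(\<integral>\<^sup>+y. ennreal (tailk N x y) \<partial>S3) \<le> ennreal e" .
  qed
qed

text \<open>A non-integrable function has integral 0 by convention, which settles that case.
  Iterated integrals can then be estimated from the outside in.\<close>

lemma abs_integral_le_nn_integral:
  fixes f :: "'a \<Rightarrow> real"
  shows "ennreal \<bar>\<integral>x. f x \<partial>M\<bar> \<le> (\<integral>\<^sup>+x. ennreal \<bar>f x\<bar> \<partial>M)"
proof (cases "integrable M f")
  case True
  then show ?thesis using integral_norm_bound_ennreal[of M f] by simp
qed (simp add: not_integrable_integral_eq)

text \<open>The bounded part of \<open>X\<close> is handled by the oscillation of \<open>f\<close>.
  The part above a high level \<open>m\<close> is small in L^(3/2), and Young's inequality with a
  small parameter \<open>\<eta>\<close> on the side of \<open>f\<close> makes both resulting terms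
  small.\<close>

lemma approx_identity:
  fixes X f :: "R4 \<Rightarrow> real"
  assumes X: "X \<in> borel_measurable S3" "integrable S3 (\<lambda>x. \<bar>X x\<bar> powr (3/2))"
    and f: "f \<in> borel_measurable S3" "integrable S3 (\<lambda>x. \<bar>f x\<bar>^3)" and e: "e > 0"
  shows "\<exists>N0. \<forall>N\<ge>N0. (\<integral>\<^sup>+x. (\<integral>\<^sup>+y. ennreal (pk N (sK x y) * (\<bar>X x\<bar> * \<bar>f y - f x\<bar>)) \<partial>S3) \<partial>S3) \<le> ennreal e"
proof -
  define F where "F = (\<integral>x. \<bar>f x\<bar>^3 \<partial>S3)"
  have F: "F \<ge> 0" unfolding F_def by simp
  \<comment> \<open>The factor 24 is three times the 8 from two copies of
    \<open>4 * (\<bar>f x\<bar>^3 + \<bar>f y\<bar>^3)\<close>, for a third of \<open>e\<close>. The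
    bound 1 gives \<open>\<eta>^3 \<le> \<eta>\<close>.\<close>
  define \<eta> where "\<eta> = min 1 (e / (24 * area3 * (F + 1)))"
  have \<eta>: "0 < \<eta>" "\<eta> \<le> 1" using e F area3_pos by (auto simp: \<eta>_def)
  have \<eta>F: "8 * \<eta> * area3 * F \<le> e / 3"
  proof -
    have "\<eta> * (24 * area3 * (F + 1)) \<le> e"
      using F area3_pos unfolding \<eta>_def by (simp add: min_le_iff_disj pos_le_divide_eq[symmetric])
    moreover have "\<eta> * (24 * area3 * F) \<le> \<eta> * (24 * area3 * (F + 1))" using \<eta> area3_pos by (intro mult_left_mono) auto
    moreover have "8 * \<eta> * area3 * F = \<eta> * (24 * area3 * F) / 3" by simp
    ultimately show ?thesis by linarith
  qed
  \<comment> \<open>The level \<open>m\<close> is chosen only after \<open>\<eta>\<close>, since the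
    large part is divided by \<open>\<eta>\<close> in Young's inequality.\<close>
  define Xm where "Xm m x = (if \<bar>X x\<bar> > real m then \<bar>X x\<bar> else 0)" for m x
  have Xmm: "Xm m \<in> borel_measurable S3" for m unfolding Xm_def using X(1) by measurable
  have Xm0: "0 \<le> Xm m x" for m x by (simp add: Xm_def)
  have "(\<lambda>m. \<integral>x. Xm m x powr (3/2) \<partial>S3) \<longlonglongrightarrow> (\<integral>x. 0 \<partial>S3)"
  proof (rule integral_dominated_convergence[where w = "\<lambda>x. \<bar>X x\<bar> powr (3/2)"])
    show "AE x in S3. (\<lambda>m. Xm m x powr (3/2)) \<longlonglongrightarrow> 0"
    proof (rule AE_I2)
      fix x
      obtain n :: nat where n: "\<bar>X x\<bar> \<le> real n" using real_arch_simple by blast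
      have "\<forall>\<^sub>F m in sequentially. Xm m x powr (3/2) = 0"
        using eventually_ge_at_top[of n] by eventually_elim (use n in \<open>auto simp: Xm_def\<close>)
      then show "(\<lambda>m. Xm m x powr (3/2)) \<longlonglongrightarrow> 0" by (rule tendsto_eventually)
    qed
    show "AE x in S3. norm (Xm m x powr (3/2)) \<le> \<bar>X x\<bar> powr (3/2)" for m
      by (intro AE_I2) (auto simp: Xm_def)
  qed (use X Xmm in simp_all)
  then have "\<forall>\<^sub>F m in sequentially. (\<integral>x. Xm m x powr (3/2) \<partial>S3) < e * \<eta> powr (3/2) / (3 * area3)"
    using e \<eta> area3_pos by (intro order_tendstoD(2)) auto
  then obtain m where m: "(\<integral>x. Xm m x powr (3/2) \<partial>S3) < e * \<eta> powr (3/2) / (3 * area3)"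
    by (auto simp: eventually_sequentially)
  have Xmi: "integrable S3 (\<lambda>x. Xm m x powr (3/2))"
  proof (rule Bochner_Integration.integrable_bound[OF X(2)])
    show "(\<lambda>x. Xm m x powr (3/2)) \<in> borel_measurable S3" using Xmm by simp
    show "AE x in S3. norm (Xm m x powr (3/2)) \<le> norm (\<bar>X x\<bar> powr (3/2))"
      by (intro AE_I2) (auto simp: Xm_def)
  qed
  have fi: "integrable S3 f"
  proof (rule Bochner_Integration.integrable_bound[of S3 "\<lambda>x. 1 + \<bar>f x\<bar>^3"])
    show "integrable S3 (\<lambda>x. 1 + \<bar>f x\<bar>^3)" using f by simp
    show "AE x in S3. norm (f x) \<le> norm (1 + \<bar>f x\<bar>^3)"
      using le_1_plus_cube[of "\<bar>f _\<bar>"] by (intro AE_I2) (simp add: abs_of_nonneg)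
  qed (use f in simp)
  have "e / (3 * (real m + 1)) > 0" using e by simp
  then obtain N0 where N0: "\<And>N. N \<ge> N0 \<Longrightarrow> osc N f \<le> ennreal (e / (3 * (real m + 1)))"
    using osc_small_integrable[OF fi] unfolding osc_small_def by blast
  show ?thesis
  proof (intro exI[of _ N0] allI impI)
    fix N assume N: "N0 \<le> N"
    let ?h1 = "\<lambda>x. (Xm m x / \<eta>) powr (3/2)" and ?h2 = "\<lambda>x. 4 * \<eta> * \<bar>f x\<bar>^3"
    have hm: "?h1 \<in> borel_measurable S3" "?h2 \<in> borel_measurable S3" using Xmm f by simp_all
    have h0: "0 \<le> ?h1 x" "0 \<le> ?h2 x" for x using \<eta> by simp_all
    let ?p = "\<lambda>x y. pk N (sK x y)"
    have M: "(\<lambda>p. ennreal (real m) * ennreal (?p (fst p) (snd p) * \<bar>f (fst p) - f (snd p)\<bar>)) \<in> borel_measurable (S3 \<Otimes>\<^sub>M S3)"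
      "(\<lambda>p. ennreal (?p (fst p) (snd p) * ?h1 (fst p))) \<in> borel_measurable (S3 \<Otimes>\<^sub>M S3)"
      "(\<lambda>p. ennreal (?p (fst p) (snd p) * ?h2 (fst p))) \<in> borel_measurable (S3 \<Otimes>\<^sub>M S3)"
      "(\<lambda>p. ennreal (?p (fst p) (snd p) * ?h2 (snd p))) \<in> borel_measurable (S3 \<Otimes>\<^sub>M S3)"
      using measurable_osc[OF f(1), of N] measurable_pk[of N] measurable_fst_S3'[OF hm(1)] measurable_fst_S3'[OF hm(2)] measurable_snd_S3'[OF hm(2)]
      by simp_all
    note M34 = borel_measurable_add[OF M(3,4)]
    note M234 = borel_measurable_add[OF M(2) M34]
    have k1: "(\<integral>\<^sup>+x. ennreal (?h1 x) \<partial>S3) \<le> ennreal (e / (3 * area3))"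
    proof -
      have "(\<integral>\<^sup>+x. ennreal (?h1 x) \<partial>S3) = (\<integral>\<^sup>+x. ennreal (1 / \<eta> powr (3/2) * Xm m x powr (3/2)) \<partial>S3)"
        using Xm0 \<eta> by (intro nn_integral_cong) (simp add: powr_divide)
      also have "\<dots> = ennreal (\<integral>x. 1 / \<eta> powr (3/2) * Xm m x powr (3/2) \<partial>S3)"
        using Xmi by (intro nn_integral_eq_integral integrable_mult_right) auto
      also have "(\<integral>x. 1 / \<eta> powr (3/2) * Xm m x powr (3/2) \<partial>S3) = 1 / \<eta> powr (3/2) * (\<integral>x. Xm m x powr (3/2) \<partial>S3)"
        by (rule integral_mult_right_zero)
      also have "\<dots> \<le> 1 / \<eta> powr (3/2) * (e * \<eta> powr (3/2) / (3 * area3))"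
        using m by (intro mult_left_mono) auto
      also have "\<dots> = e / (3 * area3)" using \<eta> by simp
      finally show ?thesis by (simp add: ennreal_leI)
    qed
    have k2: "(\<integral>\<^sup>+x. ennreal (?h2 x) \<partial>S3) = ennreal (4 * \<eta> * F)"
      unfolding F_def using f(2) \<eta> by (subst nn_integral_eq_integral) auto
    have k3: "ennreal (real m) * osc N f \<le> ennreal (real m) * ennreal (e / (3 * (real m + 1)))"
      by (intro mult_left_mono N0 N) simp
    have "(\<integral>\<^sup>+x. (\<integral>\<^sup>+y. ennreal (?p x y * (\<bar>X x\<bar> * \<bar>f y - f x\<bar>)) \<partial>S3) \<partial>S3)
      \<le> (\<integral>\<^sup>+x. (\<integral>\<^sup>+y. ennreal (real m) * ennreal (?p x y * \<bar>f x - f y\<bar>) + (ennreal (?p x y * ?h1 x) + (ennreal (?p x y * ?h2 x) + ennreal (?p x y * ?h2 y))) \<partial>S3) \<partial>S3)"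
    proof (intro nn_integral_mono)
      fix x y assume "x \<in> space S3" "y \<in> space S3"
      then have p: "0 \<le> ?p x y" using pk_nonneg by simp
      have "\<bar>X x\<bar> \<le> real m + Xm m x" by (auto simp: Xm_def)
      then have "\<bar>X x\<bar> * \<bar>f y - f x\<bar> \<le> (real m + Xm m x) * \<bar>f y - f x\<bar>" by (rule mult_right_mono) simp
      also have "\<dots> = real m * \<bar>f x - f y\<bar> + (Xm m x / \<eta>) * (\<eta> * \<bar>f y - f x\<bar>)"
        using \<eta> by (simp add: distrib_right abs_minus_commute)
      also have "\<dots> \<le> real m * \<bar>f x - f y\<bar> + (?h1 x + (\<eta> * \<bar>f y - f x\<bar>)^3)"
        using Xm0 \<eta> by (intro add_left_mono young_3_2) auto
      also have "(\<eta> * \<bar>f y - f x\<bar>)^3 \<le> \<eta> * (4 * (\<bar>f x\<bar>^3 + \<bar>f y\<bar>^3))"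
      proof -
        have "\<bar>f y - f x\<bar>^3 \<le> (\<bar>f x\<bar> + \<bar>f y\<bar>)^3" by (intro power_mono) auto
        also have "\<dots> \<le> 4 * (\<bar>f x\<bar>^3 + \<bar>f y\<bar>^3)" by (intro cube_add_le) auto
        finally have "\<bar>f y - f x\<bar>^3 \<le> 4 * (\<bar>f x\<bar>^3 + \<bar>f y\<bar>^3)" .
        moreover have "\<eta>^3 \<le> \<eta>" using \<eta> power_decreasing[of 1 3 \<eta>] by simp
        ultimately show ?thesis unfolding power_mult_distrib using \<eta> by (intro mult_mono) auto
      qed
      finally have "\<bar>X x\<bar> * \<bar>f y - f x\<bar> \<le> real m * \<bar>f x - f y\<bar> + (?h1 x + (?h2 x + ?h2 y))" by (simp add: algebra_simps)
      then have "?p x y * (\<bar>X x\<bar> * \<bar>f y - f x\<bar>) \<le> ?p x y * (real m * \<bar>f x - f y\<bar> + (?h1 x + (?h2 x + ?h2 y)))"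
        using p by (rule mult_left_mono)
      also have "\<dots> = real m * (?p x y * \<bar>f x - f y\<bar>) + (?p x y * ?h1 x + (?p x y * ?h2 x + ?p x y * ?h2 y))"
        by (simp only: distrib_left mult.left_commute)
      finally have "ennreal (?p x y * (\<bar>X x\<bar> * \<bar>f y - f x\<bar>)) \<le> ennreal (real m * (?p x y * \<bar>f x - f y\<bar>) + (?p x y * ?h1 x + (?p x y * ?h2 x + ?p x y * ?h2 y)))"
        by (rule ennreal_leI)
      also have "\<dots> = ennreal (real m) * ennreal (?p x y * \<bar>f x - f y\<bar>) + (ennreal (?p x y * ?h1 x) + (ennreal (?p x y * ?h2 x) + ennreal (?p x y * ?h2 y)))"
        using p h0(1)[of x] h0(2)[of x] h0(2)[of y]
        by (subst ennreal_plus, simp, simp, subst ennreal_plus, simp, simp, subst ennreal_plus, simp, simp, subst ennreal_mult, simp, simp) (rule refl)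
      finally show "ennreal (?p x y * (\<bar>X x\<bar> * \<bar>f y - f x\<bar>)) \<le> ennreal (real m) * ennreal (?p x y * \<bar>f x - f y\<bar>) + (ennreal (?p x y * ?h1 x) + (ennreal (?p x y * ?h2 x) + ennreal (?p x y * ?h2 y)))" .
    qed
    also have "\<dots> = ennreal (real m) * osc N f + (ennreal area3 * (\<integral>\<^sup>+x. ennreal (?h1 x) \<partial>S3) + (ennreal area3 * (\<integral>\<^sup>+x. ennreal (?h2 x) \<partial>S3) + ennreal area3 * (\<integral>\<^sup>+x. ennreal (?h2 x) \<partial>S3)))"
    proof -
      have "(\<integral>\<^sup>+x. (\<integral>\<^sup>+y. ennreal (real m) * ennreal (?p x y * \<bar>f x - f y\<bar>) \<partial>S3) \<partial>S3) = ennreal (real m) * osc N f"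
      proof -
        have "(\<integral>\<^sup>+x. (\<integral>\<^sup>+y. ennreal (real m) * ennreal (?p x y * \<bar>f x - f y\<bar>) \<partial>S3) \<partial>S3)
          = (\<integral>\<^sup>+x. ennreal (real m) * (\<integral>\<^sup>+y. ennreal (?p x y * \<bar>f x - f y\<bar>) \<partial>S3) \<partial>S3)"
          using measurable_compose[OF measurable_Pair1' measurable_osc[OF f(1), of N]] by (intro nn_integral_cong nn_integral_cmult) simp
        also have "\<dots> = ennreal (real m) * osc N f"
          unfolding osc_def using S3.borel_measurable_nn_integral_fst[OF measurable_osc[OF f(1), of N]] by (intro nn_integral_cmult) simp
        finally show ?thesis .
      qed
      then show ?thesis
        using nn_integral_S3_add[OF M(1) M234] nn_integral_S3_add[OF M(2) M34] nn_integral_S3_add[OF M(3,4)]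
          nn_integral_pk_cmult_left[OF hm(1) h0(1), of N] nn_integral_pk_cmult_left[OF hm(2) h0(2), of N] nn_integral_pk_cmult_right[OF hm(2) h0(2), of N]
        unfolding fst_conv snd_conv by (simp only:)
    qed
    also have "\<dots> \<le> ennreal (real m) * ennreal (e / (3 * (real m + 1))) + (ennreal area3 * ennreal (e / (3 * area3)) + (ennreal area3 * ennreal (4 * \<eta> * F) + ennreal area3 * ennreal (4 * \<eta> * F)))"
      unfolding k2 by (intro add_mono mult_left_mono k1 k3) auto
    also have "\<dots> = ennreal (real m * (e / (3 * (real m + 1))) + (area3 * (e / (3 * area3)) + (area3 * (4 * \<eta> * F) + area3 * (4 * \<eta> * F))))"
      using e F \<eta> area3_pos by (simp only: ennreal_mult[symmetric] ennreal_plus[symmetric] of_nat_0_le_iff less_imp_le mult_nonneg_nonneg add_nonneg_nonneg divide_nonneg_nonneg zero_le_numeral zero_le_one)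
    also have "\<dots> \<le> ennreal e"
    proof (rule ennreal_leI)
      have 1: "real m * (e / (3 * (real m + 1))) \<le> e / 3" using e by (simp add: field_simps)
      have 2: "area3 * (e / (3 * area3)) = e / 3" using area3_pos by simp
      have 3: "area3 * (4 * \<eta> * F) + area3 * (4 * \<eta> * F) = 8 * \<eta> * area3 * F" by simp
      show "real m * (e / (3 * (real m + 1))) + (area3 * (e / (3 * area3)) + (area3 * (4 * \<eta> * F) + area3 * (4 * \<eta> * F))) \<le> e"
        unfolding 2 3 using 1 \<eta>F by linarith
    qed
    finally show "(\<integral>\<^sup>+x. (\<integral>\<^sup>+y. ennreal (?p x y * (\<bar>X x\<bar> * \<bar>f y - f x\<bar>)) \<partial>S3) \<partial>S3) \<le> ennreal e" .
  qed
qed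

section \<open>The key estimate\<close>

text \<open>For a tangential field the ambient derivative along it is the intrinsic one. Polynomial
  test functions suffice, and in this form the condition passes to limits in L^1.\<close>

definition divfree :: "(R4 \<Rightarrow> R4) \<Rightarrow> bool" where
  "divfree X \<longleftrightarrow> (\<forall>f f'. real_polynomial_function f \<longrightarrow> (\<forall>x. (f has_derivative f' x) (at x)) \<longrightarrow> (\<integral>x. f' x (X x) \<partial>S3) = 0)"

lemma polynomial_derivative_coeff:
  assumes "real_polynomial_function f" "\<And>x. (f has_derivative f' x) (at x)"
  obtains g where "\<And>i. real_polynomial_function (g i)" "\<And>x h. f' x h = (\<Sum>i\<in>UNIV. (h :: R4) $ i * g i x)"
proof -
  obtain g where g: "\<forall>i. real_polynomial_function (g i)" "\<forall>x. (f has_derivative (\<lambda>h. \<Sum>i\<in>UNIV. h $ i * g i x)) (at x)"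
    using real_polynomial_partials[OF assms(1)] by blast
  have "f' x h = (\<Sum>i\<in>UNIV. h $ i * g i x)" for x h
    using has_derivative_unique[OF assms(2) g(2)[rule_format]] by (rule fun_cong)
  then show thesis using g(1) that by blast
qed

lemma integrable_polynomial_derivative:
  assumes f: "real_polynomial_function f" "\<And>x. (f has_derivative f' x) (at x)"
    and c: "continuous_on UNIV c" and X: "integrable S3 X"
  shows "integrable S3 (\<lambda>x. c x * f' x (X x))"
proof -
  obtain g where g: "\<And>i. real_polynomial_function (g i)" "\<And>x h. f' x h = (\<Sum>i\<in>UNIV. (h :: R4) $ i * g i x)"
    using polynomial_derivative_coeff[OF f] by blast
  have "integrable S3 (\<lambda>x. \<Sum>i\<in>UNIV. (c x * g i x) * (X x $ i))"
    by (intro Bochner_Integration.integrable_sum integrable_continuous_mult continuous_on_mult c continuous_real_polynomial g(1) integrable_vec_component X)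
  then show ?thesis unfolding g(2) by (simp add: sum_distrib_left mult_ac)
qed

lemma divfree_diff:
  assumes "divfree X" "divfree Y" "integrable S3 X" "integrable S3 Y"
  shows "divfree (\<lambda>x. X x - Y x)"
  unfolding divfree_def
proof (intro allI impI)
  fix f f' assume f: "real_polynomial_function f" "\<forall>x. (f has_derivative f' x) (at (x::R4))"
  have f2: "\<And>x. (f has_derivative f' x) (at x)" using f(2) by blast
  have "f' x (X x - Y x) = f' x (X x) - f' x (Y x)" for x
    using linear_diff[OF has_derivative_linear[OF f2]] .
  moreover have "integrable S3 (\<lambda>x. f' x (X x))" "integrable S3 (\<lambda>x. f' x (Y x))"
    using integrable_polynomial_derivative[OF f(1) f2 continuous_on_const, of X 1] integrable_polynomial_derivative[OF f(1) f2 continuous_on_const, of Y 1] assms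
    by simp_all
  ultimately show "(\<integral>x. f' x (X x - Y x) \<partial>S3) = 0"
    using assms(1,2) f unfolding divfree_def by simp
qed

lemma divfree_codiff_free:
  assumes "codiff_free a" and a: "\<forall>x\<in>sphere 0 1. a x \<bullet> x = 0"
  shows "divfree (\<lambda>x. norm (a x) *\<^sub>R a x)"
  unfolding divfree_def
proof (intro allI impI)
  fix f f' assume f: "real_polynomial_function f" "\<forall>x. (f has_derivative f' x) (at (x::R4))"
  have lin: "linear (f' x)" for x using f(2) has_derivative_linear by blast
  have "f' x (norm (a x) *\<^sub>R a x) = norm (a x) * (a x \<bullet> d0 f x)" if "x \<in> space S3" for x
  proof -
    have fr: "frechet_derivative f (at x) = f' x" using frechet_derivative_at[of f "f' x" x] f(2) by auto
    have "a x \<bullet> d0 f x = a x \<bullet> grad f x"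
      using a that by (simp add: d0_def tproj_def inner_diff_right)
    also have "\<dots> = (\<Sum>i\<in>UNIV. a x $ i * f' x (axis i 1))" by (simp add: grad_def inner_vec_def fr)
    also have "\<dots> = (\<Sum>i\<in>UNIV. f' x (a x $ i *\<^sub>R axis i 1))" by (simp add: linear_scale[OF lin])
    also have "\<dots> = f' x (a x)" by (simp only: linear_sum[OF lin, symmetric] sum_axis_R4)
    finally show ?thesis by (simp add: linear_scale[OF lin])
  qed
  then have "(\<integral>x. f' x (norm (a x) *\<^sub>R a x) \<partial>S3) = (\<integral>x. norm (a x) * (a x \<bullet> d0 f x) \<partial>S3)"
    by (intro Bochner_Integration.integral_cong refl)
  then show "(\<integral>x. f' x (norm (a x) *\<^sub>R a x) \<partial>S3) = 0"
    using assms(1) smooth_fun_polynomial[OF f(1)] unfolding codiff_free_def by simp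
qed

text \<open>In \<open>crs y x v\<close> the vector \<open>x\<close> can be replaced by
  \<open>x - y\<close>, which supplies the chord length in \<open>tailk\<close>; the 24 comes from
  \<open>norm_crs_le\<close>.\<close>

lemma Fk_diff_le:
  assumes x: "norm x = 1" and y: "norm y = 1" and N: "N \<le> M"
  shows "norm (Fk M k x y - Fk N k x y) \<le> 24 * tailk N x y"
    "\<bar>gamN M (sK x y) - gamN N (sK x y)\<bar> * norm (x - y) \<le> tailk N x y"
proof -
  show g: "\<bar>gamN M (sK x y) - gamN N (sK x y)\<bar> * norm (x - y) \<le> tailk N x y"
  proof (cases "x = y")
    case False
    have s: "0 \<le> sK x y" "sK x y < 1" using sK_bounds[OF x y] sK_eq_1_iff[OF x y] False by auto
    have "gamN N (sK x y) \<le> gamN M (sK x y)"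
      unfolding gamN_def using N s less_imp_le[OF ck_pos] by (intro mult_left_mono sum_mono2) auto
    then show ?thesis
      unfolding tailk_def using gamN_le_gam[OF s, of M] by (intro mult_right_mono) auto
  qed simp
  have "crs y x v = crs y (x - y) v" for v
    by (simp add: crs_def vec_eq_iff linear_diff[OF linear_vol3(2)])
  then have c: "norm (crs y x (fr k y)) \<le> 24 * norm (x - y)"
    using norm_crs_le[of y "x - y" "fr k y"] y by simp
  have "norm (Fk M k x y - Fk N k x y) = \<bar>gamN M (sK x y) - gamN N (sK x y)\<bar> * norm (crs y x (fr k y))"
    by (simp add: Fk_def scaleR_diff_left[symmetric])
  also have "\<dots> \<le> \<bar>gamN M (sK x y) - gamN N (sK x y)\<bar> * (24 * norm (x - y))"
    by (intro mult_left_mono c) simp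
  also have "\<dots> \<le> 24 * tailk N x y" using g by simp
  finally show "norm (Fk M k x y - Fk N k x y) \<le> 24 * tailk N x y" .
qed

text \<open>The contribution of the curl \<open>W\<close> to the localized product of
  \<open>X\<close> and \<open>a\<close>; \<open>Cterm\<close> is that of the potential, after
  integration by parts.\<close>

definition Bterm :: "(R4 \<Rightarrow> real) \<Rightarrow> (R4 \<Rightarrow> R4) \<Rightarrow> (R4 \<Rightarrow> R4) \<Rightarrow> nat \<Rightarrow> real" where
  "Bterm z X W N = (\<integral>x. z x * (\<Sum>k\<in>UNIV. (X x \<bullet> fr k x) * (\<integral>y. W y \<bullet> (Fk N k x y - (1/2) *\<^sub>R fr k y) \<partial>S3)) \<partial>S3)"

definition Cterm :: "(R4 \<Rightarrow> R4 \<Rightarrow> real) \<Rightarrow> (R4 \<Rightarrow> R4) \<Rightarrow> (R4 \<Rightarrow> R4) \<Rightarrow> nat \<Rightarrow> real" where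
  "Cterm z' X a N = (\<integral>x. phi N a x * z' x (X x) \<partial>S3)"

lemma integrable_inner_L3v_L32v:
  assumes X: "L32v X" and a: "L3v a"
  shows "integrable S3 (\<lambda>x. norm (X x) * norm (a x))"
proof (rule Bochner_Integration.integrable_bound[of S3 "\<lambda>x. norm (X x) powr (3/2) + norm (a x)^3"])
  show "integrable S3 (\<lambda>x. norm (X x) powr (3/2) + norm (a x)^3)" using X a by (auto simp: L3v_def L32v_def)
  show "(\<lambda>x. norm (X x) * norm (a x)) \<in> borel_measurable S3" using X a by (auto simp: L3v_def L32v_def)
  show "AE x in S3. norm (norm (X x) * norm (a x)) \<le> norm (norm (X x) powr (3/2) + norm (a x)^3)"
    using young_3_2[of "norm (X _)" "norm (a _)"] by (intro AE_I2) (simp add: abs_of_nonneg)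
qed

text \<open>The representation formula is weighted with \<open>z x * (X x \<bullet> fr k x)\<close>
  and summed over the frame. Tangency of \<open>X\<close> reassembles the derivatives of the
  potential into \<open>dphi N a x (X x)\<close>. Testing \<open>divfree X\<close> with the
  polynomial \<open>z * phi N a\<close> moves that derivative onto \<open>z\<close>.\<close>

lemma key_identity:
  assumes X: "L32v X" "divfree X" and a: "L3v a" and W: "integrable S3 W" and c: "curl_of a W"
    and z: "real_polynomial_function z" "\<And>x. (z has_derivative z' x) (at x)"
  shows "(\<integral>x. z x * (\<Sum>k\<in>UNIV. (X x \<bullet> fr k x) * (\<integral>y. pk N (sK x y) * (a y \<bullet> fr k y) \<partial>S3)) \<partial>S3)
      = Bterm z X W N - Cterm z' X a N"
    and "integrable S3 (\<lambda>x. z x * (\<Sum>k\<in>UNIV. (X x \<bullet> fr k x) * (\<integral>y. pk N (sK x y) * (a y \<bullet> fr k y) \<partial>S3)))"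
    and "integrable S3 (\<lambda>x. z x * (\<Sum>k\<in>UNIV. (X x \<bullet> fr k x) * (\<integral>y. W y \<bullet> (Fk N k x y - (1/2) *\<^sub>R fr k y) \<partial>S3)))"
    and "integrable S3 (\<lambda>x. phi N a x * z' x (X x))"
proof -
  have Xi: "integrable S3 X" and ai: "integrable S3 a" using L32v_integrable X L3v_integrable a by auto
  note ph = phi_polynomial[OF ai, of N]
  define q where "q k x = (\<integral>y. pk N (sK x y) * (a y \<bullet> fr k y) \<partial>S3)" for k x
  define w where "w k x = (\<integral>y. W y \<bullet> (Fk N k x y - (1/2) *\<^sub>R fr k y) \<partial>S3)" for k x
  have q: "continuous_on UNIV (q k)" for k
  proof -
    have eq: "q k = (\<lambda>x. 1 / mom N * (\<integral>y. sK x y ^ N * (a y \<bullet> fr k y) \<partial>S3))"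
      unfolding q_def pk_def by (simp flip: integral_mult_right_zero)
    have c1: "continuous_on UNIV (\<lambda>x. \<integral>y. sK x y ^ N * (a y \<bullet> fr k y) \<partial>S3)"
      using sK_moment_polynomial[OF integrable_curl_terms(2)[OF ai]] continuous_real_polynomial by blast
    show ?thesis unfolding eq by (intro continuous_on_mult continuous_on_const c1)
  qed
  have zc: "continuous_on UNIV z" using z(1) by (rule continuous_real_polynomial)
  have "integrable S3 (\<lambda>x. X x \<bullet> (\<Sum>k\<in>UNIV. (z x * q k x) *\<^sub>R fr k x))"
    by (intro integrable_inner_continuous Xi continuous_on_sum continuous_on_scaleR continuous_on_mult zc q continuous_fr continuous_on_id)
  then show IA: "integrable S3 (\<lambda>x. z x * (\<Sum>k\<in>UNIV. (X x \<bullet> fr k x) * q k x))"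
    by (simp add: inner_sum_right sum_distrib_left mult_ac)
  have ID: "integrable S3 (\<lambda>x. z x * dphi N a x (X x))"
    by (rule integrable_polynomial_derivative[OF ph zc Xi])
  show IC: "integrable S3 (\<lambda>x. phi N a x * z' x (X x))"
    by (rule integrable_polynomial_derivative[OF z continuous_real_polynomial[OF ph(1)] Xi])
  have pt: "z x * (\<Sum>k\<in>UNIV. (X x \<bullet> fr k x) * w k x) = z x * (\<Sum>k\<in>UNIV. (X x \<bullet> fr k x) * q k x) - z x * dphi N a x (X x)"
    if "x \<in> space S3" for x
  proof -
    have x: "norm x = 1" using that by simp
    have lin: "linear (dphi N a x)" using ph(2) by (rule has_derivative_linear)
    have Xx: "(\<Sum>k\<in>UNIV. (X x \<bullet> fr k x) *\<^sub>R fr k x) = X x"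
      using fr_expansion[of "X x" x] X(1) x that by (simp add: L32v_def dot_square_norm)
    have "(\<Sum>k\<in>UNIV. (X x \<bullet> fr k x) * dphi N a x (fr k x)) = dphi N a x (\<Sum>k\<in>UNIV. (X x \<bullet> fr k x) *\<^sub>R fr k x)"
      by (simp add: linear_sum[OF lin] linear_scale[OF lin])
    then have "(\<Sum>k\<in>UNIV. (X x \<bullet> fr k x) * dphi N a x (fr k x)) = dphi N a x (X x)" by (simp only: Xx)
    moreover have "q k x = w k x + dphi N a x (fr k x)" for k
      unfolding q_def w_def by (rule representation[OF c ai W x])
    ultimately show ?thesis by (simp add: distrib_left sum.distrib)
  qed
  have "integrable S3 (\<lambda>x. z x * (\<Sum>k\<in>UNIV. (X x \<bullet> fr k x) * q k x) - z x * dphi N a x (X x))"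
    using IA ID by simp
  then show IB: "integrable S3 (\<lambda>x. z x * (\<Sum>k\<in>UNIV. (X x \<bullet> fr k x) * w k x))"
  proof -
    assume i: "integrable S3 (\<lambda>x. z x * (\<Sum>k\<in>UNIV. (X x \<bullet> fr k x) * q k x) - z x * dphi N a x (X x))"
    have "integrable S3 (\<lambda>x. z x * (\<Sum>k\<in>UNIV. (X x \<bullet> fr k x) * w k x)) = integrable S3 (\<lambda>x. z x * (\<Sum>k\<in>UNIV. (X x \<bullet> fr k x) * q k x) - z x * dphi N a x (X x))"
      by (rule Bochner_Integration.integrable_cong[OF refl]) (rule pt)
    then show ?thesis using i by (simp only:)
  qed
  have "(\<integral>x. z x * (\<Sum>k\<in>UNIV. (X x \<bullet> fr k x) * w k x) \<partial>S3) = (\<integral>x. z x * (\<Sum>k\<in>UNIV. (X x \<bullet> fr k x) * q k x) - z x * dphi N a x (X x) \<partial>S3)"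
    by (rule Bochner_Integration.integral_cong[OF refl pt])
  also have "\<dots> = (\<integral>x. z x * (\<Sum>k\<in>UNIV. (X x \<bullet> fr k x) * q k x) \<partial>S3) - (\<integral>x. z x * dphi N a x (X x) \<partial>S3)"
    by (rule Bochner_Integration.integral_diff[OF IA ID])
  also have "(\<integral>x. z x * dphi N a x (X x) \<partial>S3) = - (\<integral>x. phi N a x * z' x (X x) \<partial>S3)"
  proof -
    have "(\<integral>x. z x * dphi N a x (X x) + z' x (X x) * phi N a x \<partial>S3) = 0"
      using X(2)[unfolded divfree_def, rule_format, of "\<lambda>x. z x * phi N a x" "\<lambda>x h. z x * dphi N a x h + z' x h * phi N a x"]
        real_polynomial_function.intros(4)[OF z(1) ph(1)] has_derivative_mult[OF z(2) ph(2)] by blast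
    moreover have "(\<integral>x. z x * dphi N a x (X x) + z' x (X x) * phi N a x \<partial>S3) = (\<integral>x. z x * dphi N a x (X x) \<partial>S3) + (\<integral>x. phi N a x * z' x (X x) \<partial>S3)"
      using Bochner_Integration.integral_add[OF ID IC] by (simp add: mult.commute[of "phi N a _"])
    ultimately show ?thesis by simp
  qed
  finally show "(\<integral>x. z x * (\<Sum>k\<in>UNIV. (X x \<bullet> fr k x) * q k x) \<partial>S3) = Bterm z X W N - Cterm z' X a N"
    unfolding Bterm_def Cterm_def w_def by simp
qed

text \<open>The constant 72 is 24 from the cross product for each of the three frame
  directions.\<close>

lemma Bterm_diff_le:
  assumes X: "L32v X" "divfree X" and a: "L3v a" and W: "integrable S3 W" and c: "curl_of a W"
    and z: "real_polynomial_function z" "\<And>x. (z has_derivative z' x) (at x)" and N: "N \<le> M"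
  shows "ennreal \<bar>Bterm z X W M - Bterm z X W N\<bar>
    \<le> (\<integral>\<^sup>+x. (\<integral>\<^sup>+y. ennreal (72 * (\<bar>z x\<bar> * norm (X x) * norm (W y) * tailk N x y)) \<partial>S3) \<partial>S3)"
proof -
  note I = key_identity(3)[OF X a W c z]
  let ?b = "\<lambda>N k x. \<integral>y. W y \<bullet> (Fk N k x y - (1/2) *\<^sub>R fr k y) \<partial>S3"
  have Ik: "integrable S3 (\<lambda>y. W y \<bullet> (Fk N k x y - (1/2) *\<^sub>R fr k y))" for N k x
    by (intro integrable_inner_continuous W continuous_on_diff continuous_Fk continuous_intros)
  have "Bterm z X W M - Bterm z X W N = (\<integral>x. z x * (\<Sum>k\<in>UNIV. (X x \<bullet> fr k x) * ?b M k x) - z x * (\<Sum>k\<in>UNIV. (X x \<bullet> fr k x) * ?b N k x) \<partial>S3)"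
    unfolding Bterm_def by (rule Bochner_Integration.integral_diff[OF I I, symmetric])
  also have "\<dots> = (\<integral>x. (\<integral>y. z x * (\<Sum>k\<in>UNIV. (X x \<bullet> fr k x) * (W y \<bullet> (Fk M k x y - Fk N k x y))) \<partial>S3) \<partial>S3)"
  proof (rule Bochner_Integration.integral_cong[OF refl])
    fix x
    have d: "?b M k x - ?b N k x = (\<integral>y. W y \<bullet> (Fk M k x y - Fk N k x y) \<partial>S3)" for k
      by (subst Bochner_Integration.integral_diff[OF Ik Ik, symmetric]) (simp add: inner_diff_right)
    have i: "integrable S3 (\<lambda>y. W y \<bullet> (Fk M k x y - Fk N k x y))" for k
      by (intro integrable_inner_continuous W continuous_on_diff continuous_Fk)
    have "z x * (\<Sum>k\<in>UNIV. (X x \<bullet> fr k x) * ?b M k x) - z x * (\<Sum>k\<in>UNIV. (X x \<bullet> fr k x) * ?b N k x)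
      = z x * (\<Sum>k\<in>UNIV. (X x \<bullet> fr k x) * (?b M k x - ?b N k x))"
      by (simp only: right_diff_distrib sum_subtractf)
    also have "\<dots> = (\<integral>y. z x * (\<Sum>k\<in>UNIV. (X x \<bullet> fr k x) * (W y \<bullet> (Fk M k x y - Fk N k x y))) \<partial>S3)"
      unfolding d using i by simp
    finally show "z x * (\<Sum>k\<in>UNIV. (X x \<bullet> fr k x) * ?b M k x) - z x * (\<Sum>k\<in>UNIV. (X x \<bullet> fr k x) * ?b N k x)
      = (\<integral>y. z x * (\<Sum>k\<in>UNIV. (X x \<bullet> fr k x) * (W y \<bullet> (Fk M k x y - Fk N k x y))) \<partial>S3)" .
  qed
  finally have "ennreal \<bar>Bterm z X W M - Bterm z X W N\<bar>
    \<le> (\<integral>\<^sup>+x. ennreal \<bar>\<integral>y. z x * (\<Sum>k\<in>UNIV. (X x \<bullet> fr k x) * (W y \<bullet> (Fk M k x y - Fk N k x y))) \<partial>S3\<bar> \<partial>S3)"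
    by (simp only: abs_integral_le_nn_integral)
  also have "\<dots> \<le> (\<integral>\<^sup>+x. (\<integral>\<^sup>+y. ennreal \<bar>z x * (\<Sum>k\<in>UNIV. (X x \<bullet> fr k x) * (W y \<bullet> (Fk M k x y - Fk N k x y)))\<bar> \<partial>S3) \<partial>S3)"
    by (intro nn_integral_mono abs_integral_le_nn_integral)
  also have "\<dots> \<le> (\<integral>\<^sup>+x. (\<integral>\<^sup>+y. ennreal (72 * (\<bar>z x\<bar> * norm (X x) * norm (W y) * tailk N x y)) \<partial>S3) \<partial>S3)"
  proof (intro nn_integral_mono ennreal_leI)
    fix x y assume "x \<in> space S3" "y \<in> space S3"
    then have xy: "norm x = 1" "norm y = 1" by simp_all
    have "\<bar>\<Sum>k\<in>UNIV. (X x \<bullet> fr k x) * (W y \<bullet> (Fk M k x y - Fk N k x y))\<bar>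
      \<le> (\<Sum>k\<in>(UNIV::3 set). norm (X x) * (norm (W y) * (24 * tailk N x y)))"
    proof (rule order_trans[OF sum_abs sum_mono])
      fix k :: 3
      have "\<bar>X x \<bullet> fr k x\<bar> \<le> norm (X x)" using Cauchy_Schwarz_ineq2[of "X x" "fr k x"] xy by simp
      moreover have "\<bar>W y \<bullet> (Fk M k x y - Fk N k x y)\<bar> \<le> norm (W y) * (24 * tailk N x y)"
        by (rule order_trans[OF Cauchy_Schwarz_ineq2 mult_left_mono[OF Fk_diff_le(1)[OF xy N]]]) simp
      ultimately show "\<bar>(X x \<bullet> fr k x) * (W y \<bullet> (Fk M k x y - Fk N k x y))\<bar> \<le> norm (X x) * (norm (W y) * (24 * tailk N x y))"
        unfolding abs_mult by (intro mult_mono) auto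
    qed
    also have "\<dots> = 72 * (norm (X x) * norm (W y) * tailk N x y)" by simp
    finally have "\<bar>z x\<bar> * \<bar>\<Sum>k\<in>UNIV. (X x \<bullet> fr k x) * (W y \<bullet> (Fk M k x y - Fk N k x y))\<bar> \<le> \<bar>z x\<bar> * (72 * (norm (X x) * norm (W y) * tailk N x y))"
      by (rule mult_left_mono) simp
    then show "\<bar>z x * (\<Sum>k\<in>UNIV. (X x \<bullet> fr k x) * (W y \<bullet> (Fk M k x y - Fk N k x y)))\<bar> \<le> 72 * (\<bar>z x\<bar> * norm (X x) * norm (W y) * tailk N x y)"
      by (simp add: abs_mult mult_ac)
  qed
  finally show ?thesis .
qed

text \<open>Because \<open>a y\<close> is tangential at \<open>y\<close>,
  \<open>x \<bullet> a y\<close> equals \<open>(x - y) \<bullet> a y\<close>. This produces the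
  chord length that turns the difference of kernels into \<open>tailk\<close>.\<close>

lemma Cterm_diff_le:
  assumes X: "L32v X" "divfree X" and a: "L3v a" and W: "integrable S3 W" and c: "curl_of a W"
    and z: "real_polynomial_function z" "\<And>x. (z has_derivative z' x) (at x)" and N: "N \<le> M"
  shows "ennreal \<bar>Cterm z' X a M - Cterm z' X a N\<bar>
    \<le> (\<integral>\<^sup>+x. (\<integral>\<^sup>+y. ennreal (\<bar>z' x (X x)\<bar> * norm (a y) * tailk N x y) \<partial>S3) \<partial>S3)"
proof -
  have ai: "integrable S3 a" using L3v_integrable a by auto
  note I = key_identity(4)[OF X a W c z]
  have Ik: "integrable S3 (\<lambda>y. gamN N (sK x y) * (x \<bullet> a y))" for N x
    by (intro integrable_continuous_mult integrable_inner_continuous ai continuous_intros)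
  have "Cterm z' X a M - Cterm z' X a N = (\<integral>x. phi M a x * z' x (X x) - phi N a x * z' x (X x) \<partial>S3)"
    unfolding Cterm_def by (rule Bochner_Integration.integral_diff[OF I I, symmetric])
  also have "\<dots> = (\<integral>x. (\<integral>y. z' x (X x) * ((gamN M (sK x y) - gamN N (sK x y)) * (x \<bullet> a y)) \<partial>S3) \<partial>S3)"
  proof (rule Bochner_Integration.integral_cong[OF refl])
    fix x
    have "phi M a x - phi N a x = (\<integral>y. (gamN M (sK x y) - gamN N (sK x y)) * (x \<bullet> a y) \<partial>S3)"
      unfolding phi_def left_diff_distrib by (rule Bochner_Integration.integral_diff[OF Ik Ik, symmetric])
    then show "phi M a x * z' x (X x) - phi N a x * z' x (X x) = (\<integral>y. z' x (X x) * ((gamN M (sK x y) - gamN N (sK x y)) * (x \<bullet> a y)) \<partial>S3)"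
      by (simp add: left_diff_distrib[symmetric] mult.commute)
  qed
  finally have "ennreal \<bar>Cterm z' X a M - Cterm z' X a N\<bar>
    \<le> (\<integral>\<^sup>+x. ennreal \<bar>\<integral>y. z' x (X x) * ((gamN M (sK x y) - gamN N (sK x y)) * (x \<bullet> a y)) \<partial>S3\<bar> \<partial>S3)"
    by (simp only: abs_integral_le_nn_integral)
  also have "\<dots> \<le> (\<integral>\<^sup>+x. (\<integral>\<^sup>+y. ennreal \<bar>z' x (X x) * ((gamN M (sK x y) - gamN N (sK x y)) * (x \<bullet> a y))\<bar> \<partial>S3) \<partial>S3)"
    by (intro nn_integral_mono abs_integral_le_nn_integral)
  also have "\<dots> \<le> (\<integral>\<^sup>+x. (\<integral>\<^sup>+y. ennreal (\<bar>z' x (X x)\<bar> * norm (a y) * tailk N x y) \<partial>S3) \<partial>S3)"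
  proof (intro nn_integral_mono ennreal_leI)
    fix x y assume "x \<in> space S3" "y \<in> space S3"
    then have xy: "norm x = 1" "norm y = 1" by simp_all
    have "a y \<bullet> y = 0" using a xy by (simp add: L3v_def)
    then have "x \<bullet> a y = (x - y) \<bullet> a y" by (simp add: inner_diff_left inner_commute[of "a y"])
    then have "\<bar>x \<bullet> a y\<bar> \<le> norm (x - y) * norm (a y)" using Cauchy_Schwarz_ineq2[of "x - y" "a y"] by simp
    then have "\<bar>gamN M (sK x y) - gamN N (sK x y)\<bar> * \<bar>x \<bullet> a y\<bar> \<le> \<bar>gamN M (sK x y) - gamN N (sK x y)\<bar> * (norm (x - y) * norm (a y))"
      by (rule mult_left_mono) simp
    also have "\<dots> \<le> norm (a y) * tailk N x y"
      using mult_right_mono[OF Fk_diff_le(2)[OF xy N], of "norm (a y)"] by (simp add: mult_ac)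
    finally have "\<bar>z' x (X x)\<bar> * (\<bar>gamN M (sK x y) - gamN N (sK x y)\<bar> * \<bar>x \<bullet> a y\<bar>) \<le> \<bar>z' x (X x)\<bar> * (norm (a y) * tailk N x y)"
      by (rule mult_left_mono) simp
    then show "\<bar>z' x (X x) * ((gamN M (sK x y) - gamN N (sK x y)) * (x \<bullet> a y))\<bar> \<le> \<bar>z' x (X x)\<bar> * norm (a y) * tailk N x y"
      by (simp add: abs_mult mult_ac)
  qed
  finally show ?thesis .
qed

text \<open>By Parseval in the frame, the error is a sum over \<open>k\<close> of averages of
  differences of frame coefficients of \<open>a\<close>, each weighted by a function of class
  L^(3/2). These are the quantities treated by \<open>approx_identity\<close>.\<close>

lemma Aterm_tendsto:
  assumes X: "L32v X" "divfree X" and a: "L3v a" and W: "integrable S3 W" and c: "curl_of a W"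
    and z: "real_polynomial_function z" "\<And>x. (z has_derivative z' x) (at x)"
  shows "(\<lambda>M. \<integral>x. z x * (\<Sum>k\<in>UNIV. (X x \<bullet> fr k x) * (\<integral>y. pk M (sK x y) * (a y \<bullet> fr k y) \<partial>S3)) \<partial>S3)
    \<longlonglongrightarrow> area3 * (\<integral>x. z x * (X x \<bullet> a x) \<partial>S3)" (is "?A \<longlonglongrightarrow> ?L")
proof (rule LIMSEQ_I)
  have ai: "integrable S3 a" using L3v_integrable a by auto
  have zc: "continuous_on UNIV z" using z(1) by (rule continuous_real_polynomial)
  have zm: "z \<in> borel_measurable S3" by (intro borel_measurable_S3I borel_measurable_continuous_onI zc)
  have "compact (z ` sphere 0 1)"
    using zc by (intro compact_continuous_image) (auto intro: continuous_on_subset)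
  then obtain B0 where B0: "\<And>y. y \<in> sphere 0 1 \<Longrightarrow> norm (z y) \<le> B0"
    by (meson bounded_iff compact_imp_bounded image_eqI)
  define B where "B = \<bar>B0\<bar> + 1"
  have B: "\<bar>z y\<bar> \<le> B" if "norm y = 1" for y using B0[of y] that by (simp add: B_def)
  have B1: "B > 0" by (simp add: B_def)
  note frm = borel_measurable_S3I[OF borel_measurable_continuous_onI[OF continuous_fr[OF continuous_on_id]]]
  fix e :: real assume e: "0 < e"
  let ?Xk = "\<lambda>k x. z x * (X x \<bullet> fr k x)" and ?ak = "\<lambda>k x. a x \<bullet> fr k x"
  have Xm: "X \<in> borel_measurable S3" and am: "a \<in> borel_measurable S3" using X a by (auto simp: L32v_def L3v_def)
  have Xkm: "?Xk k \<in> borel_measurable S3" and akm: "?ak k \<in> borel_measurable S3" for k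
    using Xm am zm frm[of k] by simp_all
  have Xkb: "\<bar>?Xk k x\<bar> \<le> B * norm (X x)" if "norm x = 1" for k x
    unfolding abs_mult using B[OF that] B1 Cauchy_Schwarz_ineq2[of "X x" "fr k x"] that by (intro mult_mono) auto
  have Xki: "integrable S3 (\<lambda>x. \<bar>?Xk k x\<bar> powr (3/2))" for k
  proof (rule Bochner_Integration.integrable_bound[of S3 "\<lambda>x. B powr (3/2) * norm (X x) powr (3/2)"])
    show "integrable S3 (\<lambda>x. B powr (3/2) * norm (X x) powr (3/2))" using X by (simp add: L32v_def)
    show "(\<lambda>x. \<bar>?Xk k x\<bar> powr (3/2)) \<in> borel_measurable S3" using Xkm[of k] by simp
    show "AE x in S3. norm (\<bar>?Xk k x\<bar> powr (3/2)) \<le> norm (B powr (3/2) * norm (X x) powr (3/2))"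
    proof (rule AE_I2)
      fix x assume "x \<in> space S3"
      then have "\<bar>?Xk k x\<bar> powr (3/2) \<le> (B * norm (X x)) powr (3/2)" using Xkb by (intro powr_mono2) auto
      also have "\<dots> = B powr (3/2) * norm (X x) powr (3/2)" using B1 by (simp add: powr_mult)
      finally show "norm (\<bar>?Xk k x\<bar> powr (3/2)) \<le> norm (B powr (3/2) * norm (X x) powr (3/2))" by simp
    qed
  qed
  have aki: "integrable S3 (\<lambda>x. \<bar>?ak k x\<bar>^3)" for k
  proof (rule Bochner_Integration.integrable_bound[of S3 "\<lambda>x. norm (a x)^3"])
    show "integrable S3 (\<lambda>x. norm (a x)^3)" using a by (simp add: L3v_def)
    show "(\<lambda>x. \<bar>?ak k x\<bar>^3) \<in> borel_measurable S3" using akm[of k] by simp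
    show "AE x in S3. norm (\<bar>?ak k x\<bar>^3) \<le> norm (norm (a x)^3)"
    proof (rule AE_I2)
      fix x assume "x \<in> space S3"
      then have "\<bar>?ak k x\<bar> \<le> norm (a x)" using Cauchy_Schwarz_ineq2[of "a x" "fr k x"] by simp
      then have "\<bar>?ak k x\<bar>^3 \<le> norm (a x)^3" by (rule power_mono) simp
      then show "norm (\<bar>?ak k x\<bar>^3) \<le> norm (norm (a x)^3)" by simp
    qed
  qed
  \<comment> \<open>A quarter for each of the three directions leaves a strict inequality at the
    end.\<close>
  have "e / 4 > 0" using e by simp
  from approx_identity[OF Xkm Xki akm aki this]
  have "\<forall>k. \<exists>N0. \<forall>N\<ge>N0. (\<integral>\<^sup>+x. (\<integral>\<^sup>+y. ennreal (pk N (sK x y) * (\<bar>?Xk k x\<bar> * \<bar>?ak k y - ?ak k x\<bar>)) \<partial>S3) \<partial>S3) \<le> ennreal (e/4)"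
    by blast
  from choice[OF this] obtain n where n: "\<And>k N. N \<ge> n k \<Longrightarrow> (\<integral>\<^sup>+x. (\<integral>\<^sup>+y. ennreal (pk N (sK x y) * (\<bar>?Xk k x\<bar> * \<bar>?ak k y - ?ak k x\<bar>)) \<partial>S3) \<partial>S3) \<le> ennreal (e/4)"
    by blast
  have Ip: "integrable S3 (\<lambda>y. pk N (sK x y) * u y)" if "integrable S3 u" for N x u
    by (intro integrable_continuous_mult continuous_pk that)
  note aI = integrable_curl_terms(2)[OF ai]
  have IL: "integrable S3 (\<lambda>x. z x * (X x \<bullet> a x))"
  proof (rule integrable_continuous_mult[OF zc], rule Bochner_Integration.integrable_bound[OF integrable_inner_L3v_L32v[OF X(1) a]])
    show "(\<lambda>x. X x \<bullet> a x) \<in> borel_measurable S3" using Xm am by simp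
    show "AE x in S3. norm (X x \<bullet> a x) \<le> norm (norm (X x) * norm (a x))"
      using Cauchy_Schwarz_ineq2 by (intro AE_I2) simp
  qed
  show "\<exists>N0. \<forall>N\<ge>N0. norm (?A N - ?L) < e"
  proof (intro exI[of _ "Max (range n)"] allI impI)
    fix N assume le: "Max (range n) \<le> N"
    have N: "n k \<le> N" for k
    proof -
      have "n k \<le> Max (range n)" by (rule Max_ge) auto
      then show ?thesis using le by simp
    qed
    have "?A N - ?L = (\<integral>x. z x * (\<Sum>k\<in>UNIV. (X x \<bullet> fr k x) * (\<integral>y. pk N (sK x y) * ?ak k y \<partial>S3)) - area3 * (z x * (X x \<bullet> a x)) \<partial>S3)"
      using Bochner_Integration.integral_diff[OF key_identity(2)[OF X a W c z, of N] integrable_mult_right[OF IL, of area3]] by simp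
    also have "\<dots> = (\<integral>x. (\<integral>y. (\<Sum>k\<in>UNIV. pk N (sK x y) * (?Xk k x * (?ak k y - ?ak k x))) \<partial>S3) \<partial>S3)"
    proof (rule Bochner_Integration.integral_cong[OF refl])
      fix x assume "x \<in> space S3"
      then have x: "norm x = 1" by simp
      have "X x \<bullet> a x = (\<Sum>k\<in>UNIV. (X x \<bullet> fr k x) * ?ak k x)"
        using fr_parseval[of "X x" x "a x"] a x by (simp add: L3v_def dot_square_norm)
      then have "z x * (\<Sum>k\<in>UNIV. (X x \<bullet> fr k x) * (\<integral>y. pk N (sK x y) * ?ak k y \<partial>S3)) - area3 * (z x * (X x \<bullet> a x))
        = (\<Sum>k\<in>UNIV. ?Xk k x * ((\<integral>y. pk N (sK x y) * ?ak k y \<partial>S3) - area3 * ?ak k x))"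
        by (simp add: sum_distrib_left right_diff_distrib sum_subtractf mult_ac)
      also have "\<dots> = (\<Sum>k\<in>UNIV. \<integral>y. pk N (sK x y) * (?Xk k x * (?ak k y - ?ak k x)) \<partial>S3)"
      proof (intro sum.cong refl)
        fix k
        have "(\<integral>y. pk N (sK x y) * ?ak k y \<partial>S3) - area3 * ?ak k x = (\<integral>y. pk N (sK x y) * ?ak k y - pk N (sK x y) * ?ak k x \<partial>S3)"
          using Ip[OF aI] integrable_S3_bounded[OF continuous_pk[of N x]] integral_pk[OF x, of N] by simp
        then have "?Xk k x * ((\<integral>y. pk N (sK x y) * ?ak k y \<partial>S3) - area3 * ?ak k x) = (\<integral>y. ?Xk k x * (pk N (sK x y) * ?ak k y - pk N (sK x y) * ?ak k x) \<partial>S3)"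
          by simp
        also have "\<dots> = (\<integral>y. pk N (sK x y) * (?Xk k x * (?ak k y - ?ak k x)) \<partial>S3)"
          by (intro Bochner_Integration.integral_cong refl) (simp add: algebra_simps)
        finally show "?Xk k x * ((\<integral>y. pk N (sK x y) * ?ak k y \<partial>S3) - area3 * ?ak k x) = (\<integral>y. pk N (sK x y) * (?Xk k x * (?ak k y - ?ak k x)) \<partial>S3)" .
      qed
      also have "\<dots> = (\<integral>y. (\<Sum>k\<in>UNIV. pk N (sK x y) * (?Xk k x * (?ak k y - ?ak k x))) \<partial>S3)"
      proof (rule Bochner_Integration.integral_sum[symmetric])
        fix k :: 3
        show "integrable S3 (\<lambda>y. pk N (sK x y) * (?Xk k x * (?ak k y - ?ak k x)))"
          using aI by (intro Ip integrable_mult_right) simp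
      qed
      finally show "z x * (\<Sum>k\<in>UNIV. (X x \<bullet> fr k x) * (\<integral>y. pk N (sK x y) * ?ak k y \<partial>S3)) - area3 * (z x * (X x \<bullet> a x))
         = (\<integral>y. (\<Sum>k\<in>UNIV. pk N (sK x y) * (?Xk k x * (?ak k y - ?ak k x))) \<partial>S3)" .
    qed
    finally have "ennreal \<bar>?A N - ?L\<bar> \<le> (\<integral>\<^sup>+x. ennreal \<bar>\<integral>y. (\<Sum>k\<in>UNIV. pk N (sK x y) * (?Xk k x * (?ak k y - ?ak k x))) \<partial>S3\<bar> \<partial>S3)"
      by (simp only: abs_integral_le_nn_integral)
    also have "\<dots> \<le> (\<integral>\<^sup>+x. (\<integral>\<^sup>+y. ennreal \<bar>\<Sum>k\<in>UNIV. pk N (sK x y) * (?Xk k x * (?ak k y - ?ak k x))\<bar> \<partial>S3) \<partial>S3)"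
      by (intro nn_integral_mono abs_integral_le_nn_integral)
    also have "\<dots> \<le> (\<integral>\<^sup>+x. (\<integral>\<^sup>+y. (\<Sum>k\<in>UNIV. ennreal (pk N (sK x y) * (\<bar>?Xk k x\<bar> * \<bar>?ak k y - ?ak k x\<bar>))) \<partial>S3) \<partial>S3)"
    proof (intro nn_integral_mono)
      fix x y assume "x \<in> space S3" "y \<in> space S3"
      then have p: "0 \<le> pk N (sK x y)" using pk_nonneg by simp
      have "\<bar>\<Sum>k\<in>UNIV. pk N (sK x y) * (?Xk k x * (?ak k y - ?ak k x))\<bar> \<le> (\<Sum>k\<in>UNIV. pk N (sK x y) * (\<bar>?Xk k x\<bar> * \<bar>?ak k y - ?ak k x\<bar>))"
        using p by (intro order_trans[OF sum_abs]) (simp add: abs_mult)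
      then have "ennreal \<bar>\<Sum>k\<in>UNIV. pk N (sK x y) * (?Xk k x * (?ak k y - ?ak k x))\<bar> \<le> ennreal (\<Sum>k\<in>UNIV. pk N (sK x y) * (\<bar>?Xk k x\<bar> * \<bar>?ak k y - ?ak k x\<bar>))"
        by (rule ennreal_leI)
      then show "ennreal \<bar>\<Sum>k\<in>UNIV. pk N (sK x y) * (?Xk k x * (?ak k y - ?ak k x))\<bar> \<le> (\<Sum>k\<in>UNIV. ennreal (pk N (sK x y) * (\<bar>?Xk k x\<bar> * \<bar>?ak k y - ?ak k x\<bar>)))"
        using p by (simp add: sum_ennreal)
    qed
    also have "\<dots> = (\<Sum>k\<in>UNIV. (\<integral>\<^sup>+x. (\<integral>\<^sup>+y. ennreal (pk N (sK x y) * (\<bar>?Xk k x\<bar> * \<bar>?ak k y - ?ak k x\<bar>)) \<partial>S3) \<partial>S3))"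
    proof -
      have M: "(\<lambda>p. ennreal (pk N (sK (fst p) (snd p)) * (\<bar>?Xk k (fst p)\<bar> * \<bar>?ak k (snd p) - ?ak k (fst p)\<bar>))) \<in> borel_measurable (S3 \<Otimes>\<^sub>M S3)" for k
        using measurable_pk[of N] measurable_fst_S3'[OF Xkm[of k]] measurable_fst_S3'[OF akm[of k]] measurable_snd_S3'[OF akm[of k]] by simp
      have M1: "(\<lambda>y. ennreal (pk N (sK x y) * (\<bar>?Xk k x\<bar> * \<bar>?ak k y - ?ak k x\<bar>))) \<in> borel_measurable S3" if "x \<in> space S3" for k x
        using measurable_compose[OF measurable_Pair1'[OF that] M[of k]] by simp
      have M2: "(\<lambda>x. \<integral>\<^sup>+y. ennreal (pk N (sK x y) * (\<bar>?Xk k x\<bar> * \<bar>?ak k y - ?ak k x\<bar>)) \<partial>S3) \<in> borel_measurable S3" for k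
        using S3.borel_measurable_nn_integral_fst[OF M[of k]] by simp
      have "(\<integral>\<^sup>+x. (\<integral>\<^sup>+y. (\<Sum>k\<in>UNIV. ennreal (pk N (sK x y) * (\<bar>?Xk k x\<bar> * \<bar>?ak k y - ?ak k x\<bar>))) \<partial>S3) \<partial>S3)
        = (\<integral>\<^sup>+x. (\<Sum>k\<in>UNIV. (\<integral>\<^sup>+y. ennreal (pk N (sK x y) * (\<bar>?Xk k x\<bar> * \<bar>?ak k y - ?ak k x\<bar>)) \<partial>S3)) \<partial>S3)"
        by (intro nn_integral_cong nn_integral_sum M1)
      also have "\<dots> = (\<Sum>k\<in>UNIV. (\<integral>\<^sup>+x. (\<integral>\<^sup>+y. ennreal (pk N (sK x y) * (\<bar>?Xk k x\<bar> * \<bar>?ak k y - ?ak k x\<bar>)) \<partial>S3) \<partial>S3))"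
        by (intro nn_integral_sum M2)
      finally show ?thesis .
    qed
    also have "\<dots> \<le> (\<Sum>k\<in>(UNIV :: 3 set). ennreal (e/4))"
      by (intro sum_mono n N)
    also have "\<dots> = ennreal (3 * (e/4))" using e by (subst sum_ennreal) auto
    finally have "\<bar>?A N - ?L\<bar> \<le> 3 * (e/4)" using e by (simp add: ennreal_le_iff)
    then show "norm (?A N - ?L) < e" using e by simp
  qed
qed

text \<open>The identity is used at a finite order \<open>M\<close>, compared with order
  \<open>N\<close>, and then \<open>M\<close> tends to infinity on the left only. The singular
  kernel thus enters through the bound \<open>tailk\<close> and never through an identity.\<close>

lemma key_estimate:
  assumes X: "L32v X" "divfree X" and a: "L3v a" and W: "integrable S3 W" and c: "curl_of a W"
    and z: "real_polynomial_function z" "\<And>x. (z has_derivative z' x) (at x)"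
  shows "ennreal \<bar>area3 * (\<integral>x. z x * (X x \<bullet> a x) \<partial>S3) - (Bterm z X W N - Cterm z' X a N)\<bar>
    \<le> (\<integral>\<^sup>+x. (\<integral>\<^sup>+y. ennreal (72 * (\<bar>z x\<bar> * norm (X x) * norm (W y) * tailk N x y)) \<partial>S3) \<partial>S3)
      + (\<integral>\<^sup>+x. (\<integral>\<^sup>+y. ennreal (\<bar>z' x (X x)\<bar> * norm (a y) * tailk N x y) \<partial>S3) \<partial>S3)" (is "_ \<le> ?R")
proof -
  let ?A = "\<lambda>M. \<integral>x. z x * (\<Sum>k\<in>UNIV. (X x \<bullet> fr k x) * (\<integral>y. pk M (sK x y) * (a y \<bullet> fr k y) \<partial>S3)) \<partial>S3"
  have le: "ennreal \<bar>?A M - (Bterm z X W N - Cterm z' X a N)\<bar> \<le> ?R" if "N \<le> M" for M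
  proof -
    have "\<bar>?A M - (Bterm z X W N - Cterm z' X a N)\<bar> \<le> \<bar>Bterm z X W M - Bterm z X W N\<bar> + \<bar>Cterm z' X a M - Cterm z' X a N\<bar>"
      unfolding key_identity(1)[OF X a W c z] by linarith
    then have "ennreal \<bar>?A M - (Bterm z X W N - Cterm z' X a N)\<bar> \<le> ennreal \<bar>Bterm z X W M - Bterm z X W N\<bar> + ennreal \<bar>Cterm z' X a M - Cterm z' X a N\<bar>"
      by (simp add: ennreal_plus[symmetric] ennreal_leI del: ennreal_plus)
    also have "\<dots> \<le> ?R"
      by (intro add_mono Bterm_diff_le[OF X a W c z that] Cterm_diff_le[OF X a W c z that])
    finally show ?thesis .
  qed
  show ?thesis
  proof (rule LIMSEQ_le_const2)
    show "(\<lambda>M. ennreal \<bar>?A M - (Bterm z X W N - Cterm z' X a N)\<bar>)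
      \<longlonglongrightarrow> ennreal \<bar>area3 * (\<integral>x. z x * (X x \<bullet> a x) \<partial>S3) - (Bterm z X W N - Cterm z' X a N)\<bar>"
      by (intro tendsto_intros Aterm_tendsto[OF X a W c z])
  qed (use le in blast)
qed

section \<open>Localization away from concentration points\<close>

text \<open>Here \<open>P\<close> and \<open>Q\<close> are integrals of powers 3/2, so the norms are
  their powers 2/3. This form is additive over cells of a partition.\<close>

lemma hls_tail:
  obtains C where "C > 0"
    "\<And>f g P Q N. f \<in> borel_measurable S3 \<Longrightarrow> g \<in> borel_measurable S3 \<Longrightarrow> (\<And>x. 0 \<le> f x) \<Longrightarrow> (\<And>x. 0 \<le> g x) \<Longrightarrow>
      0 \<le> P \<Longrightarrow> 0 \<le> Q \<Longrightarrow>
      (\<integral>\<^sup>+x. ennreal (f x powr (3/2)) \<partial>S3) \<le> ennreal P \<Longrightarrow>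
      (\<integral>\<^sup>+x. ennreal (g x powr (3/2)) \<partial>S3) \<le> ennreal Q \<Longrightarrow>
      (\<integral>\<^sup>+x. (\<integral>\<^sup>+y. ennreal (f x * g y * tailk N x y) \<partial>S3) \<partial>S3) \<le> ennreal (C * (P powr (2/3) * Q powr (2/3)))"
proof -
  obtain C where C: "C > 0" and hls: 
    "\<And>f g A B. f \<in> borel_measurable S3 \<Longrightarrow> g \<in> borel_measurable S3 \<Longrightarrow> (\<And>x. 0 \<le> f x) \<Longrightarrow> (\<And>x. 0 \<le> g x) \<Longrightarrow>
      0 < A \<Longrightarrow> 0 < B \<Longrightarrow>
      (\<integral>\<^sup>+x. ennreal (f x powr (3/2)) \<partial>S3) \<le> ennreal (A powr (3/2)) \<Longrightarrow>
      (\<integral>\<^sup>+x. ennreal (g x powr (3/2)) \<partial>S3) \<le> ennreal (B powr (3/2)) \<Longrightarrow>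
      (\<integral>\<^sup>+x. (\<integral>\<^sup>+y. ennreal (f x * g y / norm (x - y)^2) \<partial>S3) \<partial>S3) \<le> ennreal (C * A * B)"
    by (rule hardy_littlewood_sobolev) blast
  show thesis
  proof (rule that[of "6 * C"])
    fix f g :: "R4 \<Rightarrow> real" and P Q :: real and N
    assume f: "f \<in> borel_measurable S3" and g: "g \<in> borel_measurable S3" and f0: "\<And>x. 0 \<le> f x" and g0: "\<And>x. 0 \<le> g x"
      and P: "0 \<le> P" and Q: "0 \<le> Q"
      and fP: "(\<integral>\<^sup>+x. ennreal (f x powr (3/2)) \<partial>S3) \<le> ennreal P"
      and gQ: "(\<integral>\<^sup>+x. ennreal (g x powr (3/2)) \<partial>S3) \<le> ennreal Q"
    \<comment> \<open>The inequality for the Riesz kernel demands positive norms, whereas a cell may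
      carry no mass; hence the detour over \<open>P + d\<close> and \<open>Q + d\<close>.\<close>
    have le: "(\<integral>\<^sup>+x. (\<integral>\<^sup>+y. ennreal (f x * g y * tailk N x y) \<partial>S3) \<partial>S3) \<le> ennreal (6 * C * ((P + d) powr (2/3) * (Q + d) powr (2/3)))" if d: "d > 0" for d
    proof -
      have pp: "((u + d) powr (2/3)) powr (3/2) = u + d" if "0 \<le> u" for u
        using that d by (simp add: powr_powr)
      have fl: "(\<integral>\<^sup>+x. ennreal (f x powr (3/2)) \<partial>S3) \<le> ennreal (((P + d) powr (2/3)) powr (3/2))"
        unfolding pp[OF P] by (rule order_trans[OF fP ennreal_leI]) (use d in simp)
      have gl: "(\<integral>\<^sup>+x. ennreal (g x powr (3/2)) \<partial>S3) \<le> ennreal (((Q + d) powr (2/3)) powr (3/2))"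
        unfolding pp[OF Q] by (rule order_trans[OF gQ ennreal_leI]) (use d in simp)
      have k: "(\<lambda>p. ennreal (f (fst p) * g (snd p) / norm (fst p - snd p)^2)) \<in> borel_measurable (S3 \<Otimes>\<^sub>M S3)"
        using measurable_fst_S3'[OF f] measurable_snd_S3'[OF g] measurable_S3_dist by simp
      have "(\<integral>\<^sup>+x. (\<integral>\<^sup>+y. ennreal (f x * g y * tailk N x y) \<partial>S3) \<partial>S3) \<le> (\<integral>\<^sup>+x. (\<integral>\<^sup>+y. ennreal 6 * ennreal (f x * g y / norm (x - y)^2) \<partial>S3) \<partial>S3)"
      proof (intro nn_integral_mono)
        fix x y assume "x \<in> space S3" "y \<in> space S3"
        then have "tailk N x y \<le> 6 / norm (x - y)^2" using tailk_le by simp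
        then have "f x * g y * tailk N x y \<le> f x * g y * (6 / norm (x - y)^2)"
          using f0 g0 by (intro mult_left_mono) auto
        then have "ennreal (f x * g y * tailk N x y) \<le> ennreal (6 * (f x * g y / norm (x - y)^2))"
          by (intro ennreal_leI) (simp add: mult_ac)
        also have "\<dots> = ennreal 6 * ennreal (f x * g y / norm (x - y)^2)"
          using f0 g0 by (intro ennreal_mult) auto
        finally show "ennreal (f x * g y * tailk N x y) \<le> ennreal 6 * ennreal (f x * g y / norm (x - y)^2)" .
      qed
      also have "\<dots> = (\<integral>\<^sup>+x. ennreal 6 * (\<integral>\<^sup>+y. ennreal (f x * g y / norm (x - y)^2) \<partial>S3) \<partial>S3)"
        using measurable_compose[OF measurable_Pair1' k] by (intro nn_integral_cong nn_integral_cmult) simp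
      also have "\<dots> = ennreal 6 * (\<integral>\<^sup>+x. (\<integral>\<^sup>+y. ennreal (f x * g y / norm (x - y)^2) \<partial>S3) \<partial>S3)"
        using S3.borel_measurable_nn_integral_fst[OF k] by (intro nn_integral_cmult) simp
      also have "\<dots> \<le> ennreal 6 * ennreal (C * (P + d) powr (2/3) * (Q + d) powr (2/3))"
        using d P Q by (intro mult_left_mono hls f g f0 g0 fl gl) auto
      also have "\<dots> = ennreal (6 * (C * (P + d) powr (2/3) * (Q + d) powr (2/3)))"
        using C by (intro ennreal_mult[symmetric]) auto
      finally show ?thesis by (simp add: mult_ac)
    qed
    have d0: "(\<lambda>n. 1 / real (Suc n)) \<longlonglongrightarrow> 0" using LIMSEQ_inverse_real_of_nat by (simp add: inverse_eq_divide)
    have t: "(\<lambda>n. (u + 1 / real (Suc n)) powr (2/3)) \<longlonglongrightarrow> u powr (2/3)" if "0 \<le> u" for u :: real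
    proof -
      have "(\<lambda>n. u + 1 / real (Suc n)) \<longlonglongrightarrow> u + 0" by (intro tendsto_intros d0)
      then have "(\<lambda>n. (u + 1 / real (Suc n)) powr (2/3)) \<longlonglongrightarrow> (u + 0) powr (2/3)"
        using that by (intro tendsto_powr') auto
      then show ?thesis by simp
    qed
    show "(\<integral>\<^sup>+x. (\<integral>\<^sup>+y. ennreal (f x * g y * tailk N x y) \<partial>S3) \<partial>S3) \<le> ennreal (6 * C * (P powr (2/3) * Q powr (2/3)))"
    proof (rule LIMSEQ_le_const)
      show "(\<lambda>n. ennreal (6 * C * ((P + 1 / real (Suc n)) powr (2/3) * (Q + 1 / real (Suc n)) powr (2/3)))) \<longlonglongrightarrow> ennreal (6 * C * (P powr (2/3) * Q powr (2/3)))"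
        by (intro tendsto_intros t P Q)
    qed (use le in \<open>auto intro!: exI[of _ 0]\<close>)
  qed (use C in simp)
qed

text \<open>With \<open>b = 0\<close> this is the trace on the sphere of the grid cell with index
  \<open>c\<close>, with \<open>b = 1\<close> that of the cell and its neighbours. Only these two
  values are used.\<close>

definition cell :: "real \<Rightarrow> real \<Rightarrow> (4 \<Rightarrow> int) \<Rightarrow> R4 set" where
  "cell r b c = {x \<in> sphere 0 1. \<forall>i. \<bar>real_of_int \<lfloor>x $ i / r\<rfloor> - real_of_int (c i)\<bar> \<le> b}"

lemma cell_sets: "cell r b c \<in> sets S3"
proof -
  have "(\<lambda>x::R4. real_of_int \<lfloor>x $ i / r\<rfloor>) \<in> borel_measurable S3" for i
  proof -
    have "(\<lambda>x::R4. x $ i / r) \<in> borel_measurable borel"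
      unfolding divide_inverse by (intro borel_measurable_continuous_onI continuous_intros)
    then have "(\<lambda>x::R4. real_of_int \<lfloor>x $ i / r\<rfloor>) \<in> borel_measurable borel" by measurable
    then show ?thesis by (rule borel_measurable_S3I)
  qed
  then have "{x \<in> space S3. \<bar>real_of_int \<lfloor>x $ i / r\<rfloor> - real_of_int (c i)\<bar> \<le> b} \<in> sets S3" for i
    by (intro borel_measurable_le) simp_all
  then have "{x \<in> space S3. \<forall>i\<in>UNIV. \<bar>real_of_int \<lfloor>x $ i / r\<rfloor> - real_of_int (c i)\<bar> \<le> b} \<in> sets S3"
    by (intro sets.sets_Collect_finite_All) auto
  then show ?thesis by (simp add: cell_def)
qed

lemma powr_2_3_1_3_le:
  fixes s t :: real
  assumes "0 \<le> s" "0 \<le> t"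
  shows "s powr (2/3) * t powr (1/3) \<le> s + t"
proof (cases "max s t = 0")
  case False
  have "s powr (2/3) * t powr (1/3) \<le> max s t powr (2/3) * max s t powr (1/3)"
    using assms by (intro mult_mono powr_mono2) auto
  also have "\<dots> = max s t" using assms False by (simp add: powr_add[symmetric])
  also have "\<dots> \<le> s + t" using assms by simp
  finally show ?thesis .
qed (use assms in \<open>auto simp: max_def split: if_splits\<close>)

text \<open>The points of \<open>P\<close> mark the grid cells of side \<open>r\<close> whose neighbourhood carries more than
  \<open>\<epsilon>\<close> of the mass of \<open>W\<close>. On the other cells the near part of the potential gains the factor
  \<open>\<epsilon> powr (1/3)\<close> from the Hardy-Littlewood-Sobolev inequality. The number 81 counts the \<open>3^4\<close>
  neighbours of a cell.\<close>
lemma localized_potential: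
  obtains C where "C > 0"
    "\<And>r X W M \<epsilon> \<epsilon>'. r > 0 \<Longrightarrow> M > 0 \<Longrightarrow> \<epsilon> > 0 \<Longrightarrow> \<epsilon>' > 0 \<Longrightarrow>
      X \<in> borel_measurable S3 \<Longrightarrow> W \<in> borel_measurable S3 \<Longrightarrow>
      (\<integral>\<^sup>+x. ennreal (norm ((X x)::R4) powr (3/2)) \<partial>S3) \<le> ennreal M \<Longrightarrow>
      (\<integral>\<^sup>+x. ennreal (norm ((W x)::R4) powr (3/2)) \<partial>S3) \<le> ennreal M \<Longrightarrow>
      \<exists>P. finite P \<and> P \<subseteq> sphere 0 1 \<and> real (card P) \<le> 81 * M / \<epsilon> \<and>
        (\<forall>z \<tau> N. (\<forall>x. norm x = 1 \<longrightarrow> 0 \<le> z x \<and> z x \<le> 1) \<longrightarrow>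
          (\<forall>p\<in>P. \<forall>x. norm x = 1 \<longrightarrow> norm (x - p) \<le> 4 * r \<longrightarrow> z x \<le> \<epsilon>') \<longrightarrow>
          (\<forall>x y. norm x = 1 \<longrightarrow> norm y = 1 \<longrightarrow> r \<le> norm (x - y) \<longrightarrow> tailk N x y \<le> \<tau>) \<longrightarrow>
          (\<integral>\<^sup>+x. (\<integral>\<^sup>+y. ennreal (\<bar>z x\<bar> * norm (X x) * norm (W y) * tailk N x y) \<partial>S3) \<partial>S3)
            \<le> ennreal (C * (\<epsilon> powr (1/3) + \<epsilon>' * (81 * M) powr (1/3)) * (82 * M))
              + (\<integral>\<^sup>+x. (\<integral>\<^sup>+y. ennreal (\<tau> * (norm (X x) * norm (W y))) \<partial>S3) \<partial>S3))"
proof -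
  obtain C where C: "C > 0" and hls: 
    "\<And>f g P Q N. f \<in> borel_measurable S3 \<Longrightarrow> g \<in> borel_measurable S3 \<Longrightarrow> (\<And>x. 0 \<le> f x) \<Longrightarrow> (\<And>x. 0 \<le> g x) \<Longrightarrow>
      0 \<le> P \<Longrightarrow> 0 \<le> Q \<Longrightarrow>
      (\<integral>\<^sup>+x. ennreal (f x powr (3/2)) \<partial>S3) \<le> ennreal P \<Longrightarrow>
      (\<integral>\<^sup>+x. ennreal (g x powr (3/2)) \<partial>S3) \<le> ennreal Q \<Longrightarrow>
      (\<integral>\<^sup>+x. (\<integral>\<^sup>+y. ennreal (f x * g y * tailk N x y) \<partial>S3) \<partial>S3) \<le> ennreal (C * (P powr (2/3) * Q powr (2/3)))"
    by (rule hls_tail) blast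
  show thesis
  proof (rule that[OF C])
    fix r M \<epsilon> \<epsilon>' :: real and X W :: "R4 \<Rightarrow> R4"
    assume r: "r > 0" and M: "M > 0" and eps: "\<epsilon> > 0" "\<epsilon>' > 0" and Xm: "X \<in> borel_measurable S3" and Wm: "W \<in> borel_measurable S3"
      and XM: "(\<integral>\<^sup>+x. ennreal (norm (X x) powr (3/2)) \<partial>S3) \<le> ennreal M"
      and WM: "(\<integral>\<^sup>+x. ennreal (norm (W x) powr (3/2)) \<partial>S3) \<le> ennreal M"
    define idx where "idx x = (\<lambda>i::4. \<lfloor>x $ i / r\<rfloor>)" for x :: R4
    define I where "I = idx ` sphere 0 1"
    have fin: "finite I"
    proof (rule finite_subset)
      define m where "m = \<lceil>1 / r\<rceil> + 1"
      show "I \<subseteq> PiE UNIV (\<lambda>_. {-m..m})"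
      proof
        fix c assume "c \<in> I"
        then obtain x where x: "norm x = 1" "c = idx x" by (auto simp: I_def)
        have "c i \<in> {-m..m}" for i
        proof -
          have "\<bar>x $ i\<bar> \<le> 1" using component_le_norm_cart[of x i] x by simp
          then have "\<bar>x $ i / r\<bar> \<le> 1 / r" using r by (simp add: divide_right_mono)
          then have "- (1/r) \<le> x $ i / r" "x $ i / r \<le> 1/r" by linarith+
          then show ?thesis unfolding x(2) idx_def m_def by (simp add: floor_le_iff le_floor_iff) linarith
        qed
        then show "c \<in> PiE UNIV (\<lambda>_. {-m..m})" by auto
      qed
      show "finite (PiE (UNIV :: 4 set) (\<lambda>_. {-m..m}))" by (intro finite_PiE) auto
    qed
    have E: "x \<in> cell r 0 c \<longleftrightarrow> norm x = 1 \<and> idx x = c" for x c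
      by (auto simp: cell_def idx_def fun_eq_iff)
    have S: "y \<in> cell r 1 c \<longleftrightarrow> norm y = 1 \<and> (\<forall>i. c i \<in> {idx y i - 1..idx y i + 1})" for y c
    proof -
      have "\<bar>real_of_int u - real_of_int v\<bar> \<le> 1 \<longleftrightarrow> v \<in> {u - 1..u + 1}" for u v :: int
        by auto
      then show ?thesis by (auto simp: cell_def idx_def)
    qed
    define xc where "xc c = enn2real (\<integral>\<^sup>+x. ennreal ((indicator (cell r 0 c) x * norm (X x)) powr (3/2)) \<partial>S3)" for c
    define wc where "wc c = enn2real (\<integral>\<^sup>+x. ennreal ((indicator (cell r 1 c) x * norm (W x)) powr (3/2)) \<partial>S3)" for c
    have bX: "(\<integral>\<^sup>+x. ennreal ((indicator A x * norm (X x)) powr (3/2)) \<partial>S3) \<le> ennreal M" for A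
      by (rule order_trans[OF nn_integral_mono XM]) (auto intro!: ennreal_leI simp: indicator_def)
    have bW: "(\<integral>\<^sup>+x. ennreal ((indicator A x * norm (W x)) powr (3/2)) \<partial>S3) \<le> ennreal M" for A
      by (rule order_trans[OF nn_integral_mono WM]) (auto intro!: ennreal_leI simp: indicator_def)
    have xce: "(\<integral>\<^sup>+x. ennreal ((indicator (cell r 0 c) x * norm (X x)) powr (3/2)) \<partial>S3) = ennreal (xc c)" for c
      unfolding xc_def by (intro ennreal_enn2real[symmetric] le_less_trans[OF bX ennreal_less_top])
    have wce: "(\<integral>\<^sup>+x. ennreal ((indicator (cell r 1 c) x * norm (W x)) powr (3/2)) \<partial>S3) = ennreal (wc c)" for c
      unfolding wc_def by (intro ennreal_enn2real[symmetric] le_less_trans[OF bW ennreal_less_top])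
    have pos: "0 \<le> xc c" "0 \<le> wc c" for c by (auto simp: xc_def wc_def)
    have im: "(indicator (cell r b c) :: R4 \<Rightarrow> real) \<in> borel_measurable S3" for b c using cell_sets by simp
    have meas: "(\<lambda>x. indicator (cell r b c) x * norm (X x)) \<in> borel_measurable S3"
        "(\<lambda>x. indicator (cell r b c) x * norm (W x)) \<in> borel_measurable S3" for b c
      using im Xm Wm by simp_all
    have sum_le: "(\<Sum>c\<in>I. (\<integral>\<^sup>+x. ennreal ((indicator (cell r b c) x * norm (V x)) powr (3/2)) \<partial>S3)) \<le> ennreal (K * M)"
      if Vm: "V \<in> borel_measurable S3" and VM: "(\<integral>\<^sup>+x. ennreal (norm (V x) powr (3/2)) \<partial>S3) \<le> ennreal M"
        and K: "0 \<le> K" "\<And>x. norm x = 1 \<Longrightarrow> real (card {c \<in> I. x \<in> cell r b c}) \<le> K" for b K and V :: "R4 \<Rightarrow> R4"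
    proof -
      have "(\<Sum>c\<in>I. (\<integral>\<^sup>+x. ennreal ((indicator (cell r b c) x * norm (V x)) powr (3/2)) \<partial>S3))
        = (\<integral>\<^sup>+x. (\<Sum>c\<in>I. ennreal ((indicator (cell r b c) x * norm (V x)) powr (3/2))) \<partial>S3)"
        using im Vm by (intro nn_integral_sum[symmetric]) simp
      also have "\<dots> \<le> (\<integral>\<^sup>+x. ennreal K * ennreal (norm (V x) powr (3/2)) \<partial>S3)"
      proof (rule nn_integral_mono)
        fix x assume "x \<in> space S3"
        then have x: "norm x = 1" by simp
        have "(\<Sum>c\<in>I. ennreal ((indicator (cell r b c) x * norm (V x)) powr (3/2))) = ennreal (\<Sum>c\<in>I. (indicator (cell r b c) x * norm (V x)) powr (3/2))"
          by (rule sum_ennreal) simp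
        also have "(\<Sum>c\<in>I. (indicator (cell r b c) x * norm (V x)) powr (3/2)) = real (card {c \<in> I. x \<in> cell r b c}) * norm (V x) powr (3/2)"
        proof -
          have "(\<Sum>c\<in>I. (indicator (cell r b c) x * norm (V x)) powr (3/2)) = (\<Sum>c\<in>I. if x \<in> cell r b c then norm (V x) powr (3/2) else 0)"
            by (intro sum.cong refl) (simp add: indicator_def)
          also have "\<dots> = (\<Sum>c\<in>{c \<in> I. x \<in> cell r b c}. norm (V x) powr (3/2))"
            by (rule sum.inter_filter[OF fin, symmetric])
          finally show ?thesis by simp
        qed
        also have "ennreal \<dots> \<le> ennreal (K * norm (V x) powr (3/2))"
          using K(2)[OF x] by (intro ennreal_leI mult_right_mono) auto
        also have "\<dots> = ennreal K * ennreal (norm (V x) powr (3/2))" using K by (intro ennreal_mult) auto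
        finally show "(\<Sum>c\<in>I. ennreal ((indicator (cell r b c) x * norm (V x)) powr (3/2))) \<le> ennreal K * ennreal (norm (V x) powr (3/2))" .
      qed
      also have "\<dots> = ennreal K * (\<integral>\<^sup>+x. ennreal (norm (V x) powr (3/2)) \<partial>S3)"
        using Vm by (intro nn_integral_cmult) simp
      also have "\<dots> \<le> ennreal K * ennreal M" by (intro mult_left_mono VM) simp
      also have "\<dots> = ennreal (K * M)" using K M by (intro ennreal_mult[symmetric]) auto
      finally show ?thesis .
    qed
    have sx: "(\<Sum>c\<in>I. xc c) \<le> M"
    proof -
      have "real (card {c \<in> I. x \<in> cell r 0 c}) \<le> 1" if "norm x = 1" for x
      proof -
        have "{c \<in> I. x \<in> cell r 0 c} \<subseteq> {idx x}" by (auto simp: E)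
        then have "card {c \<in> I. x \<in> cell r 0 c} \<le> card {idx x}" by (intro card_mono) auto
        then show ?thesis by simp
      qed
      from sum_le[OF Xm XM _ this] have "(\<Sum>c\<in>I. ennreal (xc c)) \<le> ennreal M" by (simp add: xce)
      then show ?thesis using pos M by (simp add: sum_ennreal ennreal_le_iff)
    qed
    have sw: "(\<Sum>c\<in>I. wc c) \<le> 81 * M"
    proof -
      have "real (card {c \<in> I. x \<in> cell r 1 c}) \<le> 81" if "norm x = 1" for x
      proof -
        have sub: "{c \<in> I. x \<in> cell r 1 c} \<subseteq> PiE UNIV (\<lambda>i. {idx x i - 1..idx x i + 1})" by (auto simp: S)
        have "card {c \<in> I. x \<in> cell r 1 c} \<le> card (PiE UNIV (\<lambda>i. {idx x i - 1..idx x i + 1}))"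
          by (intro card_mono sub finite_PiE) auto
        also have "\<dots> = 81" by (simp add: card_PiE)
        finally show ?thesis by simp
      qed
      from sum_le[OF Wm WM _ this] have "(\<Sum>c\<in>I. ennreal (wc c)) \<le> ennreal (81 * M)" by (simp add: wce)
      then show ?thesis using pos M by (simp add: sum_ennreal ennreal_le_iff)
    qed
    \<comment> \<open>The enlarged cells overlap at most 81 times, so the number of bad cells is at
      most \<open>81 * M / \<epsilon>\<close>, independently of the grid size
      \<open>r\<close>.\<close>
    define bad where "bad = {c \<in> I. wc c > \<epsilon>}"
    have bfin: "finite bad" using fin by (simp add: bad_def)
    have "\<forall>c\<in>bad. \<exists>p. norm p = 1 \<and> idx p = c" by (auto simp: bad_def I_def)
    then obtain p where p: "\<And>c. c \<in> bad \<Longrightarrow> norm (p c) = 1 \<and> idx (p c) = c" by metis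
    define P where "P = p ` bad"
    have "real (card bad) * \<epsilon> = (\<Sum>c\<in>bad. \<epsilon>)" by simp
    also have "\<dots> \<le> (\<Sum>c\<in>bad. wc c)" by (intro sum_mono) (auto simp: bad_def)
    also have "\<dots> \<le> (\<Sum>c\<in>I. wc c)" using fin pos by (intro sum_mono2) (auto simp: bad_def)
    finally have "real (card bad) * \<epsilon> \<le> 81 * M" using sw by simp
    then have "real (card bad) \<le> 81 * M / \<epsilon>" using eps by (simp add: pos_le_divide_eq)
    then have cardP: "real (card P) \<le> 81 * M / \<epsilon>" using card_image_le[OF bfin, of p] unfolding P_def by linarith
    have wcM: "wc c \<le> 81 * M" if "c \<in> I" for c
      using member_le_sum[OF that, of wc] pos fin sw by force
    show "\<exists>P. finite P \<and> P \<subseteq> sphere 0 1 \<and> real (card P) \<le> 81 * M / \<epsilon> \<and>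
        (\<forall>z \<tau> N. (\<forall>x. norm x = 1 \<longrightarrow> 0 \<le> z x \<and> z x \<le> 1) \<longrightarrow>
          (\<forall>p\<in>P. \<forall>x. norm x = 1 \<longrightarrow> norm (x - p) \<le> 4 * r \<longrightarrow> z x \<le> \<epsilon>') \<longrightarrow>
          (\<forall>x y. norm x = 1 \<longrightarrow> norm y = 1 \<longrightarrow> r \<le> norm (x - y) \<longrightarrow> tailk N x y \<le> \<tau>) \<longrightarrow>
          (\<integral>\<^sup>+x. (\<integral>\<^sup>+y. ennreal (\<bar>z x\<bar> * norm (X x) * norm (W y) * tailk N x y) \<partial>S3) \<partial>S3)
            \<le> ennreal (C * (\<epsilon> powr (1/3) + \<epsilon>' * (81 * M) powr (1/3)) * (82 * M))
              + (\<integral>\<^sup>+x. (\<integral>\<^sup>+y. ennreal (\<tau> * (norm (X x) * norm (W y))) \<partial>S3) \<partial>S3))"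
    proof (intro exI[of _ P] conjI allI impI)
      show "finite P" "P \<subseteq> sphere 0 1" using bfin p by (auto simp: P_def)
      fix z :: "R4 \<Rightarrow> real" and \<tau> N
      assume z01: "\<forall>x. norm x = 1 \<longrightarrow> 0 \<le> z x \<and> z x \<le> 1"
        and zP: "\<forall>p\<in>P. \<forall>x. norm x = 1 \<longrightarrow> norm (x - p) \<le> 4 * r \<longrightarrow> z x \<le> \<epsilon>'"
        and tau: "\<forall>x y. norm x = 1 \<longrightarrow> norm y = 1 \<longrightarrow> r \<le> norm (x - y) \<longrightarrow> tailk N x y \<le> \<tau>"
      \<comment> \<open>A bound for \<open>z\<close> on the cell: on bad cells the cut-off is small,
        elsewhere it is at most 1.\<close>
      define kc where "kc c = (if c \<in> bad then \<epsilon>' else 1)" for c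
      have kc0: "0 \<le> kc c" for c using eps by (simp add: kc_def)
      let ?f = "\<lambda>c x. kc c * (indicator (cell r 0 c) x * norm (X x))" and ?g = "\<lambda>c y. indicator (cell r 1 c) y * norm (W y)"
      have zk: "z x \<le> kc (idx x)" if x: "norm x = 1" for x
      proof (cases "idx x \<in> bad")
        case True
        have eq: "idx (p (idx x)) = idx x" using p[OF True] by simp
        \<comment> \<open>Two points with the same index differ by at most \<open>r\<close> in each
          of the four coordinates, which is where the radius \<open>4 * r\<close> comes
          from.\<close>
        have "\<bar>(x - p (idx x)) $ i\<bar> \<le> r" for i
        proof -
          have "\<lfloor>p (idx x) $ i / r\<rfloor> = \<lfloor>x $ i / r\<rfloor>" using eq by (simp add: idx_def fun_eq_iff)
          then have "\<bar>x $ i / r - p (idx x) $ i / r\<bar> \<le> 1" by linarith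
          then have "\<bar>(x $ i - p (idx x) $ i) / r\<bar> \<le> 1" by (simp only: diff_divide_distrib)
          then show ?thesis using r by simp
        qed
        then have "(\<Sum>i\<in>UNIV. \<bar>(x - p (idx x)) $ i\<bar>) \<le> (\<Sum>i\<in>(UNIV::4 set). r)" by (intro sum_mono)
        then have "norm (x - p (idx x)) \<le> 4 * r" using norm_le_l1_cart[of "x - p (idx x)"] by simp
        then show ?thesis using zP x True by (simp add: kc_def P_def)
      qed (use z01 x in \<open>simp add: kc_def\<close>)
      have fm: "?f c \<in> borel_measurable S3" "?g c \<in> borel_measurable S3" for c using meas by simp_all
      have pm: "(\<lambda>p. ennreal (?f c (fst p) * ?g c (snd p) * tailk N (fst p) (snd p))) \<in> borel_measurable (S3 \<Otimes>\<^sub>M S3)" for c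
        using measurable_fst_S3'[OF fm(1)[of c]] measurable_snd_S3'[OF fm(2)[of c]] measurable_tailk[of N] by simp
      have sm: "(\<lambda>p. \<Sum>c\<in>I. ennreal (?f c (fst p) * ?g c (snd p) * tailk N (fst p) (snd p))) \<in> borel_measurable (S3 \<Otimes>\<^sub>M S3)"
        using pm by simp
      have tm: "(\<lambda>p. ennreal (\<tau> * (norm (X (fst p)) * norm (W (snd p))))) \<in> borel_measurable (S3 \<Otimes>\<^sub>M S3)"
        using measurable_fst_S3'[OF Xm] measurable_snd_S3'[OF Wm] by simp
      have "(\<integral>\<^sup>+x. (\<integral>\<^sup>+y. ennreal (\<bar>z x\<bar> * norm (X x) * norm (W y) * tailk N x y) \<partial>S3) \<partial>S3)
        \<le> (\<integral>\<^sup>+x. (\<integral>\<^sup>+y. (\<Sum>c\<in>I. ennreal (?f c x * ?g c y * tailk N x y)) + ennreal (\<tau> * (norm (X x) * norm (W y))) \<partial>S3) \<partial>S3)"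
      proof (intro nn_integral_mono)
        fix x y assume "x \<in> space S3" "y \<in> space S3"
        then have xy: "norm x = 1" "norm y = 1" by simp_all
        have t0: "0 \<le> tailk N x y" using tailk_nonneg xy by simp
        have z0: "0 \<le> z x" "z x \<le> 1" using z01 xy by auto
        show "ennreal (\<bar>z x\<bar> * norm (X x) * norm (W y) * tailk N x y) \<le> (\<Sum>c\<in>I. ennreal (?f c x * ?g c y * tailk N x y)) + ennreal (\<tau> * (norm (X x) * norm (W y)))"
        proof (cases "y \<in> cell r 1 (idx x)")
          case True
          have "z x * (norm (X x) * norm (W y) * tailk N x y) \<le> kc (idx x) * (norm (X x) * norm (W y) * tailk N x y)"
            using zk[OF xy(1)] t0 by (intro mult_right_mono) auto
          also have "\<dots> = ?f (idx x) x * ?g (idx x) y * tailk N x y"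
            using True xy by (simp add: E indicator_def)
          finally have "\<bar>z x\<bar> * norm (X x) * norm (W y) * tailk N x y \<le> ?f (idx x) x * ?g (idx x) y * tailk N x y"
            using z0 by (simp add: mult_ac)
          then have "ennreal (\<bar>z x\<bar> * norm (X x) * norm (W y) * tailk N x y) \<le> ennreal (?f (idx x) x * ?g (idx x) y * tailk N x y)"
            by (rule ennreal_leI)
          also have "\<dots> \<le> (\<Sum>c\<in>I. ennreal (?f c x * ?g c y * tailk N x y))"
            using fin xy by (intro member_le_sum) (auto simp: I_def)
          finally show ?thesis by (simp add: add_increasing2)
        next
          case False
          then obtain i where i: "idx x i \<notin> {idx y i - 1..idx y i + 1}" using xy by (auto simp: S)
          \<comment> \<open>Integer parts at least 2 apart force the quotients to be at least 1
            apart, so points outside the enlarged cell are at distance at least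
            \<open>r\<close>.\<close>
          have "\<bar>x $ i / r - y $ i / r\<bar> \<ge> 1"
          proof -
            have "idx x i \<le> idx y i - 2 \<or> idx y i + 2 \<le> idx x i" using i by auto
            then show ?thesis unfolding idx_def by linarith
          qed
          then have "\<bar>(x $ i - y $ i) / r\<bar> \<ge> 1" by (simp only: diff_divide_distrib)
          then have "r \<le> \<bar>(x - y) $ i\<bar>" using r by simp
          then have "r \<le> norm (x - y)" using component_le_norm_cart[of "x - y" i] by linarith
          then have "tailk N x y \<le> \<tau>" using tau xy by blast
          then have "z x * norm (X x) * norm (W y) * tailk N x y \<le> 1 * norm (X x) * norm (W y) * \<tau>"
            using z0 t0 by (intro mult_mono) auto
          then have "ennreal (\<bar>z x\<bar> * norm (X x) * norm (W y) * tailk N x y) \<le> ennreal (\<tau> * (norm (X x) * norm (W y)))"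
            using z0 by (intro ennreal_leI) (simp add: mult_ac)
          then show ?thesis by (simp add: add_increasing)
        qed
      qed
      also have "\<dots> = (\<integral>\<^sup>+x. (\<integral>\<^sup>+y. (\<Sum>c\<in>I. ennreal (?f c x * ?g c y * tailk N x y)) \<partial>S3) \<partial>S3) + (\<integral>\<^sup>+x. (\<integral>\<^sup>+y. ennreal (\<tau> * (norm (X x) * norm (W y))) \<partial>S3) \<partial>S3)"
        using nn_integral_S3_add[OF sm tm] unfolding fst_conv snd_conv .
      also have "(\<integral>\<^sup>+x. (\<integral>\<^sup>+y. (\<Sum>c\<in>I. ennreal (?f c x * ?g c y * tailk N x y)) \<partial>S3) \<partial>S3) \<le> ennreal (C * (\<epsilon> powr (1/3) + \<epsilon>' * (81 * M) powr (1/3)) * (82 * M))"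
      proof -
        have m1: "(\<lambda>y. ennreal (?f c x * ?g c y * tailk N x y)) \<in> borel_measurable S3" if "x \<in> space S3" for c x
          using measurable_compose[OF measurable_Pair1'[OF that] pm[of c]] by simp
        have m2: "(\<lambda>x. \<integral>\<^sup>+y. ennreal (?f c x * ?g c y * tailk N x y) \<partial>S3) \<in> borel_measurable S3" for c
          using S3.borel_measurable_nn_integral_fst[OF pm[of c]] by simp
        have "(\<integral>\<^sup>+x. (\<integral>\<^sup>+y. (\<Sum>c\<in>I. ennreal (?f c x * ?g c y * tailk N x y)) \<partial>S3) \<partial>S3)
          = (\<integral>\<^sup>+x. (\<Sum>c\<in>I. (\<integral>\<^sup>+y. ennreal (?f c x * ?g c y * tailk N x y) \<partial>S3)) \<partial>S3)"
          by (intro nn_integral_cong nn_integral_sum m1)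
        also have "\<dots> = (\<Sum>c\<in>I. (\<integral>\<^sup>+x. (\<integral>\<^sup>+y. ennreal (?f c x * ?g c y * tailk N x y) \<partial>S3) \<partial>S3))"
          by (intro nn_integral_sum m2)
        also have "\<dots> \<le> (\<Sum>c\<in>I. ennreal (C * (\<epsilon> powr (1/3) + \<epsilon>' * (81 * M) powr (1/3)) * (xc c + wc c)))"
        proof (rule sum_mono)
          fix c assume c: "c \<in> I"
          let ?K = "\<epsilon> powr (1/3) + \<epsilon>' * (81 * M) powr (1/3)"
          let ?h = "\<lambda>c x. indicator (cell r 0 c) x * norm (X x)"
          have hm: "(\<lambda>p. ennreal (?h c (fst p) * ?g c (snd p) * tailk N (fst p) (snd p))) \<in> borel_measurable (S3 \<Otimes>\<^sub>M S3)"
            using measurable_fst_S3'[OF meas(1)[of 0 c]] measurable_snd_S3'[OF meas(2)[of 1 c]] measurable_tailk[of N] by simp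
          have "(\<integral>\<^sup>+x. (\<integral>\<^sup>+y. ennreal (?f c x * ?g c y * tailk N x y) \<partial>S3) \<partial>S3) = (\<integral>\<^sup>+x. (\<integral>\<^sup>+y. ennreal (kc c) * ennreal (?h c x * ?g c y * tailk N x y) \<partial>S3) \<partial>S3)"
          proof (intro nn_integral_cong)
            fix x y assume "x \<in> space S3" "y \<in> space S3"
            then have t0: "0 \<le> tailk N x y" using tailk_nonneg by simp
            have "?f c x * ?g c y * tailk N x y = kc c * (?h c x * ?g c y * tailk N x y)" by (simp only: mult.assoc)
            then show "ennreal (?f c x * ?g c y * tailk N x y) = ennreal (kc c) * ennreal (?h c x * ?g c y * tailk N x y)"
              using kc0 t0 by (simp only: ennreal_mult mult_nonneg_nonneg indicator_pos_le norm_ge_zero)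
          qed
          also have "\<dots> = (\<integral>\<^sup>+x. ennreal (kc c) * (\<integral>\<^sup>+y. ennreal (?h c x * ?g c y * tailk N x y) \<partial>S3) \<partial>S3)"
            using measurable_compose[OF measurable_Pair1' hm] by (intro nn_integral_cong nn_integral_cmult) simp
          also have "\<dots> = ennreal (kc c) * (\<integral>\<^sup>+x. (\<integral>\<^sup>+y. ennreal (?h c x * ?g c y * tailk N x y) \<partial>S3) \<partial>S3)"
            using S3.borel_measurable_nn_integral_fst[OF hm] by (intro nn_integral_cmult) simp
          also have "\<dots> \<le> ennreal (kc c) * ennreal (C * (xc c powr (2/3) * wc c powr (2/3)))"
            using pos xce wce by (intro mult_left_mono hls meas) auto
          also have "\<dots> = ennreal (kc c * (C * (xc c powr (2/3) * wc c powr (2/3))))"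
            using kc0 C by (intro ennreal_mult[symmetric]) auto
          also have "\<dots> \<le> ennreal (C * ?K * (xc c + wc c))"
          proof (rule ennreal_leI)
            \<comment> \<open>One factor \<open>wc c powr (1/3)\<close> is spent on smallness,
              directly on good cells and through \<open>\<epsilon>'\<close> on bad ones. The other
              stays with \<open>xc c powr (2/3)\<close>, so that the bound can be summed over the
              cells; \<open>82 * M\<close> is \<open>M\<close> plus \<open>81 * M\<close>.\<close>
            have w23: "wc c powr (2/3) = wc c powr (1/3) * wc c powr (1/3)" by (simp add: powr_add[symmetric])
            have kw: "kc c * wc c powr (1/3) \<le> ?K"
            proof (cases "c \<in> bad")
              case True
              have "wc c powr (1/3) \<le> (81 * M) powr (1/3)" using pos wcM[OF c] by (intro powr_mono2) auto
              then have "\<epsilon>' * wc c powr (1/3) \<le> \<epsilon>' * (81 * M) powr (1/3)" using eps by (intro mult_left_mono) auto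
              then show ?thesis using True by (simp add: kc_def add_increasing)
            next
              case False
              then have "wc c \<le> \<epsilon>" using c by (simp add: bad_def)
              then have "wc c powr (1/3) \<le> \<epsilon> powr (1/3)" using pos by (intro powr_mono2) auto
              moreover have "0 \<le> \<epsilon>' * (81 * M) powr (1/3)" using eps by simp
              ultimately show ?thesis using False by (simp add: kc_def)
            qed
            have "kc c * (C * (xc c powr (2/3) * wc c powr (2/3))) = C * ((kc c * wc c powr (1/3)) * (xc c powr (2/3) * wc c powr (1/3)))"
              unfolding w23 by (simp add: mult_ac)
            also have "\<dots> \<le> C * (?K * (xc c + wc c))"
              using C kw kc0 pos powr_2_3_1_3_le[OF pos, of c c] eps by (intro mult_left_mono mult_mono) auto
            finally show "kc c * (C * (xc c powr (2/3) * wc c powr (2/3))) \<le> C * ?K * (xc c + wc c)" by (simp add: mult_ac)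
          qed
          finally show "(\<integral>\<^sup>+x. (\<integral>\<^sup>+y. ennreal (?f c x * ?g c y * tailk N x y) \<partial>S3) \<partial>S3) \<le> ennreal (C * ?K * (xc c + wc c))" .
        qed
        also have "\<dots> = ennreal (\<Sum>c\<in>I. C * (\<epsilon> powr (1/3) + \<epsilon>' * (81 * M) powr (1/3)) * (xc c + wc c))"
          using C eps pos by (intro sum_ennreal) auto
        also have "\<dots> \<le> ennreal (C * (\<epsilon> powr (1/3) + \<epsilon>' * (81 * M) powr (1/3)) * (82 * M))"
        proof (rule ennreal_leI)
          have "(\<Sum>c\<in>I. xc c + wc c) \<le> 82 * M" using sx sw by (simp add: sum.distrib)
          then show "(\<Sum>c\<in>I. C * (\<epsilon> powr (1/3) + \<epsilon>' * (81 * M) powr (1/3)) * (xc c + wc c)) \<le> C * (\<epsilon> powr (1/3) + \<epsilon>' * (81 * M) powr (1/3)) * (82 * M)"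
            unfolding sum_distrib_left[symmetric] using C eps by (intro mult_left_mono) auto
        qed
        finally show ?thesis .
      qed
      finally show "(\<integral>\<^sup>+x. (\<integral>\<^sup>+y. ennreal (\<bar>z x\<bar> * norm (X x) * norm (W y) * tailk N x y) \<partial>S3) \<partial>S3)
            \<le> ennreal (C * (\<epsilon> powr (1/3) + \<epsilon>' * (81 * M) powr (1/3)) * (82 * M))
              + (\<integral>\<^sup>+x. (\<integral>\<^sup>+y. ennreal (\<tau> * (norm (X x) * norm (W y))) \<partial>S3) \<partial>S3)"
        by (simp add: add_right_mono)
    qed (rule cardP)
  qed
qed

section \<open>Polynomial cut-offs\<close>

text \<open>Each factor vanishes at its point \<open>p\<close> and approaches 1 elsewhere on the
  sphere as \<open>m\<close> grows. This does the work of a bump function while staying within the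
  polynomials.\<close>

definition cutoff :: "nat \<Rightarrow> R4 set \<Rightarrow> R4 \<Rightarrow> real" where
  "cutoff m P x = (\<Prod>p\<in>P. 1 - sK p x ^ m)"

definition dcutoff :: "nat \<Rightarrow> R4 set \<Rightarrow> R4 \<Rightarrow> R4 \<Rightarrow> real" where
  "dcutoff m P x h = (\<Sum>p\<in>P. (- (real m * sK p x ^ (m-1) * (p \<bullet> h / 2))) * (\<Prod>q\<in>P - {p}. 1 - sK q x ^ m))"

lemma cutoff_polynomial:
  assumes "finite P"
  shows "real_polynomial_function (cutoff m P)"
proof -
  have "real_polynomial_function (\<lambda>x. 1 - sK p x ^ m)" for p
    unfolding diff_conv_add_uminus
    by (intro real_polynomial_function.intros(2,3) real_polynomial_function_minus real_polynomial_function_power real_polynomial_sK)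
  then have "real_polynomial_function (\<lambda>x. \<Prod>p\<in>P. 1 - sK p x ^ m)"
    using assms by (intro real_polynomial_function_prod) auto
  then show ?thesis unfolding cutoff_def .
qed

lemma measurable_cutoff: "finite P \<Longrightarrow> cutoff m P \<in> borel_measurable S3"
  by (intro borel_measurable_S3I borel_measurable_continuous_onI continuous_real_polynomial cutoff_polynomial)

lemma cutoff_has_derivative:
  assumes "finite P"
  shows "(cutoff m P has_derivative dcutoff m P x) (at x)"
proof -
  have d: "((\<lambda>x. 1 - sK p x ^ m) has_derivative (\<lambda>h. - (real m * sK p x ^ (m-1) * (p \<bullet> h / 2)))) (at x)" for p
    unfolding sK_def by (auto intro!: derivative_eq_intros simp: fun_eq_iff)
  show ?thesis
    unfolding cutoff_def dcutoff_def by (rule has_derivative_prod[OF d])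
qed

lemma cutoff_bounds:
  assumes P: "P \<subseteq> sphere 0 1" and x: "norm x = 1"
  shows "0 \<le> cutoff m P x" "cutoff m P x \<le> 1"
proof -
  have "0 \<le> 1 - sK p x ^ m \<and> 1 - sK p x ^ m \<le> 1" if "p \<in> P" for p
  proof -
    have "norm p = 1" using P that by auto
    then have "0 \<le> sK p x" "sK p x \<le> 1" using sK_bounds x by auto
    then show ?thesis by (simp add: power_le_one)
  qed
  then show "0 \<le> cutoff m P x" "cutoff m P x \<le> 1"
    unfolding cutoff_def by (auto intro!: prod_nonneg prod_le_1)
qed

lemma abs_dcutoff_le:
  assumes P: "P \<subseteq> sphere 0 1" and x: "norm x = 1"
  shows "\<bar>dcutoff m P x h\<bar> \<le> real (card P) * real m * norm h"
proof -
  have "\<bar>dcutoff m P x h\<bar> \<le> (\<Sum>p\<in>P. real m * norm h)"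
    unfolding dcutoff_def
  proof (rule order_trans[OF sum_abs sum_mono])
    fix p assume p: "p \<in> P"
    then have np: "norm p = 1" using P by auto
    have s: "0 \<le> sK p x" "sK p x \<le> 1" using sK_bounds[OF np x] by auto
    have sub: "P - {p} \<subseteq> sphere 0 1" using P by blast
    have 1: "\<bar>\<Prod>q\<in>P - {p}. 1 - sK q x ^ m\<bar> \<le> 1"
      using cutoff_bounds[OF sub x, of m] unfolding cutoff_def by simp
    have "\<bar>p \<bullet> h / 2\<bar> \<le> norm h" using Cauchy_Schwarz_ineq2[of p h] np by simp
    then have "\<bar>real m * sK p x ^ (m-1) * (p \<bullet> h / 2)\<bar> \<le> real m * 1 * norm h"
      unfolding abs_mult using s by (intro mult_mono) (auto simp: power_le_one)
    then have "\<bar>real m * sK p x ^ (m-1) * (p \<bullet> h / 2)\<bar> * \<bar>\<Prod>q\<in>P - {p}. 1 - sK q x ^ m\<bar> \<le> (real m * 1 * norm h) * 1"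
      using 1 by (intro mult_mono) auto
    then show "\<bar>- (real m * sK p x ^ (m-1) * (p \<bullet> h / 2)) * (\<Prod>q\<in>P - {p}. 1 - sK q x ^ m)\<bar> \<le> real m * norm h"
      by (simp add: abs_mult)
  qed
  then show ?thesis by (simp add: mult_ac)
qed

text \<open>Bernoulli's inequality bounds the factor belonging to \<open>p\<close> by
  \<open>m * (1 - sK p x)\<close>, which is quadratic in the distance; the other factors are at most
  1.\<close>

lemma cutoff_small:
  assumes fin: "finite P" and P: "P \<subseteq> sphere 0 1" and x: "norm x = 1" and p: "p \<in> P" and r: "norm (x - p) \<le> r"
  shows "cutoff m P x \<le> real m * r^2"
proof -
  have np: "norm p = 1" using P p by auto
  have s: "0 \<le> sK p x" "sK p x \<le> 1" using sK_bounds[OF np x] by auto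
  have r0: "0 \<le> r" using r norm_ge_zero order_trans by blast
  have "cutoff m P x = (1 - sK p x ^ m) * cutoff m (P - {p}) x"
    unfolding cutoff_def using fin p by (simp add: prod.remove)
  also have "\<dots> \<le> (1 - sK p x ^ m) * 1"
    using cutoff_bounds[of "P - {p}" x m] P x s by (intro mult_left_mono) (auto simp: power_le_one)
  also have "1 - sK p x ^ m \<le> real m * (1 - sK p x)"
    using Bernoulli_inequality[of "sK p x - 1" m] s by (simp add: algebra_simps)
  also have "1 - sK p x = (norm (p - x) / 2)^2" by (rule sK_dist[OF np x])
  also have "real m * (norm (p - x) / 2)^2 \<le> real m * r^2"
    using r r0 by (intro mult_left_mono power_mono) (auto simp: norm_minus_commute)
  finally show ?thesis by simp
qed

lemma one_minus_sum_le_prod: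
  fixes u :: "'a \<Rightarrow> real"
  assumes "finite P" "\<And>p. p \<in> P \<Longrightarrow> 0 \<le> u p \<and> u p \<le> 1"
  shows "1 - (\<Sum>p\<in>P. u p) \<le> (\<Prod>p\<in>P. 1 - u p)"
  using assms
proof (induction P)
  case (insert q P)
  have pr: "0 \<le> (\<Prod>p\<in>P. 1 - u p)" "(\<Prod>p\<in>P. 1 - u p) \<le> 1"
    using insert.prems by (auto intro!: prod_nonneg prod_le_1)
  have "u q * (\<Prod>p\<in>P. 1 - u p) \<le> u q * 1"
    using insert.prems pr by (intro mult_left_mono) auto
  moreover have "1 - (\<Sum>p\<in>P. u p) \<le> (\<Prod>p\<in>P. 1 - u p)" using insert by auto
  ultimately show ?case using insert.hyps by (simp add: left_diff_distrib)
qed simp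

text \<open>A product of factors \<open>1 - u\<close> is at least 1 minus the sum of the
  \<open>u\<close>, and each power of \<open>sK\<close> decays geometrically away from its
  point.\<close>

lemma cutoff_large:
  assumes fin: "finite P" and P: "P \<subseteq> sphere 0 1" and x: "norm x = 1" and R: "0 < R" "R \<le> 1" and far: "\<And>p. p \<in> P \<Longrightarrow> R \<le> norm (x - p)"
  shows "cutoff m P x \<ge> 1 - real (card P) * (1 - (R/2)^2)^m"
proof -
  have q: "0 \<le> sK p x ^ m \<and> sK p x ^ m \<le> (1 - (R/2)^2)^m \<and> sK p x ^ m \<le> 1" if p: "p \<in> P" for p
  proof -
    have np: "norm p = 1" using P p by auto
    have s: "0 \<le> sK p x" "sK p x \<le> 1" using sK_bounds[OF np x] by auto
    have "(R/2)^2 \<le> (norm (p - x) / 2)^2" using far[OF p] R by (intro power_mono) (auto simp: norm_minus_commute)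
    then have "sK p x \<le> 1 - (R/2)^2" using sK_dist[OF np x] by simp
    then show ?thesis using s by (auto intro: power_mono simp: power_le_one)
  qed
  have "1 - (\<Sum>p\<in>P. sK p x ^ m) \<le> (\<Prod>p\<in>P. 1 - sK p x ^ m)"
    using one_minus_sum_le_prod[OF fin, of "\<lambda>p. sK p x ^ m"] q by auto
  moreover have "(\<Sum>p\<in>P. sK p x ^ m) \<le> (\<Sum>p\<in>P. (1 - (R/2)^2)^m)" using q by (intro sum_mono) auto
  ultimately show ?thesis by (simp add: cutoff_def)
qed

section \<open>Uniform boundedness\<close>

lemma le_eta_powr:
  fixes t \<eta> :: real
  assumes "0 \<le> t" "0 < \<eta>"
  shows "t \<le> \<eta> * t powr (3/2) + 1 / \<eta>^2"
proof (cases "t \<le> 1 / \<eta>^2")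
  case True
  then show ?thesis using assms by (simp add: add_increasing)
next
  case False
  then have "(1 / \<eta>)^2 \<le> t" by (simp add: power_divide)
  then have "1 / \<eta> \<le> sqrt t" by (intro real_le_rsqrt)
  then have "1 \<le> \<eta> * sqrt t" using assms by (simp add: field_simps)
  then have "t * 1 \<le> t * (\<eta> * sqrt t)" using assms by (intro mult_left_mono)
  also have "\<dots> = \<eta> * t powr (3/2)"
    using powr_add[of t 1 "1/2"] assms by (simp add: powr_half_sqrt)
  finally show ?thesis using assms by (simp add: add_increasing2)
qed

text \<open>Gliding hump: a test function \<open>g\<close> violating the hypothesis is assembled from a subsequence
  with rapidly growing norms.\<close>
lemma uniform_boundedness_3_2:
  fixes f :: "nat \<Rightarrow> 'a \<Rightarrow> real"
  assumes f: "\<And>n. f n \<in> borel_measurable M" "\<And>n. integrable M (\<lambda>x. \<bar>f n x\<bar> powr (3/2))"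
    and bdd: "\<And>g. g \<in> borel_measurable M \<Longrightarrow> integrable M (\<lambda>x. \<bar>g x\<bar>^3) \<Longrightarrow> \<exists>B. \<forall>n. \<bar>\<integral>x. f n x * g x \<partial>M\<bar> \<le> B"
  shows "\<exists>K. \<forall>n. (\<integral>x. \<bar>f n x\<bar> powr (3/2) \<partial>M) \<le> K"
proof (rule ccontr)
  assume contra: "\<nexists>K. \<forall>n. (\<integral>x. \<bar>f n x\<bar> powr (3/2) \<partial>M) \<le> K"
  define I where "I n = (\<integral>x. \<bar>f n x\<bar> powr (3/2) \<partial>M)" for n
  \<comment> \<open>Norms of at least \<open>6^k\<close> will be met by humps of size
    \<open>(1/5)^k\<close>, so the pairings grow at least like \<open>(6/5)^k\<close>.\<close>
  have "\<forall>k. \<exists>n. I n > (6^k) powr (3/2)" using contra unfolding I_def by (meson not_le)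
  then obtain \<nu> where nu: "\<And>k. I (\<nu> k) > (6^k) powr (3/2)" by metis
  define J where "J k = I (\<nu> k)" for k
  define N where "N k = J k powr (2/3)" for k
  have J0: "J k > 0" for k using nu[of k] powr_ge_zero[of "6^k" "3/2"] unfolding J_def by linarith
  have N6: "N k \<ge> 6^k" for k
  proof -
    have "(6::real)^k = ((6^k) powr (3/2)) powr (2/3)" by (simp add: powr_powr)
    also have "\<dots> \<le> N k" unfolding N_def J_def using nu[of k] by (intro powr_mono2) auto
    finally show ?thesis .
  qed
  have N0: "N k > 0" for k using J0[of k] by (simp add: N_def)
  have NJ: "N k powr (3/2) = J k" for k using J0[of k] by (simp add: N_def powr_powr)
  let ?F = "\<lambda>k. f (\<nu> k)"
  \<comment> \<open>The extremal function in Holder's inequality for \<open>?F k\<close>, normalized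
    in L^3; its pairing with \<open>?F k\<close> is the norm \<open>N k\<close>.\<close>
  define d where "d k x = sgn (?F k x) * sqrt \<bar>?F k x\<bar> / sqrt (N k)" for k x
  have dm: "d k \<in> borel_measurable M" for k unfolding d_def using f(1)[of "\<nu> k"] by simp
  have sq: "sqrt t * sqrt t * sqrt t = t powr (3/2)" if "0 \<le> t" for t :: real
    using powr_add[of t 1 "1/2"] that by (simp add: powr_half_sqrt)
  have d3: "\<bar>d k x\<bar>^3 = \<bar>?F k x\<bar> powr (3/2) / J k" for k x
  proof -
    have "\<bar>d k x\<bar> = sqrt \<bar>?F k x\<bar> / sqrt (N k)"
      using N0[of k] by (auto simp: d_def abs_mult abs_sgn_eq)
    then have "\<bar>d k x\<bar>^3 = (sqrt \<bar>?F k x\<bar> * sqrt \<bar>?F k x\<bar> * sqrt \<bar>?F k x\<bar>) / (sqrt (N k) * sqrt (N k) * sqrt (N k))"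
      by (simp add: power3_eq_cube)
    then show ?thesis using sq[of "\<bar>?F k x\<bar>"] sq[of "N k"] N0[of k] by (simp add: NJ)
  qed
  have d3i: "integrable M (\<lambda>x. \<bar>d k x\<bar>^3)" and d3v: "(\<integral>x. \<bar>d k x\<bar>^3 \<partial>M) = 1" for k
    unfolding d3 using f(2)[of "\<nu> k"] J0[of k] by (simp_all add: J_def I_def)
  have Fd: "?F k x * d k x = \<bar>?F k x\<bar> powr (3/2) / sqrt (N k)" for k x
  proof -
    have "?F k x * d k x = \<bar>?F k x\<bar> * sqrt \<bar>?F k x\<bar> / sqrt (N k)"
      by (simp add: d_def sgn_if)
    then show ?thesis using sq[of "\<bar>?F k x\<bar>"] by simp
  qed
  have Fdv: "(\<integral>x. ?F k x * d k x \<partial>M) = N k" for k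
  proof -
    have "(\<integral>x. ?F k x * d k x \<partial>M) = J k / sqrt (N k)" unfolding Fd by (simp add: J_def I_def)
    also have "\<dots> = N k * sqrt (N k) / sqrt (N k)"
      using NJ[of k] sq[of "N k"] N0[of k] by simp
    finally show ?thesis using N0[of k] by simp
  qed
  have Fi: "integrable M (\<lambda>x. \<bar>?F k x\<bar> powr (3/2))" for k using f(2) .
  have Fdi: "integrable M (\<lambda>x. ?F k x * d j x)" and Fdb: "(\<integral>x. \<bar>?F k x * d j x\<bar> \<partial>M) \<le> 2 * N k" for k j
  proof -
    have y: "\<bar>?F k x * d j x\<bar> \<le> N k * (\<bar>?F k x\<bar> powr (3/2) / J k + \<bar>d j x\<bar>^3)" for x
    proof -
      have "\<bar>?F k x * d j x\<bar> = N k * ((\<bar>?F k x\<bar> / N k) * \<bar>d j x\<bar>)" using N0[of k] by (simp add: abs_mult)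
      also have "\<dots> \<le> N k * ((\<bar>?F k x\<bar> / N k) powr (3/2) + \<bar>d j x\<bar>^3)"
        using N0[of k] by (intro mult_left_mono young_3_2) auto
      finally show ?thesis using N0[of k] by (simp add: powr_divide NJ)
    qed
    have i: "integrable M (\<lambda>x. N k * (\<bar>?F k x\<bar> powr (3/2) / J k + \<bar>d j x\<bar>^3))" using Fi d3i by simp
    have m: "(\<lambda>x. ?F k x * d j x) \<in> borel_measurable M" using f(1) dm by simp
    show g: "integrable M (\<lambda>x. ?F k x * d j x)"
      by (rule Bochner_Integration.integrable_bound[OF i m AE_I2]) (use y in \<open>auto intro: order_trans[OF _ abs_ge_self]\<close>)
    have "(\<integral>x. \<bar>?F k x * d j x\<bar> \<partial>M) \<le> (\<integral>x. N k * (\<bar>?F k x\<bar> powr (3/2) / J k + \<bar>d j x\<bar>^3) \<partial>M)"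
      using g i y by (intro integral_mono) auto
    also have "\<dots> = N k * ((\<integral>x. \<bar>?F k x\<bar> powr (3/2) / J k \<partial>M) + (\<integral>x. \<bar>d j x\<bar>^3 \<partial>M))"
      using Fi d3i by simp
    also have "\<dots> = N k * 2" using d3v J0[of k] by (simp add: J_def I_def)
    finally show "(\<integral>x. \<bar>?F k x * d j x\<bar> \<partial>M) \<le> 2 * N k" by simp
  qed
  \<comment> \<open>The sign of each hump is chosen so that it does not cancel the earlier ones: if
    \<open>\<bar>L + t\<bar> < t\<close> then \<open>\<bar>L - t\<bar> \<ge> t\<close>.\<close>
  define s where "s = rec_nat (\<lambda>_. 0) (\<lambda>k g. if (1/5)^k * N k \<le> \<bar>\<integral>x. ?F k x * (g x + (1/5)^k * d k x) \<partial>M\<bar>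
      then (\<lambda>x. g x + (1/5)^k * d k x) else (\<lambda>x. g x - (1/5)^k * d k x))"
  have s0: "s 0 = (\<lambda>_. 0)" by (simp add: s_def)
  have sS: "s (Suc k) = (if (1/5)^k * N k \<le> \<bar>\<integral>x. ?F k x * (s k x + (1/5)^k * d k x) \<partial>M\<bar>
      then (\<lambda>x. s k x + (1/5)^k * d k x) else (\<lambda>x. s k x - (1/5)^k * d k x))" for k
    by (simp add: s_def)
  have step: "\<exists>\<sigma>. \<bar>\<sigma>\<bar> = (1/5)^k \<and> (\<forall>x. s (Suc k) x = s k x + \<sigma> * d k x)" for k
  proof (cases "(1/5)^k * N k \<le> \<bar>\<integral>x. ?F k x * (s k x + (1/5)^k * d k x) \<partial>M\<bar>")
    case True
    then show ?thesis by (intro exI[of _ "(1/5)^k"]) (simp add: sS)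
  next
    case False
    then show ?thesis by (intro exI[of _ "- ((1/5)^k)"]) (simp add: sS)
  qed
  then obtain \<sigma> where sig: "\<And>k. \<bar>\<sigma> k\<bar> = (1/5)^k" and sk: "\<And>k x. s (Suc k) x = s k x + \<sigma> k * d k x" by metis
  have sm: "s k \<in> borel_measurable M" for k
  proof (induction k)
    case (Suc k)
    have "s (Suc k) = (\<lambda>x. s k x + \<sigma> k * d k x)" using sk by blast
    then show ?case using Suc dm[of k] by simp
  qed (simp add: s0)
  have Fsi: "integrable M (\<lambda>x. ?F k x * s j x)" for k j
  proof (induction j)
    case (Suc j)
    have "(\<lambda>x. ?F k x * s (Suc j) x) = (\<lambda>x. ?F k x * s j x + \<sigma> j * (?F k x * d j x))"
      by (simp add: sk distrib_left mult_ac)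
    then show ?case using Suc Fdi[of k j] by simp
  qed (simp add: s0)
  have big: "(1/5)^k * N k \<le> \<bar>\<integral>x. ?F k x * s (Suc k) x \<partial>M\<bar>" for k
  proof (cases "(1/5)^k * N k \<le> \<bar>\<integral>x. ?F k x * (s k x + (1/5)^k * d k x) \<partial>M\<bar>")
    case True
    then show ?thesis by (simp add: sS)
  next
    case False
    let ?L = "\<integral>x. ?F k x * s k x \<partial>M" and ?t = "(1/5)^k * N k"
    have t0: "0 \<le> ?t" using N0[of k] by simp
    have split: "(\<integral>x. ?F k x * (s k x + c * d k x) \<partial>M) = ?L + c * N k" for c
    proof -
      have "(\<integral>x. ?F k x * (s k x + c * d k x) \<partial>M) = (\<integral>x. ?F k x * s k x + c * (?F k x * d k x) \<partial>M)"
        by (intro Bochner_Integration.integral_cong refl) (simp add: distrib_left mult_ac)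
      then show ?thesis using Fsi Fdi Fdv by simp
    qed
    have "\<bar>?L + ?t\<bar> < ?t" using False split[of "(1/5)^k"] by simp
    then have "?t \<le> \<bar>?L - ?t\<bar>" using t0 by linarith
    moreover have "(\<integral>x. ?F k x * s (Suc k) x \<partial>M) = ?L - ?t"
      using split[of "- ((1/5)^k)"] False by (simp add: sS)
    ultimately show ?thesis by simp
  qed
  \<comment> \<open>The weight is the cube of 2/5. Writing 1/5 as 1/2 times 2/5 lets one factor be
    controlled by this series and leaves the other for a geometric sum.\<close>
  define S where "S x = (\<Sum>j. (8/125)^j * \<bar>d j x\<bar>^3)" for x
  have ae: "AE x in M. summable (\<lambda>j. (8/125)^j * \<bar>d j x\<bar>^3)"
  proof -
    have "(\<integral>\<^sup>+x. (\<Sum>j. ennreal ((8/125)^j * \<bar>d j x\<bar>^3)) \<partial>M) = (\<Sum>j. \<integral>\<^sup>+x. ennreal ((8/125)^j * \<bar>d j x\<bar>^3) \<partial>M)"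
      using dm by (intro nn_integral_suminf) simp
    also have "\<dots> = (\<Sum>j. ennreal ((8/125)^j))"
      using d3i d3v by (intro suminf_cong) (subst nn_integral_eq_integral, auto)
    also have "\<dots> = ennreal (\<Sum>j. (8/125)^j)"
      by (intro suminf_ennreal2 summable_geometric) auto
    finally have "(\<integral>\<^sup>+x. (\<Sum>j. ennreal ((8/125)^j * \<bar>d j x\<bar>^3)) \<partial>M) \<noteq> \<infinity>" by simp
    then have "AE x in M. (\<Sum>j. ennreal ((8/125)^j * \<bar>d j x\<bar>^3)) \<noteq> \<infinity>"
      using dm by (intro nn_integral_PInf_AE) simp_all
    then show ?thesis by eventually_elim (intro summable_suminf_not_top, auto)
  qed
  have Si: "integrable M S"
    unfolding S_def
  proof (rule integrable_suminf)
    show "integrable M (\<lambda>x. (8/125)^j * \<bar>d j x\<bar>^3)" for j using d3i by simp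
    show "AE x in M. summable (\<lambda>j. norm ((8/125)^j * \<bar>d j x\<bar>^3))" using ae by simp
    show "summable (\<lambda>j. \<integral>x. norm ((8/125)^j * \<bar>d j x\<bar>^3) \<partial>M)" using d3v by (simp add: summable_geometric)
  qed
  have pt: "\<exists>l. (\<lambda>k. s k x) \<longlonglongrightarrow> l \<and> \<bar>l\<bar>^3 \<le> 8 * S x \<and> (\<forall>k. \<bar>s k x\<bar>^3 \<le> 8 * S x)"
    if sm: "summable (\<lambda>j. (8/125)^j * \<bar>d j x\<bar>^3)" for x
  proof -
    define B where "B = root 3 (S x)"
    have S0: "0 \<le> S x" unfolding S_def using sm by (intro suminf_nonneg) auto
    have B3: "B^3 = S x" "0 \<le> B" using S0 by (simp_all add: B_def)
    have dB: "(2/5)^j * \<bar>d j x\<bar> \<le> B" for j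
    proof -
      have "(8/125)^j * \<bar>d j x\<bar>^3 \<le> S x"
        unfolding S_def using sum_le_suminf[OF sm, of "{j}"] by simp
      moreover have "((2/5)^j)^3 = ((8/125)::real)^j" by (simp add: power_mult[symmetric] mult.commute[of j]) (simp add: power_mult power3_eq_cube)
      ultimately have "((2/5)^j * \<bar>d j x\<bar>)^3 \<le> B^3" by (simp add: power_mult_distrib B3)
      then show ?thesis using B3(2) by (simp add: power_mono_iff)
    qed
    have tb: "\<bar>\<sigma> j * d j x\<bar> \<le> (1/2)^j * B" for j
    proof -
      have "\<bar>\<sigma> j * d j x\<bar> = (1/2)^j * ((2/5)^j * \<bar>d j x\<bar>)"
        by (simp add: abs_mult sig power_mult_distrib[symmetric])
      also have "\<dots> \<le> (1/2)^j * B" using dB by (intro mult_left_mono) auto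
      finally show ?thesis .
    qed
    have ssum: "s k x = (\<Sum>j<k. \<sigma> j * d j x)" for k by (induction k) (simp_all add: s0 sk)
    have sumB: "summable (\<lambda>j. (1/2)^j * B)" by (intro summable_mult2 summable_geometric) simp
    have "summable (\<lambda>j. \<sigma> j * d j x)"
      by (rule summable_comparison_test'[OF sumB]) (use tb in simp)
    then have lim: "(\<lambda>k. s k x) \<longlonglongrightarrow> (\<Sum>j. \<sigma> j * d j x)" unfolding ssum by (rule summable_LIMSEQ)
    have sb: "\<bar>s k x\<bar> \<le> 2 * B" for k
    proof -
      have "\<bar>s k x\<bar> \<le> (\<Sum>j<k. (1/2)^j * B)" unfolding ssum by (rule order_trans[OF sum_abs sum_mono]) (rule tb)
      also have "\<dots> \<le> (\<Sum>j. (1/2)^j * B)" using sumB B3 by (intro sum_le_suminf) auto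
      also have "\<dots> = 2 * B" by (simp add: suminf_mult2[symmetric] suminf_geometric)
      finally show ?thesis .
    qed
    have lb: "\<bar>\<Sum>j. \<sigma> j * d j x\<bar> \<le> 2 * B"
      using LIMSEQ_le_const2[OF tendsto_rabs[OF lim]] sb by blast
    have cube: "\<bar>u\<bar>^3 \<le> 8 * S x" if "\<bar>u\<bar> \<le> 2 * B" for u
    proof -
      have "\<bar>u\<bar>^3 \<le> (2 * B)^3" using that by (intro power_mono) auto
      then show ?thesis by (simp add: power_mult_distrib B3)
    qed
    show ?thesis using lim cube[OF lb] cube[OF sb] by blast
  qed
  define g where "g x = lim (\<lambda>k. s k x)" for x
  have gm: "g \<in> borel_measurable M" unfolding g_def by (rule borel_measurable_lim_metric) (rule sm)
  have gae: "AE x in M. (\<lambda>k. s k x) \<longlonglongrightarrow> g x \<and> \<bar>g x\<bar>^3 \<le> 8 * S x \<and> (\<forall>k. \<bar>s k x\<bar>^3 \<le> 8 * S x)"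
    using ae
  proof eventually_elim
    case (elim x)
    then obtain l where l: "(\<lambda>k. s k x) \<longlonglongrightarrow> l" "\<bar>l\<bar>^3 \<le> 8 * S x" "\<forall>k. \<bar>s k x\<bar>^3 \<le> 8 * S x" using pt by blast
    then have "g x = l" unfolding g_def by (intro limI)
    then show ?case using l by simp
  qed
  have g3: "integrable M (\<lambda>x. \<bar>g x\<bar>^3)"
  proof (rule Bochner_Integration.integrable_bound[of M "\<lambda>x. 8 * S x"])
    show "AE x in M. norm (\<bar>g x\<bar>^3) \<le> norm (8 * S x)" using gae by eventually_elim auto
  qed (use Si gm in simp_all)
  obtain B where B: "\<And>n. \<bar>\<integral>x. f n x * g x \<partial>M\<bar> \<le> B" using bdd[OF gm g3] by blast
  have low: "1/2 * (6/5)^k \<le> B" for k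
  proof -
    have lim: "(\<lambda>m. \<integral>x. ?F k x * s m x \<partial>M) \<longlonglongrightarrow> (\<integral>x. ?F k x * g x \<partial>M)"
    proof (rule integral_dominated_convergence[where w = "\<lambda>x. \<bar>?F k x\<bar> powr (3/2) + 8 * S x"])
      show "AE x in M. (\<lambda>m. ?F k x * s m x) \<longlonglongrightarrow> ?F k x * g x"
        using gae by eventually_elim (intro tendsto_intros, blast)
      show "AE x in M. norm (?F k x * s m x) \<le> \<bar>?F k x\<bar> powr (3/2) + 8 * S x" for m
        using gae
      proof eventually_elim
        case (elim x)
        have "\<bar>?F k x\<bar> * \<bar>s m x\<bar> \<le> \<bar>?F k x\<bar> powr (3/2) + \<bar>s m x\<bar>^3" by (intro young_3_2) auto
        moreover have "\<bar>s m x\<bar>^3 \<le> 8 * S x" using elim by blast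
        ultimately show ?case unfolding real_norm_def abs_mult by linarith
      qed
    qed (use Fi Si f(1) sm gm in simp_all)
    have fin: "\<bar>(\<integral>x. ?F k x * s (Suc k + m) x \<partial>M) - (\<integral>x. ?F k x * s (Suc k) x \<partial>M)\<bar> \<le> (\<Sum>j<m. (1/5)^(Suc k + j) * (2 * N k))" for m
    proof (induction m)
      case (Suc m)
      have "(\<integral>x. ?F k x * s (Suc k + Suc m) x \<partial>M) = (\<integral>x. ?F k x * s (Suc k + m) x + \<sigma> (Suc k + m) * (?F k x * d (Suc k + m) x) \<partial>M)"
        by (intro Bochner_Integration.integral_cong refl) (simp add: sk distrib_left mult_ac)
      also have "\<dots> = (\<integral>x. ?F k x * s (Suc k + m) x \<partial>M) + \<sigma> (Suc k + m) * (\<integral>x. ?F k x * d (Suc k + m) x \<partial>M)"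
        using Fsi Fdi by simp
      finally have eq: "(\<integral>x. ?F k x * s (Suc k + Suc m) x \<partial>M) = \<dots>" .
      have "\<bar>\<integral>x. ?F k x * d (Suc k + m) x \<partial>M\<bar> \<le> 2 * N k"
        by (rule order_trans[OF integral_abs_bound Fdb])
      then have "\<bar>\<sigma> (Suc k + m) * (\<integral>x. ?F k x * d (Suc k + m) x \<partial>M)\<bar> \<le> (1/5)^(Suc k + m) * (2 * N k)"
        unfolding abs_mult sig by (intro mult_left_mono) auto
      then show ?case using Suc unfolding eq by simp
    qed simp
    \<comment> \<open>All later humps together change the pairing by at most half of what step
      \<open>k\<close> contributed, since the powers of 1/5 beyond \<open>k\<close> sum to a quarter
      of the \<open>k\<close>-th and each pairing is at most \<open>2 * N k\<close>.\<close>
    have geo: "(\<Sum>j<m. (1/5)^(Suc k + j) * (2 * N k)) \<le> 1/2 * ((1/5)^k * N k)" for m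
    proof -
      have "(\<Sum>j<m. (1/5)^(Suc k + j) * (2 * N k)) = (\<Sum>j<m. (1/5)^j) * ((1/5)^Suc k * (2 * N k))"
        unfolding sum_distrib_right by (intro sum.cong refl) (simp only: power_add mult_ac)
      also have "(\<Sum>j<m. (1/5::real)^j) \<le> (\<Sum>j. (1/5)^j)" by (intro sum_le_suminf summable_geometric) auto
      also have "(\<Sum>j. (1/5::real)^j) = 5/4" by (simp add: suminf_geometric)
      finally show ?thesis using N0[of k] by (simp add: mult_ac)
    qed
    have "(\<lambda>m. \<integral>x. ?F k x * s (Suc k + m) x \<partial>M) \<longlonglongrightarrow> (\<integral>x. ?F k x * g x \<partial>M)"
      using LIMSEQ_ignore_initial_segment[OF lim, of "Suc k"] by (simp only: add.commute)
    then have "(\<lambda>m. \<bar>(\<integral>x. ?F k x * s (Suc k + m) x \<partial>M) - (\<integral>x. ?F k x * s (Suc k) x \<partial>M)\<bar>) \<longlonglongrightarrow> \<bar>(\<integral>x. ?F k x * g x \<partial>M) - (\<integral>x. ?F k x * s (Suc k) x \<partial>M)\<bar>"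
      by (intro tendsto_intros)
    then have "\<bar>(\<integral>x. ?F k x * g x \<partial>M) - (\<integral>x. ?F k x * s (Suc k) x \<partial>M)\<bar> \<le> 1/2 * ((1/5)^k * N k)"
      by (rule LIMSEQ_le_const2) (use order_trans[OF fin geo] in blast)
    then have "1/2 * ((1/5)^k * N k) \<le> \<bar>\<integral>x. ?F k x * g x \<partial>M\<bar>" using big[of k] by linarith
    also have "\<dots> \<le> B" using B .
    finally have "1/2 * ((1/5)^k * N k) \<le> B" .
    moreover have "(6/5)^k \<le> (1/5)^k * N k"
    proof -
      have "(6/5::real)^k = (1/5)^k * 6^k" by (simp add: power_mult_distrib[symmetric])
      also have "\<dots> \<le> (1/5)^k * N k" using N6 by (intro mult_left_mono) auto
      finally show ?thesis .
    qed
    ultimately show ?thesis by linarith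
  qed
  obtain k where "(6/5::real)^k > 2 * B" using real_arch_pow[of "6/5" "2 * B"] by auto
  then show False using low[of k] by linarith
qed

section \<open>A priori bound and uniqueness\<close>

text \<open>The hypotheses on one member of the sequence, with the two-form replaced by the field
  \<open>W\<close>. Everything is tested against continuous fields, which makes the notion stable
  under the limits taken below.\<close>

definition admissible :: "(R4 \<Rightarrow> R4) \<Rightarrow> (R4 \<Rightarrow> R4) \<Rightarrow> bool" where
  "admissible a W \<longleftrightarrow> L3v a \<and> divfree (\<lambda>x. norm (a x) *\<^sub>R a x) \<and> L32v W \<and> curl_of a W"

lemma integral_norm_le_eta:
  assumes X: "L32v X" and eta: "0 < \<eta>"
  shows "(\<integral>x. norm (X x) \<partial>S3) \<le> \<eta> * (\<integral>x. norm (X x) powr (3/2) \<partial>S3) + area3 / \<eta>^2"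
proof -
  have "(\<integral>x. norm (X x) \<partial>S3) \<le> (\<integral>x. \<eta> * norm (X x) powr (3/2) + 1 / \<eta>^2 \<partial>S3)"
    using X L32v_integrable[OF X] le_eta_powr[OF norm_ge_zero eta] by (intro integral_mono) (auto simp: L32v_def)
  also have "\<dots> = \<eta> * (\<integral>x. norm (X x) powr (3/2) \<partial>S3) + area3 / \<eta>^2"
    using X by (simp add: L32v_def area3_def)
  finally show ?thesis .
qed

lemma nn_integral_L32v:
  assumes "L32v X"
  shows "(\<integral>\<^sup>+x. ennreal (norm (X x) powr (3/2)) \<partial>S3) = ennreal (\<integral>x. norm (X x) powr (3/2) \<partial>S3)"
  using assms by (intro nn_integral_eq_integral) (auto simp: L32v_def)

lemma gamN_0 [simp]: "gamN 0 s = 0"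
  by (simp add: gamN_def)

text \<open>For \<open>X = norm a * a\<close> and \<open>z = 1\<close> the product of
  \<open>X\<close> and \<open>a\<close> is the cube of the norm, and the integral \<open>P\<close>
  of that cube is also that of the power 3/2 of \<open>X\<close>. The right-hand side grows at most
  like the power 2/3 of \<open>P\<close>, apart from the L^1 norm of \<open>X\<close>; both are
  bounded by a small multiple of \<open>P\<close> and absorbed.\<close>

lemma a_priori_bound:
  assumes Q: "0 \<le> Q"
  shows "\<exists>B. \<forall>a W. admissible a W \<longrightarrow> (\<integral>x. norm (W x) powr (3/2) \<partial>S3) \<le> Q \<longrightarrow> (\<integral>x. norm (a x)^3 \<partial>S3) \<le> B"
proof -
  obtain C where C: "C > 0" and hls: 
    "\<And>f g P Q N. f \<in> borel_measurable S3 \<Longrightarrow> g \<in> borel_measurable S3 \<Longrightarrow> (\<And>x. 0 \<le> f x) \<Longrightarrow> (\<And>x. 0 \<le> g x) \<Longrightarrow>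
      0 \<le> P \<Longrightarrow> 0 \<le> Q \<Longrightarrow>
      (\<integral>\<^sup>+x. ennreal (f x powr (3/2)) \<partial>S3) \<le> ennreal P \<Longrightarrow>
      (\<integral>\<^sup>+x. ennreal (g x powr (3/2)) \<partial>S3) \<le> ennreal Q \<Longrightarrow>
      (\<integral>\<^sup>+x. (\<integral>\<^sup>+y. ennreal (f x * g y * tailk N x y) \<partial>S3) \<partial>S3) \<le> ennreal (C * (P powr (2/3) * Q powr (2/3)))"
    by (rule hls_tail) blast
  define K1 where "K1 = 3/2 * (Q + area3) + 72 * C * Q powr (2/3)"
  have K1: "K1 > 0" using Q C area3_pos by (auto simp: K1_def intro!: add_pos_nonneg)
  \<comment> \<open>\<open>K1\<close> collects all coefficients of \<open>\<eta> * P\<close>; this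
    choice makes their total half of the factor \<open>area3\<close> on the left.\<close>
  define \<eta> where "\<eta> = area3 / (2 * K1)"
  have eta: "\<eta> > 0" using K1 area3_pos by (simp add: \<eta>_def)
  define K2 where "K2 = 3/2 * (area3 / \<eta>^2) * (Q + area3) + 72 * C * Q powr (2/3) / \<eta>^2"
  show ?thesis
  proof (intro exI[of _ "2 * K2 / area3"] allI impI)
    fix a W assume adm: "admissible a W" and WQ: "(\<integral>x. norm (W x) powr (3/2) \<partial>S3) \<le> Q"
    define X where "X x = norm (a x) *\<^sub>R a x" for x
    have a: "L3v a" and Xd: "divfree X" and W: "L32v W" and c: "curl_of a W"
      using adm unfolding admissible_def X_def by auto
    have X: "L32v X" unfolding X_def using L32v_of_L3v[OF a] .
    define P where "P = (\<integral>x. norm (a x)^3 \<partial>S3)"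
    have P0: "0 \<le> P" by (simp add: P_def)
    have XP: "(\<integral>x. norm (X x) powr (3/2) \<partial>S3) = P"
      unfolding P_def X_def by (simp add: square_powr_3_2 flip: power2_eq_square)
    have Wi: "integrable S3 W" and Xi: "integrable S3 X" using L32v_integrable W X by auto
    \<comment> \<open>At truncation order 0 the test field \<open>Fk\<close> vanishes, so
      \<open>Bterm\<close> retains only the frame means and the whole kernel counts as tail.
      \<open>Cterm\<close> vanishes as the derivative of \<open>z\<close> is zero.\<close>
    let ?z = "\<lambda>_::R4. 1::real" and ?z' = "\<lambda>(_::R4) (_::R4). 0::real"
    have z: "real_polynomial_function ?z" "\<And>x. (?z has_derivative ?z' x) (at x)"
      by (auto intro: real_polynomial_function.intros)
    have XW1: "(\<integral>x. norm (W x) \<partial>S3) \<le> Q + area3" "(\<integral>x. norm (X x) \<partial>S3) \<le> \<eta> * P + area3 / \<eta>^2"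
      using integral_norm_le_eta[OF W, of 1] integral_norm_le_eta[OF X eta] WQ XP by simp_all
    have Bt: "\<bar>Bterm ?z X W 0\<bar> \<le> 3/2 * (\<eta> * P + area3 / \<eta>^2) * (Q + area3)"
    proof -
      let ?h = "\<lambda>k x. \<integral>y. W y \<bullet> (Fk 0 k x y - (1/2) *\<^sub>R fr k y) \<partial>S3"
      have h: "\<bar>?h k x\<bar> \<le> 1/2 * (Q + area3)" for k x
      proof -
        have "\<bar>?h k x\<bar> \<le> (\<integral>y. 1/2 * norm (W y) \<partial>S3)"
        proof (rule order_trans[OF integral_abs_bound integral_mono_AE])
          show "integrable S3 (\<lambda>y. \<bar>W y \<bullet> (Fk 0 k x y - (1/2) *\<^sub>R fr k y)\<bar>)"
            by (intro integrable_abs integrable_inner_continuous Wi continuous_on_diff continuous_Fk continuous_intros)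
          show "integrable S3 (\<lambda>y. 1/2 * norm (W y))" using Wi by simp
          show "AE y in S3. \<bar>W y \<bullet> (Fk 0 k x y - (1/2) *\<^sub>R fr k y)\<bar> \<le> 1/2 * norm (W y)"
          proof (rule AE_I2)
            fix y assume "y \<in> space S3"
            then show "\<bar>W y \<bullet> (Fk 0 k x y - (1/2) *\<^sub>R fr k y)\<bar> \<le> 1/2 * norm (W y)"
              using Cauchy_Schwarz_ineq2[of "W y" "fr k y"] by (simp add: Fk_def)
          qed
        qed
        also have "\<dots> \<le> 1/2 * (Q + area3)" using XW1 by simp
        finally show ?thesis .
      qed
      have "\<bar>Bterm ?z X W 0\<bar> \<le> (\<integral>x. 3/2 * (Q + area3) * norm (X x) \<partial>S3)"
        unfolding Bterm_def
      proof (rule order_trans[OF integral_abs_bound integral_mono_AE])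
        show "integrable S3 (\<lambda>x. \<bar>1 * (\<Sum>k\<in>UNIV. (X x \<bullet> fr k x) * ?h k x)\<bar>)"
          using key_identity(3)[OF X Xd a Wi c z, of 0] by (intro integrable_abs)
        show "integrable S3 (\<lambda>x. 3/2 * (Q + area3) * norm (X x))" using Xi by simp
        show "AE x in S3. \<bar>1 * (\<Sum>k\<in>UNIV. (X x \<bullet> fr k x) * ?h k x)\<bar> \<le> 3/2 * (Q + area3) * norm (X x)"
        proof (rule AE_I2)
          fix x assume x: "x \<in> space S3"
          have "\<bar>\<Sum>k\<in>UNIV. (X x \<bullet> fr k x) * ?h k x\<bar> \<le> (\<Sum>k\<in>(UNIV::3 set). norm (X x) * (1/2 * (Q + area3)))"
          proof (rule order_trans[OF sum_abs sum_mono])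
            fix k :: 3
            have "\<bar>X x \<bullet> fr k x\<bar> \<le> norm (X x)" using Cauchy_Schwarz_ineq2[of "X x" "fr k x"] x by simp
            then show "\<bar>(X x \<bullet> fr k x) * ?h k x\<bar> \<le> norm (X x) * (1/2 * (Q + area3))"
              unfolding abs_mult using h[of k x] by (intro mult_mono) auto
          qed
          also have "\<dots> = 3/2 * (Q + area3) * norm (X x)" by simp
          finally show "\<bar>1 * (\<Sum>k\<in>UNIV. (X x \<bullet> fr k x) * ?h k x)\<bar> \<le> 3/2 * (Q + area3) * norm (X x)"
            by simp
        qed
      qed
      also have "\<dots> = 3/2 * (Q + area3) * (\<integral>x. norm (X x) \<partial>S3)" by simp
      also have "\<dots> \<le> 3/2 * (Q + area3) * (\<eta> * P + area3 / \<eta>^2)"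
        using XW1 Q area3_pos by (intro mult_left_mono) auto
      also have "\<dots> = 3/2 * (\<eta> * P + area3 / \<eta>^2) * (Q + area3)" by (simp only: mult.commute mult.left_commute)
      finally show ?thesis .
    qed
    have Xm: "X \<in> borel_measurable S3" and Wm: "W \<in> borel_measurable S3" using X W by (auto simp: L32v_def)
    have R: "(\<integral>\<^sup>+x. (\<integral>\<^sup>+y. ennreal (72 * (\<bar>1\<bar> * norm (X x) * norm (W y) * tailk 0 x y)) \<partial>S3) \<partial>S3) \<le> ennreal (72 * (C * (P powr (2/3) * Q powr (2/3))))"
    proof -
      have km: "(\<lambda>p. ennreal (norm (X (fst p)) * norm (W (snd p)) * tailk 0 (fst p) (snd p))) \<in> borel_measurable (S3 \<Otimes>\<^sub>M S3)"
        using measurable_fst_S3'[OF Xm] measurable_snd_S3'[OF Wm] measurable_tailk[of 0] by simp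
      have "(\<integral>\<^sup>+x. (\<integral>\<^sup>+y. ennreal (72 * (\<bar>1\<bar> * norm (X x) * norm (W y) * tailk 0 x y)) \<partial>S3) \<partial>S3)
        = (\<integral>\<^sup>+x. (\<integral>\<^sup>+y. ennreal 72 * ennreal (norm (X x) * norm (W y) * tailk 0 x y) \<partial>S3) \<partial>S3)"
      proof (intro nn_integral_cong)
        fix x y assume "x \<in> space S3" "y \<in> space S3"
        then have "0 \<le> norm (X x) * norm (W y) * tailk 0 x y" using tailk_nonneg by simp
        then show "ennreal (72 * (\<bar>1\<bar> * norm (X x) * norm (W y) * tailk 0 x y)) = ennreal 72 * ennreal (norm (X x) * norm (W y) * tailk 0 x y)"
          by (subst ennreal_mult[symmetric]) auto
      qed
      also have "\<dots> = (\<integral>\<^sup>+x. ennreal 72 * (\<integral>\<^sup>+y. ennreal (norm (X x) * norm (W y) * tailk 0 x y) \<partial>S3) \<partial>S3)"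
        using measurable_compose[OF measurable_Pair1' km] by (intro nn_integral_cong nn_integral_cmult) simp
      also have "\<dots> = ennreal 72 * (\<integral>\<^sup>+x. (\<integral>\<^sup>+y. ennreal (norm (X x) * norm (W y) * tailk 0 x y) \<partial>S3) \<partial>S3)"
        using S3.borel_measurable_nn_integral_fst[OF km] by (intro nn_integral_cmult) simp
      also have "\<dots> \<le> ennreal 72 * ennreal (C * (P powr (2/3) * Q powr (2/3)))"
      proof (intro mult_left_mono hls)
        show "(\<integral>\<^sup>+x. ennreal (norm (X x) powr (3/2)) \<partial>S3) \<le> ennreal P"
          using nn_integral_L32v[OF X] XP by simp
        show "(\<integral>\<^sup>+x. ennreal (norm (W x) powr (3/2)) \<partial>S3) \<le> ennreal Q"
          using nn_integral_L32v[OF W] WQ by (simp add: ennreal_leI)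
      qed (use Xm Wm P0 Q in simp_all)
      also have "\<dots> = ennreal (72 * (C * (P powr (2/3) * Q powr (2/3))))" using C by (intro ennreal_mult[symmetric]) auto
      finally show ?thesis .
    qed
    have Ct: "Cterm ?z' X a 0 = 0" by (simp add: Cterm_def)
    have XaP: "(\<integral>x. 1 * (X x \<bullet> a x) \<partial>S3) = P"
      unfolding P_def X_def by (intro Bochner_Integration.integral_cong refl) (simp add: dot_square_norm power2_eq_square power3_eq_cube)
    have "ennreal \<bar>area3 * P - Bterm ?z X W 0\<bar> \<le> ennreal (72 * (C * (P powr (2/3) * Q powr (2/3))))"
      using order_trans[OF key_estimate[OF X Xd a Wi c z, of 0] add_right_mono[OF R]]
      by (simp only: XaP Ct) simp
    then have "\<bar>area3 * P - Bterm ?z X W 0\<bar> \<le> 72 * (C * (P powr (2/3) * Q powr (2/3)))"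
      using C by (subst (asm) ennreal_le_iff) auto
    moreover have "P powr (2/3) \<le> \<eta> * P + 1 / \<eta>^2"
      using le_eta_powr[OF powr_ge_zero eta, of P "2/3"] P0 by (simp add: powr_powr)
    then have "72 * (C * (P powr (2/3) * Q powr (2/3))) \<le> 72 * (C * ((\<eta> * P + 1 / \<eta>^2) * Q powr (2/3)))"
      using C by (intro mult_left_mono mult_right_mono) auto
    ultimately have "area3 * P \<le> 3/2 * (\<eta> * P + area3 / \<eta>^2) * (Q + area3) + 72 * (C * ((\<eta> * P + 1 / \<eta>^2) * Q powr (2/3)))"
      using Bt by linarith
    also have "\<dots> = \<eta> * K1 * P + K2" 
    proof -
      have "3/2 * (e * P + A * i) * (Q + A) + 72 * (C * ((e * P + i) * q)) = e * (3/2 * (Q + A) + 72 * C * q) * P + (3/2 * (A * i) * (Q + A) + 72 * C * q * i)"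
        for e i A q :: real by (simp add: field_simps)
      from this[of \<eta> area3 "1 / \<eta>^2" "Q powr (2/3)"] show ?thesis
        unfolding K1_def K2_def by simp
    qed
    also have "\<eta> * K1 = area3 / 2" using K1 by (simp add: \<eta>_def)
    finally have "area3 / 2 * P \<le> K2" by simp
    then show "(\<integral>x. norm (a x)^3 \<partial>S3) \<le> 2 * K2 / area3"
      using area3_pos by (simp add: P_def[symmetric] pos_le_divide_eq mult_ac)
  qed
qed

text \<open>Twice the pairing equals \<open>(norm a + norm b) * norm (a - b)^2\<close> plus a
  nonnegative term in the difference of the norms, and the first sum of norms dominates
  \<open>norm (a - b)\<close>.\<close>

lemma monotone_cubic:
  fixes a b :: "'a::real_inner"
  shows "norm (a - b)^3 \<le> 2 * ((norm a *\<^sub>R a - norm b *\<^sub>R b) \<bullet> (a - b))"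
proof -
  have ab: "a \<bullet> a = norm a^2" "b \<bullet> b = norm b^2" by (simp_all add: dot_square_norm)
  have n2: "norm (a - b)^2 = norm a^2 + norm b^2 - 2 * (a \<bullet> b)"
    by (simp add: power2_norm_eq_inner inner_diff inner_commute)
  have "2 * ((norm a *\<^sub>R a - norm b *\<^sub>R b) \<bullet> (a - b))
    = (norm a + norm b) * norm (a - b)^2 + (norm a - norm b)^2 * (norm a + norm b)"
    unfolding n2 by (simp add: inner_diff inner_commute ab power2_eq_square algebra_simps)
  moreover have "norm (a - b)^3 \<le> (norm a + norm b) * norm (a - b)^2"
    using mult_right_mono[OF norm_triangle_ineq4[of a b], of "norm (a - b)^2"] by (simp add: power2_eq_square power3_eq_cube)
  moreover have "0 \<le> (norm a - norm b)^2 * (norm a + norm b)" by simp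
  ultimately show ?thesis by linarith
qed

lemma uniqueness:
  assumes "admissible a W" "admissible a' W"
  shows "AE x in S3. a x = a' x"
proof -
  define X where "X x = norm (a x) *\<^sub>R a x - norm (a' x) *\<^sub>R a' x" for x
  define D where "D x = a x - a' x" for x
  have a: "L3v a" "L3v a'" and Wi: "integrable S3 W" and c: "curl_of a W" "curl_of a' W"
    using assms L32v_integrable unfolding admissible_def by auto
  have ai: "integrable S3 a" "integrable S3 a'" using a L3v_integrable by auto
  have D: "L3v D" unfolding D_def by (rule L3v_diff[OF a])
  have X: "L32v X" unfolding X_def by (rule L32v_diff[OF L32v_of_L3v[OF a(1)] L32v_of_L3v[OF a(2)]])
  have Xd: "divfree X"
    unfolding X_def using assms L32v_integrable[OF L32v_of_L3v[OF a(1)]] L32v_integrable[OF L32v_of_L3v[OF a(2)]]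
    by (intro divfree_diff) (auto simp: admissible_def)
  have cD: "curl_of D (\<lambda>_. 0)" unfolding D_def using curl_of_diff[OF c ai Wi Wi] by simp
  let ?z = "\<lambda>_::R4. 1::real" and ?z' = "\<lambda>(_::R4) (_::R4). 0::real"
  have z: "real_polynomial_function ?z" "\<And>x. (?z has_derivative ?z' x) (at x)"
    by (auto intro: real_polynomial_function.intros)
  have "ennreal \<bar>area3 * (\<integral>x. X x \<bullet> D x \<partial>S3)\<bar> \<le> 0"
    using key_estimate[OF X Xd D integrable_zero cD z, of 0] by (simp add: Bterm_def Cterm_def)
  then have z0: "(\<integral>x. X x \<bullet> D x \<partial>S3) = 0" using area3_pos by simp
  have XDi: "integrable S3 (\<lambda>x. X x \<bullet> D x)"
  proof (rule Bochner_Integration.integrable_bound[OF integrable_inner_L3v_L32v[OF X D]])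
    show "(\<lambda>x. X x \<bullet> D x) \<in> borel_measurable S3" using X D by (auto simp: L3v_def L32v_def)
    show "AE x in S3. norm (X x \<bullet> D x) \<le> norm (norm (X x) * norm (D x))"
      using Cauchy_Schwarz_ineq2 by (intro AE_I2) simp
  qed
  have D3: "integrable S3 (\<lambda>x. norm (D x)^3)" using D by (simp add: L3v_def)
  have "(\<integral>x. norm (D x)^3 \<partial>S3) \<le> (\<integral>x. 2 * (X x \<bullet> D x) \<partial>S3)"
    using D3 XDi monotone_cubic by (intro integral_mono) (auto simp: D_def X_def)
  then have "(\<integral>x. norm (D x)^3 \<partial>S3) = 0" using z0 by (intro antisym) simp_all
  then have "AE x in S3. norm (D x)^3 = 0"
    using integral_nonneg_eq_0_iff_AE[OF D3] by simp
  then show ?thesis by eventually_elim (simp add: D_def)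
qed

section \<open>Weakly convergent two-forms\<close>

lemma continuous_vol3:
  "continuous_on UNIV (\<lambda>x. vol3 x u v w)"
  by (intro linear_continuous_on linear_conv_bounded_linear[THEN iffD1] linear_vol3)

lemma measurable_vecI:
  fixes F :: "R4 \<Rightarrow> real ^ 'n"
  assumes "\<And>i. (\<lambda>x. F x $ i) \<in> borel_measurable S3"
  shows "F \<in> borel_measurable S3"
proof -
  have "F x = (\<Sum>i\<in>UNIV. F x $ i *\<^sub>R axis i 1)" for x
    using basis_expansion[of "F x"] by (simp add: scalar_mult_eq_scaleR)
  then have "F = (\<lambda>x. \<Sum>i\<in>UNIV. F x $ i *\<^sub>R axis i 1)" by blast
  moreover have "(\<lambda>x. \<Sum>i\<in>UNIV. F x $ i *\<^sub>R (axis i 1 :: real ^ 'n)) \<in> borel_measurable S3"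
    using assms by (intro borel_measurable_sum borel_measurable_scaleR) auto
  ultimately show ?thesis by simp
qed

lemma measurable_matI:
  fixes F :: "R4 \<Rightarrow> M4"
  assumes "\<And>i j. (\<lambda>x. F x $ i $ j) \<in> borel_measurable S3"
  shows "F \<in> borel_measurable S3"
proof -
  have "F x = (\<Sum>j\<in>UNIV. \<Sum>i\<in>UNIV. F x $ i $ j *\<^sub>R axis i (axis j 1))" for x
    by (simp add: vec_eq_iff axis_def if_distrib[where f = "\<lambda>v. v $ _"] if_distrib[where f = "\<lambda>v. _ * v"] cong: if_cong)
  then have "F = (\<lambda>x. \<Sum>j\<in>UNIV. \<Sum>i\<in>UNIV. F x $ i $ j *\<^sub>R axis i (axis j 1))" by blast
  moreover have "(\<lambda>x. \<Sum>j\<in>UNIV. \<Sum>i\<in>UNIV. F x $ i $ j *\<^sub>R (axis i (axis j 1) :: M4)) \<in> borel_measurable S3"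
    using assms by (intro borel_measurable_sum borel_measurable_scaleR) auto
  ultimately show ?thesis by simp
qed

lemma measurable_vec_nth_S3: "F \<in> borel_measurable S3 \<Longrightarrow> (\<lambda>x. (F x :: 'a::{second_countable_topology,real_normed_vector} ^ 'n) $ i) \<in> borel_measurable S3"
  by (rule measurable_compose[OF _ borel_measurable_continuous_onI[OF linear_continuous_on[OF bounded_linear_vec_nth]]])

lemma L32v_starv:
  assumes "L_2form (3/2) b"
  shows "L32v (\<lambda>x. starv (b x) x)"
  unfolding L32v_def
proof (intro conjI ballI)
  have bm: "b \<in> borel_measurable S3" and bi: "integrable S3 (\<lambda>x. norm2 (b x) powr (3/2))"
    using assms by (auto simp: L_2form_def is_2form_def)
  show m: "(\<lambda>x. starv (b x) x) \<in> borel_measurable S3"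
  proof (rule measurable_vecI)
    fix k
    have "(\<lambda>x. b x $ i $ j * vol3 x (axis i 1) (axis j 1) (axis k 1)) \<in> borel_measurable S3" for i j
      using measurable_vec_nth_S3[OF measurable_vec_nth_S3[OF bm, of i], of j]
        borel_measurable_S3I[OF borel_measurable_continuous_onI[OF continuous_vol3[of "axis i 1" "axis j 1" "axis k 1"]]]
      by simp
    then show "(\<lambda>x. starv (b x) x $ k) \<in> borel_measurable S3"
      unfolding starv_def by simp
  qed
  show "integrable S3 (\<lambda>x. norm (starv (b x) x) powr (3/2))"
  proof (rule Bochner_Integration.integrable_bound[of S3 "\<lambda>x. 1536 powr (3/2) * norm2 (b x) powr (3/2)"])
    show "integrable S3 (\<lambda>x. 1536 powr (3/2) * norm2 (b x) powr (3/2))" using bi by simp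
    show "(\<lambda>x. norm (starv (b x) x) powr (3/2)) \<in> borel_measurable S3" using m by simp
    show "AE x in S3. norm (norm (starv (b x) x) powr (3/2)) \<le> norm (1536 powr (3/2) * norm2 (b x) powr (3/2))"
    proof (rule AE_I2)
      fix x assume "x \<in> space S3"
      then have "norm (starv (b x) x) powr (3/2) \<le> (1536 * norm2 (b x)) powr (3/2)"
        using norm_starv_le by (intro powr_mono2) auto
      also have "\<dots> = 1536 powr (3/2) * norm2 (b x) powr (3/2)"
        by (rule powr_mult)
      finally show "norm (norm (starv (b x) x) powr (3/2)) \<le> norm (1536 powr (3/2) * norm2 (b x) powr (3/2))" by simp
    qed
  qed
qed (simp add: starv_tangent)

text \<open>The exponent dual to 3/2 is 3, and \<open>dual2\<close> turns the scalar
  \<open>g\<close> into a two-form of that class whose pairing selects the component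
  \<open>i\<close> of \<open>starv\<close>.\<close>

lemma weak_conv_component:
  assumes w: "weak_conv_2form (3/2) bn b" and g: "g \<in> borel_measurable S3" "integrable S3 (\<lambda>x. \<bar>g x\<bar>^3)"
  shows "(\<lambda>n. \<integral>x. starv (bn n x) x $ i * g x \<partial>S3) \<longlonglongrightarrow> (\<integral>x. starv (b x) x $ i * g x \<partial>S3)"
proof -
  define G where "G x = dual2 x (g x *\<^sub>R axis i 1)" for x
  have Gc: "G x $ k $ l = g x * vol3 x (axis k 1) (axis l 1) (axis i 1)" for x k l
    by (simp add: G_def dual2_def linear_scale[OF linear_vol3(4)])
  have Gm: "G \<in> borel_measurable S3"
  proof (rule measurable_matI)
    fix k l
    show "(\<lambda>x. G x $ k $ l) \<in> borel_measurable S3"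
      unfolding Gc using g(1) borel_measurable_S3I[OF borel_measurable_continuous_onI[OF continuous_vol3[of "axis k 1" "axis l 1" "axis i 1"]]] by simp
  qed
  have n2m: "(\<lambda>x. norm2 (G x)) \<in> borel_measurable S3"
    unfolding norm2_def inner2_def using measurable_vec_nth_S3[OF measurable_vec_nth_S3[OF Gm]] by simp
  have "L_2form (3/2 / (3/2 - 1)) G"
    unfolding L_2form_def is_2form_def
  proof (intro conjI ballI Gm)
    show "transpose (G x) = - G x" for x unfolding G_def by (rule dual2_skew)
    show "G x *v x = 0" for x unfolding G_def by (rule dual2_tangent)
    have "integrable S3 (\<lambda>x. norm2 (G x)^3)"
    proof (rule Bochner_Integration.integrable_bound[of S3 "\<lambda>x. 96^3 * \<bar>g x\<bar>^3"])
      show "integrable S3 (\<lambda>x. 96^3 * \<bar>g x\<bar>^3)" using g by simp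
      show "AE x in S3. norm (norm2 (G x)^3) \<le> norm (96^3 * \<bar>g x\<bar>^3)"
      proof (rule AE_I2)
        fix x assume "x \<in> space S3"
        then have "norm2 (G x) \<le> 96 * \<bar>g x\<bar>" using norm2_dual2_le[of x "g x *\<^sub>R axis i 1"] by (simp add: G_def)
        moreover have n0: "0 \<le> norm2 (G x)" using abs_le_norm2[of "G x" 1 1] by simp
        ultimately have "norm2 (G x)^3 \<le> (96 * \<bar>g x\<bar>)^3" by (intro power_mono)
        then show "norm (norm2 (G x)^3) \<le> norm (96^3 * \<bar>g x\<bar>^3)" using n0 by (simp add: power_mult_distrib abs_mult)
      qed
    qed (use n2m in simp)
    moreover have "norm2 (G x) powr (3/2 / (3/2 - 1)) = norm2 (G x)^3" for x
      using abs_le_norm2[of "G x" 1 1] powr_numeral[of "norm2 (G x)" "num.Bit1 num.One"] by (cases "norm2 (G x) = 0") simp_all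
    ultimately show "integrable S3 (\<lambda>x. norm2 (G x) powr (3/2 / (3/2 - 1)))" by simp
  qed
  moreover have "inner2 M (G x) = starv M x $ i * g x" for M x
    by (simp add: G_def inner2_dual2 inner_axis)
  ultimately show ?thesis using w[unfolded weak_conv_2form_def, rule_format, of G] by simp
qed

lemma weak_conv_continuous:
  assumes w: "weak_conv_2form (3/2) bn b" and b: "\<And>n. L_2form (3/2) (bn n)" "L_2form (3/2) b" and V: "continuous_on UNIV V"
  shows "(\<lambda>n. \<integral>x. starv (bn n x) x \<bullet> V x \<partial>S3) \<longlonglongrightarrow> (\<integral>x. starv (b x) x \<bullet> V x \<partial>S3)"
proof -
  have Vc: "continuous_on UNIV (\<lambda>x. V x $ i)" for i using V by (intro continuous_on_component)
  have eq: "(\<integral>x. starv (c x) x \<bullet> V x \<partial>S3) = (\<Sum>i\<in>UNIV. \<integral>x. starv (c x) x $ i * V x $ i \<partial>S3)" if "L_2form (3/2) c" for c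
  proof -
    have "integrable S3 (\<lambda>x. V x $ i * starv (c x) x $ i)" for i
      by (intro integrable_continuous_mult Vc integrable_vec_component L32v_integrable L32v_starv that)
    then have "integrable S3 (\<lambda>x. starv (c x) x $ i * V x $ i)" for i by (simp add: mult.commute)
    then show ?thesis by (simp add: inner_vec_def Bochner_Integration.integral_sum)
  qed
  have "(\<lambda>n. \<integral>x. starv (bn n x) x $ i * V x $ i \<partial>S3) \<longlonglongrightarrow> (\<integral>x. starv (b x) x $ i * V x $ i \<partial>S3)" for i
  proof (rule weak_conv_component[OF w])
    show "(\<lambda>x. V x $ i) \<in> borel_measurable S3" by (intro borel_measurable_S3I borel_measurable_continuous_onI Vc)
    show "integrable S3 (\<lambda>x. \<bar>V x $ i\<bar>^3)" by (intro integrable_S3_bounded continuous_on_power continuous_on_rabs Vc)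
  qed
  then show ?thesis unfolding eq[OF b(1)] eq[OF b(2)] by (intro tendsto_sum)
qed

text \<open>Convergent pairings are bounded for every test function, so uniform boundedness applies
  to each component.\<close>

lemma weak_conv_bounded:
  assumes w: "weak_conv_2form (3/2) bn b" and b: "\<And>n. L_2form (3/2) (bn n)"
  shows "\<exists>Q\<ge>0. \<forall>n. (\<integral>x. norm (starv (bn n x) x) powr (3/2) \<partial>S3) \<le> Q"
proof -
  let ?W = "\<lambda>n x. starv (bn n x) x"
  have L: "L32v (?W n)" for n using L32v_starv[OF b] .
  have Wm: "?W n \<in> borel_measurable S3" for n using L[of n] by (simp add: L32v_def)
  have ci: "integrable S3 (\<lambda>x. \<bar>?W n x $ i\<bar> powr (3/2))" for n i
  proof (rule Bochner_Integration.integrable_bound[of S3 "\<lambda>x. norm (?W n x) powr (3/2)"])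
    show "integrable S3 (\<lambda>x. norm (?W n x) powr (3/2))" using L[of n] by (simp add: L32v_def)
    show "(\<lambda>x. \<bar>?W n x $ i\<bar> powr (3/2)) \<in> borel_measurable S3" using measurable_vec_nth_S3[OF Wm[of n], of i] by simp
    show "AE x in S3. norm (\<bar>?W n x $ i\<bar> powr (3/2)) \<le> norm (norm (?W n x) powr (3/2))"
      by (intro AE_I2) (auto intro!: powr_mono2 simp: component_le_norm_cart)
  qed
  have "\<exists>K. \<forall>n. (\<integral>x. \<bar>?W n x $ i\<bar> powr (3/2) \<partial>S3) \<le> K" for i
  proof (rule uniform_boundedness_3_2)
    show "(\<lambda>x. ?W n x $ i) \<in> borel_measurable S3" for n using measurable_vec_nth_S3[OF Wm] .
    show "integrable S3 (\<lambda>x. \<bar>?W n x $ i\<bar> powr (3/2))" for n by (rule ci)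
    fix g :: "R4 \<Rightarrow> real" assume "g \<in> borel_measurable S3" "integrable S3 (\<lambda>x. \<bar>g x\<bar>^3)"
    then have "(\<lambda>n. \<integral>x. ?W n x $ i * g x \<partial>S3) \<longlonglongrightarrow> (\<integral>x. starv (b x) x $ i * g x \<partial>S3)"
      by (rule weak_conv_component[OF w])
    then have "Bseq (\<lambda>n. \<integral>x. ?W n x $ i * g x \<partial>S3)" by (intro convergent_imp_Bseq convergentI)
    then show "\<exists>B. \<forall>n. \<bar>\<integral>x. ?W n x $ i * g x \<partial>S3\<bar> \<le> B" by (auto simp: Bseq_def)
  qed
  then have "\<forall>i. \<exists>K. \<forall>n. (\<integral>x. \<bar>?W n x $ i\<bar> powr (3/2) \<partial>S3) \<le> K" by blast
  from choice[OF this] obtain K where K: "\<And>i n. (\<integral>x. \<bar>?W n x $ i\<bar> powr (3/2) \<partial>S3) \<le> K i" by blast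
  have le: "(\<integral>x. norm (?W n x) powr (3/2) \<partial>S3) \<le> 8 * (\<Sum>i\<in>UNIV. K i)" for n
  proof -
    \<comment> \<open>The norm is at most four times the largest component, and the power 3/2 of 4
      is 8.\<close>
    have pt: "norm v powr (3/2) \<le> 8 * (\<Sum>i\<in>UNIV. \<bar>v $ i\<bar> powr (3/2))" for v :: R4
    proof -
      define t where "t = Max (range (\<lambda>i. \<bar>v $ i\<bar>))"
      have "t \<in> range (\<lambda>i. \<bar>v $ i\<bar>)" unfolding t_def by (rule Max_in) auto
      then obtain j where j: "t = \<bar>v $ j\<bar>" by blast
      have "norm v \<le> (\<Sum>i\<in>UNIV. \<bar>v $ i\<bar>)" by (rule norm_le_l1_cart)
      also have "\<dots> \<le> (\<Sum>i\<in>(UNIV::4 set). t)" unfolding t_def by (intro sum_mono Max_ge) auto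
      finally have "norm v powr (3/2) \<le> (4 * t) powr (3/2)" by (intro powr_mono2) auto
      also have "\<dots> = 4 powr (3/2) * t powr (3/2)" by (rule powr_mult)
      also have "(4::real) powr (3/2) = 8" using square_powr_3_2[of 2] by simp
      also have "t powr (3/2) \<le> (\<Sum>i\<in>UNIV. \<bar>v $ i\<bar> powr (3/2))"
        unfolding j by (rule member_le_sum) auto
      finally show ?thesis by simp
    qed
    have "(\<integral>x. norm (?W n x) powr (3/2) \<partial>S3) \<le> (\<integral>x. 8 * (\<Sum>i\<in>UNIV. \<bar>?W n x $ i\<bar> powr (3/2)) \<partial>S3)"
      using L[of n] ci pt by (intro integral_mono) (auto simp: L32v_def)
    also have "\<dots> = 8 * (\<Sum>i\<in>UNIV. \<integral>x. \<bar>?W n x $ i\<bar> powr (3/2) \<partial>S3)" using ci by (simp add: Bochner_Integration.integral_sum)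
    also have "\<dots> \<le> 8 * (\<Sum>i\<in>UNIV. K i)" using K by (intro mult_left_mono sum_mono) auto
    finally show ?thesis .
  qed
  have "0 \<le> (\<integral>x. norm (?W 0 x) powr (3/2) \<partial>S3)" by simp
  then have "0 \<le> 8 * (\<Sum>i\<in>UNIV. K i)" using le[of 0] by linarith
  then show ?thesis using le by blast
qed

section \<open>Strong compactness\<close>

text \<open>Dominated convergence to the pointwise limit; the factor 4 for cubes of sums accounts
  for \<open>e / 8\<close>. This is how weak convergence becomes strong after pairing with a
  truncated kernel.\<close>

lemma bounded_pointwise_cauchy:
  fixes u :: "nat \<Rightarrow> R4 \<Rightarrow> real"
  assumes m: "\<And>n. u n \<in> borel_measurable S3" and b: "\<And>n x. norm x = 1 \<Longrightarrow> \<bar>u n x\<bar> \<le> K"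
    and c: "\<And>x. norm x = 1 \<Longrightarrow> convergent (\<lambda>n. u n x)" and e: "e > 0"
  shows "\<exists>n0. \<forall>n\<ge>n0. \<forall>m\<ge>n0. (\<integral>x. \<bar>u n x - u m x\<bar>^3 \<partial>S3) \<le> e"
proof -
  define l where "l x = lim (\<lambda>n. u n x)" for x
  have lm: "l \<in> borel_measurable S3" unfolding l_def by (rule borel_measurable_lim_metric) (rule m)
  have lim: "(\<lambda>n. u n x) \<longlonglongrightarrow> l x" if "norm x = 1" for x
    unfolding l_def using c[OF that] convergent_LIMSEQ_iff by blast
  have lb: "\<bar>l x\<bar> \<le> K" if "norm x = 1" for x
    using LIMSEQ_le_const2[OF tendsto_rabs[OF lim[OF that]]] b[OF that] by blast
  have d: "\<bar>u n x - l x\<bar>^3 \<le> (2 * K)^3" if "norm x = 1" for n x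
    using b[OF that, of n] lb[OF that] by (intro power_mono) auto
  have i: "integrable S3 (\<lambda>x. \<bar>u n x - l x\<bar>^3)" for n
  proof (rule S3.integrable_const_bound[of _ "(2 * K)^3"])
    show "AE x in S3. norm (\<bar>u n x - l x\<bar>^3) \<le> (2 * K)^3" using d by (intro AE_I2) simp
    show "(\<lambda>x. \<bar>u n x - l x\<bar>^3) \<in> borel_measurable S3" using m[of n] lm by simp
  qed
  have "(\<lambda>n. \<integral>x. \<bar>u n x - l x\<bar>^3 \<partial>S3) \<longlonglongrightarrow> (\<integral>x. 0 \<partial>S3)"
  proof (rule integral_dominated_convergence[where w = "\<lambda>_. (2 * K)^3"])
    show "AE x in S3. (\<lambda>n. \<bar>u n x - l x\<bar>^3) \<longlonglongrightarrow> 0"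
    proof (rule AE_I2)
      fix x assume "x \<in> space S3"
      then have "(\<lambda>n. \<bar>u n x - l x\<bar>^3) \<longlonglongrightarrow> \<bar>l x - l x\<bar>^3" by (intro tendsto_intros lim) simp
      then show "(\<lambda>n. \<bar>u n x - l x\<bar>^3) \<longlonglongrightarrow> 0" by simp
    qed
    show "AE x in S3. norm (\<bar>u n x - l x\<bar>^3) \<le> (2 * K)^3" for n using d by (intro AE_I2) simp
  qed (use m lm in simp_all)
  then have "(\<lambda>n. \<integral>x. \<bar>u n x - l x\<bar>^3 \<partial>S3) \<longlonglongrightarrow> 0" by simp
  then have "\<forall>\<^sub>F n in sequentially. (\<integral>x. \<bar>u n x - l x\<bar>^3 \<partial>S3) < e / 8"
    using e by (intro order_tendstoD(2)) auto
  then obtain n0 where n0: "\<And>n. n \<ge> n0 \<Longrightarrow> (\<integral>x. \<bar>u n x - l x\<bar>^3 \<partial>S3) < e / 8" by (auto simp: eventually_sequentially)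
  show ?thesis
  proof (intro exI[of _ n0] allI impI)
    fix n k assume nk: "n0 \<le> n" "n0 \<le> k"
    have "(\<integral>x. \<bar>u n x - u k x\<bar>^3 \<partial>S3) \<le> (\<integral>x. 4 * (\<bar>u n x - l x\<bar>^3 + \<bar>u k x - l x\<bar>^3) \<partial>S3)"
    proof (rule integral_mono_AE')
      show "integrable S3 (\<lambda>x. 4 * (\<bar>u n x - l x\<bar>^3 + \<bar>u k x - l x\<bar>^3))" using i by simp
      show "AE x in S3. \<bar>u n x - u k x\<bar>^3 \<le> 4 * (\<bar>u n x - l x\<bar>^3 + \<bar>u k x - l x\<bar>^3)"
      proof (rule AE_I2)
        fix x
        have "\<bar>u n x - u k x\<bar>^3 \<le> (\<bar>u n x - l x\<bar> + \<bar>u k x - l x\<bar>)^3" by (intro power_mono) auto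
        also have "\<dots> \<le> 4 * (\<bar>u n x - l x\<bar>^3 + \<bar>u k x - l x\<bar>^3)" by (intro cube_add_le) auto
        finally show "\<bar>u n x - u k x\<bar>^3 \<le> 4 * (\<bar>u n x - l x\<bar>^3 + \<bar>u k x - l x\<bar>^3)" .
      qed
    qed simp
    also have "\<dots> = 4 * ((\<integral>x. \<bar>u n x - l x\<bar>^3 \<partial>S3) + (\<integral>x. \<bar>u k x - l x\<bar>^3 \<partial>S3))" using i by simp
    also have "\<dots> \<le> e" using n0[OF nk(1)] n0[OF nk(2)] by simp
    finally show "(\<integral>x. \<bar>u n x - u k x\<bar>^3 \<partial>S3) \<le> e" .
  qed
qed

text \<open>The inner integral of \<open>Bterm\<close>. For fixed \<open>N\<close> and
  \<open>x\<close> it pairs \<open>W\<close> with a continuous field, so it converges under weak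
  convergence.\<close>

definition hterm :: "nat \<Rightarrow> (R4 \<Rightarrow> R4) \<Rightarrow> 3 \<Rightarrow> R4 \<Rightarrow> real" where
  "hterm N W k x = (\<integral>y. W y \<bullet> (Fk N k x y - (1/2) *\<^sub>R fr k y) \<partial>S3)"

text \<open>On the sphere the representation formula equates it with the difference of a continuous
  average and a derivative of the polynomial potential.\<close>

lemma hterm_measurable:
  assumes c: "curl_of a W" and a: "integrable S3 a" and W: "integrable S3 W"
  shows "hterm N W k \<in> borel_measurable S3"
proof -
  note ph = phi_polynomial[OF a, of N]
  define q where "q x = (\<integral>y. pk N (sK x y) * (a y \<bullet> fr k y) \<partial>S3)" for x
  have eq: "q = (\<lambda>x. 1 / mom N * (\<integral>y. sK x y ^ N * (a y \<bullet> fr k y) \<partial>S3))"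
    unfolding q_def pk_def by (simp flip: integral_mult_right_zero)
  have c1: "continuous_on UNIV (\<lambda>x. \<integral>y. sK x y ^ N * (a y \<bullet> fr k y) \<partial>S3)"
    using sK_moment_polynomial[OF integrable_curl_terms(2)[OF a]] continuous_real_polynomial by blast
  have q: "continuous_on UNIV q" unfolding eq by (intro continuous_on_mult continuous_on_const c1)
  obtain g where g: "\<And>i. real_polynomial_function (g i)" "\<And>x h. dphi N a x h = (\<Sum>i\<in>UNIV. (h :: R4) $ i * g i x)"
    using polynomial_derivative_coeff[OF ph] by blast
  have "continuous_on UNIV (\<lambda>x. q x - (\<Sum>i\<in>UNIV. fr k x $ i * g i x))"
    by (intro continuous_on_diff q continuous_on_sum continuous_on_mult continuous_on_component continuous_fr continuous_on_id continuous_real_polynomial g(1))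
  then have m: "(\<lambda>x. q x - (\<Sum>i\<in>UNIV. fr k x $ i * g i x)) \<in> borel_measurable S3"
    by (intro borel_measurable_S3I borel_measurable_continuous_onI)
  have "hterm N W k x = q x - (\<Sum>i\<in>UNIV. fr k x $ i * g i x)" if "x \<in> space S3" for x
    using representation[OF c a W, of x N k] that unfolding hterm_def q_def g(2)[symmetric] by simp
  then show ?thesis using m measurable_cong[of S3 "hterm N W k" "\<lambda>x. q x - (\<Sum>i\<in>UNIV. fr k x $ i * g i x)" borel] by blast
qed

lemma gamN_sK_bounds:
  assumes "norm x = 1" "norm y = 1"
  shows "0 \<le> gamN N (sK x y)" "gamN N (sK x y) \<le> gamN N 1"
  using gamN_nonneg[OF sK_bounds(1)[OF assms]] sK_bounds[OF assms] less_imp_le[OF ck_pos] unfolding gamN_def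
  by (auto intro!: mult_left_mono sum_mono power_le_one simp: mult_left_le power_le_one)

lemma hterm_bound:
  assumes W: "integrable S3 W" and x: "norm x = 1"
  shows "\<bar>hterm N W k x\<bar> \<le> (24 * gamN N 1 + 1) * (\<integral>y. norm (W y) \<partial>S3)"
proof -
  have "\<bar>hterm N W k x\<bar> \<le> (\<integral>y. (24 * gamN N 1 + 1) * norm (W y) \<partial>S3)"
    unfolding hterm_def
  proof (rule order_trans[OF integral_abs_bound integral_mono_AE])
    show "integrable S3 (\<lambda>y. \<bar>W y \<bullet> (Fk N k x y - (1/2) *\<^sub>R fr k y)\<bar>)"
      by (intro integrable_abs integrable_inner_continuous W continuous_on_diff continuous_Fk continuous_intros)
    show "integrable S3 (\<lambda>y. (24 * gamN N 1 + 1) * norm (W y))" using W by simp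
    show "AE y in S3. \<bar>W y \<bullet> (Fk N k x y - (1/2) *\<^sub>R fr k y)\<bar> \<le> (24 * gamN N 1 + 1) * norm (W y)"
    proof (rule AE_I2)
      fix y assume "y \<in> space S3"
      then have y: "norm y = 1" by simp
      note g = gamN_sK_bounds[OF x y, of N]
      have "norm (Fk N k x y) \<le> gamN N 1 * 24"
        unfolding Fk_def norm_scaleR using g norm_crs_le[of y x "fr k y"] x y by (intro mult_mono) auto
      then have "norm (Fk N k x y - (1/2) *\<^sub>R fr k y) \<le> gamN N 1 * 24 + 1"
        using norm_triangle_ineq4[of "Fk N k x y" "(1/2) *\<^sub>R fr k y"] y by simp
      then have "norm (W y) * norm (Fk N k x y - (1/2) *\<^sub>R fr k y) \<le> norm (W y) * (gamN N 1 * 24 + 1)"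
        by (intro mult_left_mono) auto
      then show "\<bar>W y \<bullet> (Fk N k x y - (1/2) *\<^sub>R fr k y)\<bar> \<le> (24 * gamN N 1 + 1) * norm (W y)"
        using Cauchy_Schwarz_ineq2[of "W y" "Fk N k x y - (1/2) *\<^sub>R fr k y"] by (simp add: mult_ac)
    qed
  qed
  then show ?thesis by simp
qed

lemma phi_bound:
  assumes a: "integrable S3 a" and x: "norm x = 1"
  shows "\<bar>phi N a x\<bar> \<le> gamN N 1 * (\<integral>y. norm (a y) \<partial>S3)"
proof -
  have "\<bar>phi N a x\<bar> \<le> (\<integral>y. gamN N 1 * norm (a y) \<partial>S3)"
    unfolding phi_def
  proof (rule order_trans[OF integral_abs_bound integral_mono_AE])
    show "integrable S3 (\<lambda>y. \<bar>gamN N (sK x y) * (x \<bullet> a y)\<bar>)"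
      by (intro integrable_abs integrable_continuous_mult integrable_inner_continuous a continuous_intros)
    show "integrable S3 (\<lambda>y. gamN N 1 * norm (a y))" using a by simp
    show "AE y in S3. \<bar>gamN N (sK x y) * (x \<bullet> a y)\<bar> \<le> gamN N 1 * norm (a y)"
    proof (rule AE_I2)
      fix y assume "y \<in> space S3"
      then have y: "norm y = 1" by simp
      note g = gamN_sK_bounds[OF x y, of N]
      show "\<bar>gamN N (sK x y) * (x \<bullet> a y)\<bar> \<le> gamN N 1 * norm (a y)"
        unfolding abs_mult using g Cauchy_Schwarz_ineq2[of x "a y"] x by (intro mult_mono) auto
    qed
  qed
  then show ?thesis by simp
qed

lemma young_eta:
  fixes a b \<eta> :: real
  assumes "0 \<le> a" "0 \<le> b" "0 < \<eta>"
  shows "a * b \<le> \<eta> * a powr (3/2) + b^3 / \<eta>^2"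
proof -
  \<comment> \<open>Rescaling \<open>a\<close> by \<open>t\<close> and \<open>b\<close> by its
    inverse in Young's inequality: the power 3/2 of \<open>t\<close> is \<open>\<eta>\<close>, its
    cube is \<open>\<eta>^2\<close>.\<close>
  define t where "t = \<eta> powr (2/3)"
  have t: "t > 0" "t powr (3/2) = \<eta>" using assms by (simp_all add: t_def powr_powr)
  have t3: "t^3 = \<eta>^2" using assms by (simp add: t_def powr_powr flip: powr_numeral)
  have "a * b = (t * a) * (b / t)" using t by simp
  also have "\<dots> \<le> (t * a) powr (3/2) + (b / t)^3" using assms t by (intro young_3_2) auto
  also have "\<dots> = \<eta> * a powr (3/2) + b^3 / \<eta>^2" using assms t by (simp add: powr_mult power_divide t3)
  finally show ?thesis .
qed

lemma nn_integral_product_tailk: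
  assumes F: "F \<in> borel_measurable S3" "integrable S3 F" "\<And>x. 0 \<le> F x" "(\<integral>x. F x \<partial>S3) \<le> M" and e2: "0 \<le> e2"
    and t: "\<And>x. norm x = 1 \<Longrightarrow> (\<integral>\<^sup>+y. ennreal (tailk N x y) \<partial>S3) \<le> ennreal e2"
  shows "(\<integral>\<^sup>+x. (\<integral>\<^sup>+y. ennreal (F x * tailk N x y) \<partial>S3) \<partial>S3) \<le> ennreal (e2 * M)"
    and "(\<integral>\<^sup>+x. (\<integral>\<^sup>+y. ennreal (F y * tailk N x y) \<partial>S3) \<partial>S3) \<le> ennreal (e2 * M)"
proof -
  have M: "0 \<le> M" by (rule order_trans[OF Bochner_Integration.integral_nonneg F(4)]) (rule F(3))
  show 1: "(\<integral>\<^sup>+x. (\<integral>\<^sup>+y. ennreal (F x * tailk N x y) \<partial>S3) \<partial>S3) \<le> ennreal (e2 * M)"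
  proof -
    have "(\<integral>\<^sup>+x. (\<integral>\<^sup>+y. ennreal (F x * tailk N x y) \<partial>S3) \<partial>S3) \<le> (\<integral>\<^sup>+x. ennreal e2 * ennreal (F x) \<partial>S3)"
    proof (rule nn_integral_mono)
      fix x assume x: "x \<in> space S3"
      then have nx: "norm x = 1" by simp
      have "(\<integral>\<^sup>+y. ennreal (F x * tailk N x y) \<partial>S3) = (\<integral>\<^sup>+y. ennreal (F x) * ennreal (tailk N x y) \<partial>S3)"
        using F(3) by (simp add: ennreal_mult')
      also have "\<dots> = ennreal (F x) * (\<integral>\<^sup>+y. ennreal (tailk N x y) \<partial>S3)"
        using measurable_tailk1[OF nx] by (intro nn_integral_cmult) simp
      also have "\<dots> \<le> ennreal (F x) * ennreal e2" by (intro mult_left_mono t nx) auto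
      finally show "(\<integral>\<^sup>+y. ennreal (F x * tailk N x y) \<partial>S3) \<le> ennreal e2 * ennreal (F x)" by (simp add: mult.commute)
    qed
    also have "\<dots> = ennreal e2 * ennreal (\<integral>x. F x \<partial>S3)"
      using F by (subst nn_integral_cmult) (auto simp: nn_integral_eq_integral)
    also have "\<dots> \<le> ennreal e2 * ennreal M" using F(4) by (intro mult_left_mono ennreal_leI) auto
    also have "\<dots> = ennreal (e2 * M)" using e2 by (simp add: ennreal_mult')
    finally show ?thesis .
  qed
  have m: "(\<lambda>p. ennreal (F (snd p) * tailk N (fst p) (snd p))) \<in> borel_measurable (S3 \<Otimes>\<^sub>M S3)"
    using measurable_snd_S3'[OF F(1)] measurable_tailk by simp
  have "(\<integral>\<^sup>+x. (\<integral>\<^sup>+y. ennreal (F y * tailk N x y) \<partial>S3) \<partial>S3) = (\<integral>\<^sup>+y. (\<integral>\<^sup>+x. ennreal (F y * tailk N x y) \<partial>S3) \<partial>S3)"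
    using S3xS3.Fubini[OF m] by simp
  also have "\<dots> = (\<integral>\<^sup>+y. (\<integral>\<^sup>+x. ennreal (F y * tailk N y x) \<partial>S3) \<partial>S3)"
    by (intro nn_integral_cong arg_cong[where f = ennreal] arg_cong2[where f = "(*)"] refl tailk_commute)
  finally show "(\<integral>\<^sup>+x. (\<integral>\<^sup>+y. ennreal (F y * tailk N x y) \<partial>S3) \<partial>S3) \<le> ennreal (e2 * M)"
    using 1 by (rule ord_eq_le_trans)
qed

lemma hterm_cube_integrable:
  assumes c: "curl_of a W" and a: "integrable S3 a" and W: "integrable S3 W"
  shows "integrable S3 (\<lambda>x. \<bar>hterm N W k x\<bar>^3)"
proof (rule S3.integrable_const_bound)
  show "(\<lambda>x. \<bar>hterm N W k x\<bar>^3) \<in> borel_measurable S3"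
    using hterm_measurable[OF c a W, of N k] by simp
  show "AE x in S3. norm (\<bar>hterm N W k x\<bar>^3) \<le> ((24 * gamN N 1 + 1) * (\<integral>y. norm (W y) \<partial>S3))^3"
    by (intro AE_I2) (simp add: power_mono hterm_bound[OF W])
qed

lemma phi_measurable: "integrable S3 a \<Longrightarrow> phi N a \<in> borel_measurable S3"
  using phi_polynomial(1) continuous_real_polynomial
  by (intro borel_measurable_S3I borel_measurable_continuous_onI) blast

lemma phi_cube_integrable:
  assumes a: "integrable S3 a"
  shows "integrable S3 (\<lambda>x. \<bar>phi N a x\<bar>^3)"
proof (rule S3.integrable_const_bound)
  show "(\<lambda>x. \<bar>phi N a x\<bar>^3) \<in> borel_measurable S3"
    using phi_measurable[OF a, of N] by simp
  show "AE x in S3. norm (\<bar>phi N a x\<bar>^3) \<le> (gamN N 1 * (\<integral>y. norm (a y) \<partial>S3))^3"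
    by (intro AE_I2) (simp add: power_mono phi_bound[OF a])
qed

text \<open>With the order \<open>N\<close> fixed, \<open>Bterm\<close> and \<open>Cterm\<close> are
  small because the averaged quantities are small in L^3. Of the two tail terms, the one carrying
  \<open>W\<close> is critical and bounded by the hypothesis on \<open>T\<close>; the one with the
  derivative of the cut-off is subcritical.\<close>

lemma pair_estimate:
  assumes X: "L32v X" "divfree X" and D: "L3v D" and W: "L32v W" and c: "curl_of D W"
    and P: "finite P" "P \<subseteq> sphere 0 1"
    and M: "(\<integral>x. norm (X x) powr (3/2) \<partial>S3) \<le> M" "(\<integral>x. norm (D x)^3 \<partial>S3) \<le> M"
    and h: "\<And>k. (\<integral>x. \<bar>hterm N W k x\<bar>^3 \<partial>S3) \<le> e1" and ph: "(\<integral>x. \<bar>phi N D x\<bar>^3 \<partial>S3) \<le> e1"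
    and T: "0 \<le> T" "(\<integral>\<^sup>+x. (\<integral>\<^sup>+y. ennreal (\<bar>cutoff m P x\<bar> * norm (X x) * norm (W y) * tailk N x y) \<partial>S3) \<partial>S3) \<le> ennreal T"
    and e2: "0 \<le> e2" "\<And>x. norm x = 1 \<Longrightarrow> (\<integral>\<^sup>+y. ennreal (tailk N x y) \<partial>S3) \<le> ennreal e2"
    and eta: "0 < \<eta>" and L: "L = real (card P) * real m"
  shows "area3 * (\<integral>x. cutoff m P x * (X x \<bullet> D x) \<partial>S3) \<le> (3 + L) * (\<eta> * M + e1 / \<eta>^2) + 72 * T + L * (e2 * (2 * M))"
proof -
  let ?z = "cutoff m P" and ?z' = "dcutoff m P"
  note Di = L3v_integrable[OF D] and Wi = L32v_integrable[OF W]
  have D3: "integrable S3 (\<lambda>x. norm (D x)^3)" and X3: "integrable S3 (\<lambda>x. norm (X x) powr (3/2))"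
    and Xm: "X \<in> borel_measurable S3" and Wm: "W \<in> borel_measurable S3" and Dm: "D \<in> borel_measurable S3"
    using X(1) D W by (simp_all add: L3v_def L32v_def)
  have L0: "0 \<le> L" by (simp add: L)
  have M0: "0 \<le> M" by (rule order_trans[OF Bochner_Integration.integral_nonneg M(2)]) simp
  have hi: "integrable S3 (\<lambda>x. \<bar>hterm N W k x\<bar>^3)" for k by (rule hterm_cube_integrable[OF c Di Wi])
  have phi: "integrable S3 (\<lambda>x. \<bar>phi N D x\<bar>^3)" by (rule phi_cube_integrable[OF Di])
  have yi: "(\<integral>x. \<eta> * norm (X x) powr (3/2) + \<bar>f x\<bar>^3 / \<eta>^2 \<partial>S3) \<le> \<eta> * M + e1 / \<eta>^2"
    if "integrable S3 (\<lambda>x. \<bar>f x\<bar>^3)" "(\<integral>x. \<bar>f x\<bar>^3 \<partial>S3) \<le> e1" for f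
    using that X3 M(1) eta by (simp add: add_mono mult_left_mono divide_right_mono)
  have B: "\<bar>Bterm ?z X W N\<bar> \<le> 3 * (\<eta> * M + e1 / \<eta>^2)"
  proof -
    let ?g = "\<lambda>x. \<Sum>k\<in>(UNIV::3 set). \<eta> * norm (X x) powr (3/2) + \<bar>hterm N W k x\<bar>^3 / \<eta>^2"
    have "\<bar>Bterm ?z X W N\<bar> \<le> (\<integral>x. ?g x \<partial>S3)"
      unfolding Bterm_def hterm_def[symmetric]
    proof (rule order_trans[OF integral_abs_bound integral_mono_AE'])
      show "integrable S3 ?g" using X3 hi by simp
      show "AE x in S3. \<bar>?z x * (\<Sum>k\<in>UNIV. (X x \<bullet> fr k x) * hterm N W k x)\<bar> \<le> ?g x"
      proof (rule AE_I2)
        fix x assume "x \<in> space S3"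
        then have nx: "norm x = 1" by simp
        have "\<bar>(X x \<bullet> fr k x) * hterm N W k x\<bar> \<le> \<eta> * norm (X x) powr (3/2) + \<bar>hterm N W k x\<bar>^3 / \<eta>^2" for k
        proof -
          have "\<bar>(X x \<bullet> fr k x) * hterm N W k x\<bar> \<le> norm (X x) * \<bar>hterm N W k x\<bar>"
            unfolding abs_mult using Cauchy_Schwarz_ineq2[of "X x" "fr k x"] nx by (intro mult_right_mono) auto
          also have "\<dots> \<le> \<eta> * norm (X x) powr (3/2) + \<bar>hterm N W k x\<bar>^3 / \<eta>^2" using eta by (intro young_eta) auto
          finally show ?thesis .
        qed
        then have "\<bar>\<Sum>k\<in>UNIV. (X x \<bullet> fr k x) * hterm N W k x\<bar> \<le> ?g x" by (rule order_trans[OF sum_abs sum_mono])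
        moreover have "\<bar>?z x\<bar> \<le> 1" using cutoff_bounds[OF P(2) nx, of m] by simp
        ultimately have "\<bar>?z x\<bar> * \<bar>\<Sum>k\<in>UNIV. (X x \<bullet> fr k x) * hterm N W k x\<bar> \<le> 1 * ?g x" by (intro mult_mono) auto
        then show "\<bar>?z x * (\<Sum>k\<in>UNIV. (X x \<bullet> fr k x) * hterm N W k x)\<bar> \<le> ?g x" by (simp add: abs_mult)
      qed
    qed (use eta in \<open>simp add: sum_nonneg\<close>)
    also have "\<dots> = (\<Sum>k\<in>(UNIV::3 set). \<integral>x. \<eta> * norm (X x) powr (3/2) + \<bar>hterm N W k x\<bar>^3 / \<eta>^2 \<partial>S3)"
      using X3 hi by (intro Bochner_Integration.integral_sum) auto
    also have "\<dots> \<le> (\<Sum>k\<in>(UNIV::3 set). \<eta> * M + e1 / \<eta>^2)" by (intro sum_mono yi hi h)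
    finally show ?thesis by simp
  qed
  have z'b: "\<bar>?z' x v\<bar> \<le> L * norm v" if "norm x = 1" for x v
    using abs_dcutoff_le[OF P(2) that, of m v] by (simp add: L)
  have C: "\<bar>Cterm ?z' X D N\<bar> \<le> L * (\<eta> * M + e1 / \<eta>^2)"
  proof -
    let ?g = "\<lambda>x. L * (\<eta> * norm (X x) powr (3/2) + \<bar>phi N D x\<bar>^3 / \<eta>^2)"
    have "\<bar>Cterm ?z' X D N\<bar> \<le> (\<integral>x. ?g x \<partial>S3)"
      unfolding Cterm_def
    proof (rule order_trans[OF integral_abs_bound integral_mono_AE'])
      show "integrable S3 ?g" using X3 phi by simp
      show "AE x in S3. \<bar>phi N D x * ?z' x (X x)\<bar> \<le> ?g x"
      proof (rule AE_I2)
        fix x assume "x \<in> space S3"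
        then have nx: "norm x = 1" by simp
        have "\<bar>phi N D x * ?z' x (X x)\<bar> \<le> \<bar>phi N D x\<bar> * (L * norm (X x))"
          unfolding abs_mult using z'b[OF nx] by (intro mult_left_mono) auto
        also have "\<dots> = L * (norm (X x) * \<bar>phi N D x\<bar>)" by simp
        also have "\<dots> \<le> ?g x" using eta L0 by (intro mult_left_mono young_eta) auto
        finally show "\<bar>phi N D x * ?z' x (X x)\<bar> \<le> ?g x" .
      qed
    qed (use eta L0 in simp)
    also have "\<dots> = L * (\<integral>x. \<eta> * norm (X x) powr (3/2) + \<bar>phi N D x\<bar>^3 / \<eta>^2 \<partial>S3)" by (rule integral_mult_right_zero)
    also have "\<dots> \<le> L * (\<eta> * M + e1 / \<eta>^2)" by (intro mult_left_mono yi phi ph L0)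
    finally show ?thesis .
  qed
  have t1: "(\<integral>\<^sup>+x. (\<integral>\<^sup>+y. ennreal (72 * (\<bar>?z x\<bar> * norm (X x) * norm (W y) * tailk N x y)) \<partial>S3) \<partial>S3) \<le> ennreal (72 * T)"
  proof -
    let ?f = "\<lambda>p. ennreal (\<bar>?z (fst p)\<bar> * norm (X (fst p)) * norm (W (snd p)) * tailk N (fst p) (snd p))"
    note zm = measurable_cutoff[OF P(1), of m]
    have m: "?f \<in> borel_measurable (S3 \<Otimes>\<^sub>M S3)"
      using measurable_fst_S3'[OF zm] measurable_fst_S3'[OF Xm] measurable_snd_S3'[OF Wm] measurable_tailk by simp
    have "(\<integral>\<^sup>+x. (\<integral>\<^sup>+y. ennreal (72 * (\<bar>?z x\<bar> * norm (X x) * norm (W y) * tailk N x y)) \<partial>S3) \<partial>S3)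
        = (\<integral>\<^sup>+x. 72 * (\<integral>\<^sup>+y. ?f (x, y) \<partial>S3) \<partial>S3)"
    proof (rule nn_integral_cong)
      fix x assume x: "x \<in> space S3"
      have "(\<lambda>y. ?f (x, y)) \<in> borel_measurable S3" by (rule measurable_compose[OF measurable_Pair1'[OF x] m])
      from nn_integral_cmult[OF this, of 72]
      show "(\<integral>\<^sup>+y. ennreal (72 * (\<bar>?z x\<bar> * norm (X x) * norm (W y) * tailk N x y)) \<partial>S3) = 72 * (\<integral>\<^sup>+y. ?f (x, y) \<partial>S3)"
        by (simp add: ennreal_mult' flip: ennreal_numeral)
    qed
    also have "\<dots> = 72 * (\<integral>\<^sup>+x. (\<integral>\<^sup>+y. ?f (x, y) \<partial>S3) \<partial>S3)"
      using S3.borel_measurable_nn_integral_fst[OF m] by (rule nn_integral_cmult)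
    also have "\<dots> \<le> 72 * ennreal T" using T(2) by (intro mult_left_mono) simp_all
    also have "\<dots> = ennreal (72 * T)" using T(1) by (simp add: ennreal_mult' flip: ennreal_numeral)
    finally show ?thesis .
  qed
  have t2: "(\<integral>\<^sup>+x. (\<integral>\<^sup>+y. ennreal (\<bar>?z' x (X x)\<bar> * norm (D y) * tailk N x y) \<partial>S3) \<partial>S3) \<le> ennreal (L * (e2 * (2 * M)))"
  proof -
    \<comment> \<open>Young's inequality separates \<open>X x\<close> from \<open>D y\<close> into
      two integrable functions of one variable each, so the small integral of the kernel in the
      other variable suffices.\<close>
    let ?F = "\<lambda>x. L * norm (X x) powr (3/2)" and ?G = "\<lambda>y. L * norm (D y)^3"
    have F: "?F \<in> borel_measurable S3" "integrable S3 ?F" "\<And>x. 0 \<le> ?F x" "(\<integral>x. ?F x \<partial>S3) \<le> L * M"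
      using X3 Xm M(1) L0 by (simp_all add: mult_left_mono)
    have G: "?G \<in> borel_measurable S3" "integrable S3 ?G" "\<And>x. 0 \<le> ?G x" "(\<integral>x. ?G x \<partial>S3) \<le> L * M"
      using D3 Dm M(2) L0 by (simp_all add: mult_left_mono)
    have mF: "(\<lambda>p. ennreal (?F (fst p) * tailk N (fst p) (snd p))) \<in> borel_measurable (S3 \<Otimes>\<^sub>M S3)"
      using measurable_fst_S3'[OF F(1)] measurable_tailk by simp
    have mG: "(\<lambda>p. ennreal (?G (snd p) * tailk N (fst p) (snd p))) \<in> borel_measurable (S3 \<Otimes>\<^sub>M S3)"
      using measurable_snd_S3'[OF G(1)] measurable_tailk by simp
    have "(\<integral>\<^sup>+x. (\<integral>\<^sup>+y. ennreal (\<bar>?z' x (X x)\<bar> * norm (D y) * tailk N x y) \<partial>S3) \<partial>S3)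
        \<le> (\<integral>\<^sup>+x. (\<integral>\<^sup>+y. ennreal (?F x * tailk N x y) + ennreal (?G y * tailk N x y) \<partial>S3) \<partial>S3)"
    proof (intro nn_integral_mono)
      fix x y assume "x \<in> space S3" "y \<in> space S3"
      then have nx: "norm x = 1" and ny: "norm y = 1" by simp_all
      have "\<bar>?z' x (X x)\<bar> * norm (D y) \<le> L * (norm (X x) * norm (D y))"
        using mult_right_mono[OF z'b[OF nx, of "X x"], of "norm (D y)"] by (simp add: mult.assoc)
      also have "\<dots> \<le> L * (norm (X x) powr (3/2) + norm (D y)^3)" using L0 by (intro mult_left_mono young_3_2) auto
      finally have "\<bar>?z' x (X x)\<bar> * norm (D y) * tailk N x y \<le> (?F x + ?G y) * tailk N x y"
        using tailk_nonneg[OF nx ny] by (intro mult_right_mono) (auto simp: distrib_left)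
      then have "ennreal (\<bar>?z' x (X x)\<bar> * norm (D y) * tailk N x y) \<le> ennreal (?F x * tailk N x y + ?G y * tailk N x y)"
        by (intro ennreal_leI) (simp add: distrib_right)
      also have "\<dots> = ennreal (?F x * tailk N x y) + ennreal (?G y * tailk N x y)"
        using L0 tailk_nonneg[OF nx ny] by (intro ennreal_plus) auto
      finally show "ennreal (\<bar>?z' x (X x)\<bar> * norm (D y) * tailk N x y) \<le> ennreal (?F x * tailk N x y) + ennreal (?G y * tailk N x y)" .
    qed
    also have "\<dots> = (\<integral>\<^sup>+x. (\<integral>\<^sup>+y. ennreal (?F x * tailk N x y) \<partial>S3) + (\<integral>\<^sup>+y. ennreal (?G y * tailk N x y) \<partial>S3) \<partial>S3)"
    proof (rule nn_integral_cong)
      fix x assume x: "x \<in> space S3"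
      show "(\<integral>\<^sup>+y. ennreal (?F x * tailk N x y) + ennreal (?G y * tailk N x y) \<partial>S3) = (\<integral>\<^sup>+y. ennreal (?F x * tailk N x y) \<partial>S3) + (\<integral>\<^sup>+y. ennreal (?G y * tailk N x y) \<partial>S3)"
        using nn_integral_add[OF measurable_compose[OF measurable_Pair1'[OF x] mF] measurable_compose[OF measurable_Pair1'[OF x] mG]]
        by (simp only: fst_conv snd_conv)
    qed
    also have "\<dots> = (\<integral>\<^sup>+x. (\<integral>\<^sup>+y. ennreal (?F x * tailk N x y) \<partial>S3) \<partial>S3) + (\<integral>\<^sup>+x. (\<integral>\<^sup>+y. ennreal (?G y * tailk N x y) \<partial>S3) \<partial>S3)"
      using nn_integral_add[OF S3.borel_measurable_nn_integral_fst[OF mF] S3.borel_measurable_nn_integral_fst[OF mG]]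
      by (simp only: fst_conv snd_conv)
    also have "\<dots> \<le> ennreal (e2 * (L * M)) + ennreal (e2 * (L * M))"
      by (intro add_mono nn_integral_product_tailk(1)[OF F e2] nn_integral_product_tailk(2)[OF G e2])
    also have "\<dots> = ennreal (e2 * (L * M) + e2 * (L * M))"
      using e2(1) L0 M0 by (intro ennreal_plus[symmetric]) auto
    also have "e2 * (L * M) + e2 * (L * M) = L * (e2 * (2 * M))" by simp
    finally show ?thesis .
  qed
  have "ennreal \<bar>area3 * (\<integral>x. ?z x * (X x \<bullet> D x) \<partial>S3) - (Bterm ?z X W N - Cterm ?z' X D N)\<bar> \<le> ennreal (72 * T) + ennreal (L * (e2 * (2 * M)))"
    by (rule order_trans[OF key_estimate[OF X D Wi c cutoff_polynomial[OF P(1)] cutoff_has_derivative[OF P(1)]] add_mono[OF t1 t2]])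
  also have "\<dots> = ennreal (72 * T + L * (e2 * (2 * M)))"
    using T(1) e2(1) L0 M0 by (intro ennreal_plus[symmetric]) auto
  finally have "\<bar>area3 * (\<integral>x. ?z x * (X x \<bullet> D x) \<partial>S3) - (Bterm ?z X W N - Cterm ?z' X D N)\<bar> \<le> 72 * T + L * (e2 * (2 * M))"
    using T(1) e2(1) L0 M0 by (subst (asm) ennreal_le_iff) auto
  moreover have "(3 + L) * (\<eta> * M + e1 / \<eta>^2) = 3 * (\<eta> * M + e1 / \<eta>^2) + L * (\<eta> * M + e1 / \<eta>^2)" by (rule distrib_right)
  ultimately show ?thesis using B C by linarith
qed

text \<open>Values of \<open>D\<close> below \<open>\<kappa>\<close> are harmless. Above
  \<open>\<kappa>\<close>, away from \<open>P\<close>, the norm is at most its cube over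
  \<open>\<kappa>^2\<close>, which monotonicity and the cut-off control. Near \<open>P\<close> it is
  at most \<open>1 / \<kappa>\<close>, on a set of small measure, or at most
  \<open>\<kappa>^2\<close> times its cube.\<close>

lemma integral_norm_split:
  assumes X: "L32v X" and D: "L3v D" and mono: "\<And>x. norm (D x)^3 \<le> 2 * (X x \<bullet> D x)" and DM: "(\<integral>x. norm (D x)^3 \<partial>S3) \<le> M"
    and P: "finite P" "P \<subseteq> sphere 0 1" and R: "0 < R" "R \<le> 1" and m: "real (card P) * (1 - (R/2)^2)^m \<le> 1/2"
    and C: "\<And>y r. y \<in> sphere 0 1 \<Longrightarrow> r > 0 \<Longrightarrow> measure S3 (sphere 0 1 \<inter> ball y r) \<le> C * r^3" and k: "0 < \<kappa>"
  shows "(\<integral>x. norm (D x) \<partial>S3) \<le> \<kappa> * area3 + 4 / \<kappa>^2 * (\<integral>x. cutoff m P x * (X x \<bullet> D x) \<partial>S3) + real (card P) * (C * R^3) / \<kappa> + \<kappa>^2 * M"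
proof -
  let ?z = "cutoff m P" and ?B = "\<lambda>p. sphere 0 1 \<inter> ball p R :: R4 set"
  have D3: "integrable S3 (\<lambda>x. norm (D x)^3)" using D by (simp add: L3v_def)
  have XDm: "(\<lambda>x. X x \<bullet> D x) \<in> borel_measurable S3" using X D by (auto simp: L3v_def L32v_def)
  note zm = measurable_cutoff[OF P(1), of m]
  have zi: "integrable S3 (\<lambda>x. ?z x * (X x \<bullet> D x))"
  proof (rule Bochner_Integration.integrable_bound[OF integrable_inner_L3v_L32v[OF X D]])
    show "(\<lambda>x. ?z x * (X x \<bullet> D x)) \<in> borel_measurable S3" using zm XDm by simp
    show "AE x in S3. norm (?z x * (X x \<bullet> D x)) \<le> norm (norm (X x) * norm (D x))"
    proof (rule AE_I2)
      fix x assume "x \<in> space S3"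
      then have "norm x = 1" by simp
      from cutoff_bounds[OF P(2) this, of m] have "\<bar>?z x\<bar> * \<bar>X x \<bullet> D x\<bar> \<le> 1 * (norm (X x) * norm (D x))"
        by (intro mult_mono Cauchy_Schwarz_ineq2) auto
      then show "norm (?z x * (X x \<bullet> D x)) \<le> norm (norm (X x) * norm (D x))" by (simp add: abs_mult)
    qed
  qed
  have Bs: "?B p \<in> sets S3" for p unfolding sets_S3 by (intro sets_restrict_space_iff[THEN iffD2]) auto
  have Bi: "integrable S3 (\<lambda>x. indicator (?B p) x :: real)" for p
    using Bs[of p] by (intro integrable_real_indicator) (simp_all add: S3.emeasure_eq_measure)
  have "(\<integral>x. norm (D x) \<partial>S3) \<le> (\<integral>x. \<kappa> + 4 / \<kappa>^2 * (?z x * (X x \<bullet> D x)) + (\<Sum>p\<in>P. indicator (?B p) x) / \<kappa> + \<kappa>^2 * norm (D x)^3 \<partial>S3)"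
  proof (rule integral_mono_AE)
    show "integrable S3 (\<lambda>x. norm (D x))" using L3v_integrable[OF D] by simp
    show "integrable S3 (\<lambda>x. \<kappa> + 4 / \<kappa>^2 * (?z x * (X x \<bullet> D x)) + (\<Sum>p\<in>P. indicator (?B p) x) / \<kappa> + \<kappa>^2 * norm (D x)^3)"
      by (intro Bochner_Integration.integrable_add integrable_mult_right Bochner_Integration.integrable_sum integrable_divide zi Bi D3) simp
    show "AE x in S3. norm (D x) \<le> \<kappa> + 4 / \<kappa>^2 * (?z x * (X x \<bullet> D x)) + (\<Sum>p\<in>P. indicator (?B p) x) / \<kappa> + \<kappa>^2 * norm (D x)^3"
    proof (rule AE_I2)
      fix x assume "x \<in> space S3"
      then have nx: "norm x = 1" by simp
      note z = cutoff_bounds[OF P(2) nx, of m]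
      have XD: "0 \<le> X x \<bullet> D x" using mono[of x] zero_le_power[OF norm_ge_zero, of "D x" 3] by linarith
      have t0: "0 \<le> 4 / \<kappa>^2 * (?z x * (X x \<bullet> D x))" using z XD by simp
      have s0: "0 \<le> (\<Sum>p\<in>P. indicator (?B p) x :: real) / \<kappa>" using k by (intro divide_nonneg_pos sum_nonneg) auto
      have c0: "0 \<le> \<kappa>^2 * norm (D x)^3" by simp
      show "norm (D x) \<le> \<kappa> + 4 / \<kappa>^2 * (?z x * (X x \<bullet> D x)) + (\<Sum>p\<in>P. indicator (?B p) x) / \<kappa> + \<kappa>^2 * norm (D x)^3"
      proof (cases "\<exists>p\<in>P. norm (x - p) < R")
        case True
        then obtain p where p: "p \<in> P" "norm (x - p) < R" by blast
        have "indicator (?B p) x \<le> (\<Sum>p\<in>P. indicator (?B p) x :: real)" by (rule member_le_sum[OF p(1)]) (use P in auto)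
        moreover have "x \<in> ?B p" using p nx by (simp add: dist_norm norm_minus_commute)
        ultimately have "1 / \<kappa> \<le> (\<Sum>p\<in>P. indicator (?B p) x :: real) / \<kappa>" using k by (intro divide_right_mono) auto
        moreover have "norm (D x) \<le> 1 / \<kappa> + \<kappa>^2 * norm (D x)^3"
        proof (cases "norm (D x) \<le> 1 / \<kappa>")
          case True
          then show ?thesis using c0 by linarith
        next
          case False
          then have "1 \<le> \<kappa> * norm (D x)" using k by (simp add: field_simps)
          then have "1 \<le> (\<kappa> * norm (D x))^2" by (rule one_le_power)
          then have "1 * norm (D x) \<le> (\<kappa> * norm (D x))^2 * norm (D x)" by (intro mult_right_mono) auto
          also have "\<dots> = \<kappa>^2 * norm (D x)^3" by (simp add: power_mult_distrib power2_eq_square power3_eq_cube)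
          finally show ?thesis using k by (simp add: add_increasing)
        qed
        ultimately show ?thesis using t0 k by linarith
      next
        case False
        then have "R \<le> norm (x - p)" if "p \<in> P" for p using that by force
        then have "?z x \<ge> 1 - real (card P) * (1 - (R/2)^2)^m" using cutoff_large[OF P nx R] by blast
        \<comment> \<open>Together with the factor 2 in the monotonicity inequality, the lower bound
          1/2 gives the constant 4.\<close>
        then have zh: "1/2 \<le> ?z x" using m by linarith
        have "norm (D x) \<le> \<kappa> + norm (D x)^3 / \<kappa>^2"
        proof (cases "norm (D x) \<le> \<kappa>")
          case True
          then show ?thesis using k by (simp add: add_increasing2)
        next
          case False
          then have "\<kappa>^2 * norm (D x) \<le> norm (D x)^2 * norm (D x)" using k by (intro mult_right_mono power_mono) auto
          then have "norm (D x) \<le> norm (D x)^3 / \<kappa>^2" using k by (simp add: pos_le_divide_eq power2_eq_square power3_eq_cube mult_ac)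
          then show ?thesis using k by linarith
        qed
        moreover have "norm (D x)^3 / \<kappa>^2 \<le> 4 / \<kappa>^2 * (?z x * (X x \<bullet> D x))"
        proof -
          have "1/2 * (X x \<bullet> D x) \<le> ?z x * (X x \<bullet> D x)" by (intro mult_right_mono zh XD)
          then have "norm (D x)^3 \<le> 4 * (?z x * (X x \<bullet> D x))" using mono[of x] by linarith
          then have "norm (D x)^3 / \<kappa>^2 \<le> 4 * (?z x * (X x \<bullet> D x)) / \<kappa>^2" by (intro divide_right_mono) auto
          then show ?thesis by simp
        qed
        ultimately show ?thesis using s0 c0 by linarith
      qed
    qed
  qed
  also have "\<dots> = \<kappa> * area3 + 4 / \<kappa>^2 * (\<integral>x. ?z x * (X x \<bullet> D x) \<partial>S3) + (\<Sum>p\<in>P. measure S3 (?B p)) / \<kappa> + \<kappa>^2 * (\<integral>x. norm (D x)^3 \<partial>S3)"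
  proof -
    have "(\<integral>x. (\<Sum>p\<in>P. indicator (?B p) x) / \<kappa> \<partial>S3) = (\<Sum>p\<in>P. measure S3 (?B p)) / \<kappa>"
      using Bi Bs by (simp add: Bochner_Integration.integral_sum Int_ac)
    moreover have "integrable S3 (\<lambda>x. (\<Sum>p\<in>P. indicator (?B p) x) / \<kappa>)"
      by (intro Bochner_Integration.integrable_sum integrable_divide Bi)
    ultimately show ?thesis using zi D3 by (simp add: area3_def)
  qed
  also have "\<dots> \<le> \<kappa> * area3 + 4 / \<kappa>^2 * (\<integral>x. ?z x * (X x \<bullet> D x) \<partial>S3) + real (card P) * (C * R^3) / \<kappa> + \<kappa>^2 * M"
  proof -
    have "(\<Sum>p\<in>P. measure S3 (?B p)) \<le> (\<Sum>p\<in>P. C * R^3)" using P R by (intro sum_mono C) auto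
    then have "(\<Sum>p\<in>P. measure S3 (?B p)) / \<kappa> \<le> real (card P) * (C * R^3) / \<kappa>" using k by (intro divide_right_mono) auto
    moreover have "\<kappa>^2 * (\<integral>x. norm (D x)^3 \<partial>S3) \<le> \<kappa>^2 * M" using DM by (intro mult_left_mono) auto
    ultimately show ?thesis by linarith
  qed
  finally show ?thesis .
qed

lemma hterm_diff:
  assumes W: "integrable S3 W" "integrable S3 V"
  shows "hterm N (\<lambda>x. W x - V x) k x = hterm N W k x - hterm N V k x"
proof -
  have "integrable S3 (\<lambda>y. u y \<bullet> (Fk N k x y - (1/2) *\<^sub>R fr k y))" if "integrable S3 u" for u
    by (intro integrable_inner_continuous that continuous_on_diff continuous_Fk continuous_intros)
  then show ?thesis using W unfolding hterm_def inner_diff_left by simp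
qed

lemma phi_diff:
  assumes a: "integrable S3 a" "integrable S3 b"
  shows "phi N (\<lambda>x. a x - b x) x = phi N a x - phi N b x"
proof -
  have "integrable S3 (\<lambda>y. gamN N (sK x y) * (x \<bullet> u y))" if "integrable S3 u" for u
    using integrable_continuous_mult[OF _ integrable_inner_continuous(2)[OF continuous_on_const that], of "\<lambda>y. gamN N (sK x y)" x]
    by (simp add: continuous_intros)
  then show ?thesis using a unfolding phi_def inner_diff_right right_diff_distrib by simp
qed

lemma admissible_diff:
  assumes a: "admissible a W" and b: "admissible b V"
    and A: "(\<integral>x. norm (a x)^3 \<partial>S3) \<le> A" "(\<integral>x. norm (b x)^3 \<partial>S3) \<le> A"
    and Q: "(\<integral>x. norm (W x) powr (3/2) \<partial>S3) \<le> Q" "(\<integral>x. norm (V x) powr (3/2) \<partial>S3) \<le> Q"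
  shows "L32v (\<lambda>x. norm (a x) *\<^sub>R a x - norm (b x) *\<^sub>R b x)" (is "L32v ?X")
    and "divfree (\<lambda>x. norm (a x) *\<^sub>R a x - norm (b x) *\<^sub>R b x)"
    and "L3v (\<lambda>x. a x - b x)" and "L32v (\<lambda>x. W x - V x)"
    and "curl_of (\<lambda>x. a x - b x) (\<lambda>x. W x - V x)"
    and "(\<integral>x. norm (norm (a x) *\<^sub>R a x - norm (b x) *\<^sub>R b x) powr (3/2) \<partial>S3) \<le> 8 * A"
    and "(\<integral>x. norm (a x - b x)^3 \<partial>S3) \<le> 8 * A"
    and "(\<integral>x. norm (W x - V x) powr (3/2) \<partial>S3) \<le> 8 * Q"
proof -
  have L: "L3v a" "L3v b" "L32v W" "L32v V" and dv: "divfree (\<lambda>x. norm (a x) *\<^sub>R a x)" "divfree (\<lambda>x. norm (b x) *\<^sub>R b x)"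
    and c: "curl_of a W" "curl_of b V" using a b by (simp_all add: admissible_def)
  note Xa = L32v_of_L3v[OF L(1)] and Xb = L32v_of_L3v[OF L(2)]
  show "L32v ?X" by (rule L32v_diff[OF Xa Xb])
  show "divfree ?X" by (rule divfree_diff[OF dv L32v_integrable[OF Xa] L32v_integrable[OF Xb]])
  show "L3v (\<lambda>x. a x - b x)" by (rule L3v_diff[OF L(1,2)])
  show "L32v (\<lambda>x. W x - V x)" by (rule L32v_diff[OF L(3,4)])
  show "curl_of (\<lambda>x. a x - b x) (\<lambda>x. W x - V x)"
    by (rule curl_of_diff[OF c L3v_integrable[OF L(1)] L3v_integrable[OF L(2)] L32v_integrable[OF L(3)] L32v_integrable[OF L(4)]])
  show "(\<integral>x. norm (?X x) powr (3/2) \<partial>S3) \<le> 8 * A"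
    using A by (intro integral_norm_diff_powr_le Xa Xb) (simp_all only: norm_scaleR_powr_3_2)
  show "(\<integral>x. norm (a x - b x)^3 \<partial>S3) \<le> 8 * A" by (rule integral_norm_diff_cube_le[OF L(1,2) A])
  show "(\<integral>x. norm (W x - V x) powr (3/2) \<partial>S3) \<le> 8 * Q" by (rule integral_norm_diff_powr_le[OF L(3,4) Q])
qed

lemma tail_product_bound:
  assumes X: "L32v X" and W: "L32v W" and M: "(\<integral>x. norm (X x) powr (3/2) \<partial>S3) \<le> M" "(\<integral>x. norm (W x) powr (3/2) \<partial>S3) \<le> M"
    and t: "0 \<le> \<tau>"
  shows "(\<integral>\<^sup>+x. (\<integral>\<^sup>+y. ennreal (\<tau> * (norm (X x) * norm (W y))) \<partial>S3) \<partial>S3) \<le> ennreal (\<tau> * (M + area3)^2)"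
proof -
  have i: "integrable S3 (\<lambda>x. norm (X x))" "integrable S3 (\<lambda>x. norm (W x))" using L32v_integrable X W by auto
  have b: "(\<integral>x. norm (X x) \<partial>S3) \<le> M + area3" "(\<integral>x. norm (W x) \<partial>S3) \<le> M + area3"
    using integral_norm_le_eta[OF X, of 1] integral_norm_le_eta[OF W, of 1] M by simp_all
  have b0: "0 \<le> (\<integral>x. norm (X x) \<partial>S3)" "0 \<le> (\<integral>x. norm (W x) \<partial>S3)" by simp_all
  have "(\<integral>\<^sup>+x. (\<integral>\<^sup>+y. ennreal (\<tau> * (norm (X x) * norm (W y))) \<partial>S3) \<partial>S3) = (\<integral>\<^sup>+x. ennreal (\<tau> * (\<integral>y. norm (W y) \<partial>S3) * norm (X x)) \<partial>S3)"
  proof (rule nn_integral_cong)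
    fix x
    have "(\<integral>\<^sup>+y. ennreal (\<tau> * (norm (X x) * norm (W y))) \<partial>S3) = ennreal (\<integral>y. \<tau> * (norm (X x) * norm (W y)) \<partial>S3)"
      using i t by (intro nn_integral_eq_integral) auto
    then show "(\<integral>\<^sup>+y. ennreal (\<tau> * (norm (X x) * norm (W y))) \<partial>S3) = ennreal (\<tau> * (\<integral>y. norm (W y) \<partial>S3) * norm (X x))"
      by (simp add: mult_ac)
  qed
  also have "\<dots> = ennreal (\<integral>x. \<tau> * (\<integral>y. norm (W y) \<partial>S3) * norm (X x) \<partial>S3)"
    using i t b0 by (intro nn_integral_eq_integral) auto
  also have "\<dots> \<le> ennreal (\<tau> * (M + area3)^2)"
  proof (rule ennreal_leI)
    have "(\<integral>y. norm (W y) \<partial>S3) * (\<integral>x. norm (X x) \<partial>S3) \<le> (M + area3) * (M + area3)"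
      using b b0 order_trans[OF b0(1) b(1)] by (intro mult_mono)
    then have "\<tau> * ((\<integral>y. norm (W y) \<partial>S3) * (\<integral>x. norm (X x) \<partial>S3)) \<le> \<tau> * ((M + area3) * (M + area3))" using t by (rule mult_left_mono)
    then show "(\<integral>x. \<tau> * (\<integral>y. norm (W y) \<partial>S3) * norm (X x) \<partial>S3) \<le> \<tau> * (M + area3)^2"
      by (simp add: power2_eq_square mult.assoc)
  qed
  finally show ?thesis .
qed

text \<open>The points supplied by \<open>loc\<close> depend on the pair \<open>n\<close>,
  \<open>l\<close>, yet all parameters must precede it. This works because their number is at most
  \<open>K\<close>, and \<open>K\<close> depends only on the uniform bounds and on
  \<open>e\<close>.\<close>

lemma cauchy_L1:
  assumes ad: "\<And>n. admissible (a n) (W n)" and Q: "\<And>n. (\<integral>x. norm (W n x) powr (3/2) \<partial>S3) \<le> Q"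
    and A: "\<And>n. (\<integral>x. norm (a n x)^3 \<partial>S3) \<le> A"
    and hc: "\<And>N k x. norm x = 1 \<Longrightarrow> convergent (\<lambda>n. hterm N (W n) k x)"
    and pc: "\<And>N x. norm x = 1 \<Longrightarrow> convergent (\<lambda>n. phi N (a n) x)" and e: "e > 0"
  shows "\<exists>n0. \<forall>n\<ge>n0. \<forall>l\<ge>n0. (\<integral>x. norm (a n x - a l x) \<partial>S3) \<le> e"
proof -
  obtain C1 where C1: "C1 > 0" and loc:
    "\<And>r X W M \<epsilon> \<epsilon>'. r > 0 \<Longrightarrow> M > 0 \<Longrightarrow> \<epsilon> > 0 \<Longrightarrow> \<epsilon>' > 0 \<Longrightarrow>
      X \<in> borel_measurable S3 \<Longrightarrow> W \<in> borel_measurable S3 \<Longrightarrow>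
      (\<integral>\<^sup>+x. ennreal (norm ((X x)::R4) powr (3/2)) \<partial>S3) \<le> ennreal M \<Longrightarrow>
      (\<integral>\<^sup>+x. ennreal (norm ((W x)::R4) powr (3/2)) \<partial>S3) \<le> ennreal M \<Longrightarrow>
      \<exists>P. finite P \<and> P \<subseteq> sphere 0 1 \<and> real (card P) \<le> 81 * M / \<epsilon> \<and>
        (\<forall>z \<tau> N. (\<forall>x. norm x = 1 \<longrightarrow> 0 \<le> z x \<and> z x \<le> 1) \<longrightarrow>
          (\<forall>p\<in>P. \<forall>x. norm x = 1 \<longrightarrow> norm (x - p) \<le> 4 * r \<longrightarrow> z x \<le> \<epsilon>') \<longrightarrow>
          (\<forall>x y. norm x = 1 \<longrightarrow> norm y = 1 \<longrightarrow> r \<le> norm (x - y) \<longrightarrow> tailk N x y \<le> \<tau>) \<longrightarrow>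
          (\<integral>\<^sup>+x. (\<integral>\<^sup>+y. ennreal (\<bar>z x\<bar> * norm (X x) * norm (W y) * tailk N x y) \<partial>S3) \<partial>S3)
            \<le> ennreal (C1 * (\<epsilon> powr (1/3) + \<epsilon>' * (81 * M) powr (1/3)) * (82 * M))
              + (\<integral>\<^sup>+x. (\<integral>\<^sup>+y. ennreal (\<tau> * (norm (X x) * norm (W y))) \<partial>S3) \<partial>S3))"
    by (rule localized_potential) blast
  obtain C where C: "C > 0" "\<And>y r. y \<in> sphere 0 1 \<Longrightarrow> r > 0 \<Longrightarrow> measure S3 (sphere 0 1 \<inter> ball y r) \<le> C * r^3"
    using measure_S3_ball by blast
  have Lv: "L3v (a n)" "L32v (W n)" "curl_of (a n) (W n)" for n using ad[of n] by (simp_all add: admissible_def)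
  note ai = L3v_integrable[OF Lv(1)] and Wi = L32v_integrable[OF Lv(2)]
  have A0: "0 \<le> A" by (rule order_trans[OF Bochner_Integration.integral_nonneg A[of 0]]) simp
  have Q0: "0 \<le> Q" by (rule order_trans[OF Bochner_Integration.integral_nonneg Q[of 0]]) simp
  define M where "M = 8 * A + 8 * Q + 1"
  have M: "M > 0" "8 * A \<le> M" "8 * Q \<le> M" using A0 Q0 by (auto simp: M_def)
  \<comment> \<open>Makes the two terms \<open>\<kappa> * area3\<close> and
    \<open>\<kappa>^2 * M\<close> of the splitting contribute at most \<open>e / 8\<close>
    together.\<close>
  define \<kappa> where "\<kappa> = min 1 (e / (8 * (area3 + M)))"
  have aM: "0 < area3 + M" using area3_pos M by linarith
  have k: "0 < \<kappa>" "\<kappa> \<le> 1" using e aM by (auto simp: \<kappa>_def)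
  have kM: "\<kappa> * (area3 + M) \<le> e / 8"
  proof -
    have "\<kappa> * (area3 + M) \<le> e / (8 * (area3 + M)) * (area3 + M)" using aM by (intro mult_right_mono) (auto simp: \<kappa>_def)
    moreover have "e / (8 * t) * t = e / 8" if "0 < t" for t using that by simp
    ultimately show ?thesis using aM by metis
  qed
  \<comment> \<open>Chosen so that a bound \<open>\<delta>\<close> on \<open>area3\<close> times the
    localized pairing costs \<open>e / 4\<close> after multiplication by
    \<open>4 / \<kappa>^2\<close>.\<close>
  define \<delta> where "\<delta> = \<kappa>^2 * area3 * e / 16"
  have d: "\<delta> > 0" using k e area3_pos by (simp add: \<delta>_def)
  \<comment> \<open>Solves for the localized bound to be \<open>\<delta> / (4 * 72)\<close>, with 72
    the constant in front of the critical tail; \<open>\<epsilon>\<close> and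
    \<open>\<epsilon>'\<close> contribute \<open>s\<close> each to the bracket.\<close>
  define s where "s = \<delta> / (4 * 72) / (2 * C1 * (82 * M))"
  have s: "s > 0" using d C1 M by (simp add: s_def)
  define \<epsilon> where "\<epsilon> = s^3"
  define \<epsilon>' where "\<epsilon>' = s / (81 * M) powr (1/3)"
  have eps: "\<epsilon> > 0" "\<epsilon>' > 0" using s M by (simp_all add: \<epsilon>_def \<epsilon>'_def)
  have sval: "C1 * (\<epsilon> powr (1/3) + \<epsilon>' * (81 * M) powr (1/3)) * (82 * M) = \<delta> / (4 * 72)"
  proof -
    have "\<epsilon> powr (1/3) = s" using s by (simp add: \<epsilon>_def powr_powr flip: powr_numeral)
    moreover have "\<epsilon>' * (81 * M) powr (1/3) = s" using M by (simp add: \<epsilon>'_def)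
    ultimately have "C1 * (\<epsilon> powr (1/3) + \<epsilon>' * (81 * M) powr (1/3)) * (82 * M) = s * (2 * C1 * (82 * M))" by simp
    then show ?thesis using C1 M by (simp add: s_def)
  qed
  define K where "K = 81 * M / \<epsilon>"
  have K: "K > 0" using M eps by (simp add: K_def)
  define R where "R = min 1 (e * \<kappa> / (8 * (K * C)))"
  have R: "0 < R" "R \<le> 1" using e k K C by (auto simp: R_def)
  have Rk: "K * (C * R^3) / \<kappa> \<le> e / 8"
  proof -
    have "R^3 \<le> R" using R power_decreasing[of 1 3 R] by simp
    then have "K * C * R^3 \<le> K * C * R" using K C by (intro mult_left_mono) auto
    also have "\<dots> \<le> K * C * (e * \<kappa> / (8 * (K * C)))" using K C by (intro mult_left_mono) (auto simp: R_def)
    also have "\<dots> = e * \<kappa> / 8" using K C by simp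
    finally show ?thesis using k by (simp add: pos_divide_le_eq mult_ac)
  qed
  have "0 < (R/2)^2" "(R/2)^2 \<le> 1" using R by (auto simp: abs_square_le_1)
  \<comment> \<open>The degree depends on \<open>R\<close> and \<open>K\<close> only. The grid size
    \<open>r\<close> is chosen after it, small enough for the cut-off of this degree to stay below
    \<open>\<epsilon>'\<close> on balls of radius \<open>4 * r\<close>.\<close>
  then obtain m where "(1 - (R/2)^2)^m < 1 / (2 * K)" using real_arch_pow_inv[of "1 / (2 * K)" "1 - (R/2)^2"] K by auto
  then have m: "K * (1 - (R/2)^2)^m \<le> 1/2" using K by (simp add: field_simps)
  define r where "r = sqrt (\<epsilon>' / (real m + 1)) / 4"
  have r: "r > 0" using eps by (simp add: r_def)
  have mr: "real m * (4 * r)^2 \<le> \<epsilon>'" using eps by (simp add: r_def pos_divide_le_eq mult.commute mult_right_mono)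
  define L where "L = K * real m"
  have L: "L \<ge> 0" using K by (simp add: L_def)
  define \<tau> where "\<tau> = \<delta> / (4 * 72) / (M + area3)^2"
  have tau: "\<tau> > 0" "\<tau> * (M + area3)^2 = \<delta> / (4 * 72)" using d aM by (simp_all add: \<tau>_def add.commute)
  obtain N1 where N1: "\<And>N x y. N \<ge> N1 \<Longrightarrow> norm x = 1 \<Longrightarrow> norm y = 1 \<Longrightarrow> r \<le> norm (x - y) \<Longrightarrow> tailk N x y \<le> \<tau>"
    using tailk_uniform[OF r tau(1)] by blast
  define e2 where "e2 = \<delta> / 4 / (L + 1) / (2 * M)"
  have e2: "e2 > 0" using d L M by (simp add: e2_def)
  have Le2: "L * (e2 * (2 * M)) \<le> \<delta> / 4"
  proof -
    have "L * (e2 * (2 * M)) = L * (\<delta> / 4 / (L + 1))" using M by (simp add: e2_def)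
    also have "\<dots> \<le> (L + 1) * (\<delta> / 4 / (L + 1))" using d L by (intro mult_right_mono) auto
    also have "\<dots> = \<delta> / 4"
    proof -
      have g: "t * (\<delta> / 4 / t) = \<delta> / 4" if "0 < t" for t using that by simp
      show ?thesis by (rule g) (use L in simp)
    qed
    finally show ?thesis .
  qed
  obtain N2 where N2: "\<And>N x. N \<ge> N2 \<Longrightarrow> norm x = 1 \<Longrightarrow> (\<integral>\<^sup>+y. ennreal (tailk N x y) \<partial>S3) \<le> ennreal e2"
    using nn_integral_tailk_small[OF e2] by blast
  \<comment> \<open>Only here is the truncation fixed: the tail must be small at distance
    \<open>r\<close> and in the mean, relative to the gradient bound \<open>L\<close> of the
    cut-off.\<close>
  define N where "N = max N1 N2"
  \<comment> \<open>The averaged terms have total weight \<open>3 + L\<close>; \<open>\<eta>\<close>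
    and \<open>e1\<close> give each half of the quarter of \<open>\<delta>\<close> allotted to
    them.\<close>
  define \<eta> where "\<eta> = \<delta> / 8 / (3 + L) / M"
  define e1 where "e1 = \<eta>^2 * (\<delta> / 8 / (3 + L))"
  have eta: "\<eta> > 0" using d L M by (simp add: \<eta>_def)
  have e1: "e1 > 0" using eta d L by (simp add: e1_def)
  have Leta: "(3 + L) * (\<eta> * M + e1 / \<eta>^2) = \<delta> / 4"
  proof -
    have "\<eta> * M = \<delta> / 8 / (3 + L)" using M by (simp add: \<eta>_def)
    moreover have "e1 / \<eta>^2 = \<delta> / 8 / (3 + L)" using eta by (simp add: e1_def)
    ultimately have "(3 + L) * (\<eta> * M + e1 / \<eta>^2) = (3 + L) * (\<delta> / 8 / (3 + L) + \<delta> / 8 / (3 + L))" by simp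
    also have "\<dots> = \<delta> / 4"
    proof -
      have g: "t * (\<delta> / 8 / t + \<delta> / 8 / t) = \<delta> / 4" if "0 < t" for t using that by (simp add: field_simps)
      show ?thesis by (rule g) (use L in simp)
    qed
    finally show ?thesis .
  qed
  have hb: "\<bar>hterm N (W n) k x\<bar> \<le> (24 * gamN N 1 + 1) * (Q + area3)" if "norm x = 1" for n k x
  proof -
    have "(\<integral>y. norm (W n y) \<partial>S3) \<le> Q + area3" using integral_norm_le_eta[OF Lv(2), of 1 n] Q[of n] by simp
    then show ?thesis
      by (intro order_trans[OF hterm_bound[OF Wi that] mult_left_mono]) (simp_all add: gamN_nonneg)
  qed
  have pb: "\<bar>phi N (a n) x\<bar> \<le> gamN N 1 * (A + area3)" if "norm x = 1" for n x
    by (intro order_trans[OF phi_bound[OF ai that] mult_left_mono] integral_norm_le_cube Lv A) (simp add: gamN_nonneg)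
  have "\<exists>n0. \<forall>n\<ge>n0. \<forall>l\<ge>n0. (\<integral>x. \<bar>hterm N (W n) k x - hterm N (W l) k x\<bar>^3 \<partial>S3) \<le> e1" for k
    by (rule bounded_pointwise_cauchy[OF hterm_measurable[OF Lv(3) ai Wi] hb hc e1])
  then have "\<forall>k. \<exists>n0. \<forall>n\<ge>n0. \<forall>l\<ge>n0. (\<integral>x. \<bar>hterm N (W n) k x - hterm N (W l) k x\<bar>^3 \<partial>S3) \<le> e1" by blast
  from choice[OF this] obtain nh where nh: "\<And>k n l. n \<ge> nh k \<Longrightarrow> l \<ge> nh k \<Longrightarrow> (\<integral>x. \<bar>hterm N (W n) k x - hterm N (W l) k x\<bar>^3 \<partial>S3) \<le> e1" by blast
  obtain np where np: "\<And>n l. n \<ge> np \<Longrightarrow> l \<ge> np \<Longrightarrow> (\<integral>x. \<bar>phi N (a n) x - phi N (a l) x\<bar>^3 \<partial>S3) \<le> e1"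
    using bounded_pointwise_cauchy[OF phi_measurable[OF ai] pb pc e1] by blast
  define n0 where "n0 = max np (Max (range nh))"
  have nhk: "nh k \<le> n0" for k unfolding n0_def by (intro max.coboundedI2 Max_ge) auto
  show ?thesis
  proof (intro exI[of _ n0] allI impI)
    fix n l assume nl: "n0 \<le> n" "n0 \<le> l"
    define X where "X x = norm (a n x) *\<^sub>R a n x - norm (a l x) *\<^sub>R a l x" for x
    define D where "D x = a n x - a l x" for x
    define V where "V x = W n x - W l x" for x
    note ad' = admissible_diff[OF ad ad A A Q Q, of n l, folded X_def D_def V_def]
    have XM: "(\<integral>x. norm (X x) powr (3/2) \<partial>S3) \<le> M" and DM: "(\<integral>x. norm (D x)^3 \<partial>S3) \<le> M" and VM: "(\<integral>x. norm (V x) powr (3/2) \<partial>S3) \<le> M"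
      using ad'(6-8) M by linarith+
    have mono: "norm (D x)^3 \<le> 2 * (X x \<bullet> D x)" for x unfolding D_def X_def by (rule monotone_cubic)
    have hV: "(\<integral>x. \<bar>hterm N V k x\<bar>^3 \<partial>S3) \<le> e1" for k
      unfolding V_def hterm_diff[OF Wi Wi] using nl nhk[of k] by (intro nh) auto
    have pD: "(\<integral>x. \<bar>phi N D x\<bar>^3 \<partial>S3) \<le> e1"
      unfolding D_def phi_diff[OF ai ai] using nl by (intro np) (auto simp: n0_def)
    have "(\<integral>\<^sup>+x. ennreal (norm (X x) powr (3/2)) \<partial>S3) \<le> ennreal M" "(\<integral>\<^sup>+x. ennreal (norm (V x) powr (3/2)) \<partial>S3) \<le> ennreal M"
      unfolding nn_integral_L32v[OF ad'(1)] nn_integral_L32v[OF ad'(4)] by (intro ennreal_leI XM VM)+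
    from loc[OF r M(1) eps _ _ this] ad'(1,4) obtain P where P: "finite P" "P \<subseteq> sphere 0 1" and Pc: "real (card P) \<le> K"
      and Pz: "\<And>z \<tau> N. (\<forall>x. norm x = 1 \<longrightarrow> 0 \<le> z x \<and> z x \<le> 1) \<Longrightarrow>
          (\<forall>p\<in>P. \<forall>x. norm x = 1 \<longrightarrow> norm (x - p) \<le> 4 * r \<longrightarrow> z x \<le> \<epsilon>') \<Longrightarrow>
          (\<forall>x y. norm x = 1 \<longrightarrow> norm y = 1 \<longrightarrow> r \<le> norm (x - y) \<longrightarrow> tailk N x y \<le> \<tau>) \<Longrightarrow>
          (\<integral>\<^sup>+x. (\<integral>\<^sup>+y. ennreal (\<bar>z x\<bar> * norm (X x) * norm (V y) * tailk N x y) \<partial>S3) \<partial>S3)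
            \<le> ennreal (C1 * (\<epsilon> powr (1/3) + \<epsilon>' * (81 * M) powr (1/3)) * (82 * M))
              + (\<integral>\<^sup>+x. (\<integral>\<^sup>+y. ennreal (\<tau> * (norm (X x) * norm (V y))) \<partial>S3) \<partial>S3)"
      unfolding L32v_def K_def by blast
    let ?z = "cutoff m P"
    have zs: "?z x \<le> \<epsilon>'" if "p \<in> P" "norm x = 1" "norm (x - p) \<le> 4 * r" for p x
      using cutoff_small[OF P that(2,1,3), of m] mr by linarith
    have "(\<integral>\<^sup>+x. (\<integral>\<^sup>+y. ennreal (\<bar>?z x\<bar> * norm (X x) * norm (V y) * tailk N x y) \<partial>S3) \<partial>S3)
        \<le> ennreal (\<delta> / (4 * 72)) + (\<integral>\<^sup>+x. (\<integral>\<^sup>+y. ennreal (\<tau> * (norm (X x) * norm (V y))) \<partial>S3) \<partial>S3)"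
      unfolding sval[symmetric]
    proof (rule Pz)
      show "\<forall>x. norm x = 1 \<longrightarrow> 0 \<le> ?z x \<and> ?z x \<le> 1" using cutoff_bounds[OF P(2)] by blast
      show "\<forall>p\<in>P. \<forall>x. norm x = 1 \<longrightarrow> norm (x - p) \<le> 4 * r \<longrightarrow> ?z x \<le> \<epsilon>'" using zs by blast
      show "\<forall>x y. norm x = 1 \<longrightarrow> norm y = 1 \<longrightarrow> r \<le> norm (x - y) \<longrightarrow> tailk N x y \<le> \<tau>"
        using N1[of N] by (simp add: N_def)
    qed
    also have "\<dots> \<le> ennreal (\<delta> / (4 * 72)) + ennreal (\<delta> / (4 * 72))"
      using tail_product_bound[OF ad'(1,4) XM VM, of \<tau>] tau by (intro add_left_mono) simp
    also have "\<dots> = ennreal (\<delta> / (4 * 72) + \<delta> / (4 * 72))" using d by (intro ennreal_plus[symmetric]) auto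
    also have "\<delta> / (4 * 72) + \<delta> / (4 * 72) = \<delta> / 144" by simp
    finally have T: "(\<integral>\<^sup>+x. (\<integral>\<^sup>+y. ennreal (\<bar>?z x\<bar> * norm (X x) * norm (V y) * tailk N x y) \<partial>S3) \<partial>S3) \<le> ennreal (\<delta> / 144)" .
    define L' where "L' = real (card P) * real m"
    have L': "L' \<le> L" unfolding L'_def L_def by (intro mult_right_mono Pc) simp
    have "area3 * (\<integral>x. ?z x * (X x \<bullet> D x) \<partial>S3) \<le> (3 + L') * (\<eta> * M + e1 / \<eta>^2) + 72 * (\<delta> / 144) + L' * (e2 * (2 * M))"
      by (rule pair_estimate[OF ad'(1,2,3,4,5) P XM DM hV pD _ T _ N2 eta L'_def]) (use d e2 in \<open>simp_all add: N_def\<close>)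
    also have "\<dots> \<le> (3 + L) * (\<eta> * M + e1 / \<eta>^2) + 72 * (\<delta> / 144) + L * (e2 * (2 * M))"
      using L' eta e1 e2 M d by (intro add_mono mult_right_mono) auto
    also have "\<dots> \<le> \<delta>" using Leta Le2 by simp
    also have "\<delta> = area3 * (\<kappa>^2 * e / 16)" by (simp add: \<delta>_def)
    finally have "(\<integral>x. ?z x * (X x \<bullet> D x) \<partial>S3) \<le> \<kappa>^2 * e / 16" using area3_pos by (simp only: mult_le_cancel_left_pos)
    then have "4 / \<kappa>^2 * (\<integral>x. ?z x * (X x \<bullet> D x) \<partial>S3) \<le> 4 / \<kappa>^2 * (\<kappa>^2 * e / 16)" by (intro mult_left_mono) auto
    also have "\<dots> = e / 4" using k by simp
    finally have I1: "4 / \<kappa>^2 * (\<integral>x. ?z x * (X x \<bullet> D x) \<partial>S3) \<le> e / 4" .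
    have "real (card P) * (1 - (R/2)^2)^m \<le> K * (1 - (R/2)^2)^m"
      using R by (intro mult_right_mono Pc zero_le_power) (auto simp: abs_square_le_1)
    then have m': "real (card P) * (1 - (R/2)^2)^m \<le> 1/2" using m by linarith
    have "real (card P) * (C * R^3) / \<kappa> \<le> K * (C * R^3) / \<kappa>"
      using R C k by (intro divide_right_mono mult_right_mono Pc) auto
    then have I2: "real (card P) * (C * R^3) / \<kappa> \<le> e / 8" using Rk by linarith
    have "\<kappa>^2 \<le> \<kappa>" using k power_decreasing[of 1 2 \<kappa>] by simp
    then have "\<kappa>^2 * M \<le> \<kappa> * M" using M by (intro mult_right_mono) auto
    then have I3: "\<kappa> * area3 + \<kappa>^2 * M \<le> e / 8" using kM by (simp add: distrib_left)
    have "(\<integral>x. norm (D x) \<partial>S3) \<le> e"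
      using integral_norm_split[OF ad'(1,3) mono DM P R m' C(2) k(1)] I1 I2 I3 e by linarith
    then show "(\<integral>x. norm (a n x - a l x) \<partial>S3) \<le> e" unfolding D_def .
  qed
qed

section \<open>Proof of the theorem\<close>

lemma bounded_diagonal_subsequence:
  fixes f :: "nat \<Rightarrow> nat \<Rightarrow> real"
  assumes b: "\<And>k. \<exists>B. \<forall>n. \<bar>f k n\<bar> \<le> B"
  shows "\<exists>r. strict_mono (r :: nat \<Rightarrow> nat) \<and> (\<forall>k. convergent (\<lambda>n. f k (r n)))"
proof -
  interpret subseqs "\<lambda>k r. convergent (\<lambda>n. f k (r n))"
  proof
    fix k and s :: "nat \<Rightarrow> nat" assume "strict_mono s"
    obtain B where "\<And>n. \<bar>f k n\<bar> \<le> B" using b by blast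
    then have "bounded (range (\<lambda>n. f k (s n)))" by (auto simp: bounded_iff)
    from bounded_imp_convergent_subsequence[OF this] obtain l r where "strict_mono (r :: nat \<Rightarrow> nat)" "((\<lambda>n. f k (s n)) \<circ> r) \<longlonglongrightarrow> l" by blast
    then show "\<exists>r'. strict_mono r' \<and> convergent (\<lambda>n. f k ((s \<circ> r') n))" by (auto simp: o_def convergent_def)
  qed
  \<comment> \<open>The diagonal sequence is a subsequence of the \<open>k\<close>-th stage only
    from the index \<open>Suc k\<close> on, hence the shift.\<close>
  have "convergent (\<lambda>n. f k ((diagseq \<circ> ((+) (Suc k))) n))" for k
  proof (rule diagseq_holds)
    fix r s :: "nat \<Rightarrow> nat" and k assume "strict_mono r" "convergent (\<lambda>n. f k (s n))"
    then show "convergent (\<lambda>n. f k ((s \<circ> r) n))"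
      using convergent_subseq_convergent[of "\<lambda>n. f k (s n)" r] by (simp add: o_def)
  qed
  moreover have "(\<lambda>n. f k ((diagseq \<circ> ((+) (Suc k))) n)) = (\<lambda>n. f k (diagseq (n + Suc k)))" for k
    by (rule ext) (simp add: add.commute)
  ultimately have "convergent (\<lambda>n. f k (diagseq (n + Suc k)))" for k by metis
  then have "convergent (\<lambda>n. f k (diagseq n))" for k using convergent_ignore_initial_segment[of "\<lambda>n. f k (diagseq n)" "Suc k"] by blast
  then show ?thesis using subseq_diagseq by blast
qed

text \<open>A substitute for weak compactness: a diagonal argument over a countable dense set of
  \<open>x\<close>, extended to all \<open>x\<close> because the moments are Lipschitz in
  \<open>x\<close> uniformly in \<open>n\<close>. The potentials \<open>phi\<close> are finite
  combinations of these moments.\<close>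

lemma moments_convergent_subsequence:
  fixes a :: "nat \<Rightarrow> R4 \<Rightarrow> R4"
  assumes a: "\<And>n. integrable S3 (a n)" and B: "\<And>n. (\<integral>y. norm (a n y) \<partial>S3) \<le> B"
  shows "\<exists>r. strict_mono (r :: nat \<Rightarrow> nat) \<and> (\<forall>x j i. norm x = 1 \<longrightarrow> convergent (\<lambda>n. \<integral>y. sK x y ^ j * a (r n) y $ i \<partial>S3))"
proof -
  let ?I = "\<lambda>x j i n. \<integral>y. sK x y ^ j * a n y $ i \<partial>S3"
  have I: "integrable S3 (\<lambda>y. sK x y ^ j * a n y $ i)" for x j i n
    by (intro integrable_continuous_mult integrable_vec_component[OF a] continuous_intros)
  have B0: "0 \<le> B" by (rule order_trans[OF Bochner_Integration.integral_nonneg B[of 0]]) simp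
  obtain T where T: "countable T" "T \<subseteq> sphere (0::R4) 1" "sphere 0 1 \<subseteq> closure T" using separable by blast
  have Ib: "\<bar>?I x j i n\<bar> \<le> B" if "norm x = 1" for x j i n
  proof -
    have "\<bar>?I x j i n\<bar> \<le> (\<integral>y. norm (a n y) \<partial>S3)"
    proof (rule order_trans[OF integral_abs_bound integral_mono_AE])
      show "integrable S3 (\<lambda>y. \<bar>sK x y ^ j * a n y $ i\<bar>)" using I by simp
      show "integrable S3 (\<lambda>y. norm (a n y))" using a by simp
      show "AE y in S3. \<bar>sK x y ^ j * a n y $ i\<bar> \<le> norm (a n y)"
      proof (rule AE_I2)
        fix y assume "y \<in> space S3"
        then have "norm y = 1" by simp
        from sK_bounds[OF that this] have "\<bar>sK x y ^ j\<bar> \<le> 1" by (simp add: power_le_one)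
        then have "\<bar>sK x y ^ j\<bar> * \<bar>a n y $ i\<bar> \<le> 1 * norm (a n y)" by (intro mult_mono component_le_norm_cart) auto
        then show "\<bar>sK x y ^ j * a n y $ i\<bar> \<le> norm (a n y)" by (simp add: abs_mult)
      qed
    qed
    then show ?thesis using B[of n] by linarith
  qed
  have Il: "\<bar>?I x j i n - ?I d j i n\<bar> \<le> real j * norm (x - d) * B" if x: "norm x = 1" and d: "norm d = 1" for x d j i n
  proof -
    have "\<bar>?I x j i n - ?I d j i n\<bar> = \<bar>\<integral>y. sK x y ^ j * a n y $ i - sK d y ^ j * a n y $ i \<partial>S3\<bar>" using I by simp
    also have "\<dots> \<le> (\<integral>y. real j * norm (x - d) * norm (a n y) \<partial>S3)"
    proof (rule order_trans[OF integral_abs_bound integral_mono_AE])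
      show "integrable S3 (\<lambda>y. \<bar>sK x y ^ j * a n y $ i - sK d y ^ j * a n y $ i\<bar>)" using I by simp
      show "integrable S3 (\<lambda>y. real j * norm (x - d) * norm (a n y))" using a by simp
      show "AE y in S3. \<bar>sK x y ^ j * a n y $ i - sK d y ^ j * a n y $ i\<bar> \<le> real j * norm (x - d) * norm (a n y)"
      proof (rule AE_I2)
        fix y assume "y \<in> space S3"
        then have y: "norm y = 1" by simp
        have "sK x y - sK d y = (x - d) \<bullet> y / 2" by (simp add: sK_def inner_diff_left field_simps)
        moreover have "\<bar>(x - d) \<bullet> y\<bar> \<le> norm (x - d)" using Cauchy_Schwarz_ineq2[of "x - d" y] y by simp
        ultimately have l: "\<bar>sK x y - sK d y\<bar> \<le> norm (x - d)" using norm_ge_zero[of "x - d"] by simp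
        have "\<bar>sK x y ^ j - sK d y ^ j\<bar> \<le> real j * \<bar>sK x y - sK d y\<bar>"
          using norm_power_diff[of "sK x y" "sK d y" j] sK_bounds[OF x y] sK_bounds[OF d y] by simp
        also have "\<dots> \<le> real j * norm (x - d)" using l by (intro mult_left_mono) auto
        finally have "\<bar>sK x y ^ j - sK d y ^ j\<bar> * \<bar>a n y $ i\<bar> \<le> real j * norm (x - d) * norm (a n y)"
          by (intro mult_mono component_le_norm_cart) auto
        then show "\<bar>sK x y ^ j * a n y $ i - sK d y ^ j * a n y $ i\<bar> \<le> real j * norm (x - d) * norm (a n y)"
          by (simp add: abs_mult flip: left_diff_distrib)
      qed
    qed
    also have "\<dots> = real j * norm (x - d) * (\<integral>y. norm (a n y) \<partial>S3)" by (rule integral_mult_right_zero)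
    also have "\<dots> \<le> real j * norm (x - d) * B" by (intro mult_left_mono B) auto
    finally show ?thesis .
  qed
  define S where "S = T \<times> (UNIV :: nat set) \<times> (UNIV :: 4 set)"
  have "T \<noteq> {}" using T(3) by (auto simp: sphere_def dest!: subsetD[of _ _ "axis 1 1"])
  then have Sn: "S \<noteq> {}" by (auto simp: S_def)
  have Sc: "countable S" unfolding S_def using T(1) by (intro countable_SIGMA) auto
  define g where "g = from_nat_into S"
  have gT: "norm (fst (g k)) = 1" for k
    using from_nat_into[OF Sn, of k] T(2) by (auto simp: g_def S_def)
  obtain r where r: "strict_mono (r :: nat \<Rightarrow> nat)" "\<And>k. convergent (\<lambda>n. ?I (fst (g k)) (fst (snd (g k))) (snd (snd (g k))) (r n))"
    using bounded_diagonal_subsequence[of "\<lambda>k n. ?I (fst (g k)) (fst (snd (g k))) (snd (snd (g k))) n"] Ib[OF gT] by blast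
  have cT: "convergent (\<lambda>n. ?I d j i (r n))" if "d \<in> T" for d j i
  proof -
    have "(d, j, i) \<in> S" using that by (simp add: S_def)
    then obtain k where "g k = (d, j, i)" unfolding g_def using from_nat_into_surj[OF Sc] by metis
    then show ?thesis using r(2)[of k] by simp
  qed
  have "convergent (\<lambda>n. ?I x j i (r n))" if x: "norm x = 1" for x j i
  proof -
    have "Cauchy (\<lambda>n. ?I x j i (r n))"
    proof (rule metric_CauchyI)
      fix e :: real assume e: "0 < e"
      define t where "t = e / 4 / (real j * B + 1)"
      have t: "t > 0" "(real j * B + 1) * t = e / 4"
      proof -
        have "0 < real j * B + 1" using B0 by (simp add: add_nonneg_pos)
        moreover have "c * (e / 4 / c) = e / 4" if "0 < c" for c using that by simp
        ultimately show "t > 0" "(real j * B + 1) * t = e / 4" unfolding t_def using e by (simp, blast)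
      qed
      have "x \<in> closure T" using T(3) x by auto
      then obtain d where d: "d \<in> T" "dist d x < t" using t(1) closure_approachable by blast
      have nd: "norm d = 1" using T(2) d(1) by auto
      have "real j * norm (x - d) * B \<le> real j * t * B"
        using d(2) B0 by (intro mult_right_mono mult_left_mono) (auto simp: dist_norm norm_minus_commute)
      also have "\<dots> \<le> (real j * B + 1) * t" using t(1) by (simp add: algebra_simps)
      also note t(2)
      finally have le: "\<bar>?I x j i n - ?I d j i n\<bar> \<le> e / 4" for n by (rule order_trans[OF Il[OF x nd]])
      have "Cauchy (\<lambda>n. ?I d j i (r n))" using cT[OF d(1)] by (rule convergent_Cauchy)
      then obtain M where M: "\<And>m n. m \<ge> M \<Longrightarrow> n \<ge> M \<Longrightarrow> dist (?I d j i (r m)) (?I d j i (r n)) < e / 4"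
        using metric_CauchyD[of _ "e / 4"] e by fastforce
      show "\<exists>M. \<forall>m\<ge>M. \<forall>n\<ge>M. dist (?I x j i (r m)) (?I x j i (r n)) < e"
      proof (intro exI[of _ M] allI impI)
        fix m n assume "M \<le> m" "M \<le> n"
        from M[OF this] le[of "r m"] le[of "r n"] e
        show "dist (?I x j i (r m)) (?I x j i (r n)) < e" unfolding dist_real_def by linarith
      qed
    qed
    then show ?thesis by (rule Cauchy_convergent)
  qed
  then show ?thesis using r(1) by blast
qed

section \<open>Passage to the limit\<close>

text \<open>Above a high level \<open>K\<close> the power \<open>q\<close> is at most
  \<open>K powr (q - p)\<close> times the bounded power \<open>p\<close>; below it, dominated
  convergence applies. The loss of exponent is what excludes \<open>q = 3\<close> in the
  end.\<close>

lemma vitali_powr: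
  fixes u :: "nat \<Rightarrow> R4 \<Rightarrow> real"
  assumes m: "\<And>n. u n \<in> borel_measurable S3" and u0: "\<And>n x. 0 \<le> u n x" and ae: "AE x in S3. (\<lambda>n. u n x) \<longlonglongrightarrow> 0"
    and q: "0 < q" "q < p" and i: "\<And>n. integrable S3 (\<lambda>x. u n x powr p)" and B: "\<And>n. (\<integral>x. u n x powr p \<partial>S3) \<le> B"
  shows "(\<lambda>n. \<integral>x. u n x powr q \<partial>S3) \<longlonglongrightarrow> 0"
proof (rule LIMSEQ_I)
  fix e :: real assume e: "0 < e"
  have "((\<lambda>K. (B + 1) * K powr (q - p)) \<longlongrightarrow> (B + 1) * 0) at_top"
    using q by (intro tendsto_mult_left tendsto_neg_powr filterlim_ident) auto
  then have "\<forall>\<^sub>F K in at_top. (B + 1) * K powr (q - p) < e / 2" using e by (intro order_tendstoD(2)) auto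
  then have "\<forall>\<^sub>F K in at_top. 0 < K \<and> (B + 1) * K powr (q - p) < e / 2" using eventually_gt_at_top[of 0] by eventually_elim blast
  then obtain K where K: "0 < K" "(B + 1) * K powr (q - p) < e / 2" using eventually_happens'[OF trivial_limit_at_top_linorder] by blast
  have pt: "t powr q \<le> min t K powr q + K powr (q - p) * t powr p" if "0 \<le> t" for t
  proof (cases "t \<le> K")
    case True
    then show ?thesis by (simp add: min_def)
  next
    case False
    then have "t powr q = t powr (q - p) * t powr p" by (simp flip: powr_add)
    also have "\<dots> \<le> K powr (q - p) * t powr p" using False K q by (intro mult_right_mono powr_mono2') auto
    finally show ?thesis by (simp add: add_increasing)
  qed
  have mi: "integrable S3 (\<lambda>x. min (u n x) K powr q)" for n
  proof (rule S3.integrable_const_bound)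
    show "AE x in S3. norm (min (u n x) K powr q) \<le> K powr q" using u0 K q by (intro AE_I2) (auto intro!: powr_mono2)
  qed (use m in simp)
  have "(\<lambda>n. \<integral>x. min (u n x) K powr q \<partial>S3) \<longlonglongrightarrow> (\<integral>x. 0 \<partial>S3)"
  proof (rule integral_dominated_convergence[where w = "\<lambda>_. K powr q"])
    show "AE x in S3. (\<lambda>n. min (u n x) K powr q) \<longlonglongrightarrow> 0"
      using ae
    proof eventually_elim
      case (elim x)
      have "(\<lambda>n. min (u n x) K) \<longlonglongrightarrow> min 0 K" by (intro tendsto_min elim tendsto_const)
      then have "(\<lambda>n. min (u n x) K powr q) \<longlonglongrightarrow> 0 powr q" 
        using u0 K q by (intro tendsto_powr2) (auto simp: eventually_sequentially)
      then show ?case by simp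
    qed
    show "AE x in S3. norm (min (u n x) K powr q) \<le> K powr q" for n using u0 K q by (intro AE_I2) (auto intro!: powr_mono2)
  qed (use m in simp_all)
  then have "\<forall>\<^sub>F n in sequentially. (\<integral>x. min (u n x) K powr q \<partial>S3) < e / 2" using e by (intro order_tendstoD(2)) auto
  then obtain n0 where n0: "\<And>n. n \<ge> n0 \<Longrightarrow> (\<integral>x. min (u n x) K powr q \<partial>S3) < e / 2" by (auto simp: eventually_sequentially)
  show "\<exists>n0. \<forall>n\<ge>n0. norm ((\<integral>x. u n x powr q \<partial>S3) - 0) < e"
  proof (intro exI[of _ n0] allI impI)
    fix n assume n: "n0 \<le> n"
    have "(\<integral>x. u n x powr q \<partial>S3) \<le> (\<integral>x. min (u n x) K powr q + K powr (q - p) * u n x powr p \<partial>S3)"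
    proof (rule integral_mono_AE')
      show "integrable S3 (\<lambda>x. min (u n x) K powr q + K powr (q - p) * u n x powr p)" using mi i by simp
      show "AE x in S3. u n x powr q \<le> min (u n x) K powr q + K powr (q - p) * u n x powr p" using pt[OF u0] by (intro AE_I2)
    qed simp
    also have "\<dots> = (\<integral>x. min (u n x) K powr q \<partial>S3) + K powr (q - p) * (\<integral>x. u n x powr p \<partial>S3)" using mi i by simp
    also have "\<dots> < e / 2 + K powr (q - p) * (B + 1)"
      using n0[OF n] B[of n] by (intro add_less_le_mono mult_left_mono) auto
    finally have "(\<integral>x. u n x powr q \<partial>S3) < e" using K(2) by (simp add: mult.commute)
    then show "norm ((\<integral>x. u n x powr q \<partial>S3) - 0) < e" by simp
  qed
qed

lemma tendsto_integral_inner: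
  fixes v :: "nat \<Rightarrow> R4 \<Rightarrow> R4"
  assumes v: "\<And>n. integrable S3 (v n)" "integrable S3 w" and l: "(\<lambda>n. \<integral>x. norm (v n x - w x) \<partial>S3) \<longlonglongrightarrow> 0" and G: "continuous_on UNIV G"
  shows "(\<lambda>n. \<integral>x. v n x \<bullet> G x \<partial>S3) \<longlonglongrightarrow> (\<integral>x. w x \<bullet> G x \<partial>S3)"
proof -
  have "bounded (G ` sphere 0 1)" using G by (intro compact_imp_bounded compact_continuous_image) (auto intro: continuous_on_subset)
  then obtain K where K: "\<And>x. norm x = 1 \<Longrightarrow> norm (G x) \<le> K" unfolding bounded_iff by (metis (no_types) image_eqI mem_sphere_0)
  have "(\<lambda>n. K * (\<integral>x. norm (v n x - w x) \<partial>S3)) \<longlonglongrightarrow> K * 0" by (intro tendsto_mult_left l)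
  then have K0: "(\<lambda>n. K * (\<integral>x. norm (v n x - w x) \<partial>S3)) \<longlonglongrightarrow> 0" by simp
  have le: "\<bar>(\<integral>x. v n x \<bullet> G x \<partial>S3) - (\<integral>x. w x \<bullet> G x \<partial>S3)\<bar> \<le> K * (\<integral>x. norm (v n x - w x) \<partial>S3)" for n
  proof -
    have i: "integrable S3 (\<lambda>x. (v n x - w x) \<bullet> G x)" using v by (intro integrable_inner_continuous(1)[OF G]) auto
    have "(\<integral>x. v n x \<bullet> G x \<partial>S3) - (\<integral>x. w x \<bullet> G x \<partial>S3) = (\<integral>x. (v n x - w x) \<bullet> G x \<partial>S3)"
      using integrable_inner_continuous(1)[OF G v(1)] integrable_inner_continuous(1)[OF G v(2)] by (simp add: inner_diff_left)
    also have "\<bar>\<dots>\<bar> \<le> (\<integral>x. K * norm (v n x - w x) \<partial>S3)"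
    proof (rule order_trans[OF integral_abs_bound integral_mono_AE])
      show "integrable S3 (\<lambda>x. \<bar>(v n x - w x) \<bullet> G x\<bar>)" using i by simp
      show "integrable S3 (\<lambda>x. K * norm (v n x - w x))" using v by simp
      show "AE x in S3. \<bar>(v n x - w x) \<bullet> G x\<bar> \<le> K * norm (v n x - w x)"
      proof (rule AE_I2)
        fix x assume "x \<in> space S3"
        then have "norm (v n x - w x) * norm (G x) \<le> norm (v n x - w x) * K" by (intro mult_left_mono K) auto
        then show "\<bar>(v n x - w x) \<bullet> G x\<bar> \<le> K * norm (v n x - w x)"
          using Cauchy_Schwarz_ineq2[of "v n x - w x" "G x"] by (simp add: mult.commute)
      qed
    qed
    finally show ?thesis by simp
  qed
  show ?thesis by (rule LIM_zero_cancel, rule Lim_null_comparison[OF always_eventually K0]) (use le in simp)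
qed

lemma L3v_limit:
  assumes a: "\<And>n. L3v (a n)" and A: "\<And>n. (\<integral>x. norm (a n x)^3 \<partial>S3) \<le> A"
    and b: "b \<in> borel_measurable S3" "\<forall>x\<in>sphere 0 1. b x \<bullet> x = 0" and ae: "AE x in S3. (\<lambda>n. a n x) \<longlonglongrightarrow> b x"
  shows "L3v b" and "(\<integral>x. norm (b x)^3 \<partial>S3) \<le> A"
proof -
  have A0: "0 \<le> A" by (rule order_trans[OF Bochner_Integration.integral_nonneg A[of 0]]) simp
  have am: "a n \<in> borel_measurable S3" for n using a[of n] by (simp add: L3v_def)
  have "(\<integral>\<^sup>+x. ennreal (norm (b x)^3) \<partial>S3) = (\<integral>\<^sup>+x. liminf (\<lambda>n. ennreal (norm (a n x)^3)) \<partial>S3)"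
  proof (rule nn_integral_cong_AE)
    show "AE x in S3. ennreal (norm (b x)^3) = liminf (\<lambda>n. ennreal (norm (a n x)^3))"
      using ae
    proof eventually_elim
      case (elim x)
      have "(\<lambda>n. ennreal (norm (a n x)^3)) \<longlonglongrightarrow> ennreal (norm (b x)^3)" by (intro tendsto_ennrealI tendsto_power tendsto_norm elim)
      then show ?case by (intro lim_imp_Liminf[symmetric]) auto
    qed
  qed
  also have "\<dots> \<le> liminf (\<lambda>n. \<integral>\<^sup>+x. ennreal (norm (a n x)^3) \<partial>S3)" using am by (intro nn_integral_liminf) simp
  also have "\<dots> \<le> liminf (\<lambda>n. ennreal A)"
  proof (intro Liminf_mono always_eventually allI)
    fix n
    have "(\<integral>\<^sup>+x. ennreal (norm (a n x)^3) \<partial>S3) = ennreal (\<integral>x. norm (a n x)^3 \<partial>S3)"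
      using a[of n] by (intro nn_integral_eq_integral) (auto simp: L3v_def)
    then show "(\<integral>\<^sup>+x. ennreal (norm (a n x)^3) \<partial>S3) \<le> ennreal A" using A[of n] by (simp add: ennreal_leI)
  qed
  also have "\<dots> = ennreal A" by (simp add: Liminf_const)
  finally have le: "(\<integral>\<^sup>+x. ennreal (norm (b x)^3) \<partial>S3) \<le> ennreal A" .
  have i: "integrable S3 (\<lambda>x. norm (b x)^3)"
  proof (rule integrableI_bounded)
    have "(\<integral>\<^sup>+x. ennreal (norm (b x)^3) \<partial>S3) < \<infinity>" by (rule le_less_trans[OF le]) simp
    then show "(\<integral>\<^sup>+x. ennreal (norm (norm (b x)^3)) \<partial>S3) < \<infinity>" by simp
  qed (use b in simp)
  then show "L3v b" using b by (simp add: L3v_def)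
  have "ennreal (\<integral>x. norm (b x)^3 \<partial>S3) \<le> ennreal A" using le i by (simp add: nn_integral_eq_integral)
  then show "(\<integral>x. norm (b x)^3 \<partial>S3) \<le> A" using A0 by simp
qed

lemma tendsto_integral_norm:
  fixes v :: "nat \<Rightarrow> R4 \<Rightarrow> R4"
  assumes v: "\<And>n. v n \<in> borel_measurable S3" "w \<in> borel_measurable S3" and ae: "AE x in S3. (\<lambda>n. v n x) \<longlonglongrightarrow> w x"
    and p: "0 < q" "q < p" and i: "\<And>n. integrable S3 (\<lambda>x. norm (v n x - w x) powr p)" and B: "\<And>n. (\<integral>x. norm (v n x - w x) powr p \<partial>S3) \<le> B"
  shows "(\<lambda>n. \<integral>x. norm (v n x - w x) powr q \<partial>S3) \<longlonglongrightarrow> 0"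
proof (rule vitali_powr[OF _ _ _ p i B])
  show "(\<lambda>x. norm (v n x - w x)) \<in> borel_measurable S3" for n using v(1)[of n] v(2) by simp
  show "AE x in S3. (\<lambda>n. norm (v n x - w x)) \<longlonglongrightarrow> 0"
    using ae by eventually_elim (simp add: tendsto_norm_zero LIM_zero)
qed simp

text \<open>Pointwise convergence and the bound on cubes give convergence in L^1 both of the fields
  and of the fields \<open>norm a * a\<close>. The defining identities, being pairings with
  continuous fields, survive.\<close>

lemma admissible_limit:
  assumes ad: "\<And>n. admissible (a n) (W n)" and A: "\<And>n. (\<integral>x. norm (a n x)^3 \<partial>S3) \<le> A"
    and W: "L32v V" and wc: "\<And>G. continuous_on UNIV G \<Longrightarrow> (\<lambda>n. \<integral>x. W n x \<bullet> G x \<partial>S3) \<longlonglongrightarrow> (\<integral>x. V x \<bullet> G x \<partial>S3)"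
    and b: "b \<in> borel_measurable S3" "\<forall>x\<in>sphere 0 1. b x \<bullet> x = 0" and ae: "AE x in S3. (\<lambda>n. a n x) \<longlonglongrightarrow> b x"
  shows "admissible b V"
proof -
  have Lv: "L3v (a n)" "curl_of (a n) (W n)" "divfree (\<lambda>x. norm (a n x) *\<^sub>R a n x)" for n using ad[of n] by (simp_all add: admissible_def)
  note Lb = L3v_limit[OF Lv(1) A b ae]
  have m: "a n \<in> borel_measurable S3" for n using Lv(1)[of n] by (simp add: L3v_def)
  note ai = L3v_integrable[OF Lv(1)] and bi = L3v_integrable[OF Lb(1)]
  let ?X = "\<lambda>n x. norm (a n x) *\<^sub>R a n x" and ?Y = "\<lambda>x. norm (b x) *\<^sub>R b x"
  note X = L32v_of_L3v[OF Lv(1)] and Y = L32v_of_L3v[OF Lb(1)]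
  have l1: "(\<lambda>n. \<integral>x. norm (a n x - b x) \<partial>S3) \<longlonglongrightarrow> 0"
  proof -
    have "(\<lambda>n. \<integral>x. norm (a n x - b x) powr 1 \<partial>S3) \<longlonglongrightarrow> 0"
    proof (rule tendsto_integral_norm[OF m b(1) ae])
      show "integrable S3 (\<lambda>x. norm (a n x - b x) powr 3)" for n
        unfolding norm_powr_3 using L3v_diff[OF Lv(1) Lb(1), of n] by (simp add: L3v_def)
      show "(\<integral>x. norm (a n x - b x) powr 3 \<partial>S3) \<le> 8 * A" for n
        unfolding norm_powr_3 by (rule integral_norm_diff_cube_le[OF Lv(1) Lb(1) A Lb(2)])
    qed simp_all
    then show ?thesis by simp
  qed
  have l2: "(\<lambda>n. \<integral>x. norm (?X n x - ?Y x) \<partial>S3) \<longlonglongrightarrow> 0"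
  proof -
    have "(\<lambda>n. \<integral>x. norm (?X n x - ?Y x) powr 1 \<partial>S3) \<longlonglongrightarrow> 0"
    proof (rule tendsto_integral_norm)
      show "?X n \<in> borel_measurable S3" for n using m[of n] by simp
      show "?Y \<in> borel_measurable S3" using b by simp
      show "AE x in S3. (\<lambda>n. ?X n x) \<longlonglongrightarrow> ?Y x" using ae by eventually_elim (intro tendsto_scaleR tendsto_norm)
      show "integrable S3 (\<lambda>x. norm (?X n x - ?Y x) powr (3/2))" for n
        using L32v_diff[OF X Y, of n] by (simp add: L32v_def)
      show "(\<integral>x. norm (?X n x - ?Y x) powr (3/2) \<partial>S3) \<le> 8 * A" for n
        using A Lb(2) by (intro integral_norm_diff_powr_le X Y) (simp_all only: norm_scaleR_powr_3_2)
    qed simp_all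
    then show ?thesis by simp
  qed
  have "divfree ?Y"
    unfolding divfree_def
  proof (intro allI impI)
    fix f f' assume f: "real_polynomial_function f" "\<forall>x. (f has_derivative f' x) (at (x::R4))"
    obtain g where g: "\<And>i. real_polynomial_function (g i)" "\<And>x h. f' x h = (\<Sum>i\<in>UNIV. (h :: R4) $ i * g i x)"
      using polynomial_derivative_coeff[OF f(1)] f(2) by blast
    define G where "G x = (\<chi> i. g i x)" for x
    have fG: "f' x h = h \<bullet> G x" for x h by (simp add: g(2) G_def inner_vec_def)
    have Gc: "continuous_on UNIV G" unfolding G_def by (intro continuous_on_vec_lambda continuous_real_polynomial g)
    have "(\<lambda>n. \<integral>x. ?X n x \<bullet> G x \<partial>S3) \<longlonglongrightarrow> (\<integral>x. ?Y x \<bullet> G x \<partial>S3)"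
      by (rule tendsto_integral_inner[OF L32v_integrable[OF X] L32v_integrable[OF Y] l2 Gc])
    moreover have "(\<integral>x. ?X n x \<bullet> G x \<partial>S3) = 0" for n
      using Lv(3)[of n] f unfolding divfree_def fG[symmetric] by blast
    ultimately show "(\<integral>x. f' x (?Y x) \<partial>S3) = 0"
      unfolding fG by (simp add: LIMSEQ_const_iff)
  qed
  moreover have "curl_of b V"
    unfolding curl_of_def
  proof (intro conjI allI impI)
    fix k
    have fc: "continuous_on UNIV (fr k)" by (intro continuous_intros)
    have "(\<lambda>n. \<integral>y. W n y \<bullet> fr k y \<partial>S3) \<longlonglongrightarrow> - 2 * (\<integral>y. b y \<bullet> fr k y \<partial>S3)"
      using tendsto_mult_left[OF tendsto_integral_inner[OF ai bi l1 fc], of "- 2"] Lv(2) by (simp add: curl_of_def)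
    then show "(\<integral>y. V y \<bullet> fr k y \<partial>S3) = - 2 * (\<integral>y. b y \<bullet> fr k y \<partial>S3)"
      by (rule LIMSEQ_unique[OF wc[OF fc]])
  next
    fix N k and x :: R4 assume x: "norm x = 1"
    \<comment> \<open>Collects the right-hand side of the curl identity into one pairing of the
      field with a continuous \<open>G\<close>.\<close>
    define G where "G y = (pk N (sK x y) - 1) *\<^sub>R fr k y + (dgamN N (sK x y) * (x \<bullet> fr k y)) *\<^sub>R x - gamN N (sK x y) *\<^sub>R fr k x" for y
    have G: "(pk N (sK x y) - 1) * (u y \<bullet> fr k y) + dgamN N (sK x y) * (x \<bullet> u y) * (x \<bullet> fr k y) + gamN N (sK x y) * (x \<bullet> fr k (u y)) = u y \<bullet> G y" for u y
      unfolding inner_fr_skew[of x k "u y"]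
      by (simp add: G_def inner_add_right inner_diff_right inner_commute)
    have Gc: "continuous_on UNIV G" unfolding G_def by (intro continuous_intros continuous_pk)
    have "(\<integral>y. W n y \<bullet> Fk N k x y \<partial>S3) = (\<integral>y. a n y \<bullet> G y \<partial>S3)" for n
      using Lv(2)[of n] x unfolding curl_of_def G[symmetric] by blast
    then have "(\<lambda>n. \<integral>y. W n y \<bullet> Fk N k x y \<partial>S3) \<longlonglongrightarrow> (\<integral>y. b y \<bullet> G y \<partial>S3)"
      using tendsto_integral_inner[OF ai bi l1 Gc] by simp
    then show "(\<integral>y. V y \<bullet> Fk N k x y \<partial>S3) = (\<integral>y. (pk N (sK x y) - 1) * (b y \<bullet> fr k y) + dgamN N (sK x y) * (x \<bullet> b y) * (x \<bullet> fr k y)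
         + gamN N (sK x y) * (x \<bullet> fr k (b y)) \<partial>S3)"
      unfolding G by (rule LIMSEQ_unique[OF wc[OF continuous_Fk]])
  qed
  ultimately show ?thesis using Lb(1) W by (simp add: admissible_def)
qed

lemma admissible_of_forms:
  assumes "L_1form 3 a" "codiff_free a" "L_2form (3/2) b" "weak_d a b"
  shows "admissible a (\<lambda>x. starv (b x) x)"
proof -
  have t: "\<forall>x\<in>sphere 0 1. a x \<bullet> x = 0" using assms(1) by (simp add: L_1form_def is_1form_def)
  have "L3v a" using assms(1) by (simp add: L_1form_def is_1form_def L3v_def norm_powr_3)
  then show ?thesis
    unfolding admissible_def using divfree_codiff_free[OF assms(2) t] L32v_starv[OF assms(3)] curl_of_weak_d[OF assms(4) t] by blast
qed

text \<open>The limit extracted by compactness is not known in advance to be \<open>b\<close>; both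
  are admissible with the same \<open>V\<close>, so \<open>uniqueness\<close> identifies them almost
  everywhere.\<close>

lemma convergent_subsequence:
  assumes ad: "\<And>n. admissible (a n) (W n)" and ad0: "admissible b V"
    and A: "\<And>n. (\<integral>x. norm (a n x)^3 \<partial>S3) \<le> A" and Q: "\<And>n. (\<integral>x. norm (W n x) powr (3/2) \<partial>S3) \<le> Q"
    and wc: "\<And>G. continuous_on UNIV G \<Longrightarrow> (\<lambda>n. \<integral>x. W n x \<bullet> G x \<partial>S3) \<longlonglongrightarrow> (\<integral>x. V x \<bullet> G x \<partial>S3)"
  shows "\<exists>r. strict_mono (r :: nat \<Rightarrow> nat) \<and> (AE x in S3. (\<lambda>n. a (r n) x) \<longlonglongrightarrow> b x)"
proof -
  have Lv: "L3v (a n)" for n using ad[of n] by (simp add: admissible_def)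
  note ai = L3v_integrable[OF Lv]
  from moments_convergent_subsequence[of a, OF ai integral_norm_le_cube[OF Lv A]] obtain s where s: "strict_mono (s :: nat \<Rightarrow> nat)"
    and sc: "\<And>x j i. norm x = 1 \<Longrightarrow> convergent (\<lambda>n. \<integral>y. sK x y ^ j * a (s n) y $ i \<partial>S3)" by blast
  have ph: "convergent (\<lambda>n. phi N (a (s n)) x)" if "norm x = 1" for N x
  proof -
    define l where "l j i = lim (\<lambda>n. \<integral>y. sK x y ^ j * a (s n) y $ i \<partial>S3)" for j i
    have l: "(\<lambda>n. \<integral>y. sK x y ^ j * a (s n) y $ i \<partial>S3) \<longlonglongrightarrow> l j i" for j i
      unfolding l_def convergent_LIMSEQ_iff[symmetric] by (rule sc[OF that])
    have "(\<lambda>n. \<Sum>j<N. \<Sum>i\<in>UNIV. ck j / 2 * (x $ i * (\<integral>y. sK x y ^ j * a (s n) y $ i \<partial>S3))) \<longlonglongrightarrow> (\<Sum>j<N. \<Sum>i\<in>UNIV. ck j / 2 * (x $ i * l j i))"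
      by (intro tendsto_sum tendsto_mult_left l)
    then show ?thesis unfolding phi_eq[OF ai] by (auto simp: convergent_def)
  qed
  have wcs: "(\<lambda>n. \<integral>x. W (r n) x \<bullet> G x \<partial>S3) \<longlonglongrightarrow> (\<integral>x. V x \<bullet> G x \<partial>S3)" if "continuous_on UNIV G" "strict_mono (r :: nat \<Rightarrow> nat)" for G r
    using LIMSEQ_subseq_LIMSEQ[OF wc[OF that(1)] that(2)] by (simp add: o_def)
  have hc: "convergent (\<lambda>n. hterm N (W (s n)) k x)" for N k x
    unfolding hterm_def
    by (intro convergentI[OF wcs[OF _ s]] continuous_on_diff continuous_Fk continuous_intros)
  have "\<exists>n0. \<forall>i\<ge>n0. \<forall>j\<ge>n0. (\<integral>x. norm (a (s i) x - a (s j) x) \<partial>S3) < e" if e: "e > 0" for e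
  proof -
    obtain n0 where "\<forall>i\<ge>n0. \<forall>j\<ge>n0. (\<integral>x. norm (a (s i) x - a (s j) x) \<partial>S3) \<le> e / 2"
      using cauchy_L1[OF ad Q A hc ph half_gt_zero[OF e]] by blast
    then show ?thesis using e by (intro exI[of _ n0]) force
  qed
  from cauchy_L1_AE_cauchy_subseq[OF ai this] obtain t where t: "strict_mono (t :: nat \<Rightarrow> nat)" "AE x in S3. Cauchy (\<lambda>n. a (s (t n)) x)" by blast
  define r where "r n = s (t n)" for n
  have r: "strict_mono r" unfolding r_def using s t(1) by (simp add: strict_mono_def)
  define l where "l x = lim (\<lambda>n. a (r n) x)" for x
  \<comment> \<open>Where the sequence diverges, the value of \<open>lim\<close> is arbitrary,
    whereas admissible fields are tangential everywhere. The projection repairs this and changes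
    nothing at points of convergence.\<close>
  define c where "c x = tproj x (l x)" for x
  have am: "a n \<in> borel_measurable S3" for n using Lv[of n] by (simp add: L3v_def)
  have lm: "l \<in> borel_measurable S3" unfolding l_def by (rule borel_measurable_lim_metric) (rule am)
  have cm: "c \<in> borel_measurable S3" unfolding c_def tproj_def using lm measurable_S3_borel by simp
  have ct: "\<forall>x\<in>sphere 0 1. c x \<bullet> x = 0" by (simp add: c_def tproj_def inner_diff_left dot_square_norm)
  have aec: "AE x in S3. (\<lambda>n. a (r n) x) \<longlonglongrightarrow> c x"
    using t(2) AE_space
  proof eventually_elim
    case (elim x)
    then have nx: "norm x = 1" by simp
    have lim: "(\<lambda>n. a (r n) x) \<longlonglongrightarrow> l x"
      using elim(1) unfolding r_def l_def by (simp add: Cauchy_convergent_iff convergent_LIMSEQ_iff)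
    then have "(\<lambda>n. a (r n) x \<bullet> x) \<longlonglongrightarrow> l x \<bullet> x" by (intro tendsto_inner tendsto_const)
    moreover have "a (r n) x \<bullet> x = 0" for n using Lv[of "r n"] nx by (simp add: L3v_def)
    ultimately have "l x \<bullet> x = 0" by (simp add: LIMSEQ_const_iff)
    then show ?case using lim by (simp add: c_def tproj_def)
  qed
  have "admissible c V"
    using ad0 by (intro admissible_limit[OF ad A _ wcs[OF _ r] cm ct aec]) (auto simp: admissible_def)
  from uniqueness[OF this ad0] aec have "AE x in S3. (\<lambda>n. a (r n) x) \<longlonglongrightarrow> b x" by eventually_elim simp
  then show ?thesis using r by blast
qed

theorem theorem3p2:
  fixes an :: "nat \<Rightarrow> R4 \<Rightarrow> R4" and a :: "R4 \<Rightarrow> R4"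
    and bn :: "nat \<Rightarrow> R4 \<Rightarrow> M4" and b :: "R4 \<Rightarrow> M4"
  assumes "\<And>n. L_1form 3 (an n)" and "L_1form 3 a"
    and "\<And>n. codiff_free (an n)" and "codiff_free a"
    and "\<And>n. L_2form (3/2) (bn n)" and "L_2form (3/2) b"
    and "\<And>n. weak_d (an n) (bn n)" and "weak_d a b"
    and "weak_conv_2form (3/2) bn b"
  shows "\<forall>q. 1 \<le> q \<and> q < 3 \<longrightarrow> conv_1form q an a"
proof (intro allI impI)
  fix q :: real assume q: "1 \<le> q \<and> q < 3"
  let ?W = "\<lambda>n x. starv (bn n x) x"
  let ?I = "\<lambda>n. \<integral>x. norm (an n x - a x) powr q \<partial>S3"
  have ad: "admissible (an n) (?W n)" for n by (rule admissible_of_forms[OF assms(1,3,5,7)])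
  have ad0: "admissible a (\<lambda>x. starv (b x) x)" by (rule admissible_of_forms[OF assms(2,4,6,8)])
  obtain Q where Q: "0 \<le> Q" "\<And>n. (\<integral>x. norm (?W n x) powr (3/2) \<partial>S3) \<le> Q"
    using weak_conv_bounded[OF assms(9,5)] by blast
  obtain B where "\<And>a W. admissible a W \<Longrightarrow> (\<integral>x. norm (W x) powr (3/2) \<partial>S3) \<le> Q \<Longrightarrow> (\<integral>x. norm (a x)^3 \<partial>S3) \<le> B"
    using a_priori_bound[OF Q(1)] by blast
  from this[OF ad Q(2)] have B: "(\<integral>x. norm (an n x)^3 \<partial>S3) \<le> B" for n .
  have Lv: "L3v (an n)" "L3v a" for n using ad[of n] ad0 by (simp_all add: admissible_def)
  have wc: "(\<lambda>n. \<integral>x. ?W n x \<bullet> G x \<partial>S3) \<longlonglongrightarrow> (\<integral>x. starv (b x) x \<bullet> G x \<partial>S3)" if "continuous_on UNIV G" for G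
    by (rule weak_conv_continuous[OF assms(9,5,6) that])
  show "conv_1form q an a"
    unfolding conv_1form_def
  \<comment> \<open>Compactness only yields subsequences. If the whole sequence failed to converge,
    a subsequence would stay away from the limit, and a further one could not.\<close>
  proof (rule ccontr)
    assume "\<not> ?I \<longlonglongrightarrow> 0"
    then obtain e where e: "e > 0" "\<And>n0. \<exists>n\<ge>n0. e \<le> ?I n"
      unfolding LIMSEQ_iff by (auto simp: not_less)
    then have "infinite {n. e \<le> ?I n}" unfolding infinite_nat_iff_unbounded_le by blast
    from infinite_enumerate[OF this] obtain s where s: "strict_mono (s :: nat \<Rightarrow> nat)" "\<And>n. e \<le> ?I (s n)" by blast
    have "(\<lambda>n. \<integral>x. ?W (s n) x \<bullet> G x \<partial>S3) \<longlonglongrightarrow> (\<integral>x. starv (b x) x \<bullet> G x \<partial>S3)" if "continuous_on UNIV G" for G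
      using LIMSEQ_subseq_LIMSEQ[OF wc[OF that] s(1)] by (simp add: o_def)
    from convergent_subsequence[OF ad ad0 B Q(2) this]
    obtain r where r: "strict_mono (r :: nat \<Rightarrow> nat)" "AE x in S3. (\<lambda>n. an (s (r n)) x) \<longlonglongrightarrow> a x" by blast
    have m: "an n \<in> borel_measurable S3" "a \<in> borel_measurable S3" for n using Lv(1)[of n] Lv(2) by (simp_all add: L3v_def)
    have "(\<lambda>n. ?I (s (r n))) \<longlonglongrightarrow> 0"
    proof (rule tendsto_integral_norm[OF m r(2)])
      show "integrable S3 (\<lambda>x. norm (an (s (r n)) x - a x) powr 3)" for n
        unfolding norm_powr_3 using L3v_diff[OF Lv, of "s (r n)"] by (simp add: L3v_def)
      \<comment> \<open>By Fatou's lemma the limit inherits the uniform bound on the cubes.\<close>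
      have aB: "(\<integral>x. norm (a x)^3 \<partial>S3) \<le> B"
        using L3v_limit(2)[OF Lv(1) B m(2) _ r(2)] Lv(2) by (simp add: L3v_def)
      show "(\<integral>x. norm (an (s (r n)) x - a x) powr 3 \<partial>S3) \<le> 8 * B" for n
        unfolding norm_powr_3 by (rule integral_norm_diff_cube_le[OF Lv B aB])
    qed (use q in auto)
    then have "e \<le> 0" by (rule LIMSEQ_le_const) (use s(2) in blast)
    then show False using e(1) by simp
  qed
qed

end
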